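(* Assume $1 \leq p < \infty$ and that $\eta \in L^p(\mathbb{R}^d)$ is nonnegative. When $p=1$ assume $\int_{\mathbb{R}^d} \eta \, dx = 1$, and when $1<p<\infty$ assume $P\eta \equiv 1$ (which implies $\int_{\mathbb{R}^d} \eta \, dx = 1$). Let $m \in \mathbb{N}$ and define $$\psi = \underbrace{\beta * \cdots * \beta}_{m \text{ factors}} * \,\eta, \qquad \beta = |b\mathcal{C}|^{-1} \mathbf{1}_{b\mathcal{C}} .$$ Then for all $f \in W^{m,p}(\mathbb{R}^d)$, $$\| f \|_{W^{m,p}} = \inf \left\{ \| c \|_{\ell^1(w^{m,p},\alpha)} : c\in\ell^1(w^{m,p},\alpha),\ M_b^{-1} f = Sc \right\},$$ where $M_b^{-1}f=Sc$ is understood with the series $Sc=\sum_{j>0}\sum_{k\in\mathbb{Z}^d}c_{j,k}\psi_{j,k}$ converging in the sense that the sum over $k$ converges pointwise absolutely a.e. to a function in $W^{m,p}$ and the sum over $j$ converges absolutely in $W^{m,p}$.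
   Context: Fix $d\in\mathbb{N}$. The dilation matrices are isotropic and expanding: $a_j=\alpha_j I$ ($j=1,2,3,\ldots$), where $\alpha_j$ are nonzero real numbers with $|\alpha_j|\to\infty$ as $j\to\infty$. The translation matrix $b$ is an invertible $d\times d$ real matrix. Functions are complex-valued; sums over $j>0$ are over $j=1,2,3,\ldots$. $\mathcal{C}=[0,1)^d$, $b\mathcal{C}=\{bx:x\in\mathcal{C}\}$, $|b\mathcal{C}|$ is its Lebesgue measure, and $\mathbf{1}_E$ is the indicator function of $E$. $\psi_{j,k}(x)=|\det a_j|^{1/p}\psi(a_jx-bk)$ for $k\in\mathbb{Z}^d$, and the synthesis operator is $Sc=\sum_{j>0}\sum_{k\in\mathbb{Z}^d}c_{j,k}\psi_{j,k}$. The periodization is $Pf(x)=|\det b|\sum_{k\in\mathbb{Z}^d}f(x-bk)$; identities between periodizations are understood almost everywhere. The matrix rescaling operator is $(M_bf)(x)=|\det b|f(bx)$, with inverse $(M_b^{-1}f)(x)=|\det b|^{-1}f(b^{-1}x)$. $W^{m,p}=W^{m,p}(\mathbb{R}^d)$ is the Sobolev space of functions with $m$ derivatives in $L^p$, normed by $\|f\|_{W^{m,p}}=\sum_{|\rho|\le m}\|D^\rho f\|_p$ ($\rho$ multiindices). For sequences $s=\{s_k\}_{k\in\mathbb{Z}^d}$, $\Delta_ts=\{s_k-s_{k-e_t}\}_{k\in\mathbb{Z}^d}$, $t=1,\ldots,d$, with $e_t$ the $t$-th coordinate unit vector, and $\Delta^\rho=\Delta_1^{\rho_1}\cdots\Delta_d^{\rho_d}$.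 For $c=\{c_{j,k}\}_{j>0,k\in\mathbb{Z}^d}$ complex, $\Delta^\rho$ acts on the $k$-index, and $$\|c\|_{\ell^1(w^{m,p},\alpha)}=\sum_{j>0}\sum_{|\rho|\le m}|\alpha_j|^{|\rho|}\Big(\sum_{k\in\mathbb{Z}^d}|(\Delta^\rho c)_{j,k}|^p\Big)^{1/p}.$$ $\ell^1(w^{m,p},\alpha)$ is the Banach space of sequences for which this norm is finite. *)

theory Defs
  imports "HOL-Analysis.Analysis"
begin

text \<open>Multiindices are functions \<open>'n \<Rightarrow> nat\<close> on the coordinate type. Elements of \<open>L\<^sup>p\<close> and
  \<open>W\<^bsup>m,p\<^esup>\<close> are represented by functions; membership and norms do not depend on values on null sets.\<close>

definition mdeg :: "('n::finite \<Rightarrow> nat) \<Rightarrow> nat" where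
  "mdeg \<rho> = (\<Sum>i\<in>UNIV. \<rho> i)"

text \<open>\<open>multi_op T \<rho>\<close> is the product of the powers \<open>T i ^^ \<rho> i\<close> over all coordinates. As \<open>'n\<close> carries no order, the coordinates are enumerated by an
  arbitrary fixed list; the order is irrelevant where the operators commute, as
  differences of sequences and partial derivatives of smooth functions do.\<close>

definition coords :: "'n::finite list" where
  "coords = (SOME is. distinct is \<and> set is = UNIV)"

definition multi_op :: "('n::finite \<Rightarrow> 'f \<Rightarrow> 'f) \<Rightarrow> ('n \<Rightarrow> nat) \<Rightarrow> 'f \<Rightarrow> 'f" where
  "multi_op T \<rho> = foldr (\<lambda>i. T i ^^ \<rho> i) coords"

subsection \<open>Lebesgue and Sobolev spaces\<close>

definition Lp :: "real \<Rightarrow> (real^'n \<Rightarrow> complex) set" where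
  "Lp p = {f \<in> borel_measurable lebesgue. integrable lebesgue (\<lambda>x. norm (f x) powr p)}"

definition Lp_norm :: "real \<Rightarrow> (real^'n \<Rightarrow> complex) \<Rightarrow> real" where
  "Lp_norm p f = (\<integral>x. norm (f x) powr p \<partial>lebesgue) powr (1 / p)"

definition partial :: "'n \<Rightarrow> (real^'n \<Rightarrow> real) \<Rightarrow> real^'n \<Rightarrow> real" where
  "partial i \<phi> x = frechet_derivative \<phi> (at x) (axis i 1)"

primrec C_k :: "nat \<Rightarrow> (real^'n \<Rightarrow> real) \<Rightarrow> bool" where
  "C_k 0 \<phi> \<longleftrightarrow> continuous_on UNIV \<phi>"
| "C_k (Suc k) \<phi> \<longleftrightarrow> \<phi> differentiable_on UNIV \<and> (\<forall>i. C_k k (partial i \<phi>))"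

definition test_function :: "(real^'n \<Rightarrow> real) \<Rightarrow> bool" where
  "test_function \<phi> \<longleftrightarrow> (\<forall>k. C_k k \<phi>) \<and> compact (closure {x. \<phi> x \<noteq> 0})"

definition locally_integrable :: "(real^'n \<Rightarrow> complex) \<Rightarrow> bool" where
  "locally_integrable f \<longleftrightarrow> (\<forall>K. compact K \<longrightarrow> set_integrable lebesgue K f)"

definition has_weak_deriv ::
    "('n::finite \<Rightarrow> nat) \<Rightarrow> (real^'n \<Rightarrow> complex) \<Rightarrow> (real^'n \<Rightarrow> complex) \<Rightarrow> bool" where
  "has_weak_deriv \<rho> f g \<longleftrightarrow> locally_integrable f \<and> locally_integrable g \<and>
     (\<forall>\<phi>. test_function \<phi> \<longrightarrow>
        (\<integral>x. multi_op partial \<rho> \<phi> x *\<^sub>R f x \<partial>lebesgue)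
          = (- 1) ^ mdeg \<rho> * (\<integral>x. \<phi> x *\<^sub>R g x \<partial>lebesgue))"

text \<open>Weak derivatives are unique almost everywhere, so the choice below does not affect norms.\<close>

definition weak_deriv ::
    "('n::finite \<Rightarrow> nat) \<Rightarrow> (real^'n \<Rightarrow> complex) \<Rightarrow> real^'n \<Rightarrow> complex" where
  "weak_deriv \<rho> f = (SOME g. has_weak_deriv \<rho> f g)"

definition sobolev :: "nat \<Rightarrow> real \<Rightarrow> (real^'n::finite \<Rightarrow> complex) set" where
  "sobolev m p =
     {f \<in> Lp p. \<forall>\<rho>. mdeg \<rho> \<le> m \<longrightarrow> (\<exists>g\<in>Lp p. has_weak_deriv \<rho> f g)}"

definition sobolev_norm :: "nat \<Rightarrow> real \<Rightarrow> (real^'n::finite \<Rightarrow> complex) \<Rightarrow> real" where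
  "sobolev_norm m p f = (\<Sum>\<rho> | mdeg \<rho> \<le> m. Lp_norm p (weak_deriv \<rho> f))"

subsection \<open>Coefficient sequences\<close>

text \<open>Sequences indexed by \<open>j > 0\<close> are functions on \<open>nat\<close> whose value at \<open>0\<close> is ignored.\<close>

definition diff_op :: "'n \<Rightarrow> (int^'n \<Rightarrow> complex) \<Rightarrow> int^'n \<Rightarrow> complex" where
  "diff_op t s k = s k - s (k - axis t 1)"

definition l1w ::
    "nat \<Rightarrow> real \<Rightarrow> (nat \<Rightarrow> real) \<Rightarrow> (nat \<Rightarrow> int^'n::finite \<Rightarrow> complex) set" where
  "l1w m p \<alpha> = {c.
     (\<forall>j\<ge>1. \<forall>\<rho>. mdeg \<rho> \<le> m \<longrightarrow>
        (\<lambda>k. norm (multi_op diff_op \<rho> (c j) k) powr p) summable_on UNIV) \<and>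
     (\<lambda>j. \<Sum>\<rho> | mdeg \<rho> \<le> m. \<bar>\<alpha> j\<bar> ^ mdeg \<rho> *
        (\<Sum>\<^sub>\<infinity>k. norm (multi_op diff_op \<rho> (c j) k) powr p) powr (1 / p)) summable_on {1..}}"

definition l1w_norm ::
    "nat \<Rightarrow> real \<Rightarrow> (nat \<Rightarrow> real) \<Rightarrow> (nat \<Rightarrow> int^'n::finite \<Rightarrow> complex) \<Rightarrow> real" where
  "l1w_norm m p \<alpha> c =
     (\<Sum>\<^sub>\<infinity>j\<in>{1..}. \<Sum>\<rho> | mdeg \<rho> \<le> m. \<bar>\<alpha> j\<bar> ^ mdeg \<rho> *
        (\<Sum>\<^sub>\<infinity>k. norm (multi_op diff_op \<rho> (c j) k) powr p) powr (1 / p))"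

subsection \<open>Affine systems and synthesis\<close>

definition int_vec :: "int^'n \<Rightarrow> real^'n" where
  "int_vec k = (\<chi> i. real_of_int (k $ i))"

definition dilation :: "(nat \<Rightarrow> real) \<Rightarrow> nat \<Rightarrow> real^'n^'n" where
  "dilation \<alpha> j = mat (\<alpha> j)"

definition affine_elem ::
    "real \<Rightarrow> (nat \<Rightarrow> real^'n^'n) \<Rightarrow> real^'n^'n \<Rightarrow> (real^'n \<Rightarrow> complex) \<Rightarrow>
     nat \<Rightarrow> int^'n::finite \<Rightarrow> real^'n \<Rightarrow> complex" where
  "affine_elem p a b \<psi> j k x =
     of_real (\<bar>det (a j)\<bar> powr (1 / p)) * \<psi> (a j *v x - b *v int_vec k)"

definition synthesis_level ::
    "real \<Rightarrow> (nat \<Rightarrow> real^'n^'n) \<Rightarrow> real^'n^'n \<Rightarrow> (real^'n \<Rightarrow> complex) \<Rightarrow>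
     (nat \<Rightarrow> int^'n::finite \<Rightarrow> complex) \<Rightarrow> nat \<Rightarrow> real^'n \<Rightarrow> complex" where
  "synthesis_level p a b \<psi> c j x = (\<Sum>\<^sub>\<infinity>k. c j k * affine_elem p a b \<psi> j k x)"

text \<open>\<open>F = S c\<close>: for each \<open>j\<close> the sum over \<open>k\<close> converges absolutely almost everywhere to a
  function in \<open>W\<^bsup>m,p\<^esup>\<close>, and the sum over \<open>j\<close> of these functions converges absolutely in \<open>W\<^bsup>m,p\<^esup>\<close>,
  with limit \<open>F\<close>.\<close>

definition synthesizes ::
    "nat \<Rightarrow> real \<Rightarrow> (nat \<Rightarrow> real^'n^'n) \<Rightarrow> real^'n^'n \<Rightarrow> (real^'n \<Rightarrow> complex) \<Rightarrow>
     (nat \<Rightarrow> int^'n::finite \<Rightarrow> complex) \<Rightarrow> (real^'n \<Rightarrow> complex) \<Rightarrow> bool" where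
  "synthesizes m p a b \<psi> c F \<longleftrightarrow>
     (\<forall>j\<ge>1. (AE x in lebesgue. (\<lambda>k. norm (c j k * affine_elem p a b \<psi> j k x)) summable_on UNIV) \<and>
        synthesis_level p a b \<psi> c j \<in> sobolev m p) \<and>
     (\<lambda>j. sobolev_norm m p (synthesis_level p a b \<psi> c j)) summable_on {1..} \<and>
     F \<in> sobolev m p \<and>
     (\<lambda>J. sobolev_norm m p (\<lambda>x. F x - (\<Sum>j=1..J. synthesis_level p a b \<psi> c j x)))
       \<longlonglongrightarrow> 0"

text \<open>If the series diverges at \<open>x\<close> then \<open>periodization b f x = 0\<close>; in particular an identity
  \<open>periodization b f x = 1\<close> entails convergence.\<close>

definition periodization :: "real^'n^'n \<Rightarrow> (real^'n::finite \<Rightarrow> complex) \<Rightarrow> real^'n \<Rightarrow> complex" where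
  "periodization b f x = of_real \<bar>det b\<bar> * (\<Sum>\<^sub>\<infinity>k. f (x - b *v int_vec k))"

definition rescale_inv :: "real^'n^'n \<Rightarrow> (real^'n::finite \<Rightarrow> complex) \<Rightarrow> real^'n \<Rightarrow> complex" where
  "rescale_inv b f x = of_real (inverse \<bar>det b\<bar>) * f (matrix_inv b *v x)"

definition convolution ::
    "(real^'n \<Rightarrow> complex) \<Rightarrow> (real^'n \<Rightarrow> complex) \<Rightarrow> real^'n \<Rightarrow> complex" where
  "convolution f g x = (\<integral>y. f (x - y) * g y \<partial>lebesgue)"

definition unit_cell :: "(real^'n) set" where
  "unit_cell = {x. \<forall>i. 0 \<le> x $ i \<and> x $ i < 1}"

definition cell_average :: "real^'n^'n \<Rightarrow> real^'n::finite \<Rightarrow> complex" where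
  "cell_average b x =
     of_real (indicator ((*v) b ` unit_cell) x / measure lebesgue ((*v) b ` unit_cell))"

end

(* The derivatives of the level functions of Sc are level functions of differenced
   coefficients, because convolving with the cell average turns derivatives into differences; as the
   periodization of the kernel is 1, this gives ||Sc|| <= ||c||.  Conversely, sampling local averages
   of f on a fine lattice and averaging over many scales (a weak law in L^p) approximates f in W^(m,p)
   by a finite synthesis whose coefficient norm is at most ||f||; iterating on the remainder gives an
   exact representation with norm at most ||f|| + epsilon. *)
theory Submission
  imports Defs
begin

text \<open>The bound by exactly the norm of \<open>f\<close>, without a constant, comes from using
  only contractions, for each derivative separately: a difference of samples is the sample of a
  difference, a scaled difference is an average of a derivative along a segment, and cell means and
  averages obey Jensen's inequality. The obstacle is \<open>p = 1\<close>. Only the mass of the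
  kernel is prescribed there, so its lattice sum \<open>tot\<close> has mean 1 but need not be
  constant; sampling at one scale then reproduces \<open>tot (\<alpha> x) * f x\<close> instead of
  \<open>f x\<close>, and such an oscillating factor does not converge in norm. Averaging over
  scales removes it. The scales are selected one by one, because no growth rate of the dilations is
  assumed. For \<open>p > 1\<close> a single scale suffices. All sharp estimates are made after the
  substitution of \<open>b x\<close> for \<open>x\<close>, which replaces the translation lattice by
  the integers. Going back costs constants, but only membership and convergence are carried over,
  never a sharp norm.\<close>

section \<open>Convexity of powers and the norm of L^p\<close>

lemma powr_above_tangent:
  fixes x a p :: real
  assumes "1 \<le> p" "0 \<le> x" "0 < a"
  shows "a powr p + p * a powr (p - 1) * (x - a) \<le> x powr p"
\<comment> \<open>The supporting line of a convex function is taken on the open half-line, so the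
  boundary point is computed directly: there the left side equals
  \<open>(1 - p) * a powr p\<close>.\<close>
proof (cases "x = 0")
  case True
  have "a powr (p - 1) * a = a powr p"
    using assms by (metis add.commute diff_add_cancel less_eq_real_def powr_mult_base mult.commute)
  then have "a powr p + p * a powr (p - 1) * (x - a) = (1 - p) * a powr p"
    using True by (simp add: algebra_simps)
  also have "... \<le> 0" using assms by (intro mult_nonpos_nonneg) auto
  finally show ?thesis using True by simp
next
  case False
  have *: "((\<lambda>x. x powr p) has_real_derivative p * a powr (p - 1)) (at a within {0<..})"
    using assms by (auto intro!: derivative_eq_intros simp: field_simps)
  have "p * a powr (p - 1) * (x - a) \<le> x powr p - a powr p"
    by (rule convex_on_imp_above_tangent[OF powr_convex[OF assms(1)] _ _ _ *])
      (use assms False in \<open>auto simp: interior_open\<close>)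
  then show ?thesis by simp
qed

text \<open>Convexity at the mean \<open>c\<close> of \<open>a / A\<close> and \<open>b / B\<close>,
  with weights proportional to \<open>A\<close> and \<open>B\<close>. With \<open>A\<close> and
  \<open>B\<close> close to the norms of two functions, integration turns this pointwise bound into
  Minkowski's inequality.\<close>

lemma powr_add_le_weighted:
  fixes a b A B p :: real
  assumes p: "1 \<le> p" and nn: "0 \<le> a" "0 \<le> b" and pos: "0 < A" "0 < B"
  shows "(a + b) powr p
    \<le> (A + B) powr p * (A / (A + B) * (a / A) powr p + B / (A + B) * (b / B) powr p)"
proof (cases "a + b = 0")
  case True
  then show ?thesis using nn by (simp add: add_nonneg_eq_0_iff)
next
  case False
  define c where "c = (a + b) / (A + B)"
  have c: "0 < c" using False nn pos by (simp add: c_def)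
  let ?l = "A / (A + B)" and ?k = "B / (A + B)"
  let ?D = "p * c powr (p - 1)"
  have lk: "?l + ?k = 1" "0 \<le> ?l" "0 \<le> ?k"
    using pos by (auto simp: add_divide_distrib[symmetric])
  have "?l * (a / A) + ?k * (b / B) = c"
    using pos by (simp add: c_def add_divide_distrib)
  then have "c powr p = (?l + ?k) * c powr p + ?D * ((?l * (a / A) + ?k * (b / B)) - (?l + ?k) * c)"
    unfolding lk(1) by simp
  also have "... = ?l * (c powr p + ?D * (a / A - c)) + ?k * (c powr p + ?D * (b / B - c))"
  proof -
    have "(l + k) * P + D * ((l * u + k * v) - (l + k) * c) = l * (P + D * (u - c)) + k * (P + D * (v - c))"
      for l k P D u v :: real by (simp add: algebra_simps)
    then show ?thesis .
  qed
  also have "... \<le> ?l * (a / A) powr p + ?k * (b / B) powr p"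
    using lk nn pos c p by (intro add_mono mult_left_mono powr_above_tangent) auto
  finally have "(A + B) powr p * c powr p
      \<le> (A + B) powr p * (?l * (a / A) powr p + ?k * (b / B) powr p)"
    by (intro mult_left_mono) auto
  moreover have "(A + B) powr p * c powr p = (a + b) powr p"
    using c pos nn by (simp add: powr_mult[symmetric] c_def)
  ultimately show ?thesis by simp
qed

lemma powr_add_le:
  fixes a b p :: real
  assumes "1 \<le> p" "0 \<le> a" "0 \<le> b"
  shows "(a + b) powr p \<le> 2 powr p * (a powr p + b powr p)"
proof -
  have "(a + b) powr p \<le> 2 powr p * (1 / 2 * a powr p + 1 / 2 * b powr p)"
    using powr_add_le_weighted[OF assms, of 1 1] by simp
  also have "... \<le> 2 powr p * (a powr p + b powr p)"
    by (intro mult_left_mono add_mono) (auto simp: divide_le_eq)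
  finally show ?thesis .
qed

text \<open>The p-th power of the norm as an extended nonnegative integral over an arbitrary
  measure: Lebesgue measure, counting measure on the lattice and probability measures all occur.
  Inequalities can thus be proved before finiteness is known.\<close>

definition pint :: "'a measure \<Rightarrow> real \<Rightarrow> ('a \<Rightarrow> complex) \<Rightarrow> ennreal" where
  "pint M p f = (\<integral>\<^sup>+x. ennreal (norm (f x) powr p) \<partial>M)"

text \<open>On a finite measure \<open>|f| \<le> 1 + |f|^p\<close> is enough.\<close>

lemma integrable_of_pint:
  assumes f: "f \<in> borel_measurable M" and p: "1 \<le> p" and fin: "pint M p f < \<infinity>"
    and M: "emeasure M (space M) < \<infinity>"
  shows "integrable M f"
proof (rule integrableI_bounded[OF f])
  have "(\<integral>\<^sup>+x. ennreal (norm (f x)) \<partial>M) \<le> (\<integral>\<^sup>+x. 1 + ennreal (norm (f x) powr p) \<partial>M)"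
  proof (rule nn_integral_mono)
    fix x
    have "norm (f x) \<le> 1 + norm (f x) powr p"
    proof (cases "norm (f x) \<le> 1")
      case False
      then have "norm (f x) powr 1 \<le> norm (f x) powr p" using p by (intro powr_mono) auto
      then show ?thesis using False by auto
    next
      case True
      then show ?thesis by (smt (verit) powr_ge_zero)
    qed
    then show "ennreal (norm (f x)) \<le> 1 + ennreal (norm (f x) powr p)"
      by (metis ennreal_1 ennreal_leI ennreal_plus powr_ge_zero zero_le_one)
  qed
  also have "... = emeasure M (space M) + pint M p f"
    using f by (subst nn_integral_add) (auto simp: pint_def)
  finally show "(\<integral>\<^sup>+x. ennreal (norm (f x)) \<partial>M) < \<infinity>"
    using fin M by (auto simp: top_unique less_top[symmetric])
qed

text \<open>Two regimes share one statement: for \<open>p = 1\<close> it is the triangle inequality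
  and the mass is arbitrary, for \<open>p > 1\<close> the mass must be at most 1. The two clauses in
  the definition of \<open>kernel\<close> match these regimes.\<close>

lemma jensen_pint:
  assumes f: "f \<in> borel_measurable M" and p: "1 \<le> p"
    and M: "p = 1 \<or> emeasure M (space M) \<le> 1"
  shows "ennreal (norm (\<integral>x. f x \<partial>M) powr p) \<le> pint M p f"
proof (cases "integrable M f")
  case False
  \<comment> \<open>Without integrability the Bochner integral is 0, so the left side
    vanishes.\<close>
  then show ?thesis by (simp add: not_integrable_integral_eq)
next
  case int: True
  define a where "a = (\<integral>x. norm (f x) \<partial>M)"
  have na: "norm (\<integral>x. f x \<partial>M) \<le> a" by (simp add: a_def)
  have a0: "0 \<le> a" by (simp add: a_def)
  have intn: "integrable M (\<lambda>x. norm (f x))" using int by simp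
  consider "p = 1" | "a = 0" | "pint M p f = \<infinity>"
    | "0 < a" "emeasure M (space M) \<le> 1" "pint M p f < \<infinity>"
    using M a0 by (auto simp: less_top[symmetric] le_less)
  then show ?thesis
  proof cases
    case 1
    have "pint M p f = ennreal a"
      using intn by (simp add: pint_def a_def nn_integral_eq_integral 1)
    then show ?thesis using na 1 by (simp add: ennreal_leI)
  next
    case 2
    then show ?thesis using na by simp
  next
    case 4
    have "integrable M (\<lambda>x. norm (f x) powr p)"
      using f 4(3) by (intro integrableI_bounded) (auto simp: pint_def)
    then have eq: "pint M p f = ennreal (\<integral>x. norm (f x) powr p \<partial>M)"
        and ip: "integrable M (\<lambda>x. norm (f x) powr p)"
      by (auto simp: pint_def nn_integral_eq_integral)
    interpret finite_measure M using 4(2) by (intro finite_measureI) (auto simp: top_unique)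
    have m1: "measure M (space M) \<le> 1"
      using 4(2) by (metis emeasure_eq_measure ennreal_1 ennreal_le_iff zero_le_one)
    let ?D = "p * a powr (p - 1)"
    have aa: "a powr (p - 1) * a = a powr p"
      using 4(1) by (metis add.commute diff_add_cancel less_eq_real_def powr_mult_base mult.commute)
    \<comment> \<open>The tangent at the mean \<open>a\<close> is integrated. A mass below 1 leaves
      the surplus \<open>(p - 1) * a powr p * (1 - mass)\<close>, which is nonnegative; for mass 1
      this is the usual proof of Jensen's inequality.\<close>
    have "a powr p \<le> a powr p + (p - 1) * a powr p * (1 - measure M (space M))"
      using p m1 by simp
    also have "... = a powr p * measure M (space M) + p * (a powr (p - 1) * a) * (1 - measure M (space M))"
      unfolding aa by (simp add: algebra_simps)
    also have "... = a powr p * measure M (space M) + ?D * (a - a * measure M (space M))"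
      by (simp add: algebra_simps)
    also have "... = (\<integral>x. a powr p + ?D * (norm (f x) - a) \<partial>M)"
      using intn by (simp add: a_def[symmetric] Bochner_Integration.integral_diff algebra_simps)
    also have "... \<le> (\<integral>x. norm (f x) powr p \<partial>M)"
      using intn ip p 4(1) by (intro integral_mono powr_above_tangent) auto
    finally have "a powr p \<le> (\<integral>x. norm (f x) powr p \<partial>M)" .
    moreover have "norm (\<integral>x. f x \<partial>M) powr p \<le> a powr p" using na p by (intro powr_mono2) auto
    ultimately show ?thesis using eq by (auto intro: ennreal_leI)
  qed simp
qed

lemma pint_cong_AE: "AE x in M. f x = g x ==> pint M p f = pint M p g"
  unfolding pint_def by (intro nn_integral_cong_AE) auto

lemma pint_cmult: "f \<in> borel_measurable M ==> pint M p (\<lambda>x. c * f x) = ennreal (norm c powr p) * pint M p f"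
  unfolding pint_def by (simp add: norm_mult powr_mult ennreal_mult nn_integral_cmult)

lemma pint_add_le:
  assumes "1 \<le> p" "f \<in> borel_measurable M" "g \<in> borel_measurable M"
  shows "pint M p (\<lambda>x. f x + g x) \<le> ennreal (2 powr p) * (pint M p f + pint M p g)"
proof -
  have "pint M p (\<lambda>x. f x + g x)
      \<le> (\<integral>\<^sup>+x. ennreal (2 powr p) * (ennreal (norm (f x) powr p) + ennreal (norm (g x) powr p)) \<partial>M)"
    unfolding pint_def
  proof (rule nn_integral_mono)
    fix x
    have "norm (f x + g x) powr p \<le> (norm (f x) + norm (g x)) powr p"
      using assms by (intro powr_mono2 norm_triangle_ineq) auto
    also have "... \<le> 2 powr p * (norm (f x) powr p + norm (g x) powr p)"
      using assms by (intro powr_add_le) auto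
    finally show "ennreal (norm (f x + g x) powr p)
        \<le> ennreal (2 powr p) * (ennreal (norm (f x) powr p) + ennreal (norm (g x) powr p))"
      by (metis ennreal_leI ennreal_mult ennreal_plus powr_ge_zero add_nonneg_nonneg)
  qed
  also have "... = ennreal (2 powr p) * (pint M p f + pint M p g)"
    using assms by (simp add: nn_integral_cmult nn_integral_add pint_def)
  finally show ?thesis .
qed

lemma Lp_iff: "f \<in> Lp p \<longleftrightarrow> f \<in> borel_measurable lebesgue \<and> pint lebesgue p f < \<infinity>"
proof -
  have "integrable lebesgue (\<lambda>x. norm (f x) powr p) \<longleftrightarrow> pint lebesgue p f < \<infinity>"
    if "f \<in> borel_measurable lebesgue"
    using that by (simp add: integrable_iff_bounded pint_def)
  then show ?thesis by (auto simp: Lp_def)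
qed

lemma Lp_norm_nonneg [simp]: "0 \<le> Lp_norm p f"
  by (simp add: Lp_norm_def)

lemma Lp_norm_pint:
  assumes "f \<in> Lp p" "0 < p" shows "ennreal (Lp_norm p f powr p) = pint lebesgue p f"
proof -
  have "integrable lebesgue (\<lambda>x. norm (f x) powr p)" using assms by (simp add: Lp_def)
  then have "pint lebesgue p f = ennreal (\<integral>x. norm (f x) powr p \<partial>lebesgue)"
    by (simp add: pint_def nn_integral_eq_integral)
  then show ?thesis using assms by (simp add: Lp_norm_def powr_powr)
qed

lemma Lp_norm_leI:
  assumes "f \<in> borel_measurable lebesgue" "0 < p" "0 \<le> c" "pint lebesgue p f \<le> ennreal (c powr p)"
  shows "f \<in> Lp p" "Lp_norm p f \<le> c"
proof -
  show f: "f \<in> Lp p" using assms by (auto simp: Lp_iff le_less_trans)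
  have "Lp_norm p f powr p \<le> c powr p"
    using assms Lp_norm_pint[OF f] by (metis ennreal_le_iff powr_ge_zero)
  then show "Lp_norm p f \<le> c"
    using assms powr_less_mono2[of p c "Lp_norm p f"] by force
qed

lemma Lp_norm_mono_pint:
  assumes "f \<in> borel_measurable lebesgue" "0 < p" "g \<in> Lp p" "pint lebesgue p f \<le> pint lebesgue p g"
  shows "f \<in> Lp p" "Lp_norm p f \<le> Lp_norm p g"
  using Lp_norm_leI[of f p "Lp_norm p g"] assms by (auto simp: Lp_norm_pint)

text \<open>Lebesgue measure is complete: the part of a preimage inside the exceptional null set is
  measurable, whatever it is.\<close>

lemma borel_measurable_lebesgue_AE:
  fixes f g :: "'a::euclidean_space \<Rightarrow> 'b::topological_space"
  assumes ae: "AE x in lebesgue. f x = g x" and g: "g \<in> borel_measurable lebesgue"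
  shows "f \<in> borel_measurable lebesgue"
proof -
  obtain N where N: "N \<in> null_sets lebesgue" "{x. f x \<noteq> g x} \<subseteq> N"
    using ae by (auto simp: eventually_ae_filter)
  have "f -` S \<in> sets lebesgue" if "S \<in> sets borel" for S
  proof -
    have "f -` S \<inter> N \<in> sets lebesgue"
      using N(1) null_sets_completion_subset[of "f -` S \<inter> N" N lborel] by auto
    moreover have "f -` S = (g -` S - N) \<union> (f -` S \<inter> N)" using N(2) by auto
    moreover have "g -` S \<in> sets lebesgue" using measurable_sets[OF g that] by simp
    ultimately show ?thesis using N(1) by (metis null_setsD2 sets.Diff sets.Un)
  qed
  then show ?thesis by (auto intro!: measurableI)
qed

lemma Lp_cong_AE:
  assumes "AE x in lebesgue. f x = g x" "g \<in> Lp p"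
  shows "f \<in> Lp p"
  using assms pint_cong_AE[OF assms(1)] borel_measurable_lebesgue_AE[OF assms(1)] by (simp add: Lp_iff)

lemma Lp_norm_cong_AE:
  assumes "AE x in lebesgue. f x = g x" "g \<in> Lp p" "0 < p"
  shows "Lp_norm p f = Lp_norm p g"
  using Lp_norm_mono_pint[of f p g] Lp_norm_mono_pint[of g p f] pint_cong_AE[OF assms(1)] 
    Lp_cong_AE[OF assms(1,2)] assms by (auto simp: Lp_def intro!: antisym)

lemma Lp_measurable: "f \<in> Lp p ==> f \<in> borel_measurable lebesgue"
  by (simp add: Lp_def)

lemma Lp_add: assumes "1 \<le> p" "f \<in> Lp p" "g \<in> Lp p" shows "(\<lambda>x. f x + g x) \<in> Lp p"
  using pint_add_le[of p f lebesgue g] assms 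
  by (auto simp: Lp_iff ennreal_mult_less_top elim!: le_less_trans)

lemma Lp_cmult: assumes "f \<in> Lp p" shows "(\<lambda>x. c * f x) \<in> Lp p"
  using pint_cmult[of f lebesgue p c] assms by (auto simp: Lp_iff ennreal_mult_less_top)

lemma Lp_zero: "(\<lambda>x. 0) \<in> Lp p" by (simp add: Lp_def)

lemma Lp_diff: assumes "1 \<le> p" "f \<in> Lp p" "g \<in> Lp p" shows "(\<lambda>x. f x - g x) \<in> Lp p"
  using Lp_add[OF assms(1,2) Lp_cmult[OF assms(3), of "-1"]] by simp

lemma Lp_sum:
  assumes "1 \<le> p" "\<And>i. i \<in> I ==> f i \<in> Lp p"
  shows "(\<lambda>x. \<Sum>i\<in>I. f i x) \<in> Lp p"
  using assms(2) by (induction I rule: infinite_finite_induct) (auto simp: Lp_zero intro!: Lp_add[OF assms(1)])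

lemma Lp_norm_cmult: "Lp_norm p (\<lambda>x. c * f x) = norm c * Lp_norm p f" if "0 < p"
  unfolding Lp_norm_def using that by (simp add: norm_mult powr_mult powr_powr)

lemma Lp_norm_zero [simp]: "Lp_norm p (\<lambda>x. 0) = 0"
  by (simp add: Lp_norm_def)

lemma Lp_norm_minus_commute: "Lp_norm p (\<lambda>x. f x - g x) = Lp_norm p (\<lambda>x. g x - f x)"
  by (simp add: Lp_norm_def norm_minus_commute)

lemma Lp_norm_triangle:
  assumes p: "1 \<le> p" and f: "f \<in> Lp p" and g: "g \<in> Lp p"
  shows "Lp_norm p (\<lambda>x. f x + g x) \<le> Lp_norm p f + Lp_norm p g"
proof (rule field_le_epsilon)
  fix e :: real assume e: "0 < e"
  \<comment> \<open>The extra \<open>e / 2\<close> keeps both scales positive when a norm vanishes;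
    it disappears because \<open>e\<close> is arbitrary.\<close>
  define A where "A = Lp_norm p f + e / 2"
  define B where "B = Lp_norm p g + e / 2"
  have A: "0 < A" "Lp_norm p f \<le> A" and B: "0 < B" "Lp_norm p g \<le> B"
    using e by (auto simp: A_def B_def add_nonneg_pos)
  have [measurable]: "f \<in> borel_measurable lebesgue" "g \<in> borel_measurable lebesgue"
    using f g by (auto simp: Lp_measurable)
  have le1: "pint lebesgue p (\<lambda>x. h x / C) \<le> 1" if "h \<in> Lp p" "0 < C" "Lp_norm p h \<le> C" for h and C :: real
  proof -
    have "pint lebesgue p (\<lambda>x. h x / C) = ennreal (norm (1 / C) powr p) * pint lebesgue p h"
      using that pint_cmult[of h lebesgue p "of_real (1 / C)"] by (simp add: Lp_measurable norm_divide)
    also have "... = ennreal ((Lp_norm p h / C) powr p)"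
      using that p by (simp add: Lp_norm_pint[symmetric] ennreal_mult[symmetric] powr_divide)
    also have "... \<le> ennreal (1 powr p)" using that p by (intro ennreal_leI powr_mono2) auto
    finally show ?thesis by simp
  qed
  let ?c = "(A + B) powr p"
  have "pint lebesgue p (\<lambda>x. f x + g x)
      \<le> (\<integral>\<^sup>+x. ennreal (?c * (A / (A + B))) * ennreal (norm (f x / A) powr p)
            + ennreal (?c * (B / (A + B))) * ennreal (norm (g x / B) powr p) \<partial>lebesgue)"
    unfolding pint_def
  proof (rule nn_integral_mono)
    fix x
    have "norm (f x + g x) powr p \<le> (norm (f x) + norm (g x)) powr p"
      using p by (intro powr_mono2 norm_triangle_ineq) auto
    also have "... \<le> ?c * (A / (A + B) * (norm (f x) / A) powr p + B / (A + B) * (norm (g x) / B) powr p)"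
      using p A B by (intro powr_add_le_weighted) auto
    also have "... = ?c * (A / (A + B)) * norm (f x / A) powr p + ?c * (B / (A + B)) * norm (g x / B) powr p"
      using A B by (simp add: norm_divide distrib_left mult.assoc)
    finally show "ennreal (norm (f x + g x) powr p)
      \<le> ennreal (?c * (A / (A + B))) * ennreal (norm (f x / A) powr p)
            + ennreal (?c * (B / (A + B))) * ennreal (norm (g x / B) powr p)"
      using A B by (simp add: ennreal_mult'[symmetric] flip: ennreal_plus)
  qed
  also have "... = ennreal (?c * (A / (A + B))) * pint lebesgue p (\<lambda>x. f x / A)
       + ennreal (?c * (B / (A + B))) * pint lebesgue p (\<lambda>x. g x / B)"
    by (simp add: nn_integral_add nn_integral_cmult pint_def)
  also have "... \<le> ennreal (?c * (A / (A + B))) * 1 + ennreal (?c * (B / (A + B))) * 1"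
    using le1[OF f A] le1[OF g B] by (intro add_mono mult_left_mono) auto
  also have "... = ennreal ?c"
  proof -
    have "?c * (A / (A + B)) + ?c * (B / (A + B)) = ?c"
      using A B by (metis (no_types, opaque_lifting) add_divide_distrib add_pos_pos distrib_left divide_self_if less_irrefl mult.right_neutral)
    then show ?thesis using A B by (simp flip: ennreal_plus)
  qed
  finally have "Lp_norm p (\<lambda>x. f x + g x) \<le> A + B"
    using p A B by (intro Lp_norm_leI) auto
  then show "Lp_norm p (\<lambda>x. f x + g x) \<le> Lp_norm p f + Lp_norm p g + e"
    by (simp add: A_def B_def)
qed

lemma Lp_norm_sum_le:
  assumes "1 \<le> p" "\<And>i. i \<in> I ==> f i \<in> Lp p"
  shows "Lp_norm p (\<lambda>x. \<Sum>i\<in>I. f i x) \<le> (\<Sum>i\<in>I. Lp_norm p (f i))"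
  using assms(2)
proof (induction I rule: infinite_finite_induct)
  case (insert i I)
  have "Lp_norm p (\<lambda>x. \<Sum>i\<in>insert i I. f i x) \<le> Lp_norm p (f i) + Lp_norm p (\<lambda>x. \<Sum>i\<in>I. f i x)"
    using insert by (auto intro!: Lp_norm_triangle Lp_sum assms(1))
  then show ?case using insert by auto
qed auto

lemma Lp_norm_three:
  assumes p: "1 \<le> p" and "f \<in> Lp p" "g \<in> Lp p" "h \<in> Lp p"
  shows "Lp_norm p (\<lambda>x. f x - h x) \<le> Lp_norm p (\<lambda>x. f x - g x) + Lp_norm p (\<lambda>x. g x - h x)"
  using Lp_norm_triangle[OF p Lp_diff[OF p assms(2,3)] Lp_diff[OF p assms(3,4)]] by simp

text \<open>Fubini and pushforwards need joint Borel measurability, which Lebesgue measurable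
  functions do not give; hence the passage to representatives.\<close>

lemma Lp_borel_representative:
  fixes f :: "real^'n \<Rightarrow> complex"
  assumes "f \<in> borel_measurable lebesgue"
  obtains g where "g \<in> borel_measurable borel" "AE x in lebesgue. f x = g x"
proof -
  have re: "(\<lambda>x. Re (f x)) \<in> borel_measurable (completion lborel)" "(\<lambda>x. Im (f x)) \<in> borel_measurable (completion lborel)"
    using assms by auto
  obtain r i where ri [measurable]: "r \<in> borel_measurable lborel" "i \<in> borel_measurable lborel"
    and ae: "AE x in lborel. Re (f x) = r x" "AE x in lborel. Im (f x) = i x"
    using completion_ex_borel_measurable_real[OF re(1)] completion_ex_borel_measurable_real[OF re(2)] by blast
  show ?thesis
  proof
    show "(\<lambda>x. Complex (r x) (i x)) \<in> borel_measurable borel"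
      using ri by (simp add: borel_measurable_complex_iff)
    show "AE x in lebesgue. f x = Complex (r x) (i x)"
      using ae by (intro AE_completion) (auto simp: complex_eq_iff)
  qed
qed

section \<open>Multiindices and iterated commuting operators\<close>

abbreviation inc :: "'n \<Rightarrow> ('n \<Rightarrow> nat) \<Rightarrow> 'n \<Rightarrow> nat" where
  "inc t \<rho> \<equiv> \<rho>(t := Suc (\<rho> t))"

lemma mdeg_inc [simp]: "mdeg (inc t \<rho>) = Suc (mdeg \<rho>)" for \<rho> :: "'n::finite \<Rightarrow> nat"
proof -
  have "mdeg (inc t \<rho>) = inc t \<rho> t + (\<Sum>i\<in>UNIV - {t}. inc t \<rho> i)"
    unfolding mdeg_def by (rule sum.remove) auto
  also have "... = Suc (\<rho> t + (\<Sum>i\<in>UNIV - {t}. \<rho> i))" by simp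
  also have "\<rho> t + (\<Sum>i\<in>UNIV - {t}. \<rho> i) = mdeg \<rho>"
    unfolding mdeg_def by (rule sum.remove[symmetric]) auto
  finally show ?thesis .
qed

lemma mdeg_zero [simp]: "mdeg (\<lambda>_. 0) = 0" by (simp add: mdeg_def)

text \<open>Removing a unit from a positive entry lowers the degree. Statements on higher
  derivatives and differences reduce by this rule to a first-order step, in an arbitrary
  direction.\<close>

lemma multiindex_induct [case_names zero inc]:
  fixes \<rho> :: "'n::finite \<Rightarrow> nat"
  assumes "P (\<lambda>_. 0)" and "\<And>\<rho> t. P \<rho> ==> P (inc t \<rho>)"
  shows "P \<rho>"
proof (induction "mdeg \<rho>" arbitrary: \<rho>)
  case 0
  then have "\<rho> = (\<lambda>_. 0)" by (auto simp: mdeg_def)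
  then show ?case using assms by simp
next
  case (Suc k)
  then obtain t where t: "0 < \<rho> t" by (auto simp: mdeg_def) (metis sum.neutral nat.distinct(1) gr0I)
  let ?\<sigma> = "\<rho>(t := \<rho> t - 1)"
  have \<rho>: "\<rho> = inc t ?\<sigma>" using t by auto
  then have "mdeg \<rho> = Suc (mdeg ?\<sigma>)" by (metis mdeg_inc)
  then have "P ?\<sigma>" using Suc by auto
  then show ?case using assms(2)[of ?\<sigma> t] \<rho> by simp
qed

lemma finite_mdeg_le: "finite {\<rho> :: 'n::finite \<Rightarrow> nat. mdeg \<rho> \<le> m}"
proof (rule finite_subset)
  show "{\<rho> :: 'n \<Rightarrow> nat. mdeg \<rho> \<le> m} \<subseteq> {\<rho>. \<forall>x. (x \<in> UNIV \<longrightarrow> \<rho> x \<in> {..m}) \<and> (x \<notin> UNIV \<longrightarrow> \<rho> x = 0)}"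
  proof clarsimp
    fix \<rho> :: "'n \<Rightarrow> nat" and x assume "mdeg \<rho> \<le> m"
    moreover have "\<rho> x \<le> mdeg \<rho>" unfolding mdeg_def by (rule member_le_sum) auto
    ultimately show "\<rho> x \<le> m" by simp
  qed
  show "finite {\<rho> :: 'n \<Rightarrow> nat. \<forall>x. (x \<in> UNIV \<longrightarrow> \<rho> x \<in> {..m}) \<and> (x \<notin> UNIV \<longrightarrow> \<rho> x = 0)}"
    by (rule finite_set_of_finite_funs) auto
qed

lemma coords: "distinct (coords :: 'n::finite list)" "set (coords :: 'n list) = UNIV"
proof -
  have "\<exists>is :: 'n list. distinct is \<and> set is = UNIV"
    using finite_distinct_list[of "UNIV :: 'n set"] by auto
  from someI_ex[OF this] show "distinct (coords :: 'n list)" "set (coords :: 'n list) = UNIV"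
    unfolding coords_def by auto
qed

lemma multi_op_zero [simp]: "multi_op T (\<lambda>_. 0) x = x"
proof -
  have "foldr (\<lambda>i. T i ^^ 0) xs x = x" for xs by (induction xs) auto
  then show ?thesis by (simp add: multi_op_def)
qed

context
  fixes T :: "'n::finite \<Rightarrow> 'f \<Rightarrow> 'f" and X :: "'f set"
  assumes inv: "\<And>i x. x \<in> X ==> T i x \<in> X"
    and comm: "\<And>i j x. x \<in> X ==> T i (T j x) = T j (T i x)"
begin

lemma funpow_inv: "x \<in> X ==> (T i ^^ n) x \<in> X"
  by (induction n) (auto intro: inv)

lemma foldr_inv: "x \<in> X ==> foldr (\<lambda>i. T i ^^ \<rho> i) xs x \<in> X"
  by (induction xs) (auto intro: funpow_inv)

lemma multi_op_inv: "x \<in> X ==> multi_op T \<rho> x \<in> X"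
  unfolding multi_op_def by (rule foldr_inv)

lemma funpow_comm: "x \<in> X ==> T t ((T i ^^ n) x) = (T i ^^ n) (T t x)"
  by (induction n) (auto simp: comm[OF funpow_inv])

lemma foldr_comm: "x \<in> X ==> T t (foldr (\<lambda>i. T i ^^ \<rho> i) xs x) = foldr (\<lambda>i. T i ^^ \<rho> i) xs (T t x)"
  by (induction xs) (auto simp: funpow_comm[OF foldr_inv])

lemma multi_op_comm: "x \<in> X ==> T t (multi_op T \<rho> x) = multi_op T \<rho> (T t x)"
  unfolding multi_op_def by (rule foldr_comm)

text \<open>\<open>foldr\<close> applies the powers of later coordinates first, so the extra factor
  has to pass these to reach the argument. Commutation is available only on the invariant set
  \<open>X\<close>: partial derivatives commute on test functions, differences on all
  sequences.\<close>

lemma multi_op_inc: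
  assumes "x \<in> X"
  shows "multi_op T (inc t \<rho>) x = multi_op T \<rho> (T t x)"
proof -
  have notin: "foldr (\<lambda>i. T i ^^ inc t \<rho> i) xs x = foldr (\<lambda>i. T i ^^ \<rho> i) xs x" if "t \<notin> set xs" for xs
    using that by (induction xs) auto
  have "foldr (\<lambda>i. T i ^^ inc t \<rho> i) xs x = foldr (\<lambda>i. T i ^^ \<rho> i) xs (T t x)"
    if "distinct xs" "t \<in> set xs" for xs
    using that
  proof (induction xs)
    case (Cons a xs)
    show ?case
    proof (cases "a = t")
      case True
      then show ?thesis using Cons.prems notin[of xs]
        by (simp add: foldr_comm[OF assms, symmetric] funpow_swap1)
    next
      case False
      then show ?thesis using Cons by simp
    qed
  qed simp
  then show ?thesis unfolding multi_op_def using coords by (metis UNIV_I)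
qed

lemma multi_op_inc': "x \<in> X ==> multi_op T (inc t \<rho>) x = T t (multi_op T \<rho> x)"
  by (simp add: multi_op_inc multi_op_comm)

end

section \<open>Classical derivatives of test functions\<close>

lemma C_k_differentiable: "C_k (Suc k) \<phi> ==> \<phi> differentiable (at x)"
  by (auto simp: differentiable_on_def)

lemma C_k_has_derivative: "C_k (Suc k) \<phi> ==> (\<phi> has_derivative frechet_derivative \<phi> (at x)) (at x)"
  using C_k_differentiable frechet_derivative_works by blast

lemma partial_eqI: "(\<phi> has_derivative \<phi>') (at x) ==> partial i \<phi> x = \<phi>' (axis i 1)"
  by (simp add: partial_def frechet_derivative_at[symmetric])

lemma C_k_line_derivative:
  assumes "C_k (Suc k) \<phi>"
  shows "((\<lambda>s. \<phi> (x + s *\<^sub>R axis t 1)) has_real_derivative partial t \<phi> (x + s *\<^sub>R axis t 1)) (at s)"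
proof -
  let ?y = "x + s *\<^sub>R axis t 1"
  have 1: "((\<lambda>s. x + s *\<^sub>R axis t 1) has_derivative (\<lambda>h. h *\<^sub>R axis t 1)) (at s)"
    by (auto intro!: derivative_eq_intros)
  have "((\<lambda>s. \<phi> (x + s *\<^sub>R axis t 1)) has_derivative (\<lambda>h. frechet_derivative \<phi> (at ?y) (h *\<^sub>R axis t 1))) (at s)"
    using has_derivative_compose[OF 1 C_k_has_derivative[OF assms, of ?y]] by simp
  moreover have "linear (frechet_derivative \<phi> (at ?y))"
    using C_k_has_derivative[OF assms] has_derivative_linear by blast
  ultimately show ?thesis
    by (simp add: has_field_derivative_def partial_def linear_cmul mult.commute[of _ "frechet_derivative _ _ _"] )
qed

text \<open>Schwarz's theorem by the second difference \<open>q\<close>, which is symmetric in the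
  two directions: divided by \<open>h * h\<close> it tends to either of the mixed
  derivatives.\<close>

lemma partial_commute:
  assumes C2: "C_k 2 \<phi>"
  shows "partial i (partial j \<phi>) = partial j (partial i \<phi>)"
proof
  fix x
  define q where "q h = \<phi> (x + h *\<^sub>R axis i 1 + h *\<^sub>R axis j 1) - \<phi> (x + h *\<^sub>R axis i 1)
      - \<phi> (x + h *\<^sub>R axis j 1) + \<phi> x" for h :: real
  have C1: "C_k (Suc 0) (partial a \<phi>)" "C_k (Suc 0) \<phi>" "continuous_on UNIV (partial b (partial a \<phi>))" for a b
    using C2 by (auto simp: numeral_2_eq_2 intro: differentiable_imp_continuous_on)
  \<comment> \<open>The mean value theorem twice: along \<open>a\<close> for the increment in
    direction \<open>b\<close>, then along \<open>b\<close> for the derivative obtained.\<close>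
  have key: "\<exists>u v. 0 \<le> u \<and> u \<le> h \<and> 0 \<le> v \<and> v \<le> h \<and>
      \<phi> (x + h *\<^sub>R axis a 1 + h *\<^sub>R axis b 1) - \<phi> (x + h *\<^sub>R axis a 1) - \<phi> (x + h *\<^sub>R axis b 1) + \<phi> x
        = h * h * partial b (partial a \<phi>) (x + u *\<^sub>R axis a 1 + v *\<^sub>R axis b 1)"
    if h: "0 < h" for h a b
  proof -
    let ?g = "\<lambda>s. \<phi> (x + h *\<^sub>R axis b 1 + s *\<^sub>R axis a 1) - \<phi> (x + s *\<^sub>R axis a 1)"
    have "(?g has_real_derivative partial a \<phi> (x + h *\<^sub>R axis b 1 + s *\<^sub>R axis a 1)
        - partial a \<phi> (x + s *\<^sub>R axis a 1)) (at s)" for s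
      by (intro DERIV_diff C_k_line_derivative[OF C1(2)])
    from MVT2[OF h this] obtain u where u: "0 < u" "u < h"
      "?g h - ?g 0 = (h - 0) * (partial a \<phi> (x + h *\<^sub>R axis b 1 + u *\<^sub>R axis a 1) - partial a \<phi> (x + u *\<^sub>R axis a 1))"
      by blast
    obtain v where v: "0 < v" "v < h"
      "partial a \<phi> (x + u *\<^sub>R axis a 1 + h *\<^sub>R axis b 1) - partial a \<phi> (x + u *\<^sub>R axis a 1 + 0 *\<^sub>R axis b 1)
        = (h - 0) * partial b (partial a \<phi>) (x + u *\<^sub>R axis a 1 + v *\<^sub>R axis b 1)"
      using MVT2[OF h C_k_line_derivative[OF C1(1), where x = "x + u *\<^sub>R axis a 1" and t = b and a1 = a]] by blast
    show ?thesis
      using u v by (intro exI[of _ u] exI[of _ v]) (simp add: algebra_simps)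
  qed
  have lim: "((\<lambda>h. q h / (h * h)) \<longlongrightarrow> partial b (partial a \<phi>) x) (at_right 0)"
    if q: "\<And>h. q h = \<phi> (x + h *\<^sub>R axis a 1 + h *\<^sub>R axis b 1) - \<phi> (x + h *\<^sub>R axis a 1) - \<phi> (x + h *\<^sub>R axis b 1) + \<phi> x"
    for a b
  proof -
    have "\<forall>h. \<exists>u v. 0 < h \<longrightarrow> 0 \<le> u \<and> u \<le> h \<and> 0 \<le> v \<and> v \<le> h \<and>
        q h = h * h * partial b (partial a \<phi>) (x + u *\<^sub>R axis a 1 + v *\<^sub>R axis b 1)"
      using key[of _ a b] q by metis
    then obtain u v where uv: "\<And>h. 0 < h ==> 0 \<le> u h \<and> u h \<le> h \<and> 0 \<le> v h \<and> v h \<le> h \<and>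
        q h = h * h * partial b (partial a \<phi>) (x + u h *\<^sub>R axis a 1 + v h *\<^sub>R axis b 1)"
      by metis
    have id: "((\<lambda>h::real. h) \<longlongrightarrow> 0) (at_right 0)" by (rule tendsto_ident_at)
    have pos: "eventually (\<lambda>h::real. 0 < h) (at_right 0)" by (auto simp: eventually_at_right_less)
    have "(u \<longlongrightarrow> 0) (at_right 0)" "(v \<longlongrightarrow> 0) (at_right 0)"
      by (rule tendsto_sandwich[OF _ _ tendsto_const id]; use pos uv in \<open>auto elim!: eventually_mono\<close>)+
    then have "((\<lambda>h. x + u h *\<^sub>R axis a 1 + v h *\<^sub>R axis b 1) \<longlongrightarrow> x + 0 *\<^sub>R axis a 1 + 0 *\<^sub>R axis b 1) (at_right 0)"
      by (intro tendsto_intros)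
    then have "((\<lambda>h. partial b (partial a \<phi>) (x + u h *\<^sub>R axis a 1 + v h *\<^sub>R axis b 1))
        \<longlongrightarrow> partial b (partial a \<phi>) x) (at_right 0)"
      using C1(3)[of b a] by (intro continuous_on_tendsto_compose[OF C1(3)]) auto
    then show ?thesis
      by (rule Lim_transform_eventually) (use pos uv in \<open>auto elim!: eventually_mono\<close>)
  qed
  show "partial i (partial j \<phi>) x = partial j (partial i \<phi>) x"
    by (rule tendsto_unique[OF _ lim[of j i] lim[of i j]]) (auto simp: q_def algebra_simps)
qed

lemma test_function_C_k: "test_function \<phi> ==> C_k k \<phi>"
  by (simp add: test_function_def)

lemma test_function_continuous: "test_function \<phi> ==> continuous_on UNIV \<phi>"
  using test_function_C_k[of \<phi> 0] by simp

lemma test_function_support: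
  "test_function \<phi> ==> \<exists>K. compact K \<and> (\<forall>x. x \<notin> K \<longrightarrow> \<phi> x = 0)"
  unfolding test_function_def
  by (rule exI[of _ "closure {x. \<phi> x \<noteq> 0}"]) (use closure_subset[of "{x. \<phi> x \<noteq> 0}"] in auto)

lemma compact_closure_subset:
  fixes K S :: "'a::heine_borel set"
  assumes "compact K" "S \<subseteq> K" shows "compact (closure S)"
proof -
  have "bounded S" by (rule bounded_subset[OF compact_imp_bounded[OF assms(1)] assms(2)])
  then show ?thesis by (simp add: compact_closure)
qed

lemma test_functionI:
  assumes "\<And>k. C_k k \<phi>" "compact K" "\<And>x. x \<notin> K ==> \<phi> x = 0"
  shows "test_function \<phi>"
proof -
  have "compact (closure {x. \<phi> x \<noteq> 0})"
    using assms(3) by (intro compact_closure_subset[OF assms(2)]) auto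
  then show ?thesis using assms(1) by (simp add: test_function_def)
qed

lemma test_function_partial:
  assumes "test_function \<phi>" shows "test_function (partial i \<phi>)"
proof -
  let ?K = "closure {x. \<phi> x \<noteq> 0}"
  have 1: "C_k k (partial i \<phi>)" for k
    using test_function_C_k[OF assms, of "Suc k"] by simp
  have "partial i \<phi> x = 0" if x: "x \<notin> ?K" for x
  proof -
    have "((\<lambda>_. 0) has_derivative (\<lambda>_. 0)) (at x)" by simp
    then have "(\<phi> has_derivative (\<lambda>_. 0)) (at x)"
    proof (rule has_derivative_transform_within_open)
      show "open (- ?K)" "x \<in> - ?K" using x by auto
      show "0 = \<phi> y" if "y \<in> - ?K" for y using that closure_subset[of "{x. \<phi> x \<noteq> 0}"] by auto
    qed
    then show ?thesis by (simp add: partial_eqI)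
  qed
  moreover have "compact ?K" using assms by (simp add: test_function_def)
  ultimately show ?thesis using test_functionI[of "partial i \<phi>" ?K] 1 by blast
qed

lemma test_function_partial_commute:
  "test_function \<phi> ==> partial i (partial j \<phi>) = partial j (partial i \<phi>)"
  by (intro partial_commute test_function_C_k)

lemma test_function_multi_op: "test_function \<phi> ==> test_function (multi_op partial \<rho> \<phi>)"
  using multi_op_inv[of "Collect test_function" partial \<phi> \<rho>]
  by (auto simp: test_function_partial test_function_partial_commute)

lemma multi_op_partial_inc:
  assumes "test_function \<phi>"
  shows "multi_op partial (inc t \<rho>) \<phi> = multi_op partial \<rho> (partial t \<phi>)"
    "multi_op partial (inc t \<rho>) \<phi> = partial t (multi_op partial \<rho> \<phi>)"
  using assms by (auto intro!: multi_op_inc[of "Collect test_function"] multi_op_inc'[of "Collect test_function"]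
    simp: test_function_partial test_function_partial_commute)

lemma partial_add:
  assumes "C_k (Suc k) \<phi>" "C_k (Suc k) \<theta>"
  shows "partial i (\<lambda>x. \<phi> x + \<theta> x) = (\<lambda>x. partial i \<phi> x + partial i \<theta> x)"
  by (rule ext, subst partial_eqI[OF has_derivative_add[OF C_k_has_derivative[OF assms(1)] C_k_has_derivative[OF assms(2)]]])
    (simp add: partial_def)

lemma partial_cmult:
  assumes "C_k (Suc k) \<phi>"
  shows "partial i (\<lambda>x. c * \<phi> x) = (\<lambda>x. c * partial i \<phi> x)"
  by (rule ext, subst partial_eqI[OF has_derivative_mult_right[OF C_k_has_derivative[OF assms(1)]]])
    (simp add: partial_def)

lemma C_k_add: "C_k k \<phi> ==> C_k k \<theta> ==> C_k k (\<lambda>x. \<phi> x + \<theta> x)"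
proof (induction k arbitrary: \<phi> \<theta>)
  case (Suc k)
  then show ?case using partial_add[OF Suc.prems] by (auto intro: differentiable_on_add)
qed (auto intro: continuous_on_add)

lemma C_k_cmult: "C_k k \<phi> ==> C_k k (\<lambda>x. c * \<phi> x)"
proof (induction k arbitrary: \<phi>)
  case (Suc k)
  then show ?case using partial_cmult[OF Suc.prems]
    by (auto intro: differentiable_on_mult simp: differentiable_on_const)
qed (auto intro: continuous_intros)

lemma C_k_zero: "C_k k (\<lambda>x. 0)"
proof (induction k)
  case (Suc k)
  have "partial i (\<lambda>x. 0) = (\<lambda>x. 0)" for i :: 'a
    by (rule ext, subst partial_eqI[OF has_derivative_const]) auto
  then show ?case using Suc by auto
qed auto

lemma C_k_sum: "(\<And>i. i \<in> I ==> C_k k (\<phi> i)) ==> C_k k (\<lambda>x. \<Sum>i\<in>I. \<phi> i x)"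
  by (induction I rule: infinite_finite_induct) (auto simp: C_k_zero intro: C_k_add)

lemma partial_affine:
  fixes \<phi> :: "real^'n::finite \<Rightarrow> real"
  assumes "C_k (Suc k) \<phi>"
  shows "partial i (\<lambda>x. \<phi> (L *v x + a)) = (\<lambda>x. \<Sum>s\<in>UNIV. L $ s $ i * partial s \<phi> (L *v x + a))"
proof
  fix x
  let ?F = "frechet_derivative \<phi> (at (L *v x + a))"
  have 1: "((\<lambda>x. L *v x + a) has_derivative (*v) L) (at x)"
    using matrix_vector_mul_bounded_linear[of L] by (auto intro!: derivative_eq_intros bounded_linear_imp_has_derivative)
  have lin: "linear ?F" using C_k_has_derivative[OF assms] has_derivative_linear by blast
  have Lax: "L *v axis i 1 = (\<Sum>s\<in>UNIV. L $ s $ i *\<^sub>R axis s 1)"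
    unfolding matrix_vector_mult_basis by (simp add: vec_eq_iff column_def axis_def if_distrib cong: if_cong)
  have "partial i (\<lambda>x. \<phi> (L *v x + a)) x = ?F (L *v axis i 1)"
    using has_derivative_compose[OF 1 C_k_has_derivative[OF assms, of "L *v x + a"]]
    by (intro partial_eqI) (simp add: o_def)
  also have "... = (\<Sum>s\<in>UNIV. L $ s $ i * partial s \<phi> (L *v x + a))"
    unfolding Lax partial_def by (simp add: linear_sum[OF lin] linear_cmul[OF lin])
  finally show "partial i (\<lambda>x. \<phi> (L *v x + a)) x = (\<Sum>s\<in>UNIV. L $ s $ i * partial s \<phi> (L *v x + a))" .
qed

lemma C_k_affine:
  fixes \<phi> :: "real^'n::finite \<Rightarrow> real"
  shows "C_k k \<phi> ==> C_k k (\<lambda>x. \<phi> (L *v x + a))"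
proof (induction k arbitrary: \<phi>)
  case 0
  have lin: "continuous_on UNIV (\<lambda>x. L *v x + a)"
    by (rule continuous_on_add[OF linear_continuous_on[OF matrix_vector_mul_bounded_linear] continuous_on_const])
  show ?case unfolding C_k.simps
    by (rule continuous_on_compose2[OF 0[unfolded C_k.simps] lin]) auto
next
  case (Suc k)
  have "(\<lambda>x. L *v x + a) differentiable (at x)" for x
    by (rule differentiable_add[OF bounded_linear_imp_differentiable[OF matrix_vector_mul_bounded_linear] differentiable_const])
  then have "(\<lambda>x. \<phi> (L *v x + a)) differentiable (at x)" for x
    using differentiable_chain_at[of "\<lambda>x. L *v x + a" x \<phi>] C_k_differentiable[OF Suc.prems] by (simp add: o_def)
  moreover have "C_k k (partial i (\<lambda>x. \<phi> (L *v x + a)))" for i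
    unfolding partial_affine[OF Suc.prems]
    by (rule C_k_sum, rule C_k_cmult, rule Suc.IH) (use Suc.prems in simp)
  ultimately show ?case by (auto simp: differentiable_on_def)
qed

lemma matrix_inv_inverse:
  fixes A :: "'a::semiring_1^'n^'m"
  assumes "invertible A"
  shows "matrix_inv A ** A = mat 1" "A ** matrix_inv A = mat 1"
  using someI_ex[OF assms[unfolded invertible_def]] by (auto simp: matrix_inv_def)

lemma test_function_affine:
  fixes \<phi> :: "real^'n::finite \<Rightarrow> real"
  assumes "test_function \<phi>" "invertible L"
  shows "test_function (\<lambda>x. \<phi> (L *v x + a))"
proof -
  obtain K where K: "compact K" "\<And>x. x \<notin> K ==> \<phi> x = 0"
    using test_function_support[OF assms(1)] by blast
  have Ck: "C_k k (\<lambda>x. \<phi> (L *v x + a))" for k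
    by (rule C_k_affine[OF test_function_C_k[OF assms(1)]])
  let ?g = "\<lambda>y. matrix_inv L *v (y - a)"
  have "continuous_on K ?g"
    by (intro continuous_on_compose2[of UNIV "(*v) (matrix_inv L)" K "\<lambda>y. y - a"] continuous_on_diff
        continuous_on_id continuous_on_const linear_continuous_on matrix_vector_mul_bounded_linear) auto
  then have "compact (?g ` K)" using K(1) by (rule compact_continuous_image)
  moreover have "\<phi> (L *v x + a) = 0" if "x \<notin> ?g ` K" for x
  proof (rule K(2))
    have "x = ?g (L *v x + a)"
      using assms(2) by (simp add: matrix_vector_mul_assoc matrix_inv_inverse)
    then show "L *v x + a \<notin> K" using that by blast
  qed
  ultimately show ?thesis
    using test_functionI[of "\<lambda>x. \<phi> (L *v x + a)" "?g ` K"] Ck by blast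
qed

lemma test_function_translate:
  assumes "test_function (\<phi> :: real^'n::finite \<Rightarrow> real)" shows "test_function (\<lambda>x. \<phi> (x + a))"
proof -
  have "invertible (mat 1 :: real^'n^'n)"
    unfolding invertible_def by (rule exI[of _ "mat 1"]) (simp only: matrix_mul_lid simp_thms)
  from test_function_affine[OF assms this, of a] show ?thesis
    unfolding matrix_vector_mul_lid .
qed

lemma partial_translate:
  assumes "test_function (\<phi> :: real^'n::finite \<Rightarrow> real)"
  shows "partial i (\<lambda>x. \<phi> (x + a)) = (\<lambda>x. partial i \<phi> (x + a))"
proof -
  have *: "(\<Sum>s\<in>UNIV. (mat 1 :: real^'n^'n) $ s $ i * c s) = c i" for c :: "'n \<Rightarrow> real"
  proof -
    have "(\<Sum>s\<in>UNIV. (mat 1 :: real^'n^'n) $ s $ i * c s) = (\<Sum>s\<in>UNIV. if s = i then c s else 0)"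
      by (rule sum.cong) (auto simp: mat_def)
    then show ?thesis by (simp only: sum.delta finite UNIV_I if_True)
  qed
  from partial_affine[OF test_function_C_k[OF assms, of "Suc 0"], of i "mat 1" a] show ?thesis
    unfolding matrix_vector_mul_lid * .
qed

section \<open>Smooth bumps approximating indicators of boxes\<close>

text \<open>The powers of \<open>inverse t\<close> make the span of the family closed under
  differentiation, so a single derivative formula settles smoothness of
  \<open>exp (- inverse t)\<close>, extended by 0, to all orders.\<close>

definition bump1 :: "nat \<Rightarrow> real \<Rightarrow> real" where
  "bump1 n t = (if t \<le> 0 then 0 else inverse t ^ n * exp (- inverse t))"

lemma bump1_tendsto_0: "(bump1 n \<longlongrightarrow> 0) (at 0)"
proof -
  have "((\<lambda>t::real. inverse t ^ n / exp (inverse t)) \<longlongrightarrow> 0) (at_right 0)"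
    by (rule filterlim_compose[OF tendsto_power_div_exp_0 filterlim_inverse_at_top_right])
  moreover have "eventually (\<lambda>t. inverse t ^ n / exp (inverse t) = bump1 n t) (at_right 0)"
    using eventually_at_right_less[of "0::real"] by (rule eventually_mono) (simp add: bump1_def exp_minus field_simps)
  ultimately have 1: "(bump1 n \<longlongrightarrow> 0) (at_right 0)" by (rule Lim_transform_eventually)
  have "eventually (\<lambda>t::real. t < 0) (at_left 0)" by (auto simp: eventually_at_left_field intro: exI[of _ "-1"])
  then have "eventually (\<lambda>t. 0 = bump1 n t) (at_left 0)" by (rule eventually_mono) (simp add: bump1_def)
  then have 2: "(bump1 n \<longlongrightarrow> 0) (at_left 0)" by (rule Lim_transform_eventually[OF tendsto_const])
  show ?thesis using 1 2 filterlim_split_at by blast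
qed

lemma DERIV_bump1: "(bump1 n has_real_derivative bump1 (Suc (Suc n)) t - real n * bump1 (Suc n) t) (at t)"
proof -
  consider "t < 0" | "t = 0" | "0 < t" by linarith
  then show ?thesis
  proof cases
    case 1
    have "((\<lambda>_. 0) has_real_derivative 0) (at t)" by simp
    then have "(bump1 n has_real_derivative 0) (at t)"
      by (rule has_field_derivative_transform_within_open[of _ _ _ "{..<0}"]) (use 1 in \<open>auto simp: bump1_def\<close>)
    then show ?thesis using 1 by (simp add: bump1_def)
  next
    case 2
    \<comment> \<open>The difference quotient at 0 is again a member of the family, and every member
      tends to 0 there.\<close>
    have "(\<lambda>h. (bump1 n (0 + h) - bump1 n 0) / h) = bump1 (Suc n)"
      by (auto simp: bump1_def divide_inverse)
    then have "(bump1 n has_real_derivative 0) (at 0)"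
      using bump1_tendsto_0[of "Suc n"] by (simp add: DERIV_def)
    then show ?thesis using 2 by (simp add: bump1_def)
  next
    case 3
    have "((\<lambda>t. inverse t ^ n * exp (- inverse t)) has_real_derivative
        bump1 (Suc (Suc n)) t - real n * bump1 (Suc n) t) (at t)"
    proof (cases n)
      case 0
      then show ?thesis using 3
        by (auto intro!: derivative_eq_intros simp: bump1_def power2_eq_square divide_inverse)
    next
      case (Suc k)
      have "((\<lambda>t. inverse t ^ n * exp (- inverse t)) has_real_derivative
          inverse t ^ n * (exp (- inverse t) * inverse t ^ 2) + real n * inverse t ^ (n - 1) * - (inverse t ^ 2) * exp (- inverse t)) (at t)"
        using 3 by (auto intro!: derivative_eq_intros simp: divide_inverse power2_eq_square)
      then show ?thesis using 3 Suc by (simp add: bump1_def power2_eq_square algebra_simps)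
    qed
    then show ?thesis
      by (rule has_field_derivative_transform_within_open[of _ _ _ "{0<..}"]) (use 3 in \<open>auto simp: bump1_def\<close>)
  qed
qed

text \<open>A class given by its syntax and stable under partial derivatives; membership yields
  \<open>C_k k\<close> for every \<open>k\<close> by induction, without formulas for
  derivatives.\<close>

inductive smooth :: "(real^'n \<Rightarrow> real) \<Rightarrow> bool" where
  const: "smooth (\<lambda>x. c)"
| bump: "smooth (\<lambda>x. bump1 n (c * x $ i + d))"
| add: "smooth f ==> smooth g ==> smooth (\<lambda>x. f x + g x)"
| mult: "smooth f ==> smooth g ==> smooth (\<lambda>x. f x * g x)"

lemma smooth_partial:
  fixes f :: "real^'n::finite \<Rightarrow> real"
  shows "smooth f ==> (\<forall>x. f differentiable (at x)) \<and> (\<forall>i. smooth (partial i f))"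
proof (induction rule: smooth.induct)
  case (const c)
  have "partial i (\<lambda>x::real^'n. c) = (\<lambda>x. 0)" for i
    by (rule ext, subst partial_eqI[OF has_derivative_const]) auto
  then show ?case by (simp add: smooth.const)
next
  case (bump n c i d)
  have D: "((\<lambda>x. bump1 n (c * x $ i + d)) has_derivative
      (\<lambda>h. (bump1 (Suc (Suc n)) (c * x $ i + d) - real n * bump1 (Suc n) (c * x $ i + d)) * (c * h $ i))) (at x)" for x :: "real^'n"
  proof -
    have "((\<lambda>x. c * x $ i + d) has_derivative (\<lambda>h. c * h $ i)) (at x)"
      by (auto intro!: derivative_eq_intros bounded_linear_imp_has_derivative bounded_linear_vec_nth)
    from has_derivative_compose[OF this DERIV_bump1[unfolded has_field_derivative_def]] show ?thesis .
  qed
  have "partial j (\<lambda>x. bump1 n (c * x $ i + d)) = (\<lambda>x. (c * axis j 1 $ i) * bump1 (Suc (Suc n)) (c * x $ i + d)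
      + (- real n * (c * axis j 1 $ i)) * bump1 (Suc n) (c * x $ i + d))" for j
    by (rule ext, subst partial_eqI[OF D]) (simp add: algebra_simps)
  moreover have "smooth (\<lambda>x. (c * axis j 1 $ i) * bump1 (Suc (Suc n)) (c * x $ i + d)
      + (- real n * (c * axis j 1 $ i)) * bump1 (Suc n) (c * x $ i + d))" for j
    by (rule smooth.add; rule smooth.mult; rule smooth.const smooth.bump)
  moreover have "(\<lambda>x. bump1 n (c * x $ i + d)) differentiable (at x)" for x
    using D unfolding differentiable_def by blast
  ultimately show ?case by simp
next
  case (add f g)
  have "partial i (\<lambda>x. f x + g x) = (\<lambda>x. partial i f x + partial i g x)" for i
    using add.IH frechet_derivative_works unfolding partial_def
    by (intro ext, subst frechet_derivative_at[symmetric, OF has_derivative_add]) blast+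
  then show ?case using add.IH by (auto intro: smooth.intros)
next
  case (mult f g)
  have "partial i (\<lambda>x. f x * g x) = (\<lambda>x. f x * partial i g x + partial i f x * g x)" for i
    using mult.IH frechet_derivative_works unfolding partial_def
    by (intro ext, subst frechet_derivative_at[symmetric, OF has_derivative_mult]) blast+
  moreover have "smooth (\<lambda>x. f x * partial i g x + partial i f x * g x)" for i
  proof -
    have "smooth (partial i f)" "smooth (partial i g)" using mult.IH by auto
    from smooth.add[OF smooth.mult[OF mult.hyps(1) this(2)] smooth.mult[OF this(1) mult.hyps(2)]]
    show ?thesis .
  qed
  ultimately show ?case using mult.IH by simp
qed

lemma smooth_C_k: "smooth (f :: real^'n::finite \<Rightarrow> real) ==> C_k k f"
proof (induction k arbitrary: f)
  case 0
  then show ?case using smooth_partial[OF 0]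
    by (auto simp: continuous_on_eq_continuous_at intro: differentiable_imp_continuous_within)
next
  case (Suc k)
  then show ?case using smooth_partial[OF Suc.prems] by (auto simp: differentiable_on_def)
qed

lemma smooth_prod: "(\<And>i. i \<in> I ==> smooth (f i)) ==> smooth (\<lambda>x. \<Prod>i\<in>I. f i x)"
  by (induction I rule: infinite_finite_induct) (auto intro: smooth.intros)

text \<open>For \<open>x\<close> in the box each factor is \<open>exp (- 1 / (N t))\<close>, with
  \<open>t\<close> the distance to a face, and tends to 1 as \<open>N\<close> grows. Outside some
  factor is 0, so the limit is the indicator of the open box.\<close>

definition box_bump :: "real^'n \<Rightarrow> real^'n \<Rightarrow> nat \<Rightarrow> real^'n::finite \<Rightarrow> real" where
  "box_bump l u N x = (\<Prod>i\<in>UNIV. bump1 0 (real N * x $ i + - (real N * l $ i))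
      * bump1 0 (- real N * x $ i + real N * u $ i))"

lemma bump1_0_range: "0 \<le> bump1 0 t" "bump1 0 t \<le> 1"
  by (auto simp: bump1_def)

lemma box_bump_outside:
  assumes "x \<notin> box l u" shows "box_bump l u N x = 0"
proof -
  obtain i where "x $ i \<le> l $ i \<or> u $ i \<le> x $ i"
    using assms by (auto simp: mem_box_cart not_less)
  then have "bump1 0 (real N * x $ i + - (real N * l $ i)) * bump1 0 (- real N * x $ i + real N * u $ i) = 0"
    by (auto simp: bump1_def mult_left_mono)
  then show ?thesis unfolding box_bump_def by (intro prod_zero) auto
qed

lemma box_bump_le: "\<bar>box_bump l u N x\<bar> \<le> indicator (box l u) x"
proof (cases "x \<in> box l u")
  case True
  have "0 \<le> box_bump l u N x" "box_bump l u N x \<le> 1"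
    unfolding box_bump_def by (auto intro!: prod_nonneg prod_le_1 mult_nonneg_nonneg mult_le_one simp: bump1_0_range)
  then show ?thesis using True by simp
qed (simp add: box_bump_outside)

lemma box_bump_tendsto: "(\<lambda>N. box_bump l u N x) \<longlonglongrightarrow> indicator (box l u) x"
proof (cases "x \<in> box l u")
  case True
  have lim: "(\<lambda>N. bump1 0 (real N * t)) \<longlonglongrightarrow> 1" if "0 < t" for t
  proof -
    have "(\<lambda>N. exp (- (inverse (real N) * inverse t))) \<longlonglongrightarrow> exp (- (0 * inverse t))"
      by (intro tendsto_intros lim_inverse_n)
    moreover have "eventually (\<lambda>N. exp (- (inverse (real N) * inverse t)) = bump1 0 (real N * t)) sequentially"
      using eventually_gt_at_top[of 0] by (rule eventually_mono) (use that in \<open>simp add: bump1_def mult_le_0_iff\<close>)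
    ultimately show ?thesis by (simp add: Lim_transform_eventually)
  qed
  have "(\<lambda>N. box_bump l u N x) \<longlonglongrightarrow> (\<Prod>i\<in>(UNIV::'a set). 1 * 1)"
    unfolding box_bump_def
  proof (intro tendsto_prod tendsto_mult)
    fix i
    show "(\<lambda>N. bump1 0 (real N * x $ i + - (real N * l $ i))) \<longlonglongrightarrow> 1"
      using lim[of "x $ i - l $ i"] True by (simp add: algebra_simps mem_box_cart)
    show "(\<lambda>N. bump1 0 (- real N * x $ i + real N * u $ i)) \<longlonglongrightarrow> 1"
      using lim[of "u $ i - x $ i"] True by (simp add: algebra_simps mem_box_cart)
  qed
  then show ?thesis using True by simp
qed (simp add: box_bump_outside)

lemma test_function_box_bump: "test_function (box_bump l u N)"
proof (rule test_functionI)
  have "smooth (box_bump l u N)"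
    unfolding box_bump_def by (intro smooth_prod smooth.mult smooth.bump)
  then show "C_k k (box_bump l u N)" for k by (rule smooth_C_k)
  show "compact (cbox l u)" by (rule compact_cbox)
  show "box_bump l u N x = 0" if "x \<notin> cbox l u" for x
    using that box_subset_cbox by (intro box_bump_outside) blast
qed

section \<open>The fundamental lemma of the calculus of variations\<close>

text \<open>The measures with the positive and the negative part of \<open>r\<close> as densities
  agree on boxes, an intersection-stable generator of the Borel sets. They are equal therefore, and
  densities are unique.\<close>

lemma AE_zero_of_box_integrals:
  fixes r :: "real^'n::finite \<Rightarrow> real"
  assumes [measurable]: "r \<in> borel_measurable borel"
    and int: "\<And>l u. integrable lborel (\<lambda>x. indicator (box l u) x * r x)"
    and zero: "\<And>l u. (\<integral>x. indicator (box l u) x * r x \<partial>lborel) = 0"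
  shows "AE x in lborel. r x = 0"
proof -
  \<comment> \<open>\<open>ennreal\<close> cuts negative values to 0, so these densities are the
    positive and the negative part.\<close>
  let ?P = "density lborel (\<lambda>x. ennreal (r x))" and ?N = "density lborel (\<lambda>x. ennreal (- r x))"
  let ?E = "range (\<lambda>(a, b). box a b :: (real^'n) set)"
  have em: "emeasure ?P (box l u) = (\<integral>\<^sup>+x. ennreal (indicator (box l u) x * r x) \<partial>lborel)"
           "emeasure ?N (box l u) = (\<integral>\<^sup>+x. ennreal (- (indicator (box l u) x * r x)) \<partial>lborel)" for l u
    by (auto simp: emeasure_density intro!: nn_integral_cong split: split_indicator)
  have fin: "emeasure ?P (box l u) < \<infinity>" "emeasure ?N (box l u) < \<infinity>" for l u
    using int[of l u] unfolding em by (auto simp: real_integrable_def less_top)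
  have eq: "emeasure ?P (box l u) = emeasure ?N (box l u)" for l u
  proof -
    have "enn2real (emeasure ?P (box l u)) = enn2real (emeasure ?N (box l u))"
      using real_lebesgue_integral_def[OF int[of l u]] zero[of l u] unfolding em by simp
    then show ?thesis using fin[of l u] by (metis ennreal_enn2real infinity_ennreal_def)
  qed
  have "?P = ?N"
  proof (rule measure_eqI_generator_eq)
    show "Int_stable ?E" by (auto simp: Int_stable_def box_Int_box)
    show "?E \<subseteq> Pow UNIV" by simp
    show "sets ?P = sigma_sets UNIV ?E" "sets ?N = sigma_sets UNIV ?E"
      by (simp_all add: borel_eq_box)
    let ?A = "\<lambda>n::nat. box (- (real n *\<^sub>R One)) (real n *\<^sub>R One) :: (real^'n) set"
    show "range ?A \<subseteq> ?E" by auto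
    show "(\<Union>i. ?A i) = UNIV" by (rule UN_box_eq_UNIV)
    show "emeasure ?P (?A i) \<noteq> \<infinity>" for i using fin(1)[of "- (real i *\<^sub>R One)" "real i *\<^sub>R One"] by simp
    show "emeasure ?P X = emeasure ?N X" if "X \<in> ?E" for X using that eq by auto
  qed
  then have "AE x in lborel. ennreal (r x) = ennreal (- r x)"
    by (intro sigma_finite_measure.density_unique[OF sigma_finite_lborel]) auto
  then show ?thesis
  proof (rule AE_mp, intro AE_I2 impI)
    fix x assume "ennreal (r x) = ennreal (- r x)"
    then show "r x = 0"
      by (cases "0 \<le> r x") (auto simp: ennreal_neg ennreal_eq_0_iff)
  qed
qed

lemma borel_imp_lebesgue_measurable:
  "f \<in> borel_measurable borel ==> f \<in> borel_measurable lebesgue"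
  by (rule measurable_completion[of f lborel borel, simplified])

lemma locally_integrable_measurable:
  assumes "locally_integrable (f :: real^'n \<Rightarrow> complex)" shows "f \<in> borel_measurable lebesgue"
proof -
  have "(\<lambda>x. indicator (cball 0 (real n)) x *\<^sub>R f x) \<in> borel_measurable lebesgue" for n
    by (rule borel_measurable_integrable) (use assms in \<open>simp add: locally_integrable_def set_integrable_def\<close>)
  moreover have "(\<lambda>n. indicator (cball 0 (real n)) x *\<^sub>R f x) \<longlonglongrightarrow> f x" for x
  proof -
    obtain k where k: "norm x \<le> real k" using real_arch_simple by blast
    have "eventually (\<lambda>n. f x = indicator (cball 0 (real n)) x *\<^sub>R f x) sequentially"
      using eventually_ge_at_top[of k] by (rule eventually_mono) (use k in \<open>auto simp: indicator_def\<close>)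
    then show ?thesis by (rule Lim_transform_eventually[OF tendsto_const])
  qed
  ultimately show ?thesis by (rule borel_measurable_LIMSEQ_metric)
qed

lemma locally_integrable_cong_AE:
  assumes "AE x in lebesgue. f x = g x" "locally_integrable g"
  shows "locally_integrable f"
  unfolding locally_integrable_def set_integrable_def
proof (intro allI impI)
  fix K :: "(real^'a) set" assume "compact K"
  then have i: "integrable lebesgue (\<lambda>x. indicat_real K x *\<^sub>R g x)"
    using assms by (simp add: locally_integrable_def set_integrable_def)
  have ae: "AE x in lebesgue. indicat_real K x *\<^sub>R f x = indicat_real K x *\<^sub>R g x"
    using assms(1) by auto
  show "integrable lebesgue (\<lambda>x. indicat_real K x *\<^sub>R f x)"
    using i borel_measurable_lebesgue_AE[OF ae] ae integrable_cong_AE[OF _ _ ae] by auto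
qed

lemma integrable_bounded_support:
  fixes f :: "real^'n \<Rightarrow> complex" and \<phi> :: "real^'n \<Rightarrow> real"
  assumes f: "locally_integrable f" and K: "compact K" "\<And>x. x \<notin> K ==> \<phi> x = 0"
    and \<phi>: "\<phi> \<in> borel_measurable borel" "\<And>x. \<bar>\<phi> x\<bar> \<le> B"
  shows "integrable lebesgue (\<lambda>x. \<phi> x *\<^sub>R f x)"
proof (rule Bochner_Integration.integrable_bound)
  show "integrable lebesgue (\<lambda>x. B *\<^sub>R (indicat_real K x *\<^sub>R f x))"
    by (rule integrable_scaleR_right) (use f K in \<open>simp add: locally_integrable_def set_integrable_def\<close>)
  have [measurable]: "f \<in> borel_measurable lebesgue" using f by (rule locally_integrable_measurable)
  have [measurable]: "\<phi> \<in> borel_measurable lebesgue" using \<phi>(1) by (rule borel_imp_lebesgue_measurable)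
  show "(\<lambda>x. \<phi> x *\<^sub>R f x) \<in> borel_measurable lebesgue" by measurable
  have "norm (\<phi> x *\<^sub>R f x) \<le> norm (B *\<^sub>R (indicat_real K x *\<^sub>R f x))" for x
    using K(2)[of x] \<phi>(2)[of x] by (cases "x \<in> K") (auto intro!: mult_right_mono)
  then show "AE x in lebesgue. norm (\<phi> x *\<^sub>R f x) \<le> norm (B *\<^sub>R (indicat_real K x *\<^sub>R f x))" by simp
qed

lemma continuous_compact_support_bounded:
  fixes \<phi> :: "'a::topological_space \<Rightarrow> 'b::real_normed_vector"
  assumes "continuous_on UNIV \<phi>" "compact K" "\<And>x. x \<notin> K ==> \<phi> x = 0"
  obtains B where "0 < B" "\<And>x. norm (\<phi> x) \<le> B"
proof -
  have "bounded (\<phi> ` K)"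
    using assms by (intro compact_imp_bounded compact_continuous_image) (auto intro: continuous_on_subset)
  then obtain B where B: "0 < B" "\<And>x. x \<in> K ==> norm (\<phi> x) \<le> B"
    by (auto simp: bounded_pos)
  then have "norm (\<phi> x) \<le> B" for x using assms(3)[of x] by (cases "x \<in> K") auto
  with B(1) show ?thesis by (rule that)
qed

lemma test_function_bounds:
  assumes "test_function \<phi>"
  obtains K B where "compact K" "\<And>x. x \<notin> K ==> \<phi> x = 0" "0 < B" "\<And>x. \<bar>\<phi> x\<bar> \<le> B" "\<phi> \<in> borel_measurable borel"
proof -
  obtain K where K: "compact K" "\<And>x. x \<notin> K ==> \<phi> x = 0" using test_function_support[OF assms] by blast
  obtain B where "0 < B" "\<And>x. norm (\<phi> x) \<le> B"
    using continuous_compact_support_bounded[OF test_function_continuous[OF assms] K] by blast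
  moreover have "\<phi> \<in> borel_measurable borel"
    using test_function_continuous[OF assms] by (rule borel_measurable_continuous_onI)
  ultimately show ?thesis using that[OF K] by simp
qed

lemma integrable_test_function:
  assumes "test_function \<phi>" "locally_integrable f"
  shows "integrable lebesgue (\<lambda>x. \<phi> x *\<^sub>R f x)"
  using test_function_bounds[OF assms(1)] integrable_bounded_support[OF assms(2)] by metis

lemma indicator_lebesgue_box: "indicat_real (box l u) \<in> borel_measurable lebesgue"
  by (intro borel_measurable_indicator) simp

text \<open>Bumps converge boundedly to the indicator of a box, within that box, so the integrals of
  \<open>g\<close> over boxes vanish. Real and imaginary part of a Borel representative are then
  treated separately.\<close>

lemma AE_zero_of_test_functions:
  fixes g :: "real^'n::finite \<Rightarrow> complex"
  assumes g: "locally_integrable g"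
    and zero: "\<And>\<phi>. test_function \<phi> ==> (\<integral>x. \<phi> x *\<^sub>R g x \<partial>lebesgue) = 0"
  shows "AE x in lebesgue. g x = 0"
proof -
  have ic: "integrable lebesgue (\<lambda>x. indicat_real (cbox l u) x *\<^sub>R g x)" for l u
    using g by (simp add: locally_integrable_def set_integrable_def)
  have [measurable]: "g \<in> borel_measurable lebesgue" using g by (rule locally_integrable_measurable)
  have ib: "integrable lebesgue (\<lambda>x. indicat_real (box l u) x *\<^sub>R g x)" for l u
    by (rule Bochner_Integration.integrable_bound[OF ic[of l u]])
       (use box_subset_cbox[of l u] borel_measurable_scaleR[OF indicator_lebesgue_box locally_integrable_measurable[OF g]]
         in \<open>auto split: split_indicator\<close>)
  have box0: "(\<integral>x. indicat_real (box l u) x *\<^sub>R g x \<partial>lebesgue) = 0" for l u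
  proof -
    have "(\<lambda>N. \<integral>x. box_bump l u N x *\<^sub>R g x \<partial>lebesgue) \<longlonglongrightarrow> (\<integral>x. indicat_real (box l u) x *\<^sub>R g x \<partial>lebesgue)"
    proof (rule integral_dominated_convergence)
      show "integrable lebesgue (\<lambda>x. norm (indicat_real (box l u) x *\<^sub>R g x))"
        by (rule integrable_norm[OF ib])
      show "AE x in lebesgue. (\<lambda>N. box_bump l u N x *\<^sub>R g x) \<longlonglongrightarrow> indicat_real (box l u) x *\<^sub>R g x"
        by (intro AE_I2 tendsto_scaleR box_bump_tendsto tendsto_const)
      show "AE x in lebesgue. norm (box_bump l u N x *\<^sub>R g x) \<le> norm (indicat_real (box l u) x *\<^sub>R g x)" for N
        using box_bump_le[of l u N] by (intro AE_I2) (auto intro!: mult_right_mono)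
      show "(\<lambda>x. box_bump l u N x *\<^sub>R g x) \<in> borel_measurable lebesgue" for N
        using integrable_test_function[OF test_function_box_bump g] by (rule borel_measurable_integrable)
    qed (use ib in \<open>auto intro: borel_measurable_integrable\<close>)
    then show ?thesis by (simp add: zero[OF test_function_box_bump] LIMSEQ_const_iff)
  qed
  obtain h where h [measurable]: "h \<in> borel_measurable borel" and ae: "AE x in lebesgue. g x = h x"
    using Lp_borel_representative[OF locally_integrable_measurable[OF g]] by blast
  have m: "(\<lambda>x. indicat_real (box l u) x *\<^sub>R h x) \<in> borel_measurable lborel" for l u by measurable
  have ih: "integrable lborel (\<lambda>x. indicat_real (box l u) x *\<^sub>R h x)" for l u
  proof -
    have "integrable lebesgue (\<lambda>x. indicat_real (box l u) x *\<^sub>R h x)"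
      using ib[of l u] by (rule integrable_cong_AE_imp) (use ae in \<open>auto intro!: measurable_completion\<close>)
    then show ?thesis using integrable_completion[OF m] by simp
  qed
  have h0: "(\<integral>x. indicat_real (box l u) x *\<^sub>R h x \<partial>lborel) = 0" for l u
  proof -
    have "(\<integral>x. indicat_real (box l u) x *\<^sub>R h x \<partial>lborel) = (\<integral>x. indicat_real (box l u) x *\<^sub>R h x \<partial>lebesgue)"
      by (rule integral_completion[OF m, symmetric])
    also have "... = (\<integral>x. indicat_real (box l u) x *\<^sub>R g x \<partial>lebesgue)"
    proof (rule integral_cong_AE[OF measurable_completion[OF m] borel_measurable_integrable[OF ib]])
      show "AE x in lebesgue. indicat_real (box l u) x *\<^sub>R h x = indicat_real (box l u) x *\<^sub>R g x"
        using ae by eventually_elim simp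
    qed
    finally show ?thesis by (simp add: box0)
  qed
  have "AE x in lborel. Re (h x) = 0"
  proof (rule AE_zero_of_box_integrals)
    show "integrable lborel (\<lambda>x. indicat_real (box l u) x * Re (h x))" for l u
      using integrable_Re[OF ih[of l u]] by simp
    show "(\<integral>x. indicat_real (box l u) x * Re (h x) \<partial>lborel) = 0" for l u
      using integral_Re[OF ih[of l u]] h0[of l u] by simp
  qed auto
  moreover have "AE x in lborel. Im (h x) = 0"
  proof (rule AE_zero_of_box_integrals)
    show "integrable lborel (\<lambda>x. indicat_real (box l u) x * Im (h x))" for l u
      using integrable_Im[OF ih[of l u]] by simp
    show "(\<integral>x. indicat_real (box l u) x * Im (h x) \<partial>lborel) = 0" for l u
      using integral_Im[OF ih[of l u]] h0[of l u] by simp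
  qed auto
  ultimately have "AE x in lborel. h x = 0" by eventually_elim (simp add: complex_eq_iff)
  then have "AE x in lebesgue. h x = 0" by (rule AE_completion)
  with ae show ?thesis by eventually_elim simp
qed

section \<open>Weak derivatives\<close>

abbreviation unit_mi :: "'n \<Rightarrow> 'n \<Rightarrow> nat" where "unit_mi t \<equiv> inc t (\<lambda>_. 0)"

lemma mdeg_unit_mi [simp]: "mdeg (unit_mi t :: 'n::finite \<Rightarrow> nat) = 1"
  using mdeg_inc[of "\<lambda>_. 0" t] by (simp only: mdeg_zero One_nat_def)

lemma has_weak_deriv_locally:
  assumes "has_weak_deriv \<rho> f g" shows "locally_integrable f" "locally_integrable g"
  using assms by (auto simp: has_weak_deriv_def)

lemma has_weak_derivD:
  "has_weak_deriv \<rho> f g ==> test_function \<phi> ==>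
    (\<integral>x. multi_op partial \<rho> \<phi> x *\<^sub>R f x \<partial>lebesgue) = (- 1) ^ mdeg \<rho> * (\<integral>x. \<phi> x *\<^sub>R g x \<partial>lebesgue)"
  by (simp add: has_weak_deriv_def)

lemma locally_integrable_add:
  "locally_integrable f ==> locally_integrable g ==> locally_integrable (\<lambda>x. f x + g x)"
  unfolding locally_integrable_def set_integrable_def by (simp add: scaleR_add_right)

lemma locally_integrable_cmult:
  "locally_integrable f ==> locally_integrable (\<lambda>x. c * f x)"
  unfolding locally_integrable_def set_integrable_def
  by (simp add: mult_scaleR_right[symmetric] del: mult_scaleR_right)

lemma has_weak_deriv_unique:
  fixes f :: "real^'n::finite \<Rightarrow> complex"
  assumes "has_weak_deriv \<rho> f g" "has_weak_deriv \<rho> f h"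
  shows "AE x in lebesgue. g x = h x"
proof -
  have l: "locally_integrable g" "locally_integrable h" using assms has_weak_deriv_locally by blast+
  have d: "locally_integrable (\<lambda>x. g x - h x)"
    using locally_integrable_add[OF l(1) locally_integrable_cmult[OF l(2), of "-1"]] by simp
  have "AE x in lebesgue. g x - h x = 0"
  proof (rule AE_zero_of_test_functions[OF d])
    fix \<phi> :: "real^'n \<Rightarrow> real" assume t: "test_function \<phi>"
    have "(- 1) ^ mdeg \<rho> * (\<integral>x. \<phi> x *\<^sub>R g x \<partial>lebesgue) = (- 1) ^ mdeg \<rho> * (\<integral>x. \<phi> x *\<^sub>R h x \<partial>lebesgue)"
      using has_weak_derivD[OF assms(1) t] has_weak_derivD[OF assms(2) t] by simp
    then have "(\<integral>x. \<phi> x *\<^sub>R g x \<partial>lebesgue) = (\<integral>x. \<phi> x *\<^sub>R h x \<partial>lebesgue)" by simp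
    then show "(\<integral>x. \<phi> x *\<^sub>R (g x - h x) \<partial>lebesgue) = 0"
      using integrable_test_function[OF t l(1)] integrable_test_function[OF t l(2)]
      by (simp add: scaleR_diff_right)
  qed
  then show ?thesis by simp
qed

lemma integral_test_cong:
  assumes "AE x in lebesgue. f x = g x" "locally_integrable f" "locally_integrable g" "test_function \<phi>"
  shows "(\<integral>x. \<phi> x *\<^sub>R f x \<partial>lebesgue) = (\<integral>x. \<phi> x *\<^sub>R g x \<partial>lebesgue)"
proof (rule integral_cong_AE)
  show "AE x in lebesgue. \<phi> x *\<^sub>R f x = \<phi> x *\<^sub>R g x" using assms(1) by eventually_elim simp
qed (use assms integrable_test_function borel_measurable_integrable in blast)+

lemma has_weak_deriv_cong_AE:
  fixes f :: "real^'n::finite \<Rightarrow> complex"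
  assumes wd: "has_weak_deriv \<rho> f g" and f: "AE x in lebesgue. f' x = f x" and g: "AE x in lebesgue. g' x = g x"
  shows "has_weak_deriv \<rho> f' g'"
proof -
  have l: "locally_integrable f" "locally_integrable g" using has_weak_deriv_locally[OF wd] by blast+
  have l': "locally_integrable f'" "locally_integrable g'"
    using locally_integrable_cong_AE[OF f l(1)] locally_integrable_cong_AE[OF g l(2)] by blast+
  show ?thesis
    unfolding has_weak_deriv_def
    using l' has_weak_derivD[OF wd] integral_test_cong[OF f l'(1) l(1) test_function_multi_op]
      integral_test_cong[OF g l'(2) l(2)] by simp
qed

lemma has_weak_deriv_zero:
  "locally_integrable f ==> has_weak_deriv (\<lambda>_. 0) (f :: real^'n::finite \<Rightarrow> complex) f"
  by (simp add: has_weak_deriv_def)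

lemma has_weak_deriv_add:
  assumes "has_weak_deriv \<rho> f g" "has_weak_deriv \<rho> f' g'"
  shows "has_weak_deriv \<rho> (\<lambda>x. f x + f' x) (\<lambda>x. g x + g' x)"
  using assms has_weak_deriv_locally[OF assms(1)] has_weak_deriv_locally[OF assms(2)]
  by (simp add: has_weak_deriv_def locally_integrable_add scaleR_add_right integrable_test_function
      test_function_multi_op distrib_left)

lemma has_weak_deriv_cmult:
  assumes "has_weak_deriv \<rho> f g"
  shows "has_weak_deriv \<rho> (\<lambda>x. c * f x) (\<lambda>x. c * g x)"
proof -
  have "(\<integral>x. \<phi> x *\<^sub>R (c * h x) \<partial>lebesgue) = c * (\<integral>x. \<phi> x *\<^sub>R h x \<partial>lebesgue)" for \<phi> and h :: "real^'a \<Rightarrow> complex"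
    by (simp add: mult_scaleR_right[symmetric] del: mult_scaleR_right)
  then show ?thesis using assms by (simp add: has_weak_deriv_def locally_integrable_cmult)
qed

lemma locally_integrable_zero: "locally_integrable (\<lambda>x. 0)"
  by (simp add: locally_integrable_def set_integrable_def)

lemma has_weak_deriv_const_zero: "has_weak_deriv \<rho> (\<lambda>x. 0) (\<lambda>x. 0)"
  by (simp add: has_weak_deriv_def locally_integrable_zero)

lemma has_weak_deriv_sum:
  assumes "\<And>i. i \<in> I ==> has_weak_deriv \<rho> (f i) (g i)"
  shows "has_weak_deriv \<rho> (\<lambda>x. \<Sum>i\<in>I. f i x) (\<lambda>x. \<Sum>i\<in>I. g i x)"
  using assms
  by (induction I rule: infinite_finite_induct) (auto simp: has_weak_deriv_const_zero intro: has_weak_deriv_add)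

lemma multi_op_unit_mi: "test_function \<phi> ==> multi_op partial (unit_mi t) \<phi> = partial t \<phi>"
  using multi_op_partial_inc(2)[of \<phi> "\<lambda>_. 0" t] by simp

lemma has_weak_deriv_unit_iff:
  "has_weak_deriv (unit_mi t) f g \<longleftrightarrow> locally_integrable f \<and> locally_integrable g \<and>
     (\<forall>\<phi>. test_function \<phi> \<longrightarrow> (\<integral>x. partial t \<phi> x *\<^sub>R f x \<partial>lebesgue) = - (\<integral>x. \<phi> x *\<^sub>R g x \<partial>lebesgue))"
  by (auto simp: has_weak_deriv_def multi_op_unit_mi simp del: fun_upd_apply)

lemma has_weak_deriv_inc:
  assumes fg: "has_weak_deriv \<rho> f g" and gh: "has_weak_deriv (unit_mi t) g h"
  shows "has_weak_deriv (inc t \<rho>) f h"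
proof -
  have "(\<integral>x. multi_op partial (inc t \<rho>) \<phi> x *\<^sub>R f x \<partial>lebesgue)
      = (- 1) ^ mdeg (inc t \<rho>) * (\<integral>x. \<phi> x *\<^sub>R h x \<partial>lebesgue)" if "test_function \<phi>" for \<phi>
    using has_weak_derivD[OF fg test_function_partial[OF that, of t]] gh that
    by (simp add: multi_op_partial_inc(1) has_weak_deriv_unit_iff del: fun_upd_apply)
  then show ?thesis using fg gh by (simp add: has_weak_deriv_def del: fun_upd_apply)
qed

text \<open>The first-order identity is tested with \<open>multi_op partial \<rho> \<phi>\<close>,
  again a test function. This lets an induction on \<open>\<rho>\<close> pass from \<open>f\<close>
  to its first derivative \<open>g\<close>.\<close>

lemma has_weak_deriv_inc_left:
  assumes fg: "has_weak_deriv (unit_mi t) f g" and fh: "has_weak_deriv (inc t \<rho>) f h"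
  shows "has_weak_deriv \<rho> g h"
proof -
  have "(\<integral>x. multi_op partial \<rho> \<phi> x *\<^sub>R g x \<partial>lebesgue) = (- 1) ^ mdeg \<rho> * (\<integral>x. \<phi> x *\<^sub>R h x \<partial>lebesgue)"
    if t: "test_function \<phi>" for \<phi>
  proof -
    have "(\<integral>x. partial t (multi_op partial \<rho> \<phi>) x *\<^sub>R f x \<partial>lebesgue) = - (\<integral>x. multi_op partial \<rho> \<phi> x *\<^sub>R g x \<partial>lebesgue)"
      using fg test_function_multi_op[OF t] by (simp only: has_weak_deriv_unit_iff)
    then show ?thesis
      using has_weak_derivD[OF fh t] by (simp add: multi_op_partial_inc(2)[OF t] del: fun_upd_apply)
  qed
  then show ?thesis using fg fh by (simp add: has_weak_deriv_def del: fun_upd_apply)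
qed

section \<open>Borel representatives in L^p\<close>

text \<open>Genuinely Borel functions: \<open>U (x - y)\<close> is then jointly measurable in
  \<open>x\<close> and \<open>y\<close>, also when \<open>y\<close> is distributed by a measure
  carried by a segment.\<close>

definition bLp :: "real \<Rightarrow> (real^'n::finite \<Rightarrow> complex) set" where
  "bLp p = {f \<in> borel_measurable borel. pint lborel p f < \<infinity>}"

lemma pint_lebesgue: "pint lebesgue p f = pint lborel p f"
  by (simp add: pint_def nn_integral_completion)

lemma bLp_Lp: "f \<in> bLp p ==> f \<in> Lp p"
  by (simp add: bLp_def Lp_iff pint_lebesgue borel_imp_lebesgue_measurable)

lemma bLp_iff: "f \<in> bLp p \<longleftrightarrow> f \<in> Lp p \<and> f \<in> borel_measurable borel"
  by (auto simp: bLp_def Lp_iff pint_lebesgue borel_imp_lebesgue_measurable)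

lemma bLp_measurable: "f \<in> bLp p ==> f \<in> borel_measurable borel"
  by (simp add: bLp_def)

text \<open>On a compact set the measure is finite, where p-integrability implies
  integrability.\<close>

lemma Lp_locally_integrable:
  fixes f :: "real^'n::finite \<Rightarrow> complex"
  assumes "1 \<le> p" "f \<in> Lp p" shows "locally_integrable f"
  unfolding locally_integrable_def set_integrable_def
proof (intro allI impI)
  fix K :: "(real^'n) set" assume K: "compact K"
  have Ks: "K \<in> sets lebesgue" using K by (simp add: borel_compact)
  have "integrable (restrict_space lebesgue K) f"
  proof (rule integrable_of_pint[OF _ assms(1)])
    show "f \<in> borel_measurable (restrict_space lebesgue K)"
      using Lp_measurable[OF assms(2)] by (rule measurable_restrict_space1)
    have "pint (restrict_space lebesgue K) p f \<le> pint lebesgue p f"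
      unfolding pint_def using Ks
      by (auto simp: nn_integral_restrict_space intro!: nn_integral_mono split: split_indicator)
    then show "pint (restrict_space lebesgue K) p f < \<infinity>"
      using assms(2) by (auto simp: Lp_iff elim: le_less_trans)
    show "emeasure (restrict_space lebesgue K) (space (restrict_space lebesgue K)) < \<infinity>"
      using Ks emeasure_compact_finite[OF K] K by (simp add: emeasure_restrict_space space_restrict_space borel_compact)
  qed
  then show "integrable lebesgue (\<lambda>x. indicat_real K x *\<^sub>R f x)"
    using Ks by (simp add: integrable_restrict_space)
qed

lemma integral_lebesgue_lborel:
  fixes f :: "real^'n::finite \<Rightarrow> 'b::{banach, second_countable_topology}"
  shows "f \<in> borel_measurable borel ==> (\<integral>x. f x \<partial>lebesgue) = (\<integral>x. f x \<partial>lborel)"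
  by (rule integral_completion) simp

lemma test_function_measurable: "test_function \<phi> ==> \<phi> \<in> borel_measurable borel"
  using test_function_continuous by (rule borel_measurable_continuous_onI)

lemma has_weak_deriv_unit_lborel:
  assumes "1 \<le> p" "f \<in> bLp p" "g \<in> bLp p"
  shows "has_weak_deriv (unit_mi t) f g \<longleftrightarrow>
     (\<forall>\<phi>. test_function \<phi> \<longrightarrow> (\<integral>x. partial t \<phi> x *\<^sub>R f x \<partial>lborel) = - (\<integral>x. \<phi> x *\<^sub>R g x \<partial>lborel))"
proof -
  have [measurable]: "f \<in> borel_measurable borel" "g \<in> borel_measurable borel"
    using assms by (auto simp: bLp_def)
  have "(\<integral>x. \<phi> x *\<^sub>R h x \<partial>lebesgue) = (\<integral>x. \<phi> x *\<^sub>R h x \<partial>lborel)"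
    if "test_function \<phi>" "h \<in> borel_measurable borel" for \<phi> and h :: "real^'a \<Rightarrow> complex"
    using that by (intro integral_lebesgue_lborel borel_measurable_scaleR test_function_measurable)
  then show ?thesis
    using assms by (simp add: has_weak_deriv_unit_iff Lp_locally_integrable bLp_Lp test_function_partial bLp_def del: fun_upd_apply)
qed

subsection \<open>Averages over translations\<close>

definition bprob :: "(real^'n::finite) measure \<Rightarrow> bool" where
  "bprob \<mu> \<longleftrightarrow> sets \<mu> = sets borel \<and> emeasure \<mu> UNIV = 1"

text \<open>The convolution of \<open>U\<close> with \<open>\<mu>\<close>. Where the integral does
  not exist the value is 0; for a probability measure and \<open>U\<close> in L^p this concerns a
  null set only.\<close>

definition avg :: "(real^'n) measure \<Rightarrow> (real^'n \<Rightarrow> complex) \<Rightarrow> real^'n \<Rightarrow> complex" where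
  "avg \<mu> U x = (\<integral>y. U (x - y) \<partial>\<mu>)"

lemma bprob_space: "bprob \<mu> ==> space \<mu> = UNIV"
  unfolding bprob_def using sets_eq_imp_space_eq[of \<mu> borel] by simp

lemma bprob_sets: "bprob \<mu> ==> sets \<mu> = sets borel"
  by (simp add: bprob_def)

lemma bprob_finite: "bprob \<mu> ==> finite_measure \<mu>"
  by (rule finite_measureI) (simp add: bprob_space, simp add: bprob_def)

lemma bprob_sigma_finite: "bprob \<mu> ==> sigma_finite_measure \<mu>"
  using bprob_finite finite_measure.axioms by blast

lemma pair_sigma_finite_lborel: "bprob \<mu> ==> pair_sigma_finite lborel \<mu>"
  by (simp add: pair_sigma_finite_def bprob_sigma_finite sigma_finite_lborel)

lemma nn_integral_lborel_translate:
  fixes F :: "'a::euclidean_space \<Rightarrow> ennreal"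
  assumes [measurable]: "F \<in> borel_measurable borel"
  shows "(\<integral>\<^sup>+x. F (x + a) \<partial>lborel) = (\<integral>\<^sup>+x. F x \<partial>lborel)"
proof -
  have "(\<integral>\<^sup>+x. F x \<partial>lborel) = (\<integral>\<^sup>+x. F x \<partial>distr lborel borel ((+) a))" by (simp add: lborel_distr_plus)
  also have "... = (\<integral>\<^sup>+x. F (x + a) \<partial>lborel)" by (subst nn_integral_distr) (auto simp: add.commute)
  finally show ?thesis by simp
qed

lemma integral_lborel_translate:
  fixes F :: "'a::euclidean_space \<Rightarrow> 'b::{banach, second_countable_topology}"
  assumes [measurable]: "F \<in> borel_measurable borel"
  shows "(\<integral>x. F (x + a) \<partial>lborel) = (\<integral>x. F x \<partial>lborel)"
proof -
  have "(\<integral>x. F x \<partial>lborel) = (\<integral>x. F x \<partial>distr lborel borel ((+) a))" by (simp add: lborel_distr_plus)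
  also have "... = (\<integral>x. F (x + a) \<partial>lborel)" by (subst integral_distr) (auto simp: add.commute)
  finally show ?thesis by simp
qed

lemma pint_translate:
  assumes [measurable]: "U \<in> borel_measurable borel"
  shows "pint lborel p (\<lambda>x. U (x - y)) = pint lborel p U"
  using nn_integral_lborel_translate[of "\<lambda>x. ennreal (norm (U x) powr p)" "- y"] by (simp add: pint_def)

lemma bLp_translate:
  assumes "U \<in> bLp p" shows "(\<lambda>x. U (x - y)) \<in> bLp p"
proof -
  have [measurable]: "U \<in> borel_measurable borel" using assms by (simp add: bLp_def)
  show ?thesis using assms by (simp add: bLp_def pint_translate)
qed

lemma avg_measurable:
  assumes "bprob \<mu>" and [measurable]: "U \<in> borel_measurable borel"
  shows "avg \<mu> U \<in> borel_measurable borel"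
proof -
  interpret sigma_finite_measure \<mu> using assms(1) by (rule bprob_sigma_finite)
  have [measurable_cong]: "sets \<mu> = sets borel" using assms(1) by (rule bprob_sets)
  show ?thesis unfolding avg_def by measurable
qed

text \<open>Tonelli, translation invariance, and mass 1. Besides the norm bound for averages it
  gives finiteness of the inner integral for almost every \<open>x\<close>.\<close>

lemma pint_avg_le_iterated:
  assumes \<mu>: "bprob \<mu>" and [measurable]: "U \<in> borel_measurable borel" and p: "1 \<le> p"
  shows "(\<integral>\<^sup>+x. pint \<mu> p (\<lambda>y. U (x - y)) \<partial>lborel) = pint lborel p U"
proof -
  interpret pair_sigma_finite lborel \<mu> using \<mu> by (rule pair_sigma_finite_lborel)
  have [measurable_cong]: "sets \<mu> = sets borel" using \<mu> by (rule bprob_sets)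
  have "(\<integral>\<^sup>+x. pint \<mu> p (\<lambda>y. U (x - y)) \<partial>lborel) = (\<integral>\<^sup>+y. (\<integral>\<^sup>+x. ennreal (norm (U (x - y)) powr p) \<partial>lborel) \<partial>\<mu>)"
    unfolding pint_def by (rule Fubini'[symmetric]) measurable
  also have "... = (\<integral>\<^sup>+y. pint lborel p U \<partial>\<mu>)" by (simp add: pint_translate flip: pint_def)
  also have "... = pint lborel p U" using \<mu> by (simp add: bprob_space) (simp add: bprob_def)
  finally show ?thesis .
qed

text \<open>Young's inequality for convolution with a probability measure: Jensen at each
  \<open>x\<close>, then Tonelli.\<close>

lemma pint_avg:
  assumes \<mu>: "bprob \<mu>" and U [measurable]: "U \<in> borel_measurable borel" and p: "1 \<le> p"
  shows "pint lborel p (avg \<mu> U) \<le> pint lborel p U"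
proof -
  have [measurable_cong]: "sets \<mu> = sets borel" using \<mu> by (rule bprob_sets)
  have "pint lborel p (avg \<mu> U) \<le> (\<integral>\<^sup>+x. pint \<mu> p (\<lambda>y. U (x - y)) \<partial>lborel)"
    unfolding pint_def[of lborel] avg_def
    using \<mu> by (intro nn_integral_mono jensen_pint p) (measurable, simp add: bprob_space, simp add: bprob_def)
  then show ?thesis by (simp add: pint_avg_le_iterated[OF assms])
qed

lemma bLp_avg: "bprob \<mu> ==> 1 \<le> p ==> U \<in> bLp p ==> avg \<mu> U \<in> bLp p"
  using pint_avg[of \<mu> U p] by (auto simp: bLp_def avg_measurable elim: le_less_trans)

lemma AE_avg_integrable:
  assumes \<mu>: "bprob \<mu>" and U: "U \<in> bLp p" and p: "1 \<le> p"
  shows "AE x in lborel. integrable \<mu> (\<lambda>y. U (x - y))"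
proof -
  have [measurable_cong]: "sets \<mu> = sets borel" using \<mu> by (rule bprob_sets)
  interpret sigma_finite_measure \<mu> using \<mu> by (rule bprob_sigma_finite)
  have [measurable]: "U \<in> borel_measurable borel" using U by (simp add: bLp_def)
  have "AE x in lborel. pint \<mu> p (\<lambda>y. U (x - y)) \<noteq> \<infinity>"
  proof (rule nn_integral_PInf_AE)
    show "(\<lambda>x. pint \<mu> p (\<lambda>y. U (x - y))) \<in> borel_measurable lborel" unfolding pint_def by measurable
    show "(\<integral>\<^sup>+x. pint \<mu> p (\<lambda>y. U (x - y)) \<partial>lborel) \<noteq> \<infinity>"
      using U by (simp add: pint_avg_le_iterated[OF \<mu> _ p] bLp_def)
  qed
  then show ?thesis
  proof eventually_elim
    fix x assume "pint \<mu> p (\<lambda>y. U (x - y)) \<noteq> \<infinity>"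
    then show "integrable \<mu> (\<lambda>y. U (x - y))"
      using \<mu> by (intro integrable_of_pint[OF _ p])
        (measurable, simp add: less_top, simp add: bprob_space, simp add: bprob_def)
  qed
qed

lemma avg_diff_AE:
  assumes "bprob \<mu>" "1 \<le> p" "U \<in> bLp p" "W \<in> bLp p"
  shows "AE x in lborel. avg \<mu> (\<lambda>x. U x - W x) x = avg \<mu> U x - avg \<mu> W x"
  using AE_avg_integrable[OF assms(1,3,2)] AE_avg_integrable[OF assms(1,4,2)]
  by eventually_elim (simp add: avg_def)

text \<open>Not automatic, since \<open>\<mu>\<close> may be singular: a translate of a null set can
  have full \<open>\<mu>\<close>-measure. Integration over all translates shows that this happens
  for \<open>x\<close> in a null set only.\<close>

lemma avg_cong_AE:
  assumes \<mu>: "bprob \<mu>" and [measurable]: "U \<in> borel_measurable borel" "W \<in> borel_measurable borel"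
    and ae: "AE x in lborel. U x = W x"
  shows "AE x in lborel. avg \<mu> U x = avg \<mu> W x"
proof -
  have [measurable_cong]: "sets \<mu> = sets borel" using \<mu> by (rule bprob_sets)
  have "pint lborel 1 (avg \<mu> (\<lambda>x. U x - W x)) \<le> pint lborel 1 (\<lambda>x. U x - W x)"
    by (rule pint_avg[OF \<mu>]) auto
  have "(\<integral>\<^sup>+x. pint \<mu> 1 (\<lambda>y. U (x - y) - W (x - y)) \<partial>lborel) = pint lborel 1 (\<lambda>x. U x - W x)"
    by (rule pint_avg_le_iterated[OF \<mu>]) auto
  also have "... = 0" using ae unfolding pint_def by (subst nn_integral_0_iff_AE) auto
  finally have z: "(\<integral>\<^sup>+x. pint \<mu> 1 (\<lambda>y. U (x - y) - W (x - y)) \<partial>lborel) = 0" .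
  interpret sigma_finite_measure \<mu> using \<mu> by (rule bprob_sigma_finite)
  have "(\<lambda>x. pint \<mu> 1 (\<lambda>y. U (x - y) - W (x - y))) \<in> borel_measurable lborel" unfolding pint_def by measurable
  then have "AE x in lborel. pint \<mu> 1 (\<lambda>y. U (x - y) - W (x - y)) = 0"
    using z nn_integral_0_iff_AE by blast
  then show ?thesis
  proof eventually_elim
    fix x assume "pint \<mu> 1 (\<lambda>y. U (x - y) - W (x - y)) = 0"
    then have "AE y in \<mu>. ennreal (norm (U (x - y) - W (x - y)) powr 1) = 0"
      unfolding pint_def by (subst (asm) nn_integral_0_iff_AE) auto
    then have "AE y in \<mu>. U (x - y) = W (x - y)" by eventually_elim simp
    then show "avg \<mu> U x = avg \<mu> W x" unfolding avg_def by (intro integral_cong_AE) auto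
  qed
qed

text \<open>The hypothesis of Fubini for pairings of a test function with an L^p function. Both maps
  \<open>X\<close> and \<open>Y\<close> carry the product measure to \<open>lborel\<close>, and the
  indicator of \<open>K\<close> times \<open>|U|\<close> is at most this indicator plus
  \<open>|U|^p\<close>. The maps are parameters because the translation sits either on the test
  function or on \<open>U\<close>.\<close>

lemma integrable_pair_bound:
  fixes U :: "real^'n::finite \<Rightarrow> complex"
  assumes \<mu>: "bprob \<mu>" and K: "compact K" and U: "U \<in> bLp p" and p: "1 \<le> p"
    and X: "X \<in> borel_measurable (lborel \<Otimes>\<^sub>M \<mu>)" "X = (\<lambda>(x, y). x + a *\<^sub>R y)"
    and Y: "Y \<in> borel_measurable (lborel \<Otimes>\<^sub>M \<mu>)" "Y = (\<lambda>(x, y). x + c *\<^sub>R y)"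
    and F: "F \<in> borel_measurable (lborel \<Otimes>\<^sub>M \<mu>)"
    and le: "\<And>z. norm (F z) \<le> B * (indicator K (X z) * norm (U (Y z)))" and B: "0 < B"
  shows "integrable (lborel \<Otimes>\<^sub>M \<mu>) (F :: _ \<Rightarrow> complex)"
proof (rule integrableI_bounded[OF F])
  interpret pair_sigma_finite lborel \<mu> using \<mu> by (rule pair_sigma_finite_lborel)
  have [measurable_cong]: "sets \<mu> = sets borel" using \<mu> by (rule bprob_sets)
  have [measurable]: "U \<in> borel_measurable borel" using U by (simp add: bLp_def)
  have [measurable]: "K \<in> sets borel" using K by (rule borel_compact)
  note X(1)[measurable] Y(1)[measurable]
  have tr: "(\<integral>\<^sup>+z. G (fst z + b *\<^sub>R snd z) \<partial>(lborel \<Otimes>\<^sub>M \<mu>)) = (\<integral>\<^sup>+x. G x \<partial>lborel)"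
    if [measurable]: "G \<in> borel_measurable borel" for G b
  proof -
    have "(\<integral>\<^sup>+z. G (fst z + b *\<^sub>R snd z) \<partial>(lborel \<Otimes>\<^sub>M \<mu>)) = (\<integral>\<^sup>+y. (\<integral>\<^sup>+x. G (x + b *\<^sub>R y) \<partial>lborel) \<partial>\<mu>)"
      by (subst nn_integral_snd[symmetric]) auto
    also have "... = (\<integral>\<^sup>+x. G x \<partial>lborel)"
      using \<mu> by (simp add: nn_integral_lborel_translate bprob_space) (simp add: bprob_def)
    finally show ?thesis .
  qed
  have "(\<integral>\<^sup>+z. ennreal (norm (F z)) \<partial>(lborel \<Otimes>\<^sub>M \<mu>))
      \<le> (\<integral>\<^sup>+z. ennreal B * (indicator K (X z) + ennreal (norm (U (Y z)) powr p)) \<partial>(lborel \<Otimes>\<^sub>M \<mu>))"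
  proof (rule nn_integral_mono)
    fix z
    have "norm (U (Y z)) \<le> 1 + norm (U (Y z)) powr p"
    proof (cases "norm (U (Y z)) \<le> 1")
      case False
      then have "norm (U (Y z)) powr 1 \<le> norm (U (Y z)) powr p" using p by (intro powr_mono) auto
      then show ?thesis using False by auto
    next
      case True
      then show ?thesis by (smt (verit) powr_ge_zero)
    qed
    then have "indicator K (X z) * norm (U (Y z)) \<le> indicator K (X z) + norm (U (Y z)) powr p"
      by (auto split: split_indicator)
    then have "norm (F z) \<le> B * (indicator K (X z) + norm (U (Y z)) powr p)"
      using le[of z] B by (meson mult_left_mono order.trans less_imp_le)
    then show "ennreal (norm (F z)) \<le> ennreal B * (indicator K (X z) + ennreal (norm (U (Y z)) powr p))"
      using B by (simp add: ennreal_mult'[symmetric] ennreal_indicator[symmetric] del: ennreal_plus ennreal_indicator flip: ennreal_plus)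
  qed
  also have "... = ennreal B * ((\<integral>\<^sup>+z. indicator K (X z) \<partial>(lborel \<Otimes>\<^sub>M \<mu>)) + (\<integral>\<^sup>+z. ennreal (norm (U (Y z)) powr p) \<partial>(lborel \<Otimes>\<^sub>M \<mu>)))"
    by (simp add: nn_integral_cmult nn_integral_add)
  also have "... = ennreal B * (emeasure lborel K + pint lborel p U)"
    using tr[of "indicator K" a] tr[of "\<lambda>x. ennreal (norm (U x) powr p)" c]
    by (simp add: X(2) Y(2) case_prod_beta pint_def)
  also have "... < \<infinity>"
    using U emeasure_compact_finite[OF K] by (simp add: bLp_def ennreal_mult_less_top)
  finally show "(\<integral>\<^sup>+z. ennreal (norm (F z)) \<partial>(lborel \<Otimes>\<^sub>M \<mu>)) < \<infinity>" .
qed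

text \<open>The average is shifted from \<open>U\<close> to the test function, where derivatives and
  the fundamental theorem of calculus are classical.\<close>

lemma
  fixes U :: "real^'n::finite \<Rightarrow> complex"
  assumes \<mu>: "bprob \<mu>" and t: "test_function \<phi>" and U: "U \<in> bLp p" and p: "1 \<le> p"
  shows avg_pairing: "(\<integral>x. \<phi> x *\<^sub>R avg \<mu> U x \<partial>lborel) = (\<integral>y. (\<integral>x. \<phi> (x + y) *\<^sub>R U x \<partial>lborel) \<partial>\<mu>)"
    and avg_pairing_swap: "(\<integral>y. (\<integral>x. \<phi> (x + y) *\<^sub>R U x \<partial>lborel) \<partial>\<mu>) = (\<integral>x. (\<integral>y. \<phi> (x + y) \<partial>\<mu>) *\<^sub>R U x \<partial>lborel)"
proof -
  interpret pair_sigma_finite lborel \<mu> using \<mu> by (rule pair_sigma_finite_lborel)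
  have [measurable_cong]: "sets \<mu> = sets borel" using \<mu> by (rule bprob_sets)
  have [measurable]: "U \<in> borel_measurable borel" using U by (simp add: bLp_def)
  obtain K B where K: "compact K" "\<And>x. x \<notin> K ==> \<phi> x = 0" "0 < B" "\<And>x. \<bar>\<phi> x\<bar> \<le> B"
    and [measurable]: "\<phi> \<in> borel_measurable borel" using test_function_bounds[OF t] by blast
  have ble: "\<bar>\<phi> x\<bar> * r \<le> B * (indicator K x * r)" if "0 \<le> r" for x r
    using K(2)[of x] K(4)[of x] that by (cases "x \<in> K") (auto intro: mult_right_mono)
  have i1: "integrable (lborel \<Otimes>\<^sub>M \<mu>) (\<lambda>(x, y). \<phi> x *\<^sub>R U (x - y))"
    by (rule integrable_pair_bound[OF \<mu> K(1) U p, where a = 0 and c = "-1" and X = "\<lambda>(x, y). x" and Y = "\<lambda>(x, y). x - y" and B = B])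
      (use K(3) ble in \<open>auto\<close>)
  have i2: "integrable (lborel \<Otimes>\<^sub>M \<mu>) (\<lambda>(x, y). \<phi> (x + y) *\<^sub>R U x)"
    by (rule integrable_pair_bound[OF \<mu> K(1) U p, where a = 1 and c = 0 and X = "\<lambda>(x, y). x + y" and Y = "\<lambda>(x, y). x" and B = B])
      (use K(3) ble in \<open>auto\<close>)
  have "(\<integral>x. \<phi> x *\<^sub>R avg \<mu> U x \<partial>lborel) = (\<integral>x. (\<integral>y. \<phi> x *\<^sub>R U (x - y) \<partial>\<mu>) \<partial>lborel)"
    by (simp add: avg_def)
  also have "... = (\<integral>y. (\<integral>x. \<phi> x *\<^sub>R U (x - y) \<partial>lborel) \<partial>\<mu>)"
    using Fubini_integral[of "\<lambda>x y. \<phi> x *\<^sub>R U (x - y)"] i1 by simp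
  also have "... = (\<integral>y. (\<integral>x. \<phi> (x + y) *\<^sub>R U x \<partial>lborel) \<partial>\<mu>)"
  proof (rule Bochner_Integration.integral_cong[OF refl])
    fix y
    show "(\<integral>x. \<phi> x *\<^sub>R U (x - y) \<partial>lborel) = (\<integral>x. \<phi> (x + y) *\<^sub>R U x \<partial>lborel)"
      using integral_lborel_translate[of "\<lambda>x. \<phi> x *\<^sub>R U (x - y)" y] by simp
  qed
  finally show "(\<integral>x. \<phi> x *\<^sub>R avg \<mu> U x \<partial>lborel) = (\<integral>y. (\<integral>x. \<phi> (x + y) *\<^sub>R U x \<partial>lborel) \<partial>\<mu>)" .
  have ip: "integrable \<mu> (\<lambda>y. \<phi> (x + y))" for x
    using bprob_finite[OF \<mu>] K(4) by (intro finite_measure.integrable_const_bound[of \<mu> _ B]) auto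
  have "(\<integral>y. (\<integral>x. \<phi> (x + y) *\<^sub>R U x \<partial>lborel) \<partial>\<mu>) = (\<integral>x. (\<integral>y. \<phi> (x + y) *\<^sub>R U x \<partial>\<mu>) \<partial>lborel)"
    using Fubini_integral[of "\<lambda>x y. \<phi> (x + y) *\<^sub>R U x"] i2 by simp
  also have "... = (\<integral>x. (\<integral>y. \<phi> (x + y) \<partial>\<mu>) *\<^sub>R U x \<partial>lborel)"
    by (intro Bochner_Integration.integral_cong[OF refl] integral_scaleR_left ip)
  finally show "(\<integral>y. (\<integral>x. \<phi> (x + y) *\<^sub>R U x \<partial>lborel) \<partial>\<mu>) = (\<integral>x. (\<integral>y. \<phi> (x + y) \<partial>\<mu>) *\<^sub>R U x \<partial>lborel)" .
qed

text \<open>Weak differentiation commutes with translation, seen by testing with translates of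
  \<open>\<phi>\<close>, hence with averages of translations.\<close>

lemma has_weak_deriv_avg:
  assumes \<mu>: "bprob \<mu>" and p: "1 \<le> p" and U: "U \<in> bLp p" "G \<in> bLp p"
    and wd: "has_weak_deriv (unit_mi t) U G"
  shows "has_weak_deriv (unit_mi t) (avg \<mu> U) (avg \<mu> G)"
  unfolding has_weak_deriv_unit_lborel[OF p bLp_avg[OF \<mu> p U(1)] bLp_avg[OF \<mu> p U(2)]]
proof (intro allI impI)
  fix \<phi> :: "real^'a \<Rightarrow> real" assume t: "test_function \<phi>"
  have "(\<integral>x. partial t \<phi> (x + y) *\<^sub>R U x \<partial>lborel) = - (\<integral>x. \<phi> (x + y) *\<^sub>R G x \<partial>lborel)" for y
    using wd[unfolded has_weak_deriv_unit_lborel[OF p U]] test_function_translate[OF t, of y]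
      partial_translate[OF t, of t y] by metis
  then show "(\<integral>x. partial t \<phi> x *\<^sub>R avg \<mu> U x \<partial>lborel) = - (\<integral>x. \<phi> x *\<^sub>R avg \<mu> G x \<partial>lborel)"
    by (simp add: avg_pairing[OF \<mu> test_function_partial[OF t] U(1) p] avg_pairing[OF \<mu> t U(2) p])
qed

section \<open>Averages over segments\<close>

text \<open>The uniform distribution on the segment from 0 to \<open>v\<close>. The parametrization
  makes sense for \<open>v = 0\<close>, where it gives a Dirac mass, and for either sign of a
  direction.\<close>

definition seg :: "real^'n \<Rightarrow> (real^'n::finite) measure" where
  "seg v = distr (density lborel (indicator {0..1::real})) borel (\<lambda>s. s *\<^sub>R v)"

lemma bprob_seg: "bprob (seg v)"
proof -
  have "emeasure (seg v) UNIV = 1"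
    unfolding seg_def by (subst emeasure_distr) (auto simp: emeasure_density)
  then show ?thesis by (simp add: bprob_def seg_def)
qed

lemma integral_seg:
  fixes F :: "real^'n::finite \<Rightarrow> 'b::{banach, second_countable_topology}"
  assumes [measurable]: "F \<in> borel_measurable borel"
  shows "(\<integral>y. F y \<partial>seg v) = (\<integral>s. indicator {0..1} s *\<^sub>R F (s *\<^sub>R v) \<partial>lborel)"
proof -
  have "(\<integral>y. F y \<partial>seg v) = (\<integral>s. F (s *\<^sub>R v) \<partial>density lborel (\<lambda>s. ennreal (indicator {0..1} s)))"
    unfolding seg_def by (subst integral_distr) (auto simp: ennreal_indicator)
  also have "... = (\<integral>s. indicator {0..1} s *\<^sub>R F (s *\<^sub>R v) \<partial>lborel)"
    by (rule integral_density) auto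
  finally show ?thesis .
qed

lemma nn_integral_seg:
  assumes [measurable]: "F \<in> borel_measurable borel"
  shows "(\<integral>\<^sup>+y. F y \<partial>seg v) = (\<integral>\<^sup>+s. indicator {0..1} s * F (s *\<^sub>R v) \<partial>lborel)"
  unfolding seg_def by (subst nn_integral_distr) (auto simp: nn_integral_density)

lemma seg_partial:
  assumes t: "test_function \<phi>"
  shows "h * (\<integral>y. partial t \<phi> (x + y) \<partial>seg (h *\<^sub>R axis t 1)) = \<phi> (x + h *\<^sub>R axis t 1) - \<phi> x"
proof -
  let ?F = "\<lambda>s. \<phi> (x + (s * h) *\<^sub>R axis t 1)"
  let ?f = "\<lambda>s. h * partial t \<phi> (x + (s * h) *\<^sub>R axis t 1)"
  have [measurable]: "partial t \<phi> \<in> borel_measurable borel"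
    by (intro test_function_measurable test_function_partial t)
  have "(\<integral>y. partial t \<phi> (x + y) \<partial>seg (h *\<^sub>R axis t 1))
      = (\<integral>s. indicator {0..1} s *\<^sub>R partial t \<phi> (x + (s * h) *\<^sub>R axis t 1) \<partial>lborel)"
    by (subst integral_seg) auto
  then have "h * (\<integral>y. partial t \<phi> (x + y) \<partial>seg (h *\<^sub>R axis t 1))
      = (\<integral>s. ?f s * indicator {0..1} s \<partial>lborel)"
    by (simp add: integral_mult_right_zero[symmetric] mult_ac del: integral_mult_right_zero)
  also have "... = ?F 1 - ?F 0"
  proof (rule integral_FTC_Icc_real)
    fix s :: real
    have "((\<lambda>s. s * h) has_real_derivative h) (at s)" by (auto intro!: derivative_eq_intros)
    from DERIV_chain2[OF C_k_line_derivative[OF test_function_C_k[OF t]] this]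
    show "(?F has_real_derivative ?f s) (at s)" by (simp add: mult.commute)
    have "continuous_on UNIV (partial t \<phi>)" by (intro test_function_continuous test_function_partial t)
    then have "continuous_on UNIV ?f"
      by (intro continuous_on_mult continuous_on_const, rule continuous_on_compose2) (auto intro!: continuous_intros)
    then show "isCont ?f s" by (simp add: continuous_on_eq_continuous_at)
  qed simp
  finally show ?thesis by simp
qed

text \<open>The fundamental theorem of calculus in direction \<open>t\<close>, on the dual side:
  formally, \<open>h\<close> times the derivative of the segment average of \<open>U\<close> is the
  difference of \<open>U\<close>. The function \<open>U\<close> is only in L^p. The sign of
  \<open>h\<close> is free, as dilation factors may be negative.\<close>

lemma seg_pairing:
  assumes t: "test_function \<phi>" and U: "U \<in> bLp p" and p: "1 \<le> p"
  shows "of_real h * (\<integral>y. (\<integral>x. partial t \<phi> (x + y) *\<^sub>R U x \<partial>lborel) \<partial>seg (h *\<^sub>R axis t 1))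
    = - (\<integral>x. \<phi> x *\<^sub>R (U x - U (x - h *\<^sub>R axis t 1)) \<partial>lborel)"
proof -
  let ?v = "h *\<^sub>R axis t 1"
  have [measurable]: "U \<in> borel_measurable borel" "\<phi> \<in> borel_measurable borel"
    using U t by (auto simp: bLp_def test_function_measurable)
  have il: "integrable lborel (\<lambda>x. \<theta> x *\<^sub>R W x)" if "test_function \<theta>" "W \<in> bLp p" for \<theta> W
  proof -
    have "(\<lambda>x. \<theta> x *\<^sub>R W x) \<in> borel_measurable lborel"
      using that test_function_measurable[OF that(1)] bLp_measurable[OF that(2)] by simp
    then show ?thesis
      using integrable_test_function[OF that(1) Lp_locally_integrable[OF p bLp_Lp[OF that(2)]]] integrable_completion by blast
  qed
  have "of_real h * (\<integral>y. (\<integral>x. partial t \<phi> (x + y) *\<^sub>R U x \<partial>lborel) \<partial>seg ?v)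
      = h *\<^sub>R (\<integral>x. (\<integral>y. partial t \<phi> (x + y) \<partial>seg ?v) *\<^sub>R U x \<partial>lborel)"
    unfolding avg_pairing_swap[OF bprob_seg test_function_partial[OF t] U p] by (simp only: scaleR_conv_of_real)
  also have "... = (\<integral>x. (h * (\<integral>y. partial t \<phi> (x + y) \<partial>seg ?v)) *\<^sub>R U x \<partial>lborel)"
    by (simp flip: integral_scaleR_right scaleR_scaleR)
  also have "... = (\<integral>x. \<phi> (x + ?v) *\<^sub>R U x - \<phi> x *\<^sub>R U x \<partial>lborel)"
    by (simp add: seg_partial[OF t] scaleR_diff_left)
  also have "... = (\<integral>x. \<phi> (x + ?v) *\<^sub>R U x \<partial>lborel) - (\<integral>x. \<phi> x *\<^sub>R U x \<partial>lborel)"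
    by (intro Bochner_Integration.integral_diff il test_function_translate t U)
  also have "(\<integral>x. \<phi> (x + ?v) *\<^sub>R U x \<partial>lborel) = (\<integral>x. \<phi> x *\<^sub>R U (x - ?v) \<partial>lborel)"
    using integral_lborel_translate[of "\<lambda>x. \<phi> x *\<^sub>R U (x - ?v)" ?v] by simp
  also have "... - (\<integral>x. \<phi> x *\<^sub>R U x \<partial>lborel) = - ((\<integral>x. \<phi> x *\<^sub>R U x \<partial>lborel) - (\<integral>x. \<phi> x *\<^sub>R U (x - ?v) \<partial>lborel))"
    by simp
  also have "(\<integral>x. \<phi> x *\<^sub>R U x \<partial>lborel) - (\<integral>x. \<phi> x *\<^sub>R U (x - ?v) \<partial>lborel) = (\<integral>x. \<phi> x *\<^sub>R (U x - U (x - ?v)) \<partial>lborel)"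
    by (simp add: scaleR_diff_right Bochner_Integration.integral_diff[OF il[OF t U] il[OF t bLp_translate[OF U]]])
  finally show ?thesis .
qed

lemma bLp_add: "1 \<le> p ==> f \<in> bLp p ==> g \<in> bLp p ==> (\<lambda>x. f x + g x) \<in> bLp p"
  by (simp add: bLp_iff Lp_add borel_measurable_add borel_measurable_times borel_measurable_diff)

lemma bLp_cmult: "f \<in> bLp p ==> (\<lambda>x. c * f x) \<in> bLp p"
  by (simp add: bLp_iff Lp_cmult borel_measurable_add borel_measurable_times borel_measurable_diff)

lemma bLp_diff: "1 \<le> p ==> f \<in> bLp p ==> g \<in> bLp p ==> (\<lambda>x. f x - g x) \<in> bLp p"
  by (simp add: bLp_iff Lp_diff borel_measurable_add borel_measurable_times borel_measurable_diff)

text \<open>Convolution turns a derivative into a difference already along one edge of the cell; the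
  rest of the cell is a further average.\<close>

lemma has_weak_deriv_avg_seg:
  assumes p: "1 \<le> p" and U: "U \<in> bLp p"
  shows "has_weak_deriv (unit_mi t) (avg (seg (axis t 1)) U) (\<lambda>x. U x - U (x - axis t 1))"
  unfolding has_weak_deriv_unit_lborel[OF p bLp_avg[OF bprob_seg p U] bLp_diff[OF p U bLp_translate[OF U]]]
  using seg_pairing[OF _ U p, of _ 1 t] avg_pairing[OF bprob_seg test_function_partial U p] by simp

text \<open>The same pairing read backwards: if \<open>U\<close> is weakly differentiable, its
  increment is \<open>h\<close> times a segment average of the derivative. This is the source of the
  constant 1 in the bound for differences.\<close>

lemma translate_diff_eq_avg_seg:
  assumes p: "1 \<le> p" and U: "U \<in> bLp p" "G \<in> bLp p" and wd: "has_weak_deriv (unit_mi t) U G"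
  shows "AE x in lborel. U x - U (x - h *\<^sub>R axis t 1) = of_real h * avg (seg (h *\<^sub>R axis t 1)) G x"
proof -
  let ?v = "h *\<^sub>R axis t 1"
  let ?l = "\<lambda>x. U x - U (x - ?v)" and ?r = "\<lambda>x. of_real h * avg (seg ?v) G x"
  have l: "?l \<in> bLp p" and a: "avg (seg ?v) G \<in> bLp p" and r: "?r \<in> bLp p"
    using p U bprob_seg by (auto intro!: bLp_diff bLp_translate bLp_cmult bLp_avg)
  have "AE x in lebesgue. ?l x - ?r x = 0"
  proof (rule AE_zero_of_test_functions)
    show "locally_integrable (\<lambda>x. ?l x - ?r x)"
      by (intro Lp_locally_integrable[OF p] bLp_Lp bLp_diff p l r)
    fix \<phi> :: "real^'a \<Rightarrow> real" assume t: "test_function \<phi>"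
    have m [measurable]: "?l \<in> borel_measurable borel" "avg (seg ?v) G \<in> borel_measurable borel" "\<phi> \<in> borel_measurable borel"
      using l a t by (auto simp: bLp_def test_function_measurable)
    have "(\<integral>x. partial t \<phi> (x + y) *\<^sub>R U x \<partial>lborel) = - (\<integral>x. \<phi> (x + y) *\<^sub>R G x \<partial>lborel)" for y
      using wd[unfolded has_weak_deriv_unit_lborel[OF p U]] test_function_translate[OF t, of y]
        partial_translate[OF t, of t y] by metis
    then have "(\<integral>x. \<phi> x *\<^sub>R ?l x \<partial>lborel) = of_real h * (\<integral>y. (\<integral>x. \<phi> (x + y) *\<^sub>R G x \<partial>lborel) \<partial>seg ?v)"
      using seg_pairing[OF t U(1) p, of h t] by simp
    also have "... = of_real h * (\<integral>x. \<phi> x *\<^sub>R avg (seg ?v) G x \<partial>lborel)"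
      by (simp add: avg_pairing[OF bprob_seg t U(2) p])
    also have "... = (\<integral>x. \<phi> x *\<^sub>R ?r x \<partial>lborel)"
      by (simp add: mult_scaleR_right[symmetric] del: mult_scaleR_right)
    finally have eq: "(\<integral>x. \<phi> x *\<^sub>R ?l x \<partial>lebesgue) = (\<integral>x. \<phi> x *\<^sub>R ?r x \<partial>lebesgue)"
      by (subst (1 2) integral_lebesgue_lborel) auto
    have "(\<integral>x. \<phi> x *\<^sub>R (?l x - ?r x) \<partial>lebesgue) = (\<integral>x. \<phi> x *\<^sub>R ?l x \<partial>lebesgue) - (\<integral>x. \<phi> x *\<^sub>R ?r x \<partial>lebesgue)"
      unfolding scaleR_diff_right[of "\<phi> _" "?l _"]
      by (intro Bochner_Integration.integral_diff integrable_test_function t Lp_locally_integrable[OF p] bLp_Lp l r)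
    then show "(\<integral>x. \<phi> x *\<^sub>R (?l x - ?r x) \<partial>lebesgue) = 0" using eq by simp
  qed
  then show ?thesis by (simp add: AE_completion_iff)
qed

section \<open>The unit cell as the sum of a face and an edge\<close>

lemma nn_integral_cart_prod:
  fixes f :: "'n::finite \<Rightarrow> real \<Rightarrow> ennreal"
  assumes [measurable]: "\<And>i. f i \<in> borel_measurable borel"
  shows "(\<integral>\<^sup>+x. (\<Prod>i\<in>UNIV. f i (x $ i)) \<partial>(lborel :: (real^'n) measure)) = (\<Prod>i\<in>UNIV. \<integral>\<^sup>+x. f i x \<partial>lborel)"
proof -
  define idx where "idx b = (THE i. b = axis i (1::real))" for b :: "real^'n"
  have idx: "idx (axis i 1) = i" for i by (simp add: idx_def axis_eq_axis)
  have bij: "bij_betw (\<lambda>i. axis i (1::real)) (UNIV :: 'n set) (Basis :: (real^'n) set)"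
    by (auto simp: bij_betw_def inj_on_def axis_eq_axis Basis_vec_def)
  have "(\<integral>\<^sup>+x. (\<Prod>b\<in>Basis. f (idx b) (x \<bullet> b)) \<partial>(lborel :: (real^'n) measure))
      = (\<Prod>b\<in>(Basis :: (real^'n) set). (\<integral>\<^sup>+x. f (idx b) x \<partial>lborel))"
    by (rule nn_integral_lborel_prod) auto
  then show ?thesis
    by (simp add: prod.reindex_bij_betw[OF bij, symmetric] idx inner_axis)
qed

lemma indicator_prod_cart:
  fixes A :: "'n::finite \<Rightarrow> real set"
  shows "indicator {x. \<forall>i. x $ i \<in> A i} x = (\<Prod>i\<in>UNIV. indicator (A i) (x $ i) :: ennreal)"
proof (cases "\<forall>i. x $ i \<in> A i")
  case False
  then obtain j where "x $ j \<notin> A j" by blast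
  then have "(\<Prod>i\<in>UNIV. indicator (A i) (x $ i) :: ennreal) = 0" by (intro prod_zero bexI[of _ j]) auto
  then show ?thesis using False by simp
qed simp

lemma unit_cell_eq: "unit_cell = {x :: real^'n::finite. \<forall>i. x $ i \<in> {0..<1}}"
  by (auto simp: unit_cell_def)

lemma indicator_unit_cell:
  "(indicator unit_cell y :: ennreal) = (\<Prod>i\<in>UNIV. indicator {0..<1} (y $ i))" for y :: "real^'n::finite"
  by (simp only: unit_cell_eq indicator_prod_cart)

lemma unit_cell_borel [measurable]: "(unit_cell :: (real^'n::finite) set) \<in> sets borel"
proof -
  have "{x :: real^'n. x $ i \<in> {0..<1}} \<in> sets borel" for i
    using measurable_sets[of "\<lambda>x :: real^'n. x $ i" borel borel "{0..<1}"] by (simp add: vimage_def)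
  then show ?thesis by (simp add: unit_cell_eq Collect_all_eq)
qed

lemma emeasure_unit_cell: "emeasure lborel (unit_cell :: (real^'n::finite) set) = 1"
proof -
  have "emeasure lborel (unit_cell :: (real^'n) set) = (\<integral>\<^sup>+x. indicator (unit_cell :: (real^'n) set) x \<partial>lborel)"
    by simp
  also have "... = (\<integral>\<^sup>+x. (\<Prod>i\<in>UNIV. indicator {0..<1} (x $ i)) \<partial>(lborel :: (real^'n) measure))"
    by (simp only: unit_cell_eq indicator_prod_cart)
  also have "... = 1" by (subst nn_integral_cart_prod) auto
  finally show ?thesis .
qed

definition cell :: "(real^'n::finite) measure" where
  "cell = density lborel (indicator unit_cell)"

lemma bprob_cell: "bprob cell"
  using emeasure_unit_cell by (simp add: bprob_def cell_def emeasure_density)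

lemma nn_integral_cell:
  "F \<in> borel_measurable borel ==> (\<integral>\<^sup>+y. F y \<partial>cell) = (\<integral>\<^sup>+y. indicator unit_cell y * F y \<partial>lborel)"
  unfolding cell_def by (rule nn_integral_density) auto

lemma integral_cell:
  fixes F :: "real^'n::finite \<Rightarrow> 'b::{banach, second_countable_topology}"
  assumes "F \<in> borel_measurable borel"
  shows "(\<integral>y. F y \<partial>cell) = (\<integral>y. indicator unit_cell y *\<^sub>R F y \<partial>lborel)"
proof -
  have "cell = density lborel (\<lambda>y :: real^'n. ennreal (indicator unit_cell y :: real))"
    by (simp add: cell_def ennreal_indicator)
  moreover have "(\<integral>y. F y \<partial>density lborel (\<lambda>y. ennreal (indicator unit_cell y)))
      = (\<integral>y. indicator unit_cell y *\<^sub>R F y \<partial>lborel)"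
    using assms by (intro integral_density) auto
  ultimately show ?thesis by simp
qed

text \<open>The uniform distribution on the face \<open>x $ t = 0\<close> of the cell, obtained by
  projection along the \<open>t\<close>-axis.\<close>

definition cellx :: "'n \<Rightarrow> (real^'n::finite) measure" where
  "cellx t = distr cell borel (\<lambda>z. z - (z $ t) *\<^sub>R axis t 1)"

lemma bprob_distr:
  assumes "bprob \<mu>" "f \<in> borel_measurable borel" shows "bprob (distr \<mu> borel f)"
proof -
  have "f \<in> measurable \<mu> borel" using assms bprob_sets[OF assms(1)] by (simp cong: measurable_cong_sets)
  then show ?thesis using assms(1) bprob_space[OF assms(1)] by (simp add: bprob_def emeasure_distr)
qed

lemma bprob_cellx: "bprob (cellx t)"
  unfolding cellx_def by (rule bprob_distr[OF bprob_cell]) measurable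

definition mconv :: "(real^'n::finite) measure \<Rightarrow> (real^'n) measure \<Rightarrow> (real^'n) measure" where
  "mconv \<mu> \<nu> = distr (\<mu> \<Otimes>\<^sub>M \<nu>) borel (\<lambda>(a, b). a + b)"

lemma nn_integral_mconv:
  assumes \<mu>: "bprob \<mu>" and \<nu>: "bprob \<nu>" and [measurable]: "F \<in> borel_measurable borel"
  shows "(\<integral>\<^sup>+y. F y \<partial>mconv \<mu> \<nu>) = (\<integral>\<^sup>+a. \<integral>\<^sup>+b. F (a + b) \<partial>\<nu> \<partial>\<mu>)"
proof -
  have [measurable_cong]: "sets \<mu> = sets borel" "sets \<nu> = sets borel" using \<mu> \<nu> by (simp_all add: bprob_sets)
  interpret \<nu>: sigma_finite_measure \<nu> using \<nu> by (rule bprob_sigma_finite)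
  have "(\<integral>\<^sup>+y. F y \<partial>mconv \<mu> \<nu>) = (\<integral>\<^sup>+z. F (fst z + snd z) \<partial>(\<mu> \<Otimes>\<^sub>M \<nu>))"
    unfolding mconv_def by (subst nn_integral_distr) (auto simp: case_prod_beta)
  also have "... = (\<integral>\<^sup>+a. \<integral>\<^sup>+b. F (a + b) \<partial>\<nu> \<partial>\<mu>)"
    by (subst \<nu>.nn_integral_fst[symmetric]) auto
  finally show ?thesis .
qed

lemma bprob_mconv:
  assumes "bprob \<mu>" "bprob \<nu>" shows "bprob (mconv \<mu> \<nu>)"
proof -
  have "emeasure (mconv \<mu> \<nu>) UNIV = (\<integral>\<^sup>+y. 1 \<partial>mconv \<mu> \<nu>)"
    by (simp add: mconv_def)
  also have "... = 1"
    using assms by (subst nn_integral_mconv) (auto simp: bprob_space, simp add: bprob_def)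
  finally show ?thesis by (simp add: bprob_def mconv_def)
qed

text \<open>Associativity of convolution, by Fubini at those points where the double integral
  converges absolutely.\<close>

lemma avg_mconv:
  assumes \<mu>: "bprob \<mu>" and \<nu>: "bprob \<nu>" and p: "1 \<le> p" and U: "U \<in> bLp p"
  shows "AE x in lborel. avg (mconv \<mu> \<nu>) U x = avg \<mu> (avg \<nu> U) x"
  using AE_avg_integrable[OF bprob_mconv[OF \<mu> \<nu>] U p]
proof eventually_elim
  fix x assume int: "integrable (mconv \<mu> \<nu>) (\<lambda>y. U (x - y))"
  have [measurable_cong]: "sets \<mu> = sets borel" "sets \<nu> = sets borel" using \<mu> \<nu> by (simp_all add: bprob_sets)
  have [measurable]: "U \<in> borel_measurable borel" using U by (simp add: bLp_def)
  interpret pair_sigma_finite \<mu> \<nu> using \<mu> \<nu> by (simp add: pair_sigma_finite_def bprob_sigma_finite)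
  have "integrable (\<mu> \<Otimes>\<^sub>M \<nu>) (\<lambda>z. U (x - (fst z + snd z)))"
    using int unfolding mconv_def by (subst (asm) integrable_distr_eq) (auto simp: case_prod_beta)
  then have i: "integrable (\<mu> \<Otimes>\<^sub>M \<nu>) (\<lambda>(a, b). U (x - a - b))"
    by (simp add: case_prod_unfold diff_diff_eq)
  have "avg (mconv \<mu> \<nu>) U x = (\<integral>z. U (x - (fst z + snd z)) \<partial>(\<mu> \<Otimes>\<^sub>M \<nu>))"
    unfolding avg_def mconv_def by (subst integral_distr) (auto simp: case_prod_beta)
  also have "... = (\<integral>z. (case z of (a, b) \<Rightarrow> U (x - a - b)) \<partial>(\<mu> \<Otimes>\<^sub>M \<nu>))"
    by (simp add: case_prod_unfold diff_diff_eq)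
  also have "... = (\<integral>a. \<integral>b. U (x - a - b) \<partial>\<nu> \<partial>\<mu>)"
    using integral_fst[OF i] by simp
  finally show "avg (mconv \<mu> \<nu>) U x = avg \<mu> (avg \<nu> U) x" by (simp add: avg_def)
qed

lemma cell_eq_mconv: "cell = mconv (cellx t) (seg (axis t 1))" for t :: "'n::finite"
proof (rule measure_eqI_generator_eq)
  let ?R = "mconv (cellx t) (seg (axis t (1::real)))"
  let ?E = "range (\<lambda>(a, b). box a b :: (real^'n) set)"
  show "Int_stable ?E" by (auto simp: Int_stable_def box_Int_box)
  show "?E \<subseteq> Pow UNIV" by simp
  show "sets cell = sigma_sets UNIV ?E" "sets ?R = sigma_sets UNIV ?E"
    by (simp_all add: borel_eq_box cell_def mconv_def)
  let ?A = "\<lambda>n::nat. box (- (real n *\<^sub>R One)) (real n *\<^sub>R One) :: (real^'n) set"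
  show "range ?A \<subseteq> ?E" by auto
  show "(\<Union>i. ?A i) = UNIV" by (rule UN_box_eq_UNIV)
  show "emeasure cell (?A i) \<noteq> \<infinity>" for i
    using finite_measure.emeasure_finite[OF bprob_finite[OF bprob_cell], of "?A i"] by simp
  show "emeasure cell X = emeasure ?R X" if XE: "X \<in> ?E" for X
  proof -
    obtain l u where X: "X = box l u" using XE by auto
    have X': "X = {x. \<forall>i. x $ i \<in> {l $ i<..<u $ i}}" by (auto simp: X mem_box_cart)
    have [measurable]: "X \<in> sets borel" by (simp add: X)
    have indX: "(indicator X y :: ennreal) = (\<Prod>i\<in>UNIV. indicator {l $ i<..<u $ i} (y $ i))" for y
      by (simp only: X' indicator_prod_cart)
    let ?k = "\<lambda>i. indicator {0..<1} :: real \<Rightarrow> ennreal" and ?b = "\<lambda>i. indicator {l $ i<..<u $ i} :: real \<Rightarrow> ennreal"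
    let ?c = "\<lambda>i. \<integral>\<^sup>+s. indicator {0..<1} s * ?b i s \<partial>lborel"
    \<comment> \<open>The cell is half-open and the segment closed; the difference is a null
      set.\<close>
    have ae01: "AE s in lborel. (indicator {0..1::real} s :: ennreal) = indicator {0..<1} s"
      using AE_lborel_singleton[of "1::real"] by eventually_elim (auto split: split_indicator)
    have J: "(\<integral>\<^sup>+s. indicator {0..1} s * ?b t s \<partial>lborel) = ?c t"
      using ae01 by (intro nn_integral_cong_AE) (auto elim!: eventually_mono)
    have "emeasure cell X = (\<integral>\<^sup>+y. indicator X y \<partial>cell)" by (simp add: cell_def)
    also have "... = (\<integral>\<^sup>+y. (\<Prod>i\<in>UNIV. indicator {0..<1} (y $ i) * ?b i (y $ i)) \<partial>lborel)"
      using nn_integral_cell[of "indicator X"] by (simp add: prod.distrib indX indicator_unit_cell)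
    also have "... = (\<Prod>i\<in>UNIV. ?c i)" by (subst nn_integral_cart_prod) auto
    also have "... = ?c t * (\<Prod>i\<in>UNIV - {t}. ?c i)" by (rule prod.remove) auto
    finally have L: "emeasure cell X = ?c t * (\<Prod>i\<in>UNIV - {t}. ?c i)" .
    \<comment> \<open>In coordinate \<open>t\<close> the cell variable \<open>z\<close> contributes
      its full mass 1, since the projection forgets it; the constraint of the box falls on the
      segment variable there.\<close>
    let ?g = "\<lambda>i s. indicator {0..<1} s * (if i = t then 1 else ?b i s)"
    have split: "indicator X (z - (z $ t) *\<^sub>R axis t 1 + s *\<^sub>R axis t 1) = ?b t s * (\<Prod>i\<in>UNIV. if i = t then 1 else ?b i (z $ i))" for z s
    proof -
      have "indicator X (z - (z $ t) *\<^sub>R axis t 1 + s *\<^sub>R axis t 1) = (\<Prod>i\<in>UNIV. ?b i (if i = t then s else z $ i))"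
        unfolding indX by (intro prod.cong) (auto simp: axis_def)
      also have "... = ?b t s * (\<Prod>i\<in>UNIV - {t}. ?b i (z $ i))"
        by (subst prod.remove[of _ t]) auto
      also have "(\<Prod>i\<in>UNIV - {t}. ?b i (z $ i)) = (\<Prod>i\<in>UNIV. if i = t then 1 else ?b i (z $ i))"
        by (subst prod.remove[of UNIV t]) auto
      finally show ?thesis .
    qed
    have "emeasure ?R X = (\<integral>\<^sup>+y. indicator X y \<partial>?R)" by (simp add: mconv_def)
    also have "... = (\<integral>\<^sup>+a. \<integral>\<^sup>+b. indicator X (a + b) \<partial>seg (axis t 1) \<partial>cellx t)"
      by (rule nn_integral_mconv[OF bprob_cellx bprob_seg]) auto
    also have "... = (\<integral>\<^sup>+a. \<integral>\<^sup>+s. indicator {0..1} s * indicator X (a + s *\<^sub>R axis t 1) \<partial>lborel \<partial>cellx t)"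
      by (subst nn_integral_seg) auto
    also have "... = (\<integral>\<^sup>+z. \<integral>\<^sup>+s. indicator {0..1} s * indicator X (z - (z $ t) *\<^sub>R axis t 1 + s *\<^sub>R axis t 1) \<partial>lborel \<partial>cell)"
      unfolding cellx_def by (subst nn_integral_distr) (auto simp: cell_def)
    also have "... = (\<integral>\<^sup>+z. indicator unit_cell z * (?c t * (\<Prod>i\<in>UNIV. if i = t then 1 else ?b i (z $ i))) \<partial>lborel)"
      unfolding split by (subst nn_integral_cell) (auto simp: nn_integral_multc mult.assoc[symmetric] J)
    also have "... = (\<integral>\<^sup>+z. ?c t * (\<Prod>i\<in>UNIV. ?g i (z $ i)) \<partial>lborel)"
      by (simp add: indicator_unit_cell prod.distrib mult_ac)
    also have "... = ?c t * (\<Prod>i\<in>UNIV. \<integral>\<^sup>+s. ?g i s \<partial>lborel)"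
    proof -
      have gm [measurable]: "?g i \<in> borel_measurable borel" for i by (cases "i = t") auto
      have "(\<lambda>z :: real^'n. \<Prod>i\<in>UNIV. ?g i (z $ i)) \<in> borel_measurable lborel"
        by (intro borel_measurable_prod_ennreal measurable_compose[OF _ gm]) simp
      from nn_integral_cmult[OF this] nn_integral_cart_prod[of ?g, OF gm] show ?thesis by simp
    qed
    also have "(\<Prod>i\<in>UNIV. \<integral>\<^sup>+s. ?g i s \<partial>lborel) = (\<Prod>i\<in>UNIV - {t}. ?c i)"
      by (subst prod.remove[of UNIV t]) auto
    finally show ?thesis by (simp add: L)
  qed
qed

lemma avg_cell_split:
  assumes "1 \<le> p" "U \<in> bLp p"
  shows "AE x in lborel. avg cell U x = avg (cellx t) (avg (seg (axis t 1)) U) x"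
  using avg_mconv[OF bprob_cellx bprob_seg assms, of t "axis t 1"] by (simp only: cell_eq_mconv[of t])

subsection \<open>Synthesis with integer translates of a kernel\<close>

lemma int_vec_measurable [measurable]: "int_vec \<in> borel_measurable (count_space UNIV)"
  by simp

lemma sigma_finite_count: "sigma_finite_measure (count_space (UNIV :: (int^'n::finite) set))"
  by (rule sigma_finite_measure_count_space_countable) simp

definition lp :: "real \<Rightarrow> (int^'n \<Rightarrow> complex) \<Rightarrow> bool" where
  "lp p s \<longleftrightarrow> pint (count_space UNIV) p s < \<infinity>"

text \<open>At a point \<open>x\<close> the numbers \<open>\<kappa> (x - k)\<close> serve as weights
  on the lattice. For \<open>p > 1\<close> Jensen needs their total mass to be 1; for
  \<open>p = 1\<close> unit integral over space is enough. These are the two hypotheses on the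
  generator, in coordinates where the lattice consists of the integer points.\<close>

definition kernel :: "real \<Rightarrow> (real^'n::finite \<Rightarrow> real) \<Rightarrow> bool" where
  "kernel p \<kappa> \<longleftrightarrow> \<kappa> \<in> borel_measurable borel \<and> (\<forall>x. 0 \<le> \<kappa> x) \<and> (\<integral>\<^sup>+x. ennreal (\<kappa> x) \<partial>lborel) = 1 \<and>
     (1 < p \<longrightarrow> (AE x in lborel. (\<integral>\<^sup>+k. ennreal (\<kappa> (x - int_vec k)) \<partial>count_space UNIV) = 1))"

text \<open>An integral over counting measure instead of an infinite sum: Jensen and Fubini then
  apply as they stand.\<close>

definition syn :: "(real^'n::finite \<Rightarrow> real) \<Rightarrow> (int^'n \<Rightarrow> complex) \<Rightarrow> real^'n \<Rightarrow> complex" where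
  "syn \<kappa> s x = (\<integral>k. \<kappa> (x - int_vec k) *\<^sub>R s k \<partial>count_space UNIV)"

lemma kernelD:
  assumes "kernel p \<kappa>"
  shows "\<kappa> \<in> borel_measurable borel" "0 \<le> \<kappa> x" "(\<integral>\<^sup>+x. ennreal (\<kappa> x) \<partial>lborel) = 1"
  using assms by (auto simp: kernel_def)

lemma syn_measurable:
  assumes [measurable]: "\<kappa> \<in> borel_measurable borel"
  shows "syn \<kappa> s \<in> borel_measurable borel"
proof -
  interpret sigma_finite_measure "count_space (UNIV :: (int^'a) set)" by (rule sigma_finite_count)
  have [measurable]: "s \<in> borel_measurable (count_space UNIV)" by simp
  show ?thesis unfolding syn_def by measurable
qed

abbreviation wmeas :: "(real^'n::finite \<Rightarrow> real) \<Rightarrow> real^'n \<Rightarrow> (int^'n) measure" where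
  "wmeas \<kappa> x \<equiv> density (count_space UNIV) (\<lambda>k. ennreal (\<kappa> (x - int_vec k)))"

lemma pint_wmeas: "pint (wmeas \<kappa> x) p s = (\<integral>\<^sup>+k. ennreal (\<kappa> (x - int_vec k)) * ennreal (norm (s k) powr p) \<partial>count_space UNIV)"
  unfolding pint_def by (rule nn_integral_density) auto

lemma nn_integral_kernel_translates:
  assumes \<kappa>: "kernel p \<kappa>"
  shows "(\<integral>\<^sup>+x. (\<integral>\<^sup>+k. ennreal (\<kappa> (x - int_vec k)) * c k \<partial>count_space UNIV) \<partial>lborel) = (\<integral>\<^sup>+k. c k \<partial>count_space UNIV)"
proof -
  interpret pair_sigma_finite lborel "count_space (UNIV :: (int^'a) set)"
    by (simp add: pair_sigma_finite_def sigma_finite_count sigma_finite_lborel)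
  have [measurable]: "\<kappa> \<in> borel_measurable borel" using \<kappa> by (simp add: kernel_def)
  have [measurable]: "c \<in> borel_measurable (count_space UNIV)" by simp
  have "(\<integral>\<^sup>+x. (\<integral>\<^sup>+k. ennreal (\<kappa> (x - int_vec k)) * c k \<partial>count_space UNIV) \<partial>lborel)
      = (\<integral>\<^sup>+k. (\<integral>\<^sup>+x. ennreal (\<kappa> (x - int_vec k)) * c k \<partial>lborel) \<partial>count_space UNIV)"
    by (rule Fubini'[symmetric]) measurable
  also have "... = (\<integral>\<^sup>+k. (\<integral>\<^sup>+x. ennreal (\<kappa> (x - int_vec k)) \<partial>lborel) * c k \<partial>count_space UNIV)"
    by (simp add: nn_integral_multc)
  also have "... = (\<integral>\<^sup>+k. c k \<partial>count_space UNIV)"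
    using nn_integral_lborel_translate[of "\<lambda>x. ennreal (\<kappa> x)" "- int_vec _"] kernelD(3)[OF \<kappa>] by simp
  finally show ?thesis .
qed

lemma wmeas_bound:
  assumes "kernel p \<kappa>" "1 \<le> p"
  shows "AE x in lborel. p = 1 \<or> emeasure (wmeas \<kappa> x) (space (wmeas \<kappa> x)) \<le> 1"
proof (cases "p = 1")
  case False
  then have "AE x in lborel. (\<integral>\<^sup>+k. ennreal (\<kappa> (x - int_vec k)) \<partial>count_space UNIV) = 1"
    using assms by (simp add: kernel_def)
  then show ?thesis by eventually_elim (simp add: emeasure_density)
qed simp

lemma syn_wmeas: "(\<And>x. 0 \<le> \<kappa> x) ==> syn \<kappa> s x = (\<integral>k. s k \<partial>wmeas \<kappa> x)"
  unfolding syn_def by (rule integral_density[symmetric]) auto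

text \<open>Jensen for the weights at each \<open>x\<close>, then integration in \<open>x\<close>,
  where each translate of the kernel has mass 1. This contraction is the norm bound for
  synthesis.\<close>

lemma pint_syn:
  assumes \<kappa>: "kernel p \<kappa>" and p: "1 \<le> p"
  shows "pint lborel p (syn \<kappa> s) \<le> pint (count_space UNIV) p s"
proof -
  have "pint lborel p (syn \<kappa> s) \<le> (\<integral>\<^sup>+x. pint (wmeas \<kappa> x) p s \<partial>lborel)"
    unfolding pint_def[of lborel]
  proof (rule nn_integral_mono_AE)
    show "AE x in lborel. ennreal (norm (syn \<kappa> s x) powr p) \<le> pint (wmeas \<kappa> x) p s"
      using wmeas_bound[OF \<kappa> p]
      by eventually_elim (subst syn_wmeas[OF kernelD(2)[OF \<kappa>]], intro jensen_pint p, auto)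
  qed
  also have "... = pint (count_space UNIV) p s"
    unfolding pint_wmeas nn_integral_kernel_translates[OF \<kappa>] by (simp add: pint_def)
  finally show ?thesis .
qed

lemma bLp_syn: "kernel p \<kappa> ==> 1 \<le> p ==> lp p s ==> syn \<kappa> s \<in> bLp p"
  using pint_syn[of p \<kappa> s] by (auto simp: bLp_def lp_def kernelD syn_measurable elim: le_less_trans)

text \<open>The weighted p-sum of the coefficients has a finite integral in \<open>x\<close>, hence
  is finite almost everywhere.\<close>

lemma AE_syn_integrable:
  assumes \<kappa>: "kernel p \<kappa>" and p: "1 \<le> p" and s: "lp p s"
  shows "AE x in lborel. integrable (count_space UNIV) (\<lambda>k. \<kappa> (x - int_vec k) *\<^sub>R s k)"
proof -
  interpret sigma_finite_measure "count_space (UNIV :: (int^'a) set)" by (rule sigma_finite_count)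
  have [measurable]: "\<kappa> \<in> borel_measurable borel" using \<kappa> by (simp add: kernel_def)
  have [measurable]: "s \<in> borel_measurable (count_space UNIV)" by simp
  have "AE x in lborel. pint (wmeas \<kappa> x) p s \<noteq> \<infinity>"
  proof (rule nn_integral_PInf_AE)
    show "(\<lambda>x. pint (wmeas \<kappa> x) p s) \<in> borel_measurable lborel" unfolding pint_wmeas by measurable
    show "(\<integral>\<^sup>+x. pint (wmeas \<kappa> x) p s \<partial>lborel) \<noteq> \<infinity>"
      unfolding pint_wmeas nn_integral_kernel_translates[OF \<kappa>] using s by (simp add: lp_def pint_def)
  qed
  then show ?thesis using wmeas_bound[OF \<kappa> p]
  proof eventually_elim
    fix x assume fin: "pint (wmeas \<kappa> x) p s \<noteq> \<infinity>" and *: "p = 1 \<or> emeasure (wmeas \<kappa> x) (space (wmeas \<kappa> x)) \<le> 1"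
    have "integrable (wmeas \<kappa> x) s"
    proof (cases "p = 1")
      case True
      then show ?thesis using fin by (intro integrableI_bounded) (auto simp: pint_def less_top)
    next
      case False
      then show ?thesis using fin * by (intro integrable_of_pint[OF _ p]) (auto simp: less_top intro: le_less_trans)
    qed
    then show "integrable (count_space UNIV) (\<lambda>k. \<kappa> (x - int_vec k) *\<^sub>R s k)"
      using kernelD(2)[OF \<kappa>] by (subst (asm) integrable_density) auto
  qed
qed

lemma AE_translate:
  fixes P :: "'a::euclidean_space \<Rightarrow> bool"
  assumes "AE x in lborel. P x" shows "AE x in lborel. P (a + x)"
proof -
  have m: "(+) a \<in> measurable lborel borel" by measurable
  have d: "almost_everywhere (distr lborel borel ((+) a)) P" by (subst lborel_distr_plus) (rule assms)
  show ?thesis by (rule AE_distrD[of "(+) a" lborel borel P, OF m d])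
qed

text \<open>The exceptional set moves with \<open>y\<close>, and \<open>\<mu>\<close> may be
  singular. By Tonelli almost every \<open>x\<close> avoids it for almost every
  \<open>y\<close>.\<close>

lemma AE_translate_bprob:
  assumes \<mu>: "bprob \<mu>" and P: "AE x in lborel. P x"
  shows "AE x in lborel. AE y in \<mu>. P (x - y)"
proof -
  from P obtain N where N: "N \<in> null_sets lborel" "{x \<in> space lborel. \<not> P x} \<subseteq> N"
    unfolding eventually_ae_filter by blast
  have [measurable]: "N \<in> sets borel" using N(1) by auto
  have [measurable_cong]: "sets \<mu> = sets borel" using \<mu> by (rule bprob_sets)
  interpret pair_sigma_finite lborel \<mu> using \<mu> by (rule pair_sigma_finite_lborel)
  have "(\<integral>\<^sup>+x. (\<integral>\<^sup>+y. indicator N (x - y) \<partial>\<mu>) \<partial>lborel) = (\<integral>\<^sup>+y. (\<integral>\<^sup>+x. indicator N (x - y) \<partial>lborel) \<partial>\<mu>)"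
    by (rule Fubini'[symmetric]) measurable
  also have "... = (\<integral>\<^sup>+y. emeasure lborel N \<partial>\<mu>)"
    using nn_integral_lborel_translate[of "indicator N" "- _"] by simp
  also have "... = 0" using N by (simp add: null_setsD1)
  finally have z: "(\<integral>\<^sup>+x. (\<integral>\<^sup>+y. indicator N (x - y) \<partial>\<mu>) \<partial>lborel) = 0" .
  have m: "(\<lambda>x. \<integral>\<^sup>+y. indicator N (x - y) \<partial>\<mu>) \<in> borel_measurable lborel" by measurable
  have "AE x in lborel. (\<integral>\<^sup>+y. indicator N (x - y) \<partial>\<mu>) = 0"
    using z nn_integral_0_iff_AE[OF m] by blast
  then show ?thesis
  proof eventually_elim
    fix x assume z: "(\<integral>\<^sup>+y. indicator N (x - y) \<partial>\<mu>) = 0"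
    have m: "(\<lambda>y. indicator N (x - y) :: ennreal) \<in> borel_measurable \<mu>" by measurable
    have "AE y in \<mu>. (indicator N (x - y) :: ennreal) = 0"
      using z nn_integral_0_iff_AE[OF m] by blast
    then show "AE y in \<mu>. P (x - y)"
      by eventually_elim (use N(2) in \<open>auto split: split_indicator_asm\<close>)
  qed
qed

lemma AE_all_translates:
  fixes P :: "real^'n::finite \<Rightarrow> bool"
  assumes "AE x in lborel. P x" shows "AE x in lborel. \<forall>k. P (x - int_vec k)"
  unfolding AE_all_countable
proof
  fix k show "AE x in lborel. P (x - int_vec k)" using AE_translate[OF assms, of "- int_vec k"] by simp
qed

lemma translate_swap: "x - int_vec k - y = x - y - int_vec k"
  by (simp add: algebra_simps)

definition avgR :: "(real^'n) measure \<Rightarrow> (real^'n \<Rightarrow> real) \<Rightarrow> real^'n \<Rightarrow> real" where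
  "avgR \<mu> \<kappa> x = (\<integral>y. \<kappa> (x - y) \<partial>\<mu>)"

lemma avgR_measurable:
  assumes "bprob \<mu>" and [measurable]: "\<kappa> \<in> borel_measurable borel"
  shows "avgR \<mu> \<kappa> \<in> borel_measurable borel"
proof -
  interpret sigma_finite_measure \<mu> using assms(1) by (rule bprob_sigma_finite)
  have [measurable_cong]: "sets \<mu> = sets borel" using assms(1) by (rule bprob_sets)
  show ?thesis unfolding avgR_def by measurable
qed

lemma nn_integral_avgR:
  assumes \<mu>: "bprob \<mu>" and \<kappa>: "kernel p \<kappa>"
  shows "(\<integral>\<^sup>+x. (\<integral>\<^sup>+y. ennreal (\<kappa> (x - y)) \<partial>\<mu>) \<partial>lborel) = 1"
proof -
  have [measurable]: "\<kappa> \<in> borel_measurable borel" using \<kappa> by (simp add: kernel_def)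
  have [measurable_cong]: "sets \<mu> = sets borel" using \<mu> by (rule bprob_sets)
  interpret pair_sigma_finite lborel \<mu> using \<mu> by (rule pair_sigma_finite_lborel)
  have "(\<integral>\<^sup>+x. (\<integral>\<^sup>+y. ennreal (\<kappa> (x - y)) \<partial>\<mu>) \<partial>lborel) = (\<integral>\<^sup>+y. (\<integral>\<^sup>+x. ennreal (\<kappa> (x - y)) \<partial>lborel) \<partial>\<mu>)"
    by (rule Fubini'[symmetric]) measurable
  also have "... = (\<integral>\<^sup>+y. 1 \<partial>\<mu>)"
    using nn_integral_lborel_translate[of "\<lambda>x. ennreal (\<kappa> x)" "- _"] kernelD(3)[OF \<kappa>] by simp
  also have "... = 1" using \<mu> by (simp add: bprob_space) (simp add: bprob_def)
  finally show ?thesis .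
qed

lemma AE_avgR:
  assumes \<mu>: "bprob \<mu>" and \<kappa>: "kernel p \<kappa>"
  shows "AE x in lborel. integrable \<mu> (\<lambda>y. \<kappa> (x - y)) \<and> ennreal (avgR \<mu> \<kappa> x) = (\<integral>\<^sup>+y. ennreal (\<kappa> (x - y)) \<partial>\<mu>)"
proof -
  have [measurable]: "\<kappa> \<in> borel_measurable borel" using \<kappa> by (simp add: kernel_def)
  have [measurable_cong]: "sets \<mu> = sets borel" using \<mu> by (rule bprob_sets)
  interpret sigma_finite_measure \<mu> using \<mu> by (rule bprob_sigma_finite)
  have "AE x in lborel. (\<integral>\<^sup>+y. ennreal (\<kappa> (x - y)) \<partial>\<mu>) \<noteq> \<infinity>"
  proof (rule nn_integral_PInf_AE)
    show "(\<lambda>x. \<integral>\<^sup>+y. ennreal (\<kappa> (x - y)) \<partial>\<mu>) \<in> borel_measurable lborel" by measurable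
    show "(\<integral>\<^sup>+x. (\<integral>\<^sup>+y. ennreal (\<kappa> (x - y)) \<partial>\<mu>) \<partial>lborel) \<noteq> \<infinity>"
      unfolding nn_integral_avgR[OF assms] by simp
  qed
  then show ?thesis
  proof eventually_elim
    fix x assume fin: "(\<integral>\<^sup>+y. ennreal (\<kappa> (x - y)) \<partial>\<mu>) \<noteq> \<infinity>"
    have int: "integrable \<mu> (\<lambda>y. \<kappa> (x - y))"
      by (rule integrableI_nonneg) (use fin kernelD(2)[OF \<kappa>] in \<open>auto simp: less_top\<close>)
    moreover have "(\<integral>\<^sup>+y. ennreal (\<kappa> (x - y)) \<partial>\<mu>) = ennreal (\<integral>y. \<kappa> (x - y) \<partial>\<mu>)"
      by (rule nn_integral_eq_integral[OF int]) (use kernelD(2)[OF \<kappa>] in auto)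
    ultimately show "integrable \<mu> (\<lambda>y. \<kappa> (x - y)) \<and> ennreal (avgR \<mu> \<kappa> x) = (\<integral>\<^sup>+y. ennreal (\<kappa> (x - y)) \<partial>\<mu>)"
      by (simp add: avgR_def)
  qed
qed

lemma pair_sigma_finite_count: "bprob \<mu> ==> pair_sigma_finite \<mu> (count_space (UNIV :: (int^'n::finite) set))"
  by (simp add: pair_sigma_finite_def bprob_sigma_finite sigma_finite_count)

text \<open>Averages keep the mass, and the lattice sum of an average is the average of the lattice
  sums.\<close>

lemma kernel_avgR:
  assumes \<mu>: "bprob \<mu>" and \<kappa>: "kernel p \<kappa>"
  shows "kernel p (avgR \<mu> \<kappa>)"
  unfolding kernel_def
proof (intro conjI impI allI)
  have [measurable]: "\<kappa> \<in> borel_measurable borel" using \<kappa> by (simp add: kernel_def)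
  have [measurable_cong]: "sets \<mu> = sets borel" using \<mu> by (rule bprob_sets)
  show "avgR \<mu> \<kappa> \<in> borel_measurable borel" using \<mu> by (rule avgR_measurable) measurable
  show "0 \<le> avgR \<mu> \<kappa> x" for x
    unfolding avgR_def by (rule Bochner_Integration.integral_nonneg) (simp add: kernelD(2)[OF \<kappa>])
  have "(\<integral>\<^sup>+x. ennreal (avgR \<mu> \<kappa> x) \<partial>lborel) = (\<integral>\<^sup>+x. (\<integral>\<^sup>+y. ennreal (\<kappa> (x - y)) \<partial>\<mu>) \<partial>lborel)"
    by (rule nn_integral_cong_AE) (use AE_avgR[OF assms] in eventually_elim, simp)
  then show "(\<integral>\<^sup>+x. ennreal (avgR \<mu> \<kappa> x) \<partial>lborel) = 1" by (simp add: nn_integral_avgR[OF assms])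
  assume p: "1 < p"
  then have "AE x in lborel. (\<integral>\<^sup>+k. ennreal (\<kappa> (x - int_vec k)) \<partial>count_space UNIV) = 1"
    using \<kappa> by (simp add: kernel_def)
  from AE_translate_bprob[OF \<mu> this] AE_all_translates[OF AE_avgR[OF assms]]
  show "AE x in lborel. (\<integral>\<^sup>+k. ennreal (avgR \<mu> \<kappa> (x - int_vec k)) \<partial>count_space UNIV) = 1"
  proof eventually_elim
    fix x
    assume one: "AE y in \<mu>. (\<integral>\<^sup>+k. ennreal (\<kappa> (x - y - int_vec k)) \<partial>count_space UNIV) = 1"
      and eq: "\<forall>k. integrable \<mu> (\<lambda>y. \<kappa> (x - int_vec k - y)) \<and>
        ennreal (avgR \<mu> \<kappa> (x - int_vec k)) = (\<integral>\<^sup>+y. ennreal (\<kappa> (x - int_vec k - y)) \<partial>\<mu>)"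
    interpret pair_sigma_finite \<mu> "count_space (UNIV :: (int^'a) set)" using \<mu> by (rule pair_sigma_finite_count)
    have "(\<integral>\<^sup>+k. ennreal (avgR \<mu> \<kappa> (x - int_vec k)) \<partial>count_space UNIV)
        = (\<integral>\<^sup>+k. (\<integral>\<^sup>+y. ennreal (\<kappa> (x - y - int_vec k)) \<partial>\<mu>) \<partial>count_space UNIV)"
      using eq by (simp add: translate_swap)
    also have "... = (\<integral>\<^sup>+y. (\<integral>\<^sup>+k. ennreal (\<kappa> (x - y - int_vec k)) \<partial>count_space UNIV) \<partial>\<mu>)"
      by (rule Fubini') measurable
    also have "... = (\<integral>\<^sup>+y. 1 \<partial>\<mu>)" by (rule nn_integral_cong_AE[OF one])
    also have "... = 1" using \<mu> by (simp add: bprob_space) (simp add: bprob_def)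
    finally show "(\<integral>\<^sup>+k. ennreal (avgR \<mu> \<kappa> (x - int_vec k)) \<partial>count_space UNIV) = 1" .
  qed
qed

lemma syn_avgR:
  assumes \<mu>: "bprob \<mu>" and \<kappa>: "kernel p \<kappa>" and p: "1 \<le> p" and s: "lp p s"
  shows "AE x in lborel. syn (avgR \<mu> \<kappa>) s x = avg \<mu> (syn \<kappa> s) x"
proof -
  \<comment> \<open>Synthesis from the absolute values of the coefficients dominates; its average is
    finite almost everywhere, which is what Fubini asks for.\<close>
  let ?s = "\<lambda>k. complex_of_real (norm (s k))"
  have s': "lp p ?s" using s by (simp add: lp_def pint_def)
  have [measurable]: "\<kappa> \<in> borel_measurable borel" using \<kappa> by (simp add: kernel_def)
  have [measurable_cong]: "sets \<mu> = sets borel" using \<mu> by (rule bprob_sets)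
  have [measurable]: "s \<in> borel_measurable (count_space UNIV)" by simp
  interpret pair_sigma_finite \<mu> "count_space (UNIV :: (int^'a) set)" using \<mu> by (rule pair_sigma_finite_count)
  show ?thesis
    using AE_translate_bprob[OF \<mu> AE_syn_integrable[OF \<kappa> p s]] AE_avg_integrable[OF \<mu> bLp_syn[OF \<kappa> p s'] p]
      AE_all_translates[OF AE_avgR[OF \<mu> \<kappa>]]
  proof eventually_elim
    fix x
    assume 1: "AE y in \<mu>. integrable (count_space UNIV) (\<lambda>k. \<kappa> (x - y - int_vec k) *\<^sub>R s k)"
      and 2: "integrable \<mu> (\<lambda>y. syn \<kappa> ?s (x - y))"
      and 3: "\<forall>k. integrable \<mu> (\<lambda>y. \<kappa> (x - int_vec k - y)) \<and>
        ennreal (avgR \<mu> \<kappa> (x - int_vec k)) = (\<integral>\<^sup>+y. ennreal (\<kappa> (x - int_vec k - y)) \<partial>\<mu>)"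
    have n: "(\<integral>k. norm (\<kappa> (x - y - int_vec k) *\<^sub>R s k) \<partial>count_space UNIV) = norm (syn \<kappa> ?s (x - y))" for y
    proof -
      have "syn \<kappa> ?s (x - y) = (\<integral>k. complex_of_real (norm (\<kappa> (x - y - int_vec k) *\<^sub>R s k)) \<partial>count_space UNIV)"
        unfolding syn_def
        by (intro Bochner_Integration.integral_cong refl) (simp add: kernelD(2)[OF \<kappa>] scaleR_conv_of_real norm_mult)
      also have "... = complex_of_real (\<integral>k. norm (\<kappa> (x - y - int_vec k) *\<^sub>R s k) \<partial>count_space UNIV)"
        by (rule integral_complex_of_real)
      finally show ?thesis by simp
    qed
    have F: "integrable (\<mu> \<Otimes>\<^sub>M count_space UNIV) (\<lambda>(y, k). \<kappa> (x - y - int_vec k) *\<^sub>R s k)"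
    proof (rule Fubini_integrable)
      show "integrable \<mu> (\<lambda>y. \<integral>k. norm (case (y, k) of (y, k) \<Rightarrow> \<kappa> (x - y - int_vec k) *\<^sub>R s k) \<partial>count_space UNIV)"
        using integrable_norm[OF 2] unfolding prod.case n .
      show "AE y in \<mu>. integrable (count_space UNIV) (\<lambda>k. case (y, k) of (y, k) \<Rightarrow> \<kappa> (x - y - int_vec k) *\<^sub>R s k)"
        using 1 by simp
    qed measurable
    have "syn (avgR \<mu> \<kappa>) s x = (\<integral>k. (\<integral>y. \<kappa> (x - y - int_vec k) *\<^sub>R s k \<partial>\<mu>) \<partial>count_space UNIV)"
      unfolding syn_def avgR_def using 3
      by (intro Bochner_Integration.integral_cong refl) (simp add: translate_swap)
    also have "... = (\<integral>y. (\<integral>k. \<kappa> (x - y - int_vec k) *\<^sub>R s k \<partial>count_space UNIV) \<partial>\<mu>)"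
      by (rule Fubini_integral[OF F])
    finally show "syn (avgR \<mu> \<kappa>) s x = avg \<mu> (syn \<kappa> s) x" by (simp add: avg_def syn_def)
  qed
qed

lemma int_vec_add: "int_vec (k + l) = int_vec k + int_vec l"
  by (simp add: int_vec_def vec_eq_iff)

lemma int_vec_axis: "int_vec (axis t 1) = axis t 1"
  by (simp add: int_vec_def vec_eq_iff axis_def)

lemma integral_count_shift:
  fixes F :: "int^'n::finite \<Rightarrow> 'b::{banach, second_countable_topology}"
  shows "(\<integral>k. F (k + a) \<partial>count_space UNIV) = (\<integral>k. F k \<partial>count_space UNIV)"
proof -
  have "bij_betw (\<lambda>k. k + a) UNIV (UNIV :: (int^'n) set)" by (rule bij_betwI[of _ _ _ "\<lambda>k. k - a"]) auto
  from integral_bij_count_space[OF this, of F] show ?thesis .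
qed

lemma nn_integral_count_shift:
  fixes F :: "int^'n::finite \<Rightarrow> ennreal"
  shows "(\<integral>\<^sup>+k. F (k + a) \<partial>count_space UNIV) = (\<integral>\<^sup>+k. F k \<partial>count_space UNIV)"
proof -
  have "bij_betw (\<lambda>k. k + a) UNIV (UNIV :: (int^'n) set)" by (rule bij_betwI[of _ _ _ "\<lambda>k. k - a"]) auto
  from nn_integral_bij_count_space[OF this, of F] show ?thesis .
qed

lemma lp_diff_op:
  assumes "1 \<le> p" "lp p s" shows "lp p (diff_op t s)"
proof -
  let ?s = "\<lambda>k. s (k - axis t 1)"
  have "pint (count_space UNIV) p ?s = pint (count_space UNIV) p s"
    unfolding pint_def using nn_integral_count_shift[of "\<lambda>k. ennreal (norm (s k) powr p)" "- axis t 1"] by simp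
  moreover have "pint (count_space UNIV) p (\<lambda>k. - 1 * ?s k) = pint (count_space UNIV) p ?s"
    by (simp add: pint_def)
  moreover have "pint (count_space UNIV) p (\<lambda>k. s k + - 1 * ?s k)
      \<le> ennreal (2 powr p) * (pint (count_space UNIV) p s + pint (count_space UNIV) p (\<lambda>k. - 1 * ?s k))"
    using assms by (intro pint_add_le) auto
  moreover have "diff_op t s = (\<lambda>k. s k + - 1 * ?s k)" by (auto simp: diff_op_def)
  ultimately show ?thesis
    using assms(2) by (auto simp: lp_def ennreal_mult_less_top elim!: le_less_trans)
qed

lemma syn_shift: "syn \<kappa> (\<lambda>k. s (k - axis t 1)) x = syn \<kappa> s (x - axis t 1)"
  unfolding syn_def
  by (subst integral_count_shift[where a = "axis t 1", symmetric]) (simp add: int_vec_add int_vec_axis algebra_simps)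

lemma syn_diff_op:
  assumes \<kappa>: "kernel p \<kappa>" and p: "1 \<le> p" and s: "lp p s"
  shows "AE x in lborel. syn \<kappa> (diff_op t s) x = syn \<kappa> s x - syn \<kappa> s (x - axis t 1)"
proof -
  have "lp p (\<lambda>k. s (k - axis t 1))"
    using s nn_integral_count_shift[of "\<lambda>k. ennreal (norm (s k) powr p)" "- axis t 1"] by (simp add: lp_def pint_def)
  from AE_syn_integrable[OF \<kappa> p s] AE_syn_integrable[OF \<kappa> p this] show ?thesis
  proof eventually_elim
    fix x
    assume i: "integrable (count_space UNIV) (\<lambda>k. \<kappa> (x - int_vec k) *\<^sub>R s k)"
      "integrable (count_space UNIV) (\<lambda>k. \<kappa> (x - int_vec k) *\<^sub>R s (k - axis t 1))"
    have "syn \<kappa> (diff_op t s) x = syn \<kappa> s x - syn \<kappa> (\<lambda>k. s (k - axis t 1)) x"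
      unfolding syn_def diff_op_def using i by (simp add: scaleR_diff_right)
    then show "syn \<kappa> (diff_op t s) x = syn \<kappa> s x - syn \<kappa> s (x - axis t 1)" by (simp add: syn_shift)
  qed
qed

text \<open>Regularity is stated for the synthesized functions; \<open>\<kappa>\<close> itself is
  never differentiated. The kernel changes with each derivative, as the derivative of a spline is a
  difference of splines of lower order. The new kernel depends on the direction but not on the
  coefficients.\<close>

primrec reg :: "real \<Rightarrow> nat \<Rightarrow> (real^'n::finite \<Rightarrow> real) \<Rightarrow> bool" where
  "reg p 0 \<kappa> \<longleftrightarrow> kernel p \<kappa>"
| "reg p (Suc n) \<kappa> \<longleftrightarrow> kernel p \<kappa> \<and>
     (\<forall>t. \<exists>\<kappa>'. reg p n \<kappa>' \<and> (\<forall>s. lp p s \<longrightarrow> has_weak_deriv (unit_mi t) (syn \<kappa> s) (syn \<kappa>' (diff_op t s))))"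

lemma reg_kernel: "reg p n \<kappa> ==> kernel p \<kappa>"
  by (cases n) auto

text \<open>An average commutes with synthesis and with weak derivatives, so it can be applied to
  \<open>\<kappa>\<close> and to each derived kernel alike.\<close>

lemma reg_avgR:
  assumes \<mu>: "bprob \<mu>" and p: "1 \<le> p"
  shows "reg p n \<kappa> ==> reg p n (avgR \<mu> \<kappa>)"
proof (induction n arbitrary: \<kappa>)
  case (Suc n)
  have \<kappa>: "kernel p \<kappa>" using Suc.prems by simp
  have "\<exists>\<kappa>'. reg p n \<kappa>' \<and> (\<forall>s. lp p s \<longrightarrow> has_weak_deriv (unit_mi t) (syn (avgR \<mu> \<kappa>) s) (syn \<kappa>' (diff_op t s)))" for t
  proof -
    obtain \<kappa>' where \<kappa>': "reg p n \<kappa>'"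
      and wd: "\<And>s. lp p s ==> has_weak_deriv (unit_mi t) (syn \<kappa> s) (syn \<kappa>' (diff_op t s))"
      using Suc.prems by auto
    have "has_weak_deriv (unit_mi t) (syn (avgR \<mu> \<kappa>) s) (syn (avgR \<mu> \<kappa>') (diff_op t s))" if s: "lp p s" for s
    proof (rule has_weak_deriv_cong_AE)
      show "has_weak_deriv (unit_mi t) (avg \<mu> (syn \<kappa> s)) (avg \<mu> (syn \<kappa>' (diff_op t s)))"
        by (rule has_weak_deriv_avg[OF \<mu> p bLp_syn[OF \<kappa> p s] bLp_syn[OF reg_kernel[OF \<kappa>'] p lp_diff_op[OF p s]] wd[OF s]])
      show "AE x in lebesgue. syn (avgR \<mu> \<kappa>) s x = avg \<mu> (syn \<kappa> s) x"
        by (rule AE_completion[OF syn_avgR[OF \<mu> \<kappa> p s]])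
      show "AE x in lebesgue. syn (avgR \<mu> \<kappa>') (diff_op t s) x = avg \<mu> (syn \<kappa>' (diff_op t s)) x"
        by (rule AE_completion[OF syn_avgR[OF \<mu> reg_kernel[OF \<kappa>'] p lp_diff_op[OF p s]]])
    qed
    then show ?thesis using Suc.IH[OF \<kappa>'] by blast
  qed
  then show ?case using kernel_avgR[OF \<mu> \<kappa>] by simp
qed (simp add: kernel_avgR[OF \<mu>])

text \<open>The cell is split into edge and face in direction \<open>t\<close>. The edge is spent on
  turning the derivative into a difference, the face stays in the new kernel.\<close>

lemma reg_cell:
  assumes p: "1 \<le> p" and r: "reg p n \<kappa>"
  shows "reg p (Suc n) (avgR cell \<kappa>)"
proof -
  have \<kappa>: "kernel p \<kappa>" using r by (rule reg_kernel)
  have "reg p n (avgR (cellx t) \<kappa>) \<and>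
      (\<forall>s. lp p s \<longrightarrow> has_weak_deriv (unit_mi t) (syn (avgR cell \<kappa>) s) (syn (avgR (cellx t) \<kappa>) (diff_op t s)))" for t
  proof (intro conjI allI impI)
    show "reg p n (avgR (cellx t) \<kappa>)" by (rule reg_avgR[OF bprob_cellx p r])
    fix s assume s: "lp p (s :: int^'a \<Rightarrow> complex)"
    let ?U = "syn \<kappa> s" and ?G = "\<lambda>x. syn \<kappa> s x - syn \<kappa> s (x - axis t 1)"
    have U: "?U \<in> bLp p" by (rule bLp_syn[OF \<kappa> p s])
    have G: "?G \<in> bLp p" by (rule bLp_diff[OF p U bLp_translate[OF U]])
    have D: "syn \<kappa> (diff_op t s) \<in> bLp p" by (rule bLp_syn[OF \<kappa> p lp_diff_op[OF p s]])
    have e1: "AE x in lborel. syn (avgR cell \<kappa>) s x = avg (cellx t) (avg (seg (axis t 1)) ?U) x"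
      using syn_avgR[OF bprob_cell \<kappa> p s] avg_cell_split[OF p U] by eventually_elim simp
    have e2: "AE x in lborel. syn (avgR (cellx t) \<kappa>) (diff_op t s) x = avg (cellx t) ?G x"
      using syn_avgR[OF bprob_cellx[of t] \<kappa> p lp_diff_op[OF p s, of t]]
        avg_cong_AE[OF bprob_cellx[of t] bLp_measurable[OF D] bLp_measurable[OF G] syn_diff_op[OF \<kappa> p s]]
      by eventually_elim simp
    show "has_weak_deriv (unit_mi t) (syn (avgR cell \<kappa>) s) (syn (avgR (cellx t) \<kappa>) (diff_op t s))"
      by (rule has_weak_deriv_cong_AE[OF has_weak_deriv_avg[OF bprob_cellx p bLp_avg[OF bprob_seg p U] G
              has_weak_deriv_avg_seg[OF p U]] AE_completion[OF e1] AE_completion[OF e2]])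
  qed
  then show ?thesis unfolding reg.simps using kernel_avgR[OF bprob_cell \<kappa>] by blast
qed

lemma diff_op_commute: "diff_op i (diff_op j s) = diff_op j (diff_op i s)"
  by (simp add: diff_op_def fun_eq_iff algebra_simps)

lemma multi_op_diff_op_inc: "multi_op diff_op (inc t \<rho>) s = diff_op t (multi_op diff_op \<rho> s)"
  by (rule multi_op_inc'[of UNIV]) (simp_all add: diff_op_commute)

lemma lp_multi_op: "1 \<le> p ==> lp p s ==> lp p (multi_op diff_op \<rho> s)"
  by (induction \<rho> rule: multiindex_induct) (simp_all add: multi_op_diff_op_inc lp_diff_op del: fun_upd_apply)

text \<open>Every derivative uses up one cell average, hence the remaining order
  \<open>n - mdeg \<rho>\<close>; with \<open>m\<close> averages all derivatives up to order
  \<open>m\<close> are reached.\<close>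

lemma reg_has_weak_deriv:
  fixes \<kappa> :: "real^'n::finite \<Rightarrow> real"
  assumes p: "1 \<le> p" and r: "reg p n \<kappa>"
  shows "mdeg \<rho> \<le> n ==> \<exists>\<kappa>'. reg p (n - mdeg \<rho>) \<kappa>' \<and>
    (\<forall>s. lp p s \<longrightarrow> has_weak_deriv \<rho> (syn \<kappa> s) (syn \<kappa>' (multi_op diff_op \<rho> s)))"
proof (induction \<rho> rule: multiindex_induct)
  case zero
  have "has_weak_deriv (\<lambda>_. 0) (syn \<kappa> s) (syn \<kappa> s)" if "lp p s" for s
    by (intro has_weak_deriv_zero Lp_locally_integrable[OF p] bLp_Lp bLp_syn[OF reg_kernel[OF r] p that])
  then show ?case using r by (intro exI[of _ \<kappa>]) simp
next
  case (inc \<rho> t)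
  have le: "mdeg \<rho> < n" using inc.prems by (simp del: fun_upd_apply)
  obtain \<kappa>1 where 1: "reg p (n - mdeg \<rho>) \<kappa>1"
    "\<And>s. lp p s ==> has_weak_deriv \<rho> (syn \<kappa> s) (syn \<kappa>1 (multi_op diff_op \<rho> s))"
    using inc.IH le by auto
  have "n - mdeg \<rho> = Suc (n - mdeg (inc t \<rho>))" using le by (simp del: fun_upd_apply)
  with 1(1) obtain \<kappa>2 where 2: "reg p (n - mdeg (inc t \<rho>)) \<kappa>2"
    "\<And>s. lp p s ==> has_weak_deriv (unit_mi t) (syn \<kappa>1 s) (syn \<kappa>2 (diff_op t s))"
    by (auto simp del: fun_upd_apply mdeg_inc)
  have "has_weak_deriv (inc t \<rho>) (syn \<kappa> s) (syn \<kappa>2 (multi_op diff_op (inc t \<rho>) s))" if s: "lp p s" for s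
    unfolding multi_op_diff_op_inc
    by (rule has_weak_deriv_inc[OF 1(2)[OF s] 2(2)[OF lp_multi_op[OF p s]]])
  then show ?case using 2(1) by blast
qed

section \<open>Dilation, tiling and sampling by cell means\<close>

lemma nn_integral_dilate:
  fixes F :: "real^'n::finite \<Rightarrow> ennreal"
  assumes [measurable]: "F \<in> borel_measurable borel" and "\<alpha> \<noteq> 0"
  shows "(\<integral>\<^sup>+x. F x \<partial>lborel) = ennreal (\<bar>\<alpha>\<bar> ^ CARD('n)) * (\<integral>\<^sup>+x. F (\<alpha> *\<^sub>R x) \<partial>lborel)"
proof -
  have "(\<integral>\<^sup>+x. F x \<partial>lborel) = (\<integral>\<^sup>+x. F x \<partial>density (distr lborel borel (\<lambda>x :: real^'n. 0 + \<alpha> *\<^sub>R x)) (\<lambda>_. ennreal (\<bar>\<alpha>\<bar> ^ DIM(real^'n))))"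
    using lborel_affine[OF assms(2), of "0 :: real^'n"] by simp
  also have "... = ennreal (\<bar>\<alpha>\<bar> ^ CARD('n)) * (\<integral>\<^sup>+x. F (\<alpha> *\<^sub>R x) \<partial>lborel)"
    by (subst nn_integral_density) (auto simp: nn_integral_distr nn_integral_cmult)
  finally show ?thesis .
qed

lemma pint_dilate:
  fixes U :: "real^'n::finite \<Rightarrow> complex"
  assumes [measurable]: "U \<in> borel_measurable borel" and "\<alpha> \<noteq> 0"
  shows "pint lborel p U = ennreal (\<bar>\<alpha>\<bar> ^ CARD('n)) * pint lborel p (\<lambda>x. U (\<alpha> *\<^sub>R x))"
  unfolding pint_def using assms(2) by (intro nn_integral_dilate) auto

lemma AE_dilate:
  fixes P :: "real^'n::finite \<Rightarrow> bool"
  assumes P: "AE x in lborel. P x" and \<alpha>: "\<alpha> \<noteq> 0"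
  shows "AE x in lborel. P (\<alpha> *\<^sub>R x)"
proof -
  from P obtain N where N: "N \<in> null_sets lborel" "{x \<in> space lborel. \<not> P x} \<subseteq> N"
    unfolding eventually_ae_filter by blast
  have [measurable]: "N \<in> sets borel" using N(1) by auto
  have "ennreal (\<bar>\<alpha>\<bar> ^ CARD('n)) * (\<integral>\<^sup>+x. indicator N (\<alpha> *\<^sub>R x) \<partial>lborel) = (\<integral>\<^sup>+x. indicator N x \<partial>lborel)"
    by (rule nn_integral_dilate[symmetric]) (use \<alpha> in auto)
  also have "... = 0" using N(1) by (simp add: null_setsD1)
  finally have "(\<integral>\<^sup>+x. indicator N (\<alpha> *\<^sub>R x) \<partial>(lborel :: (real^'n) measure)) = 0" using \<alpha> by simp
  moreover have m: "(\<lambda>x. indicator N (\<alpha> *\<^sub>R x) :: ennreal) \<in> borel_measurable lborel" by measurable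
  ultimately have "AE x in lborel. (indicator N (\<alpha> *\<^sub>R x) :: ennreal) = 0"
    using nn_integral_0_iff_AE[OF m] by blast
  then show ?thesis
    by eventually_elim (use N(2) in \<open>auto split: split_indicator_asm\<close>)
qed

lemma tile_indicator:
  fixes x :: "real^'n::finite"
  shows "(\<integral>\<^sup>+k. indicator unit_cell (x - int_vec k) \<partial>count_space UNIV) = 1"
proof -
  define k0 :: "int^'n" where "k0 = (\<chi> i. \<lfloor>x $ i\<rfloor>)"
  have iff: "x - int_vec k \<in> unit_cell \<longleftrightarrow> k = k0" for k
  proof -
    have "0 \<le> x $ i - real_of_int (k $ i) \<and> x $ i - real_of_int (k $ i) < 1 \<longleftrightarrow> k $ i = \<lfloor>x $ i\<rfloor>" for i
      by (auto simp: floor_unique algebra_simps eq_commute[of _ "\<lfloor>_\<rfloor>"]) linarith+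
    then show ?thesis by (auto simp: unit_cell_def int_vec_def k0_def vec_eq_iff)
  qed
  have "(indicator unit_cell (x - int_vec k) :: ennreal) = indicator {k0} k" for k
    by (simp add: indicator_def iff)
  then show ?thesis by simp
qed

lemma nn_integral_tile:
  fixes F :: "real^'n::finite \<Rightarrow> ennreal"
  assumes [measurable]: "F \<in> borel_measurable borel"
  shows "(\<integral>\<^sup>+k. (\<integral>\<^sup>+y. F (int_vec k + y) \<partial>cell) \<partial>count_space UNIV) = (\<integral>\<^sup>+x. F x \<partial>lborel)"
proof -
  interpret pair_sigma_finite lborel "count_space (UNIV :: (int^'n) set)"
    by (simp add: pair_sigma_finite_def sigma_finite_count sigma_finite_lborel)
  have "(\<integral>\<^sup>+y. F (int_vec k + y) \<partial>cell) = (\<integral>\<^sup>+x. indicator unit_cell (x - int_vec k) * F x \<partial>lborel)" for k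
    using nn_integral_lborel_translate[of "\<lambda>x. indicator unit_cell (x - int_vec k) * F x" "int_vec k"]
    by (simp add: nn_integral_cell add.commute)
  then have "(\<integral>\<^sup>+k. (\<integral>\<^sup>+y. F (int_vec k + y) \<partial>cell) \<partial>count_space UNIV)
      = (\<integral>\<^sup>+x. (\<integral>\<^sup>+k. indicator unit_cell (x - int_vec k) * F x \<partial>count_space UNIV) \<partial>lborel)"
    by (simp, intro Fubini') measurable
  also have "... = (\<integral>\<^sup>+x. F x \<partial>lborel)"
    by (subst nn_integral_multc) (auto simp: tile_indicator)
  finally show ?thesis .
qed

text \<open>With this kernel, sampling followed by synthesis averages over the cells of a grid. It
  is the auxiliary operator behind the Riemann-Lebesgue lemma.\<close>

lemma kernel_unit_cell: "kernel p (indicator unit_cell)"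
proof -
  have "(\<integral>\<^sup>+x. ennreal (indicator unit_cell x) \<partial>(lborel :: (real^'a) measure)) = 1"
    by (simp add: ennreal_indicator emeasure_unit_cell)
  moreover have "(\<integral>\<^sup>+k. ennreal (indicator unit_cell (x - int_vec k)) \<partial>count_space UNIV) = 1" for x :: "real^'a"
    by (simp only: ennreal_indicator tile_indicator)
  ultimately show ?thesis by (auto simp: kernel_def)
qed

text \<open>The mean of \<open>g\<close> over the image of \<open>k\<close> plus the unit cell under
  \<open>inverse \<alpha>\<close>. Means over cells, unlike point values, make sense in L^p and
  satisfy Jensen's inequality.\<close>

definition smp :: "real \<Rightarrow> (real^'n::finite \<Rightarrow> complex) \<Rightarrow> int^'n \<Rightarrow> complex" where
  "smp \<alpha> g k = (\<integral>y. g (inverse \<alpha> *\<^sub>R (int_vec k + y)) \<partial>cell)"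

lemma cell_sets [measurable_cong]: "sets cell = sets borel" by (simp add: cell_def)

lemma cell_UNIV [simp]: "space cell = UNIV" "emeasure cell UNIV = 1"
  using bprob_space[OF bprob_cell] bprob_cell unfolding bprob_def by blast+

text \<open>Jensen on each cell; the cells tile the space. The factor is the number of cells per
  unit volume.\<close>

lemma pint_smp:
  fixes g :: "real^'n::finite \<Rightarrow> complex"
  assumes \<alpha>: "\<alpha> \<noteq> 0" and p: "1 \<le> p" and g [measurable]: "g \<in> borel_measurable borel"
  shows "pint (count_space UNIV) p (smp \<alpha> g) \<le> ennreal (\<bar>\<alpha>\<bar> ^ CARD('n)) * pint lborel p g"
proof -
  let ?G = "\<lambda>z. g (inverse \<alpha> *\<^sub>R z)"
  have "pint (count_space UNIV) p (smp \<alpha> g) \<le> (\<integral>\<^sup>+k. pint cell p (\<lambda>y. ?G (int_vec k + y)) \<partial>count_space UNIV)"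
    unfolding pint_def[of "count_space UNIV"] smp_def
  proof (rule nn_integral_mono, rule jensen_pint[OF _ p])
    show "(\<lambda>y. ?G (int_vec k + y)) \<in> borel_measurable cell" for k :: "int^'n" by measurable
    show "p = 1 \<or> emeasure (cell :: (real^'n) measure) (space cell) \<le> 1"
      by simp
  qed
  also have "... = pint lborel p ?G" unfolding pint_def by (rule nn_integral_tile) measurable
  also have "... = ennreal (\<bar>\<alpha>\<bar> ^ CARD('n)) * pint lborel p (\<lambda>x. ?G (\<alpha> *\<^sub>R x))"
    using \<alpha> by (intro pint_dilate) auto
  finally show ?thesis using \<alpha> by simp
qed

lemma lp_smp: "\<alpha> \<noteq> 0 ==> 1 \<le> p ==> g \<in> bLp p ==> lp p (smp \<alpha> g)"
  using pint_smp[of \<alpha> p g] by (auto simp: lp_def bLp_def ennreal_mult_less_top elim!: le_less_trans)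

lemma smp_integrable:
  fixes g :: "real^'n::finite \<Rightarrow> complex"
  assumes \<alpha>: "\<alpha> \<noteq> 0" and p: "1 \<le> p" and g: "g \<in> bLp p"
  shows "integrable cell (\<lambda>y. g (inverse \<alpha> *\<^sub>R (int_vec k + y)))"
proof (rule integrable_of_pint[OF _ p])
  have [measurable]: "g \<in> borel_measurable borel" using g by (simp add: bLp_def)
  show "(\<lambda>y. g (inverse \<alpha> *\<^sub>R (int_vec k + y))) \<in> borel_measurable cell" by measurable
  let ?G = "\<lambda>z. g (inverse \<alpha> *\<^sub>R z)"
  have "pint cell p (\<lambda>y. ?G (int_vec k + y)) \<le> pint lborel p (\<lambda>y. ?G (y - - int_vec k))"
    unfolding pint_def by (subst nn_integral_cell)
      (auto simp: add.commute intro!: nn_integral_mono split: split_indicator)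
  also have "... = pint lborel p ?G" by (rule pint_translate) measurable
  also have "... = ennreal (\<bar>\<alpha>\<bar> ^ CARD('n)) * pint lborel p g"
    using \<alpha> pint_dilate[of ?G \<alpha> p] by simp
  also have "... < \<infinity>" using g by (simp add: bLp_def ennreal_mult_less_top)
  finally show "pint cell p (\<lambda>y. ?G (int_vec k + y)) < \<infinity>" .
  show "emeasure (cell :: (real^'n) measure) (space cell) < \<infinity>"
    by simp
qed

lemma smp_diff:
  assumes "\<alpha> \<noteq> 0" "1 \<le> p" "g \<in> bLp p" "h \<in> bLp p"
  shows "smp \<alpha> (\<lambda>x. g x - h x) k = smp \<alpha> g k - smp \<alpha> h k"
  unfolding smp_def using assms by (intro Bochner_Integration.integral_diff smp_integrable)

lemma smp_cmult: "smp \<alpha> (\<lambda>x. c * g x) k = c * smp \<alpha> g k"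
  unfolding smp_def by simp

text \<open>The step is the spacing of the fine lattice, so that a unit shift of the index in the
  samples is this translation of the function.\<close>

definition dlt :: "real \<Rightarrow> 'n \<Rightarrow> (real^'n::finite \<Rightarrow> complex) \<Rightarrow> real^'n \<Rightarrow> complex" where
  "dlt \<alpha> t g x = g x - g (x - inverse \<alpha> *\<^sub>R axis t 1)"

lemma bLp_dlt: "1 \<le> p ==> g \<in> bLp p ==> dlt \<alpha> t g \<in> bLp p"
  unfolding dlt_def by (intro bLp_diff bLp_translate)

lemma multi_op_dlt_inc: "multi_op (dlt \<alpha>) (inc t \<rho>) g = dlt \<alpha> t (multi_op (dlt \<alpha>) \<rho> g)"
  by (rule multi_op_inc'[of UNIV]) (simp_all add: dlt_def fun_eq_iff algebra_simps)

lemma bLp_multi_dlt: "1 \<le> p ==> g \<in> bLp p ==> multi_op (dlt \<alpha>) \<rho> g \<in> bLp p"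
  by (induction \<rho> rule: multiindex_induct) (simp_all add: multi_op_dlt_inc bLp_dlt del: fun_upd_apply)

lemma diff_op_smp:
  assumes "\<alpha> \<noteq> 0" "1 \<le> p" "g \<in> bLp p"
  shows "diff_op t (smp \<alpha> g) = smp \<alpha> (dlt \<alpha> t g)"
proof
  fix k
  have "int_vec (k - axis t 1) = int_vec k - axis t 1"
    using int_vec_add[of "k - axis t 1" "axis t 1"] by (simp add: int_vec_axis)
  then have "inverse \<alpha> *\<^sub>R (int_vec (k - axis t 1) + y) = inverse \<alpha> *\<^sub>R (int_vec k + y) - inverse \<alpha> *\<^sub>R axis t 1" for y
    by (simp add: scaleR_add_right scaleR_diff_right)
  then have "smp \<alpha> g (k - axis t 1) = smp \<alpha> (\<lambda>x. g (x - inverse \<alpha> *\<^sub>R axis t 1)) k"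
    unfolding smp_def by simp
  then show "diff_op t (smp \<alpha> g) k = smp \<alpha> (dlt \<alpha> t g) k"
    using smp_diff[OF assms bLp_translate[OF assms(3)], of "inverse \<alpha> *\<^sub>R axis t 1" k]
    by (simp add: diff_op_def dlt_def[abs_def])
qed

lemma multi_diff_op_smp:
  assumes "\<alpha> \<noteq> 0" "1 \<le> p" "g \<in> bLp p"
  shows "multi_op diff_op \<rho> (smp \<alpha> g) = smp \<alpha> (multi_op (dlt \<alpha>) \<rho> g)"
  by (induction \<rho> rule: multiindex_induct)
    (simp_all add: multi_op_dlt_inc multi_op_diff_op_inc diff_op_smp[OF assms(1,2) bLp_multi_dlt[OF assms(2,3)]] del: fun_upd_apply)

text \<open>A quasi-interpolation operator: samples at scale \<open>\<alpha>\<close>, synthesized at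
  the same scale. The powers of \<open>|\<alpha>|\<close> that normalize coefficients and generators
  cancel and are left out.\<close>

definition Qop :: "(real^'n::finite \<Rightarrow> real) \<Rightarrow> real \<Rightarrow> (real^'n \<Rightarrow> complex) \<Rightarrow> real^'n \<Rightarrow> complex" where
  "Qop \<kappa> \<alpha> g x = syn \<kappa> (smp \<alpha> g) (\<alpha> *\<^sub>R x)"

text \<open>Sampling and synthesis are both contractions, up to the factors from dilation and from
  the density of cells, which cancel.\<close>

lemma pint_Qop:
  fixes g :: "real^'n::finite \<Rightarrow> complex"
  assumes \<kappa>: "kernel p \<kappa>" and \<alpha>: "\<alpha> \<noteq> 0" and p: "1 \<le> p" and g: "g \<in> borel_measurable borel"
  shows "pint lborel p (Qop \<kappa> \<alpha> g) \<le> pint lborel p g"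
proof -
  have m: "syn \<kappa> (smp \<alpha> g) \<in> borel_measurable borel" using \<kappa> by (intro syn_measurable) (rule kernelD)
  have "ennreal (\<bar>\<alpha>\<bar> ^ CARD('n)) * pint lborel p (Qop \<kappa> \<alpha> g) = pint lborel p (syn \<kappa> (smp \<alpha> g))"
    using pint_dilate[OF m \<alpha>] by (simp add: Qop_def[abs_def])
  also have "... \<le> pint (count_space UNIV) p (smp \<alpha> g)" by (rule pint_syn[OF \<kappa> p])
  also have "... \<le> ennreal (\<bar>\<alpha>\<bar> ^ CARD('n)) * pint lborel p g" by (rule pint_smp[OF \<alpha> p g])
  finally show ?thesis using \<alpha> by (simp add: ennreal_mult_le_mult_iff)
qed

lemma Qop_measurable: "kernel p \<kappa> ==> Qop \<kappa> \<alpha> g \<in> borel_measurable borel"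
  unfolding Qop_def using syn_measurable[of \<kappa> "smp \<alpha> g"] kernelD(1)[of p \<kappa>] by measurable

lemma bLp_Qop: "kernel p \<kappa> ==> \<alpha> \<noteq> 0 ==> 1 \<le> p ==> g \<in> bLp p ==> Qop \<kappa> \<alpha> g \<in> bLp p"
  using pint_Qop[of p \<kappa> \<alpha> g] by (auto simp: bLp_def Qop_measurable elim!: le_less_trans)

lemma bLp_norm_mono:
  assumes "f \<in> bLp p" "g \<in> bLp p" "0 < p" "pint lborel p f \<le> pint lborel p g"
  shows "Lp_norm p f \<le> Lp_norm p g"
  using Lp_norm_mono_pint(2)[OF Lp_measurable[OF bLp_Lp[OF assms(1)]] assms(3) bLp_Lp[OF assms(2)]] assms(4)
  by (simp add: pint_lebesgue)

lemma Lp_norm_Qop: "kernel p \<kappa> ==> \<alpha> \<noteq> 0 ==> 1 \<le> p ==> g \<in> bLp p ==> Lp_norm p (Qop \<kappa> \<alpha> g) \<le> Lp_norm p g"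
  by (intro bLp_norm_mono bLp_Qop pint_Qop) (auto simp: bLp_def)

lemma Lp_norm_avg: "bprob \<mu> ==> 1 \<le> p ==> g \<in> bLp p ==> Lp_norm p (avg \<mu> g) \<le> Lp_norm p g"
  by (intro bLp_norm_mono bLp_avg pint_avg) (auto simp: bLp_def)

lemma Qop_diff_AE:
  assumes \<kappa>: "kernel p \<kappa>" and \<alpha>: "\<alpha> \<noteq> 0" and p: "1 \<le> p" and g: "g \<in> bLp p" and h: "h \<in> bLp p"
  shows "AE x in lborel. Qop \<kappa> \<alpha> (\<lambda>x. g x - h x) x = Qop \<kappa> \<alpha> g x - Qop \<kappa> \<alpha> h x"
proof -
  have "AE x in lborel. syn \<kappa> (smp \<alpha> (\<lambda>x. g x - h x)) x = syn \<kappa> (smp \<alpha> g) x - syn \<kappa> (smp \<alpha> h) x"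
    using AE_syn_integrable[OF \<kappa> p lp_smp[OF \<alpha> p g]] AE_syn_integrable[OF \<kappa> p lp_smp[OF \<alpha> p h]]
    by eventually_elim (simp add: syn_def smp_diff[OF \<alpha> p g h] scaleR_diff_right)
  from AE_dilate[OF this \<alpha>] show ?thesis by (simp add: Qop_def)
qed

subsection \<open>Approximation in the mean\<close>

lemma Lp_norm_tendsto_0:
  assumes p: "1 \<le> p" and m: "\<And>n. F n \<in> borel_measurable lebesgue" and w: "integrable lebesgue w"
    and bd: "\<And>n x. norm (F n x) powr p \<le> w x" and lim: "AE x in lebesgue. (\<lambda>n. F n x) \<longlonglongrightarrow> 0"
  shows "(\<lambda>n. Lp_norm p (F n)) \<longlonglongrightarrow> 0"
proof -
  have "(\<lambda>n. \<integral>x. norm (F n x) powr p \<partial>lebesgue) \<longlonglongrightarrow> (\<integral>x. 0 \<partial>(lebesgue :: (real^'a) measure))"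
  proof (rule integral_dominated_convergence[OF _ _ w])
    show "AE x in lebesgue. (\<lambda>n. norm (F n x) powr p) \<longlonglongrightarrow> 0"
      using lim
    proof eventually_elim
      fix x assume "(\<lambda>n. F n x) \<longlonglongrightarrow> 0"
      from tendsto_norm_zero[OF this] show "(\<lambda>n. norm (F n x) powr p) \<longlonglongrightarrow> 0"
        using p by (intro tendsto_zero_powrI[OF _ tendsto_const]) auto
    qed
    show "(\<lambda>x. norm (F n x) powr p) \<in> borel_measurable lebesgue" for n
      using m[of n] by measurable
    show "AE x in lebesgue. norm (norm (F n x) powr p) \<le> w x" for n using bd by simp
  qed simp
  then show ?thesis
    unfolding Lp_norm_def using p by (intro tendsto_zero_powrI[OF _ tendsto_const]) auto
qed

definition Cc :: "(real^'n::finite \<Rightarrow> complex) set" where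
  "Cc = {g. continuous_on UNIV g \<and> (\<exists>R. \<forall>x. R < norm x \<longrightarrow> g x = 0)}"

lemma Cc_bounds:
  assumes "g \<in> Cc"
  obtains B R where "0 < B" "0 < R" "\<And>x. norm (g x) \<le> B" "\<And>x. R < norm x ==> g x = 0"
proof -
  obtain R0 where R0: "\<forall>x. R0 < norm x \<longrightarrow> g x = 0" using assms by (auto simp: Cc_def)
  define R where "R = max R0 1"
  have R: "0 < R" "\<And>x. R < norm x ==> g x = 0" using R0 by (auto simp: R_def)
  have "continuous_on UNIV g" using assms by (simp add: Cc_def)
  moreover have "g x = 0" if "x \<notin> cball 0 R" for x using R(2)[of x] that by simp
  ultimately obtain B where "0 < B" "\<And>x. norm (g x) \<le> B"
    using continuous_compact_support_bounded[OF _ compact_cball, of g 0 R] by blast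
  with R show ?thesis by (intro that)
qed

lemma bounded_support_integrable:
  assumes [measurable]: "w \<in> borel_measurable lebesgue" and "\<And>x. \<bar>w x\<bar> \<le> (B::real)" "\<And>x :: real^'n::finite. R < norm x ==> w x = 0"
  shows "integrable lebesgue w"
proof (rule Bochner_Integration.integrable_bound)
  show "integrable lebesgue (\<lambda>x :: real^'n. B * indicat_real (cball 0 R) x :: real)"
    using emeasure_compact_finite[OF compact_cball[of "0 :: real^'n" R]] by (intro integrable_mult_right integrable_real_indicator) auto
  show "AE x in lebesgue. norm (w x) \<le> norm (B * indicat_real (cball 0 R) x)"
  proof (rule AE_I2)
    fix x show "norm (w x) \<le> norm (B * indicat_real (cball 0 R) x)"
      using assms(2)[of x] assms(3)[of x] by (cases "norm x \<le> R") auto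
  qed
qed simp

lemma Cc_bLp: "g \<in> Cc ==> 0 < p ==> g \<in> bLp p"
proof -
  assume g: "g \<in> Cc" and p: "0 < p"
  have m [measurable]: "g \<in> borel_measurable borel" using g by (auto simp: Cc_def intro: borel_measurable_continuous_onI)
  have [measurable]: "g \<in> borel_measurable lebesgue" using m by (rule borel_imp_lebesgue_measurable)
  obtain B R where B: "0 < B" "0 < R" "\<And>x. norm (g x) \<le> B" "\<And>x. R < norm x ==> g x = 0"
    using Cc_bounds[OF g] by blast
  have "integrable lebesgue (\<lambda>x. norm (g x) powr p)"
    using B p by (intro bounded_support_integrable[where B = "B powr p" and R = R]) (auto intro!: powr_mono2)
  then show ?thesis by (simp add: bLp_iff Lp_def)
qed

text \<open>A measurable function is an almost everywhere limit of continuous ones. The retraction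
  \<open>P\<close> onto the ball of radius \<open>M\<close> and the cutoff \<open>c\<close> make
  these uniformly bounded with support in one ball and keep the limit, so convergence is
  dominated.\<close>

lemma Cc_dense_bounded:
  fixes f :: "real^'n::finite \<Rightarrow> complex"
  assumes p: "1 \<le> p" and m: "f \<in> borel_measurable lebesgue" and M: "0 < M" "\<And>x. norm (f x) \<le> M"
    and R: "0 < R" "\<And>x. R < norm x ==> f x = 0" and e: "0 < e"
  shows "\<exists>g\<in>Cc. Lp_norm p (\<lambda>x. f x - g x) < e"
proof -
  have "f measurable_on UNIV" using lebesgue_measurable_imp_measurable_on[OF m, of UNIV] by simp
  then obtain N g where N: "negligible N" and g: "\<And>n. continuous_on UNIV (g n)"
    and lim: "\<And>x. x \<notin> N ==> (\<lambda>n. g n x) \<longlonglongrightarrow> f x" unfolding measurable_on_def by auto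
  define P where "P z = z /\<^sub>R max 1 (norm z / M)" for z :: complex
  define c where "c x = max 0 (min 1 (R + 1 - norm x))" for x :: "real^'n"
  define h where "h n x = c x *\<^sub>R P (g n x)" for n x
  have Pc: "continuous_on UNIV P" unfolding P_def using M(1) by (intro continuous_intros) (auto simp: max_def)
  have cc: "continuous_on UNIV c" unfolding c_def by (intro continuous_intros)
  have PM: "norm (P z) \<le> M" for z
    using M(1) by (auto simp: P_def field_simps max_def)
  have Pid: "norm z \<le> M ==> P z = z" for z using M(1) by (simp add: P_def max_def)
  have hcont: "continuous_on UNIV (h n)" for n
    unfolding h_def by (intro continuous_on_scaleR cc continuous_on_compose2[OF Pc g]) auto
  have hsupp: "R + 1 < norm x ==> h n x = 0" for n x by (simp add: h_def c_def)
  have hC: "h n \<in> Cc" for n using hcont hsupp by (auto simp: Cc_def)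
  have c01: "0 \<le> c x" "c x \<le> 1" for x by (auto simp: c_def)
  have hM: "norm (h n x) \<le> M" for n x
    using mult_mono[OF c01(2)[of x] PM[of "g n x"]] c01[of x] by (simp add: h_def)
  have [measurable]: "h n \<in> borel_measurable lebesgue" for n
    using hcont by (intro borel_imp_lebesgue_measurable borel_measurable_continuous_onI)
  note m[measurable]
  have "(\<lambda>n. Lp_norm p (\<lambda>x. f x - h n x)) \<longlonglongrightarrow> 0"
  proof (rule Lp_norm_tendsto_0[OF p])
    show "integrable lebesgue (\<lambda>x :: real^'n. (2 * M) powr p * indicat_real (cball 0 (R + 1)) x :: real)"
      using emeasure_compact_finite[OF compact_cball[of "0 :: real^'n" "R + 1"]]
      by (intro integrable_mult_right integrable_real_indicator) auto
    show "norm (f x - h n x) powr p \<le> (2 * M) powr p * indicat_real (cball 0 (R + 1)) x" for n x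
    proof (cases "norm x \<le> R + 1")
      case True
      have "norm (f x - h n x) \<le> 2 * M" using norm_triangle_ineq4[of "f x" "h n x"] M(2)[of x] hM[of n x] by simp
      then show ?thesis using True p by (auto intro!: powr_mono2)
    next
      case False
      then show ?thesis using R(2)[of x] hsupp[of x n] by simp
    qed
    have "(\<lambda>n. f x - h n x) \<longlonglongrightarrow> 0" if "x \<notin> N" for x
    proof -
      have "isCont P (f x)" using Pc by (simp add: continuous_on_eq_continuous_at)
      then have "(\<lambda>n. P (g n x)) \<longlonglongrightarrow> P (f x)" using lim[OF that] by (rule isCont_tendsto_compose)
      then have "(\<lambda>n. f x - h n x) \<longlonglongrightarrow> f x - c x *\<^sub>R P (f x)" unfolding h_def by (intro tendsto_intros)
      moreover have "c x *\<^sub>R P (f x) = f x"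
        using R(2)[of x] Pid[OF M(2)[of x]] by (cases "norm x \<le> R") (auto simp: c_def)
      ultimately show ?thesis by simp
    qed
    moreover have "AE x in lebesgue. x \<notin> N" using N by (simp add: negligible_iff_null_sets AE_not_in)
    ultimately show "AE x in lebesgue. (\<lambda>n. f x - h n x) \<longlonglongrightarrow> 0" by (auto elim: eventually_mono)
  qed measurable
  then have "eventually (\<lambda>n. Lp_norm p (\<lambda>x. f x - h n x) < e) sequentially" using e by (rule order_tendstoD)
  then show ?thesis using hC by (auto simp: eventually_sequentially)
qed

text \<open>Truncation in height and in space reduces to the bounded case.\<close>

lemma Cc_dense:
  fixes f :: "real^'n::finite \<Rightarrow> complex"
  assumes p: "1 \<le> p" and f: "f \<in> Lp p" and e: "0 < e"
  shows "\<exists>g\<in>Cc. Lp_norm p (\<lambda>x. f x - g x) < e"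
proof -
  define F where "F n x = (if norm (f x) \<le> real n \<and> norm x \<le> real n then f x else 0)" for n x
  have [measurable]: "f \<in> borel_measurable lebesgue" using f by (rule Lp_measurable)
  have [measurable]: "(\<lambda>x :: real^'n. norm x) \<in> borel_measurable lebesgue" by (intro borel_imp_lebesgue_measurable) measurable
  have Fm [measurable]: "F n \<in> borel_measurable lebesgue" for n unfolding F_def by measurable
  have FL: "F n \<in> Lp p" for n
    using f by (intro Lp_norm_mono_pint(1)[OF Fm _ f]) (use p in \<open>auto simp: pint_def F_def intro!: nn_integral_mono\<close>)
  have "(\<lambda>n. Lp_norm p (\<lambda>x. f x - F n x)) \<longlonglongrightarrow> 0"
  proof (rule Lp_norm_tendsto_0[OF p])
    show "integrable lebesgue (\<lambda>x. norm (f x) powr p)" using f by (simp add: Lp_def)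
    show "norm (f x - F n x) powr p \<le> norm (f x) powr p" for n x by (simp add: F_def)
    show "AE x in lebesgue. (\<lambda>n. f x - F n x) \<longlonglongrightarrow> 0"
    proof (rule AE_I2)
      fix x
      obtain k where k: "max (norm (f x)) (norm x) \<le> real k" using real_arch_simple by blast
      have "eventually (\<lambda>n. 0 = f x - F n x) sequentially"
        using eventually_ge_at_top[of k] by (rule eventually_mono) (use k in \<open>auto simp: F_def\<close>)
      then show "(\<lambda>n. f x - F n x) \<longlonglongrightarrow> 0" by (rule Lim_transform_eventually[OF tendsto_const])
    qed
  qed measurable
  then have "eventually (\<lambda>n. Lp_norm p (\<lambda>x. f x - F n x) < e / 2) sequentially" using e by (intro order_tendstoD) auto
  then obtain n where n: "Lp_norm p (\<lambda>x. f x - F n x) < e / 2" by (auto simp: eventually_sequentially)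
  have "norm (F n x) \<le> real n + 1" "real n + 1 < norm x ==> F n x = 0" for x by (auto simp: F_def)
  then obtain g where g: "g \<in> Cc" "Lp_norm p (\<lambda>x. F n x - g x) < e / 2"
    using Cc_dense_bounded[OF p Fm[of n], of "real n + 1" "real n + 1" "e / 2"] e by auto
  have "Lp_norm p (\<lambda>x. f x - g x) \<le> Lp_norm p (\<lambda>x. f x - F n x) + Lp_norm p (\<lambda>x. F n x - g x)"
    using p by (intro Lp_norm_three f FL bLp_Lp Cc_bLp g) auto
  then show ?thesis using n g by (intro bexI[of _ g]) auto
qed

lemma Cc_uniformly_continuous:
  assumes g: "g \<in> Cc" and e: "0 < e"
  obtains \<delta> where "0 < \<delta>" "\<And>x y. norm (x - y) < \<delta> ==> norm (g x - g y) < e"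
proof -
  obtain B R where B: "0 < B" "\<And>x. norm (g x) \<le> B" and R: "0 < R" "\<And>x. R < norm x ==> g x = 0"
    using Cc_bounds[OF g] by metis
  have "continuous_on (cball 0 (R + 1)) g" using g by (auto simp: Cc_def intro: continuous_on_subset)
  then have "uniformly_continuous_on (cball 0 (R + 1)) g" by (intro compact_uniformly_continuous compact_cball)
  then obtain d where d: "0 < d" "\<And>x y. x \<in> cball 0 (R + 1) ==> y \<in> cball 0 (R + 1) ==> dist y x < d ==> dist (g y) (g x) < e"
    using e unfolding uniformly_continuous_on_def by meson
  show ?thesis
  proof (rule that[of "min d 1"])
    fix x y :: "real^'a" assume xy: "norm (x - y) < min d 1"
    show "norm (g x - g y) < e"
    proof (cases "norm x \<le> R + 1 \<and> norm y \<le> R + 1")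
      case True
      then show ?thesis using d(2)[of y x] xy by (auto simp: dist_norm)
    next
      case False
      moreover have "norm x \<le> norm y + norm (x - y)" "norm y \<le> norm x + norm (x - y)"
        using norm_triangle_ineq[of y "x - y"] norm_triangle_ineq4[of x "x - y"] by auto
      ultimately have "R < norm x" "R < norm y" using xy by auto
      then show ?thesis using R(2)[of x] R(2)[of y] e by simp
    qed
  qed (use d in auto)
qed

lemma Lp_norm_le_indicator:
  fixes F :: "real^'n::finite \<Rightarrow> complex"
  assumes p: "1 \<le> p" and m: "F \<in> borel_measurable borel" and a: "0 \<le> a"
    and le: "\<And>x. norm (F x) \<le> a * indicator (cball 0 R) x"
  shows "Lp_norm p F \<le> a * measure lborel (cball 0 R :: (real^'n) set) powr (1 / p)"
proof (rule Lp_norm_leI(2))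
  let ?K = "cball 0 R :: (real^'n) set"
  have fin: "emeasure lborel ?K = ennreal (measure lborel ?K)"
    using emeasure_compact_finite[OF compact_cball, of "0 :: real^'n" R] by (intro emeasure_eq_ennreal_measure) auto
  have "pint lebesgue p F \<le> (\<integral>\<^sup>+x. ennreal (a powr p) * indicator ?K x \<partial>lborel)"
    unfolding pint_lebesgue unfolding pint_def
  proof (rule nn_integral_mono)
    fix x
    have "norm (F x) powr p \<le> (a * indicator ?K x) powr p" using le p by (intro powr_mono2) auto
    then show "ennreal (norm (F x) powr p) \<le> ennreal (a powr p) * indicator ?K x"
      by (auto simp: ennreal_leI split: split_indicator)
  qed
  also have "... = ennreal (a powr p * measure lborel ?K)"
    by (subst nn_integral_cmult_indicator) (auto simp: fin ennreal_mult)
  also have "a powr p * measure lborel ?K = (a * measure lborel ?K powr (1 / p)) powr p"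
    using p a by (simp add: powr_mult powr_powr)
  finally show "pint lebesgue p F \<le> ennreal ((a * measure lborel ?K powr (1 / p)) powr p)" .
qed (use p a m in \<open>auto intro: borel_imp_lebesgue_measurable\<close>)

lemma AE_seg: "AE y in seg v. norm y \<le> norm v"
proof -
  have "AE s in density lborel (indicator {0..1::real}). norm (s *\<^sub>R v) \<le> norm v"
    by (subst AE_density) (auto split: split_indicator intro!: AE_I2 mult_left_le_one_le)
  then show ?thesis unfolding seg_def by (subst AE_distr_iff) auto
qed

lemma avg_seg_Cc:
  fixes g :: "real^'n::finite \<Rightarrow> complex"
  assumes p: "1 \<le> p" and g: "g \<in> Cc" and e: "0 < e"
  shows "\<exists>\<delta>>0. \<forall>v. norm v < \<delta> \<longrightarrow> Lp_norm p (\<lambda>x. avg (seg v) g x - g x) < e"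
proof -
  obtain B R where B: "0 < B" "\<And>x. norm (g x) \<le> B" and R: "0 < R" "\<And>x. R < norm x ==> g x = 0"
    using Cc_bounds[OF g] by metis
  define M where "M = measure lborel (cball 0 (R + 1) :: (real^'n) set) powr (1 / p)"
  have M: "0 \<le> M" by (simp add: M_def)
  \<comment> \<open>\<open>M\<close> is the L^p norm of the indicator of the ball;
    \<open>M + 1\<close> avoids a division by 0.\<close>
  define e' where "e' = e / (M + 1) / 2"
  have e': "0 < e'" using e M by (simp add: e'_def)
  have "e' * M < e" using e M by (simp add: e'_def field_simps) (smt (verit) mult_nonneg_nonneg)
  obtain d where d: "0 < d" "\<And>x y. norm (x - y) < d ==> norm (g x - g y) < e'"
    using Cc_uniformly_continuous[OF g e'] by blast
  have gm [measurable]: "g \<in> borel_measurable borel" using Cc_bLp[OF g, of 1] by (simp add: bLp_def)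
  \<comment> \<open>Segments shorter than 1 keep the support of the average in the ball of radius
    \<open>R + 1\<close>, and shorter than \<open>d\<close> they see only oscillations below
    \<open>e'\<close>.\<close>
  have "Lp_norm p (\<lambda>x. avg (seg v) g x - g x) \<le> e' * M" if v: "norm v < min d 1" for v
    unfolding M_def
  proof (rule Lp_norm_le_indicator[OF p])
    have [measurable]: "avg (seg v) g \<in> borel_measurable borel" by (rule avg_measurable[OF bprob_seg gm])
    show "(\<lambda>x. avg (seg v) g x - g x) \<in> borel_measurable borel" by measurable
    fix x
    have [measurable_cong]: "sets (seg v) = sets borel" by (rule bprob_sets[OF bprob_seg])
    interpret finite_measure "seg v" by (rule bprob_finite[OF bprob_seg])
    have m1: "measure (seg v) UNIV = 1" using bprob_seg[of v] by (simp add: bprob_def measure_def)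
    have sp: "space (seg v) = UNIV" by (rule bprob_space[OF bprob_seg])
    have int: "integrable (seg v) (\<lambda>y. g (x - y))" by (rule integrable_const_bound[where B = B]) (auto simp: B(2))
    have eq: "avg (seg v) g x - g x = (\<integral>y. g (x - y) - g x \<partial>seg v)"
      using int by (simp add: avg_def sp m1)
    show "norm (avg (seg v) g x - g x) \<le> e' * indicator (cball 0 (R + 1)) x"
    proof (cases "norm x \<le> R + 1")
      case True
      have "norm (\<integral>y. g (x - y) - g x \<partial>seg v) \<le> (\<integral>y. norm (g (x - y) - g x) \<partial>seg v)" by simp
      also have "... \<le> (\<integral>y. e' \<partial>seg v)"
      proof (rule integral_mono_AE)
        show "AE y in seg v. norm (g (x - y) - g x) \<le> e'"
          using AE_seg[of v] by eventually_elim (use d(2) v in \<open>auto intro!: less_imp_le\<close>)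
      qed (use int in auto)
      also have "... = e'" by (simp add: sp m1)
      finally show ?thesis using True eq by simp
    next
      case False
      have "AE y in seg v. g (x - y) - g x = 0"
        using AE_seg[of v]
      proof eventually_elim
        fix y :: "real^'n" assume "norm y \<le> norm v"
        then have "R < norm (x - y)" using False v norm_triangle_ineq2[of x y] by auto
        then show "g (x - y) - g x = 0" using R(2)[of x] R(2)[of "x - y"] False by simp
      qed
      then have "(\<integral>y. g (x - y) - g x \<partial>seg v) = 0" by (rule integral_eq_zero_AE)
      then show ?thesis using False eq by simp
    qed
  qed (use e' in simp)
  then show ?thesis using d(1) \<open>e' * M < e\<close> by (intro exI[of _ "min d 1"]) (auto intro: le_less_trans)
qed

text \<open>Density of \<open>Cc\<close>: as averaging is a contraction, the approximation error
  enters twice, hence the thirds of \<open>e\<close>.\<close>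

lemma avg_seg_tendsto:
  fixes G :: "real^'n::finite \<Rightarrow> complex"
  assumes p: "1 \<le> p" and G: "G \<in> bLp p" and v: "v \<longlonglongrightarrow> 0"
  shows "(\<lambda>j. Lp_norm p (\<lambda>x. avg (seg (v j)) G x - G x)) \<longlonglongrightarrow> 0"
proof (rule order_tendstoI)
  fix e :: real assume e: "0 < e"
  obtain g where g: "g \<in> Cc" "Lp_norm p (\<lambda>x. G x - g x) < e / 3"
    using Cc_dense[OF p bLp_Lp[OF G], of "e / 3"] e by auto
  have gb: "g \<in> bLp p" using g p by (intro Cc_bLp) auto
  obtain d where d: "0 < d" "\<And>v. norm v < d ==> Lp_norm p (\<lambda>x. avg (seg v) g x - g x) < e / 3"
    using avg_seg_Cc[OF p g(1), of "e / 3"] e by auto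
  have "eventually (\<lambda>j. norm (v j) < d) sequentially"
    using tendsto_norm_zero[OF v] d(1) by (rule order_tendstoD)
  then show "eventually (\<lambda>j. Lp_norm p (\<lambda>x. avg (seg (v j)) G x - G x) < e) sequentially"
  proof eventually_elim
    fix j assume j: "norm (v j) < d"
    let ?A = "avg (seg (v j))"
    have b: "?A G \<in> bLp p" "?A g \<in> bLp p" by (auto intro!: bLp_avg bprob_seg p G gb)
    have ae: "AE x in lebesgue. ?A G x - ?A g x = ?A (\<lambda>x. G x - g x) x"
      using avg_diff_AE[OF bprob_seg p G gb, of "v j"] by (intro AE_completion) (auto elim: eventually_mono)
    have "Lp_norm p (\<lambda>x. ?A G x - G x) \<le> Lp_norm p (\<lambda>x. ?A G x - ?A g x) + Lp_norm p (\<lambda>x. ?A g x - G x)"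
      by (intro Lp_norm_three bLp_Lp b G p)
    also have "Lp_norm p (\<lambda>x. ?A g x - G x) \<le> Lp_norm p (\<lambda>x. ?A g x - g x) + Lp_norm p (\<lambda>x. g x - G x)"
      by (intro Lp_norm_three bLp_Lp b G gb p)
    also have "Lp_norm p (\<lambda>x. ?A G x - ?A g x) = Lp_norm p (?A (\<lambda>x. G x - g x))"
      using p by (intro Lp_norm_cong_AE[OF ae] bLp_Lp bLp_avg bprob_seg bLp_diff G gb) auto
    also have "... \<le> Lp_norm p (\<lambda>x. G x - g x)"
      by (intro Lp_norm_avg bprob_seg p bLp_diff G gb)
    finally show "Lp_norm p (\<lambda>x. ?A G x - G x) < e"
      using d(2)[OF j] g(2) Lp_norm_minus_commute[of p g G] by simp
  qed
next
  fix e :: real assume "e < 0"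
  then show "eventually (\<lambda>j. e < Lp_norm p (\<lambda>x. avg (seg (v j)) G x - G x)) sequentially"
    by (intro always_eventually allI less_le_trans[OF _ Lp_norm_nonneg])
qed

section \<open>Difference quotients of Sobolev functions\<close>

lemma has_weak_deriv_dlt:
  fixes U G :: "real^'n::finite \<Rightarrow> complex"
  assumes p: "1 \<le> p" and U: "U \<in> bLp p" "G \<in> bLp p" and wd: "has_weak_deriv (unit_mi t) U G"
  shows "has_weak_deriv (unit_mi t) (dlt \<alpha> s U) (dlt \<alpha> s G)"
proof -
  let ?a = "inverse \<alpha> *\<^sub>R axis s (1::real)"
  \<comment> \<open>The Dirac mass at \<open>?a\<close>: translation becomes a special average and
    inherits its rule for weak derivatives.\<close>
  let ?\<mu> = "distr (cell :: (real^'n) measure) borel (\<lambda>_. ?a)"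
  have \<mu>: "bprob ?\<mu>" by (rule bprob_distr[OF bprob_cell]) simp
  have "avg ?\<mu> W x = W (x - ?a)" if [measurable]: "W \<in> borel_measurable borel" for W :: "real^'n \<Rightarrow> complex" and x
    unfolding avg_def by (subst integral_distr) (auto simp: measure_def)
  then have "avg ?\<mu> W = (\<lambda>x. W (x - ?a))" if "W \<in> bLp p" for W :: "real^'n \<Rightarrow> complex"
    using that by (auto simp: bLp_def)
  with has_weak_deriv_avg[OF \<mu> p U wd]
  have tr: "has_weak_deriv (unit_mi t) (\<lambda>x. U (x - ?a)) (\<lambda>x. G (x - ?a))"
    using U by simp
  show ?thesis
    using has_weak_deriv_add[OF wd has_weak_deriv_cmult[OF tr, of "-1"]] by (simp add: dlt_def[abs_def])
qed

lemma has_weak_deriv_multi_dlt: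
  assumes p: "1 \<le> p" and U: "U \<in> bLp p" "G \<in> bLp p" and wd: "has_weak_deriv (unit_mi t) U G"
  shows "has_weak_deriv (unit_mi t) (multi_op (dlt \<alpha>) \<rho> U) (multi_op (dlt \<alpha>) \<rho> G)"
proof (induction \<rho> rule: multiindex_induct)
  case (inc \<rho> s)
  show ?case unfolding multi_op_dlt_inc
    by (rule has_weak_deriv_dlt[OF p bLp_multi_dlt[OF p U(1)] bLp_multi_dlt[OF p U(2)] inc.IH])
qed (simp add: wd del: fun_upd_apply)

text \<open>Sobolev membership with Borel representatives of the function and of each derivative, as
  averages along segments require.\<close>

definition bsob :: "nat \<Rightarrow> real \<Rightarrow> (real^'n::finite \<Rightarrow> complex) \<Rightarrow> bool" where
  "bsob m p f \<longleftrightarrow> f \<in> bLp p \<and> (\<forall>\<sigma>. mdeg \<sigma> \<le> m \<longrightarrow> (\<exists>h\<in>bLp p. has_weak_deriv \<sigma> f h))"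

lemma bsob_partial:
  assumes f: "bsob (Suc m) p f" and wd: "has_weak_deriv (unit_mi t) f f1" and f1: "f1 \<in> bLp p"
  shows "bsob m p f1"
  unfolding bsob_def
proof (intro conjI allI impI f1)
  fix \<sigma> :: "'a \<Rightarrow> nat" assume "mdeg \<sigma> \<le> m"
  then have "mdeg (inc t \<sigma>) \<le> Suc m" by (simp del: fun_upd_apply)
  then obtain h where "h \<in> bLp p" "has_weak_deriv (inc t \<sigma>) f h" using f unfolding bsob_def by blast
  then show "\<exists>h\<in>bLp p. has_weak_deriv \<sigma> f1 h" using has_weak_deriv_inc_left[OF wd] by blast
qed

text \<open>Both parts rest on \<open>translate_diff_eq_avg_seg\<close>: each scaled difference is an average of
  a derivative over a short segment, hence an \<open>L\<^sup>p\<close> contraction of it that tends to it.\<close>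

lemma difference_quotients:
  fixes f g :: "real^'n::finite \<Rightarrow> complex"
  assumes p: "1 \<le> p"
  shows "bsob (mdeg \<rho>) p f ==> g \<in> bLp p ==> has_weak_deriv \<rho> f g ==>
    (\<forall>\<alpha>. \<alpha> \<noteq> 0 \<longrightarrow> Lp_norm p (\<lambda>x. of_real \<alpha> ^ mdeg \<rho> * multi_op (dlt \<alpha>) \<rho> f x) \<le> Lp_norm p g) \<and>
    (\<forall>a. (\<forall>j. a j \<noteq> 0) \<longrightarrow> filterlim (\<lambda>j. \<bar>a j\<bar>) at_top sequentially \<longrightarrow>
      (\<lambda>j::nat. Lp_norm p (\<lambda>x. of_real (a j) ^ mdeg \<rho> * multi_op (dlt (a j)) \<rho> f x - g x)) \<longlonglongrightarrow> 0)"
proof (induction \<rho> arbitrary: f rule: multiindex_induct)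
  case zero
  have f: "f \<in> bLp p" using zero by (simp add: bsob_def)
  have "has_weak_deriv (\<lambda>_. 0) f f" by (intro has_weak_deriv_zero Lp_locally_integrable[OF p] bLp_Lp f)
  then have ae: "AE x in lebesgue. f x = g x" using has_weak_deriv_unique zero(3) by blast
  have "Lp_norm p f = Lp_norm p g" using p by (intro Lp_norm_cong_AE[OF ae] bLp_Lp zero) auto
  moreover have "Lp_norm p (\<lambda>x. f x - g x) = Lp_norm p (\<lambda>x :: real^'n. 0)"
    using p ae by (intro Lp_norm_cong_AE Lp_zero) (auto elim: eventually_mono)
  ultimately show ?case by simp
next
  case (inc \<rho> t)
  have f: "f \<in> bLp p" using inc.prems(1) by (simp add: bsob_def)
  have s: "bsob (Suc (mdeg \<rho>)) p f" using inc.prems(1) unfolding mdeg_inc .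
  obtain f1 where f1: "f1 \<in> bLp p" "has_weak_deriv (unit_mi t) f f1"
    using s unfolding bsob_def by (metis One_nat_def Suc_le_mono le0 mdeg_unit_mi)
  have s1: "bsob (mdeg \<rho>) p f1" by (rule bsob_partial[OF s f1(2,1)])
  note g = inc.prems(2)
  have wd1: "has_weak_deriv \<rho> f1 g" by (rule has_weak_deriv_inc_left[OF f1(2) inc.prems(3)])
  let ?W = "\<lambda>\<alpha> x. of_real \<alpha> ^ mdeg \<rho> * multi_op (dlt \<alpha>) \<rho> f1 x"
  let ?A = "\<lambda>\<alpha>. avg (seg (inverse \<alpha> *\<^sub>R axis t 1))"
  have W: "?W \<alpha> \<in> bLp p" for \<alpha> by (intro bLp_cmult bLp_multi_dlt p f1)
  have AW: "?A \<alpha> U \<in> bLp p" if "U \<in> bLp p" for \<alpha> U by (intro bLp_avg bprob_seg p that)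
  \<comment> \<open>One difference in direction \<open>t\<close> is traded for an average of the
    derivative \<open>f1\<close>. The remaining differences act on \<open>f1\<close>, which the
    induction hypothesis covers.\<close>
  have eq: "AE x in lebesgue. of_real \<alpha> ^ mdeg (inc t \<rho>) * multi_op (dlt \<alpha>) (inc t \<rho>) f x = ?A \<alpha> (?W \<alpha>) x"
    if \<alpha>: "\<alpha> \<noteq> 0" for \<alpha> :: real
  proof (rule AE_completion)
    show "AE x in lborel. of_real \<alpha> ^ mdeg (inc t \<rho>) * multi_op (dlt \<alpha>) (inc t \<rho>) f x = ?A \<alpha> (?W \<alpha>) x"
      using translate_diff_eq_avg_seg[OF p bLp_multi_dlt[OF p f, of \<alpha> \<rho>] bLp_multi_dlt[OF p f1(1)]
          has_weak_deriv_multi_dlt[OF p f f1], where h = "inverse \<alpha>"]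
    proof eventually_elim
      case (elim x)
      have "?A \<alpha> (?W \<alpha>) x = of_real \<alpha> ^ mdeg \<rho> * ?A \<alpha> (multi_op (dlt \<alpha>) \<rho> f1) x"
        unfolding avg_def by simp
      moreover have "of_real \<alpha> ^ mdeg (inc t \<rho>) * multi_op (dlt \<alpha>) (inc t \<rho>) f x
          = of_real \<alpha> ^ mdeg \<rho> * (of_real \<alpha> * dlt \<alpha> t (multi_op (dlt \<alpha>) \<rho> f) x)"
        unfolding multi_op_dlt_inc mdeg_inc by (simp add: mult_ac)
      moreover have "of_real \<alpha> * dlt \<alpha> t (multi_op (dlt \<alpha>) \<rho> f) x = ?A \<alpha> (multi_op (dlt \<alpha>) \<rho> f1) x"
        unfolding dlt_def[of \<alpha> t] elim using \<alpha> by simp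
      ultimately show ?case by simp
    qed
  qed
  note IH = inc.IH[OF s1 g wd1]
  show ?case
  proof (intro conjI allI impI)
    fix \<alpha> :: real assume \<alpha>: "\<alpha> \<noteq> 0"
    have "Lp_norm p (\<lambda>x. of_real \<alpha> ^ mdeg (inc t \<rho>) * multi_op (dlt \<alpha>) (inc t \<rho>) f x) = Lp_norm p (?A \<alpha> (?W \<alpha>))"
      using p by (intro Lp_norm_cong_AE[OF eq[OF \<alpha>]] bLp_Lp AW W) auto
    also have "... \<le> Lp_norm p (?W \<alpha>)" by (rule Lp_norm_avg[OF bprob_seg p W])
    also have "... \<le> Lp_norm p g" using IH \<alpha> by blast
    finally show "Lp_norm p (\<lambda>x. of_real \<alpha> ^ mdeg (inc t \<rho>) * multi_op (dlt \<alpha>) (inc t \<rho>) f x) \<le> Lp_norm p g" .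
  next
    fix a :: "nat \<Rightarrow> real" assume a: "\<forall>j. a j \<noteq> 0" "filterlim (\<lambda>j. \<bar>a j\<bar>) at_top sequentially"
    have lim: "(\<lambda>j. Lp_norm p (\<lambda>x. ?W (a j) x - g x)) \<longlonglongrightarrow> 0" using IH a by blast
    have "(\<lambda>j. inverse \<bar>a j\<bar>) \<longlonglongrightarrow> 0" by (rule tendsto_inverse_0_at_top[OF a(2)])
    moreover have "\<bar>inverse (a j)\<bar> = inverse \<bar>a j\<bar>" for j by (metis norm_inverse real_norm_def)
    ultimately have "(\<lambda>j. \<bar>inverse (a j)\<bar>) \<longlonglongrightarrow> 0" by presburger
    then have "(\<lambda>j. inverse (a j)) \<longlonglongrightarrow> 0" by (rule tendsto_rabs_zero_cancel)
    from tendsto_scaleR[OF this tendsto_const, of "axis t (1::real)"]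
    have "(\<lambda>j. inverse (a j) *\<^sub>R axis t (1::real)) \<longlonglongrightarrow> 0" by simp
    from tendsto_add[OF lim avg_seg_tendsto[OF p g this]]
    have lim2: "(\<lambda>j. Lp_norm p (\<lambda>x. ?W (a j) x - g x) + Lp_norm p (\<lambda>x. ?A (a j) g x - g x)) \<longlonglongrightarrow> 0" by simp
    show "(\<lambda>j. Lp_norm p (\<lambda>x. of_real (a j) ^ mdeg (inc t \<rho>) * multi_op (dlt (a j)) (inc t \<rho>) f x - g x)) \<longlonglongrightarrow> 0"
    proof (rule tendsto_sandwich[OF _ _ tendsto_const lim2])
      show "eventually (\<lambda>j. Lp_norm p (\<lambda>x. of_real (a j) ^ mdeg (inc t \<rho>) * multi_op (dlt (a j)) (inc t \<rho>) f x - g x)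
          \<le> Lp_norm p (\<lambda>x. ?W (a j) x - g x) + Lp_norm p (\<lambda>x. ?A (a j) g x - g x)) sequentially"
      proof (intro always_eventually allI)
        fix j
        let ?AW = "?A (a j) (?W (a j))" and ?Ag = "?A (a j) g"
        have "AE x in lebesgue. of_real (a j) ^ mdeg (inc t \<rho>) * multi_op (dlt (a j)) (inc t \<rho>) f x - g x = ?AW x - g x"
          using eq[of "a j"] a(1) by (auto elim: eventually_mono)
        then have "Lp_norm p (\<lambda>x. of_real (a j) ^ mdeg (inc t \<rho>) * multi_op (dlt (a j)) (inc t \<rho>) f x - g x)
            = Lp_norm p (\<lambda>x. ?AW x - g x)"
          using p by (intro Lp_norm_cong_AE bLp_Lp bLp_diff AW W g) auto
        also have "... \<le> Lp_norm p (\<lambda>x. ?AW x - ?Ag x) + Lp_norm p (\<lambda>x. ?Ag x - g x)"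
          by (intro Lp_norm_three p bLp_Lp AW W g)
        also have "Lp_norm p (\<lambda>x. ?AW x - ?Ag x) = Lp_norm p (?A (a j) (\<lambda>x. ?W (a j) x - g x))"
        proof (rule Lp_norm_cong_AE)
          show "AE x in lebesgue. ?AW x - ?Ag x = ?A (a j) (\<lambda>x. ?W (a j) x - g x) x"
            using avg_diff_AE[OF bprob_seg p W g, of "inverse (a j) *\<^sub>R axis t 1" "a j"]
            by (intro AE_completion) (auto elim: eventually_mono)
        qed (use p in \<open>auto intro!: bLp_Lp AW bLp_diff W g\<close>)
        also have "... \<le> Lp_norm p (\<lambda>x. ?W (a j) x - g x)" by (intro Lp_norm_avg bprob_seg p bLp_diff W g)
        finally show "Lp_norm p (\<lambda>x. of_real (a j) ^ mdeg (inc t \<rho>) * multi_op (dlt (a j)) (inc t \<rho>) f x - g x)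
          \<le> Lp_norm p (\<lambda>x. ?W (a j) x - g x) + Lp_norm p (\<lambda>x. ?A (a j) g x - g x)"
          by (simp del: fun_upd_apply mdeg_inc)
      qed
    qed simp
  qed
qed

section \<open>The lattice sum of a kernel\<close>

lemma pair_sigma_finite_lborel_count:
  "pair_sigma_finite (lborel :: (real^'n::finite) measure) (count_space (UNIV :: (int^'n) set))"
  by (simp add: pair_sigma_finite_def sigma_finite_count sigma_finite_lborel)

lemma exists_cell_translate: "\<exists>k. x - int_vec k \<in> (unit_cell :: (real^'n::finite) set)"
proof (rule ccontr)
  assume "\<nexists>k. x - int_vec k \<in> unit_cell"
  then have "(\<integral>\<^sup>+k. indicator unit_cell (x - int_vec k) \<partial>count_space UNIV) = (0 :: ennreal)" by simp
  then show False by (simp add: tile_indicator)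
qed

text \<open>Integer translates of the cell cover the space, and there are countably many.\<close>

lemma AE_periodic:
  fixes P :: "real^'n::finite \<Rightarrow> bool"
  assumes ae: "AE x in cell. P x" and per: "\<And>x k. P (x - int_vec k) \<longleftrightarrow> P x"
  shows "AE x in lborel. P x"
proof -
  have "AE x in lborel. 0 < (indicator unit_cell x :: ennreal) \<longrightarrow> P x"
    using ae unfolding cell_def by (subst (asm) AE_density) auto
  then have "AE x in lborel. x \<in> unit_cell \<longrightarrow> P x" by eventually_elim auto
  from AE_all_translates[OF this] show ?thesis
    by eventually_elim (use exists_cell_translate per in metis)
qed

text \<open>The periodization of the kernel. For \<open>p > 1\<close> it is 1 almost everywhere; for
  \<open>p = 1\<close> just its mean over the cell is known to be 1.\<close>

definition tot :: "(real^'n::finite \<Rightarrow> real) \<Rightarrow> real^'n \<Rightarrow> real" where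
  "tot \<kappa> x = (\<integral>k. \<kappa> (x - int_vec k) \<partial>count_space UNIV)"

lemma tot_measurable:
  assumes [measurable]: "\<kappa> \<in> borel_measurable borel" shows "tot \<kappa> \<in> borel_measurable borel"
proof -
  interpret sigma_finite_measure "count_space (UNIV :: (int^'a) set)" by (rule sigma_finite_count)
  show ?thesis unfolding tot_def by measurable
qed

lemma int_vec_minus: "int_vec (- k) = - int_vec k"
  by (simp add: int_vec_def vec_eq_iff)

lemma tot_periodic: "tot \<kappa> (x - int_vec m) = tot \<kappa> x"
  using integral_count_shift[of "\<lambda>k. \<kappa> (x - int_vec k)" m] by (simp add: tot_def int_vec_add diff_diff_eq add.commute)

lemma nn_integral_cell_kernel:
  assumes \<kappa>: "kernel p \<kappa>"
  shows "(\<integral>\<^sup>+z. (\<integral>\<^sup>+k. ennreal (\<kappa> (z - int_vec k)) \<partial>count_space UNIV) \<partial>cell) = 1"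
proof -
  interpret pair_sigma_finite cell "count_space (UNIV :: (int^'a) set)" by (rule pair_sigma_finite_count[OF bprob_cell])
  have [measurable]: "\<kappa> \<in> borel_measurable borel" using \<kappa> by (rule kernelD)
  have bij: "bij_betw uminus UNIV (UNIV :: (int^'a) set)" by (rule bij_betwI[of _ _ _ uminus]) auto
  have "(\<integral>\<^sup>+z. (\<integral>\<^sup>+k. ennreal (\<kappa> (z - int_vec k)) \<partial>count_space UNIV) \<partial>cell)
      = (\<integral>\<^sup>+k. (\<integral>\<^sup>+z. ennreal (\<kappa> (z - int_vec k)) \<partial>cell) \<partial>count_space UNIV)"
    by (rule Fubini'[symmetric]) measurable
  also have "... = (\<integral>\<^sup>+k. (\<integral>\<^sup>+z. ennreal (\<kappa> (int_vec k + z)) \<partial>cell) \<partial>count_space UNIV)"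
    using nn_integral_bij_count_space[OF bij, of "\<lambda>k. \<integral>\<^sup>+z. ennreal (\<kappa> (z - int_vec k)) \<partial>cell"]
    by (simp add: int_vec_minus add.commute)
  also have "... = 1" using nn_integral_tile[of "\<lambda>x. ennreal (\<kappa> x)"] kernelD(3)[OF \<kappa>] by simp
  finally show ?thesis .
qed

lemma AE_tot:
  assumes \<kappa>: "kernel p \<kappa>"
  shows "AE x in lborel. integrable (count_space UNIV) (\<lambda>k. \<kappa> (x - int_vec k))"
proof (rule AE_periodic)
  interpret sigma_finite_measure "count_space (UNIV :: (int^'a) set)" by (rule sigma_finite_count)
  have [measurable]: "\<kappa> \<in> borel_measurable borel" using \<kappa> by (rule kernelD)
  have "AE x in cell. (\<integral>\<^sup>+k. ennreal (\<kappa> (x - int_vec k)) \<partial>count_space UNIV) \<noteq> \<infinity>"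
    by (rule nn_integral_PInf_AE, measurable) (simp add: nn_integral_cell_kernel[OF \<kappa>])
  then show "AE x in cell. integrable (count_space UNIV) (\<lambda>k. \<kappa> (x - int_vec k))"
    by eventually_elim (rule integrableI_nonneg, use kernelD(2)[OF \<kappa>] in \<open>auto simp: less_top\<close>)
  fix x and m :: "int^'a"
  have bij: "bij_betw (\<lambda>k. k + m) UNIV (UNIV :: (int^'a) set)" by (rule bij_betwI[of _ _ _ "\<lambda>k. k - m"]) auto
  show "integrable (count_space UNIV) (\<lambda>k. \<kappa> (x - int_vec m - int_vec k))
      \<longleftrightarrow> integrable (count_space UNIV) (\<lambda>k. \<kappa> (x - int_vec k))"
    using integrable_bij_count_space[OF bij, of "\<lambda>k. \<kappa> (x - int_vec k)"]
    by (simp add: int_vec_add diff_diff_eq add.commute)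
qed

lemma tot_cell:
  assumes \<kappa>: "kernel p \<kappa>"
  shows "integrable cell (tot \<kappa>)" "(\<integral>x. tot \<kappa> x \<partial>cell) = 1"
proof -
  have [measurable]: "tot \<kappa> \<in> borel_measurable borel" by (rule tot_measurable[OF kernelD(1)[OF \<kappa>]])
  have nn: "0 \<le> tot \<kappa> x" for x unfolding tot_def by (rule Bochner_Integration.integral_nonneg) (simp add: kernelD(2)[OF \<kappa>])
  have "AE x in cell. integrable (count_space UNIV) (\<lambda>k. \<kappa> (x - int_vec k))"
    using AE_tot[OF \<kappa>] unfolding cell_def by (subst AE_density) (auto elim: eventually_mono)
  then have "AE x in cell. ennreal (tot \<kappa> x) = (\<integral>\<^sup>+k. ennreal (\<kappa> (x - int_vec k)) \<partial>count_space UNIV)"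
    by eventually_elim (simp add: tot_def nn_integral_eq_integral kernelD(2)[OF \<kappa>])
  then have "(\<integral>\<^sup>+x. ennreal (tot \<kappa> x) \<partial>cell) = 1"
    using nn_integral_cell_kernel[OF \<kappa>] by (simp cong: nn_integral_cong_AE)
  then have e: "(\<integral>\<^sup>+x. ennreal (tot \<kappa> x) \<partial>cell) = ennreal 1" by simp
  show i: "integrable cell (tot \<kappa>)" by (rule integrableI_nonneg) (use e nn in auto)
  show "(\<integral>x. tot \<kappa> x \<partial>cell) = 1" by (rule integral_eq_nn_integral[THEN trans]) (use e nn in auto)
qed

lemma tot_eq_1:
  assumes \<kappa>: "kernel p \<kappa>" and "1 < p" shows "AE x in lborel. tot \<kappa> x = 1"
proof -
  have "AE x in lborel. (\<integral>\<^sup>+k. ennreal (\<kappa> (x - int_vec k)) \<partial>count_space UNIV) = 1" using assms by (simp add: kernel_def)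
  then show ?thesis
    by eventually_elim (simp add: tot_def integral_eq_nn_integral kernelD(2)[OF \<kappa>])
qed

section \<open>Quasi-interpolation of continuous functions with bounded support\<close>

lemma norm_unit_cell: "y \<in> unit_cell ==> norm (y :: real^'n::finite) \<le> CARD('n)"
proof -
  assume "y \<in> unit_cell"
  then have "(\<Sum>i\<in>UNIV. \<bar>y $ i\<bar>) \<le> (\<Sum>i\<in>(UNIV :: 'n set). 1)" by (intro sum_mono) (auto simp: unit_cell_def less_imp_le)
  then show ?thesis using norm_le_l1_cart[of y] by simp
qed

lemma nn_integral_dilate_inverse:
  fixes F :: "real^'n::finite \<Rightarrow> ennreal"
  assumes [measurable]: "F \<in> borel_measurable borel" and \<alpha>: "\<alpha> \<noteq> 0"
  shows "(\<integral>\<^sup>+x. F (inverse \<alpha> *\<^sub>R x) \<partial>lborel) = ennreal (\<bar>\<alpha>\<bar> ^ CARD('n)) * (\<integral>\<^sup>+x. F x \<partial>lborel)"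
  using nn_integral_dilate[of "\<lambda>x. F (inverse \<alpha> *\<^sub>R x)" \<alpha>] \<alpha> by simp

lemma emeasure_cball_eq:
  "emeasure lborel (cball 0 R :: 'a::euclidean_space set) = ennreal (measure lborel (cball 0 R :: 'a set))"
  using emeasure_compact_finite[OF compact_cball, of "0 :: 'a" R] by (intro emeasure_eq_ennreal_measure) auto

lemma measurable_indicator_cball [measurable (raw)]:
  fixes f :: "'a \<Rightarrow> 'b::euclidean_space"
  assumes "f \<in> borel_measurable M"
  shows "(\<lambda>x. indicator (cball a r) (f x) :: ennreal) \<in> borel_measurable M"
proof -
  have "(indicator (cball a r) :: 'b \<Rightarrow> ennreal) \<in> borel_measurable borel"
    by (rule borel_measurable_indicator) simp
  from measurable_compose[OF assms this] show ?thesis .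
qed

text \<open>Lattice points are counted by volume: each is replaced by its cell, which after scaling
  by \<open>inverse \<alpha>\<close> stays within distance \<open>CARD('n)\<close> of the point
  because \<open>|\<alpha>| \<ge> 1\<close>.\<close>

lemma lattice_count_bound:
  fixes u :: "real^'n::finite"
  assumes \<alpha>: "1 \<le> \<bar>\<alpha>\<bar>"
  shows "(\<integral>\<^sup>+k. indicator (cball 0 R) (inverse \<alpha> *\<^sub>R (int_vec k + u)) \<partial>count_space UNIV)
    \<le> ennreal (\<bar>\<alpha>\<bar> ^ CARD('n)) * emeasure lborel (cball 0 (R + CARD('n)) :: (real^'n) set)"
proof -
  let ?K = "cball 0 (R + CARD('n)) :: (real^'n) set"
  let ?F = "\<lambda>z. indicator ?K (inverse \<alpha> *\<^sub>R z) :: ennreal"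
  have \<alpha>0: "\<alpha> \<noteq> 0" using \<alpha> by auto
  have "indicator (cball 0 R) (inverse \<alpha> *\<^sub>R (int_vec k + u)) \<le> (\<integral>\<^sup>+y. ?F (int_vec k + y + u) \<partial>cell)" for k
  proof (cases "inverse \<alpha> *\<^sub>R (int_vec k + u) \<in> cball 0 R")
    case True
    have "?F (int_vec k + y + u) = 1" if y: "y \<in> unit_cell" for y
    proof -
      have "norm (inverse \<alpha> *\<^sub>R y) \<le> 1 * norm y"
        unfolding norm_scaleR using \<alpha> by (intro mult_right_mono) (auto simp: field_simps)
      then have "norm (inverse \<alpha> *\<^sub>R (int_vec k + u) + inverse \<alpha> *\<^sub>R y) \<le> R + CARD('n)"
        using True norm_unit_cell[OF y] by (intro norm_triangle_le) auto
      then show ?thesis by (simp add: scaleR_add_right add_ac)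
    qed
    then have "(\<integral>\<^sup>+y. indicator unit_cell y * ?F (int_vec k + y + u) \<partial>lborel) = (\<integral>\<^sup>+y. indicator unit_cell y \<partial>(lborel :: (real^'n) measure))"
      by (intro nn_integral_cong) (auto split: split_indicator)
    moreover have "(\<lambda>y. ?F (int_vec k + y + u)) \<in> borel_measurable borel"
      by measurable
    ultimately have "(\<integral>\<^sup>+y. ?F (int_vec k + y + u) \<partial>cell) = 1"
      using emeasure_unit_cell[where 'n = 'n] by (simp add: nn_integral_cell)
    then show ?thesis by (simp only:) (simp split: split_indicator)
  qed simp
  then have "(\<integral>\<^sup>+k. indicator (cball 0 R) (inverse \<alpha> *\<^sub>R (int_vec k + u)) \<partial>count_space UNIV)
      \<le> (\<integral>\<^sup>+k. (\<integral>\<^sup>+y. ?F (int_vec k + y + u) \<partial>cell) \<partial>count_space UNIV)" by (rule nn_integral_mono)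
  also have "... = (\<integral>\<^sup>+x. ?F (x + u) \<partial>lborel)" by (rule nn_integral_tile) measurable
  also have "... = (\<integral>\<^sup>+x. ?F x \<partial>lborel)" by (rule nn_integral_lborel_translate) measurable
  also have "... = ennreal (\<bar>\<alpha>\<bar> ^ CARD('n)) * emeasure lborel ?K"
    by (subst nn_integral_dilate_inverse[OF _ \<alpha>0]) auto
  finally show ?thesis .
qed

text \<open>The comparison is with \<open>tot * g\<close> and not with \<open>g\<close>, because the
  weights at \<open>z = \<alpha> x\<close> add up to \<open>tot \<kappa> z\<close>. Jensen is used
  for these weights and for the cell means; the substitution \<open>z = k + u\<close> then separates
  the kernel, a function of the offset \<open>u\<close>, from the oscillation of \<open>g\<close>
  near the lattice point.\<close>

lemma pint_Qop_diff:
  fixes g :: "real^'n::finite \<Rightarrow> complex"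
  assumes \<kappa>: "kernel p \<kappa>" and p: "1 \<le> p" and \<alpha>: "\<alpha> \<noteq> 0" and g: "g \<in> Cc"
  shows "ennreal (\<bar>\<alpha>\<bar> ^ CARD('n)) * pint lborel p (\<lambda>x. Qop \<kappa> \<alpha> g x - of_real (tot \<kappa> (\<alpha> *\<^sub>R x)) * g x)
    \<le> (\<integral>\<^sup>+u. ennreal (\<kappa> u) * (\<integral>\<^sup>+k. pint cell p (\<lambda>y. g (inverse \<alpha> *\<^sub>R (int_vec k + y)) - g (inverse \<alpha> *\<^sub>R (int_vec k + u))) \<partial>count_space UNIV) \<partial>lborel)"
proof -
  interpret pair_sigma_finite "lborel :: (real^'n) measure" "count_space (UNIV :: (int^'n) set)" by (rule pair_sigma_finite_lborel_count)
  interpret c: finite_measure "cell :: (real^'n) measure" by (rule bprob_finite[OF bprob_cell])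
  have gb: "g \<in> bLp p" using g p by (intro Cc_bLp) auto
  have [measurable]: "g \<in> borel_measurable borel" "\<kappa> \<in> borel_measurable borel"
    using gb kernelD(1)[OF \<kappa>] by (auto simp: bLp_def)
  have [measurable]: "tot \<kappa> \<in> borel_measurable borel" "syn \<kappa> (smp \<alpha> g) \<in> borel_measurable borel"
    by (auto intro!: tot_measurable syn_measurable)
  let ?s = "smp \<alpha> g"
  let ?A = "\<lambda>z k. pint cell p (\<lambda>y. g (inverse \<alpha> *\<^sub>R (int_vec k + y)) - g (inverse \<alpha> *\<^sub>R z))"
  let ?D = "\<lambda>z. syn \<kappa> ?s z - of_real (tot \<kappa> z) * g (inverse \<alpha> *\<^sub>R z)"
  have Am [measurable]: "(\<lambda>(z, k). ?A z k) \<in> borel_measurable (borel \<Otimes>\<^sub>M count_space UNIV)"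
    unfolding pint_def by measurable
  have A1: "ennreal (norm (?s k - g (inverse \<alpha> *\<^sub>R z)) powr p) \<le> ?A z k" for z k
  proof -
    have eq: "?s k - g (inverse \<alpha> *\<^sub>R z) = (\<integral>y. g (inverse \<alpha> *\<^sub>R (int_vec k + y)) - g (inverse \<alpha> *\<^sub>R z) \<partial>cell)"
      using smp_integrable[OF \<alpha> p gb] by (simp add: smp_def measure_def)
    show ?thesis unfolding eq
    proof (rule jensen_pint[OF _ p])
      show "(\<lambda>y. g (inverse \<alpha> *\<^sub>R (int_vec k + y)) - g (inverse \<alpha> *\<^sub>R z)) \<in> borel_measurable cell" by measurable
      show "p = 1 \<or> emeasure (cell :: (real^'n) measure) (space cell) \<le> 1" by simp
    qed
  qed
  have D: "AE z in lborel. ennreal (norm (?D z) powr p) \<le> (\<integral>\<^sup>+k. ennreal (\<kappa> (z - int_vec k)) * ?A z k \<partial>count_space UNIV)"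
    using AE_syn_integrable[OF \<kappa> p lp_smp[OF \<alpha> p gb]] AE_tot[OF \<kappa>] wmeas_bound[OF \<kappa> p]
  proof eventually_elim
    fix z
    assume i: "integrable (count_space UNIV) (\<lambda>k. \<kappa> (z - int_vec k) *\<^sub>R ?s k)"
        "integrable (count_space UNIV) (\<lambda>k. \<kappa> (z - int_vec k))"
      and w: "p = 1 \<or> emeasure (wmeas \<kappa> z) (space (wmeas \<kappa> z)) \<le> 1"
    let ?c = "g (inverse \<alpha> *\<^sub>R z)"
    have "?D z = (\<integral>k. \<kappa> (z - int_vec k) *\<^sub>R ?s k \<partial>count_space UNIV) - (\<integral>k. \<kappa> (z - int_vec k) *\<^sub>R ?c \<partial>count_space UNIV)"
    proof -
      have "(\<integral>k. \<kappa> (z - int_vec k) *\<^sub>R ?c \<partial>count_space UNIV) = tot \<kappa> z *\<^sub>R ?c"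
        unfolding tot_def by (rule integral_scaleR_left) (rule i(2))
      then show ?thesis by (simp only: syn_def scaleR_conv_of_real)
    qed
    also have "... = (\<integral>k. \<kappa> (z - int_vec k) *\<^sub>R (?s k - ?c) \<partial>count_space UNIV)"
      using i by (simp add: scaleR_diff_right Bochner_Integration.integral_diff[OF i(1) integrable_scaleR_left[OF i(2)]])
    also have "... = (\<integral>k. ?s k - ?c \<partial>wmeas \<kappa> z)"
      by (rule integral_density[symmetric]) (auto simp: kernelD(2)[OF \<kappa>])
    finally have eq: "?D z = (\<integral>k. ?s k - ?c \<partial>wmeas \<kappa> z)" .
    have "ennreal (norm (?D z) powr p) \<le> pint (wmeas \<kappa> z) p (\<lambda>k. ?s k - ?c)"
      unfolding eq by (rule jensen_pint[OF _ p w]) simp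
    also have "... \<le> (\<integral>\<^sup>+k. ennreal (\<kappa> (z - int_vec k)) * ?A z k \<partial>count_space UNIV)"
      unfolding pint_wmeas using A1[of _ z] by (intro nn_integral_mono mult_left_mono) auto
    finally show "ennreal (norm (?D z) powr p) \<le> (\<integral>\<^sup>+k. ennreal (\<kappa> (z - int_vec k)) * ?A z k \<partial>count_space UNIV)" .
  qed
  have "ennreal (\<bar>\<alpha>\<bar> ^ CARD('n)) * pint lborel p (\<lambda>x. Qop \<kappa> \<alpha> g x - of_real (tot \<kappa> (\<alpha> *\<^sub>R x)) * g x) = pint lborel p ?D"
    using pint_dilate[of ?D \<alpha> p] \<alpha> by (simp add: Qop_def)
  also have "... \<le> (\<integral>\<^sup>+z. (\<integral>\<^sup>+k. ennreal (\<kappa> (z - int_vec k)) * ?A z k \<partial>count_space UNIV) \<partial>lborel)"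
    unfolding pint_def[of lborel] by (rule nn_integral_mono_AE[OF D])
  also have "... = (\<integral>\<^sup>+k. (\<integral>\<^sup>+z. ennreal (\<kappa> (z - int_vec k)) * ?A z k \<partial>lborel) \<partial>count_space UNIV)"
    by (rule Fubini'[symmetric]) measurable
  also have "... = (\<integral>\<^sup>+k. (\<integral>\<^sup>+u. ennreal (\<kappa> u) * ?A (int_vec k + u) k \<partial>lborel) \<partial>count_space UNIV)"
  proof (rule nn_integral_cong)
    fix k :: "int^'n"
    show "(\<integral>\<^sup>+z. ennreal (\<kappa> (z - int_vec k)) * ?A z k \<partial>lborel) = (\<integral>\<^sup>+u. ennreal (\<kappa> u) * ?A (int_vec k + u) k \<partial>lborel)"
    proof -
      have "(\<lambda>z. ennreal (\<kappa> (z - int_vec k)) * ?A z k) \<in> borel_measurable borel"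
        unfolding pint_def by measurable
      from nn_integral_lborel_translate[OF this, of "int_vec k"] show ?thesis by (simp add: add.commute)
    qed
  qed
  also have "... = (\<integral>\<^sup>+u. (\<integral>\<^sup>+k. ennreal (\<kappa> u) * ?A (int_vec k + u) k \<partial>count_space UNIV) \<partial>lborel)"
    by (rule Fubini') measurable
  also have "... = (\<integral>\<^sup>+u. ennreal (\<kappa> u) * (\<integral>\<^sup>+k. ?A (int_vec k + u) k \<partial>count_space UNIV) \<partial>lborel)"
    by (simp add: nn_integral_cmult)
  finally show ?thesis .
qed

text \<open>A term is nonzero only if one of its two points lies in the ball. The total weight of
  such terms is at most a multiple of the density of cells, uniformly in the offset
  \<open>u\<close>.\<close>

lemma oscillation_bound:
  fixes g :: "real^'n::finite \<Rightarrow> complex"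
  assumes p: "1 \<le> p" and \<alpha>: "1 \<le> \<bar>\<alpha>\<bar>" and g [measurable]: "g \<in> borel_measurable borel" and R: "\<And>x. R < norm x ==> g x = 0"
    and e: "\<And>k y. y \<in> unit_cell ==> norm (g (inverse \<alpha> *\<^sub>R (int_vec k + y)) - g (inverse \<alpha> *\<^sub>R (int_vec k + u))) \<le> e"
  shows "(\<integral>\<^sup>+k. pint cell p (\<lambda>y. g (inverse \<alpha> *\<^sub>R (int_vec k + y)) - g (inverse \<alpha> *\<^sub>R (int_vec k + u))) \<partial>count_space UNIV)
    \<le> ennreal (\<bar>\<alpha>\<bar> ^ CARD('n)) * (ennreal (e powr p) * (emeasure lborel (cball 0 R :: (real^'n) set) + emeasure lborel (cball 0 (R + CARD('n)) :: (real^'n) set)))"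
proof -
  have \<alpha>0: "\<alpha> \<noteq> 0" using \<alpha> by auto
  let ?K = "indicator (cball 0 R) :: real^'n \<Rightarrow> ennreal"
  let ?x = "\<lambda>k y. inverse \<alpha> *\<^sub>R (int_vec k + y) :: real^'n"
  have "pint cell p (\<lambda>y. g (?x k y) - g (?x k u)) \<le> ennreal (e powr p) * ((\<integral>\<^sup>+y. ?K (?x k y) \<partial>cell) + ?K (?x k u))" for k
  proof -
    have "pint cell p (\<lambda>y. g (?x k y) - g (?x k u)) \<le> (\<integral>\<^sup>+y. ennreal (e powr p) * (?K (?x k y) + ?K (?x k u)) \<partial>cell)"
      unfolding pint_def
    proof (subst (1 2) nn_integral_cell, measurable, rule nn_integral_mono)
      fix y :: "real^'n"
      have "ennreal (norm (g (?x k y) - g (?x k u)) powr p) \<le> ennreal (e powr p) * (?K (?x k y) + ?K (?x k u))" if y: "y \<in> unit_cell"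
      proof (cases "?x k y \<in> cball 0 R \<or> ?x k u \<in> cball 0 R")
        case True
        then have "1 \<le> ?K (?x k y) + ?K (?x k u)" by (auto split: split_indicator)
        then have a: "ennreal (e powr p) * 1 \<le> ennreal (e powr p) * (?K (?x k y) + ?K (?x k u))" by (rule mult_left_mono) simp
        have b: "norm (g (?x k y) - g (?x k u)) powr p \<le> e powr p"
          by (rule powr_mono2[OF _ norm_ge_zero e[OF y]]) (use p in simp)
        show ?thesis by (rule order_trans[OF ennreal_leI[OF b] a[unfolded mult_1_right]])
      next
        case False
        then have "g (?x k y) = 0" "g (?x k u) = 0" by (auto intro!: R)
        then show ?thesis by simp
      qed
      then show "indicator unit_cell y * ennreal (norm (g (?x k y) - g (?x k u)) powr p)
          \<le> indicator unit_cell y * (ennreal (e powr p) * (?K (?x k y) + ?K (?x k u)))"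
        by (auto split: split_indicator)
    qed
    also have "... = ennreal (e powr p) * ((\<integral>\<^sup>+y. ?K (?x k y) \<partial>cell) + ?K (?x k u))"
      by (simp add: nn_integral_cmult nn_integral_add)
    finally show ?thesis .
  qed
  then have "(\<integral>\<^sup>+k. pint cell p (\<lambda>y. g (?x k y) - g (?x k u)) \<partial>count_space UNIV)
      \<le> (\<integral>\<^sup>+k. ennreal (e powr p) * ((\<integral>\<^sup>+y. ?K (?x k y) \<partial>cell) + ?K (?x k u)) \<partial>count_space UNIV)"
    by (rule nn_integral_mono)
  also have "... = ennreal (e powr p) * ((\<integral>\<^sup>+k. (\<integral>\<^sup>+y. ?K (?x k y) \<partial>cell) \<partial>count_space UNIV) + (\<integral>\<^sup>+k. ?K (?x k u) \<partial>count_space UNIV))"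
    by (simp add: nn_integral_cmult nn_integral_add)
  also have "(\<integral>\<^sup>+k. (\<integral>\<^sup>+y. ?K (?x k y) \<partial>cell) \<partial>count_space UNIV) = (\<integral>\<^sup>+z. ?K (inverse \<alpha> *\<^sub>R z) \<partial>lborel)"
    by (rule nn_integral_tile) measurable
  also have "... = ennreal (\<bar>\<alpha>\<bar> ^ CARD('n)) * emeasure lborel (cball 0 R :: (real^'n) set)"
    by (subst nn_integral_dilate_inverse[OF _ \<alpha>0]) auto
  also have "ennreal (e powr p) * (ennreal (\<bar>\<alpha>\<bar> ^ CARD('n)) * emeasure lborel (cball 0 R :: (real^'n) set) + (\<integral>\<^sup>+k. ?K (?x k u) \<partial>count_space UNIV))
      \<le> ennreal (e powr p) * (ennreal (\<bar>\<alpha>\<bar> ^ CARD('n)) * emeasure lborel (cball 0 R :: (real^'n) set)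
        + ennreal (\<bar>\<alpha>\<bar> ^ CARD('n)) * emeasure lborel (cball 0 (R + CARD('n)) :: (real^'n) set))"
    by (intro mult_left_mono add_left_mono lattice_count_bound[OF \<alpha>]) auto
  finally show ?thesis by (simp add: distrib_left mult_ac)
qed

lemma ennreal_tendsto_0I:
  fixes F :: "nat \<Rightarrow> ennreal" and c p :: real
  assumes p: "0 < p" and c: "0 \<le> c" and F: "\<And>e. 0 < e ==> eventually (\<lambda>j. F j \<le> ennreal (e powr p) * ennreal c) sequentially"
  shows "F \<longlonglongrightarrow> 0"
proof (rule order_tendstoI)
  fix l :: ennreal assume "0 < l"
  then obtain z where z: "0 < z" "z < l" using dense by blast
  then obtain r where r: "z = ennreal r" "0 < r" by (cases z) auto
  \<comment> \<open>Chosen to give \<open>e powr p * c \<le> r\<close>; the denominator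
    \<open>c + 1\<close> covers \<open>c = 0\<close>.\<close>
  define e where "e = (r / (c + 1)) powr (1 / p)"
  have e: "0 < e" "e powr p = r / (c + 1)" using r c p by (auto simp: e_def powr_powr)
  have "e powr p * c \<le> r" using r c by (simp add: e(2) field_simps)
  then have "ennreal (e powr p) * ennreal c < l"
    using z r by (metis ennreal_leI ennreal_mult c le_less_trans powr_ge_zero)
  then show "eventually (\<lambda>j. F j < l) sequentially"
    using F[OF e(1)] by (auto elim!: eventually_mono le_less_trans)
qed simp

text \<open>The kernel may have unbounded support, so the offset \<open>u\<close> is not uniformly
  small after scaling. For fixed \<open>u\<close> the limit follows from uniform continuity of
  \<open>g\<close>, and a multiple of \<open>\<kappa>\<close> dominates.\<close>

lemma Qop_Cc_tendsto:
  fixes g :: "real^'n::finite \<Rightarrow> complex"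
  assumes \<kappa>: "kernel p \<kappa>" and p: "1 \<le> p" and g: "g \<in> Cc"
    and a: "\<And>j. a j \<noteq> 0" "filterlim (\<lambda>j. \<bar>a j\<bar>) at_top sequentially"
  shows "(\<lambda>j::nat. pint lborel p (\<lambda>x. Qop \<kappa> (a j) g x - of_real (tot \<kappa> (a j *\<^sub>R x)) * g x)) \<longlonglongrightarrow> 0"
proof -
  obtain B R where B: "0 < B" "\<And>x. norm (g x) \<le> B" and R: "0 < R" "\<And>x. R < norm x ==> g x = 0"
    using Cc_bounds[OF g] by metis
  have [measurable]: "g \<in> borel_measurable borel" "\<kappa> \<in> borel_measurable borel"
    using Cc_bLp[OF g, of 1] kernelD(1)[OF \<kappa>] by (auto simp: bLp_def)
  have [measurable_cong]: "sets (cell :: (real^'n) measure) = sets borel" by (rule cell_sets)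
  interpret sigma_finite_measure "count_space (UNIV :: (int^'n) set)" by (rule sigma_finite_count)
  interpret c: finite_measure "cell :: (real^'n) measure" by (rule bprob_finite[OF bprob_cell])
  let ?d = "\<lambda>j. ennreal (\<bar>a j\<bar> ^ CARD('n))"
  define I where "I j u = (\<integral>\<^sup>+k. pint cell p (\<lambda>y. g (inverse (a j) *\<^sub>R (int_vec k + y)) - g (inverse (a j) *\<^sub>R (int_vec k + u))) \<partial>count_space UNIV)" for j u
  define c where "c = measure lborel (cball 0 R :: (real^'n) set) + measure lborel (cball 0 (R + CARD('n)) :: (real^'n) set)"
  have c0: "0 \<le> c" by (simp add: c_def)
  have ce: "emeasure lborel (cball 0 R :: (real^'n) set) + emeasure lborel (cball 0 (R + CARD('n)) :: (real^'n) set) = ennreal c"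
    unfolding emeasure_cball_eq c_def by (rule ennreal_plus[symmetric]) auto
  have Im [measurable]: "I j \<in> borel_measurable borel" for j unfolding I_def pint_def by measurable
  have dnz: "?d j \<noteq> 0" "?d j \<noteq> top" for j using a(1)[of j] by auto
  have div: "X / ?d j \<le> Y" if "X \<le> ?d j * Y" for X Y j
    using divide_right_mono_ennreal[OF that] ennreal_mult_divide_eq[OF dnz] by (metis mult.commute)
  have Ibd: "I j u / ?d j \<le> ennreal (e powr p) * ennreal c"
    if "1 \<le> \<bar>a j\<bar>" "\<And>k y. y \<in> unit_cell ==> norm (g (inverse (a j) *\<^sub>R (int_vec k + y)) - g (inverse (a j) *\<^sub>R (int_vec k + u))) \<le> e" for j u e
    unfolding I_def ce[symmetric]
    by (intro div oscillation_bound[where g = g and \<alpha> = "a j" and u = u and e = e and R = R] p R(2) that) auto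
  have I0: "(\<lambda>j. I j u / ?d j) \<longlonglongrightarrow> 0" for u
  proof (rule ennreal_tendsto_0I[OF _ c0])
    fix e :: real assume e: "0 < e"
    obtain \<delta> where \<delta>: "0 < \<delta>" "\<And>x y. norm (x - y) < \<delta> ==> norm (g x - g y) < e"
      using Cc_uniformly_continuous[OF g e] by blast
    have "eventually (\<lambda>j. max 1 ((CARD('n) + norm u) / \<delta> + 1) \<le> \<bar>a j\<bar>) sequentially"
      using a(2)[unfolded filterlim_at_top] by (rule spec)
    then show "eventually (\<lambda>j. I j u / ?d j \<le> ennreal (e powr p) * ennreal c) sequentially"
    proof eventually_elim
      fix j assume j: "max 1 ((CARD('n) + norm u) / \<delta> + 1) \<le> \<bar>a j\<bar>"
      show "I j u / ?d j \<le> ennreal (e powr p) * ennreal c"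
      proof (rule Ibd)
        fix k and y :: "real^'n" assume y: "y \<in> unit_cell"
        have "norm (y - u) \<le> CARD('n) + norm u" using norm_triangle_ineq4[of y u] norm_unit_cell[OF y] by linarith
        also have "... < \<bar>a j\<bar> * \<delta>"
        proof -
          have "(CARD('n) + norm u) / \<delta> < \<bar>a j\<bar>" using j by auto
          then show ?thesis using \<delta>(1) by (simp only: pos_divide_less_eq)
        qed
        finally have "norm (y - u) / \<bar>a j\<bar> < \<delta>"
          using a(1)[of j] by (simp add: pos_divide_less_eq mult.commute)
        then have "norm (inverse (a j) *\<^sub>R (y - u)) < \<delta>"
          by (simp add: divide_inverse mult.commute)
        moreover have "inverse (a j) *\<^sub>R (y - u) = inverse (a j) *\<^sub>R (int_vec k + y) - inverse (a j) *\<^sub>R (int_vec k + u)"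
          by (simp add: scaleR_add_right scaleR_diff_right)
        ultimately show "norm (g (inverse (a j) *\<^sub>R (int_vec k + y)) - g (inverse (a j) *\<^sub>R (int_vec k + u))) \<le> e"
          using \<delta>(2) by (metis less_imp_le)
      qed (use j in simp)
    qed
  qed (use p in simp)
  \<comment> \<open>The bounds on the oscillation require \<open>|a j| \<ge> 1\<close>, hence the
    shift of the sequence by \<open>N\<close>.\<close>
  have "eventually (\<lambda>j. 1 \<le> \<bar>a j\<bar>) sequentially" using a(2)[unfolded filterlim_at_top] by (rule spec)
  then obtain N where N: "\<And>j. N \<le> j ==> 1 \<le> \<bar>a j\<bar>" unfolding eventually_sequentially by auto
  have "(\<lambda>j. \<integral>\<^sup>+u. ennreal (\<kappa> u) * (I (j + N) u / ?d (j + N)) \<partial>lborel) \<longlonglongrightarrow> (\<integral>\<^sup>+u. ennreal (\<kappa> u) * 0 \<partial>lborel)"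
  proof (rule nn_integral_dominated_convergence[where w = "\<lambda>u. ennreal (\<kappa> u) * (ennreal ((2 * B) powr p) * ennreal c)"])
    show "AE u in lborel. ennreal (\<kappa> u) * (I (j + N) u / ?d (j + N)) \<le> ennreal (\<kappa> u) * (ennreal ((2 * B) powr p) * ennreal c)" for j
    proof (intro AE_I2 mult_left_mono Ibd N)
      fix u k and y :: "real^'n"
      have "norm (g v - g w) \<le> B + B" for v w
        by (rule order_trans[OF norm_triangle_ineq4 add_mono[OF B(2) B(2)]])
      then show "norm (g (inverse (a (j + N)) *\<^sub>R (int_vec k + y)) - g (inverse (a (j + N)) *\<^sub>R (int_vec k + u))) \<le> 2 * B"
        unfolding mult_2 .
    qed auto
    show "(\<integral>\<^sup>+u. ennreal (\<kappa> u) * (ennreal ((2 * B) powr p) * ennreal c) \<partial>lborel) < \<infinity>"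
      by (simp add: nn_integral_multc kernelD(3)[OF \<kappa>] ennreal_mult_less_top)
    show "AE u in lborel. (\<lambda>j. ennreal (\<kappa> u) * (I (j + N) u / ?d (j + N))) \<longlonglongrightarrow> ennreal (\<kappa> u) * 0"
    proof (rule AE_I2)
      fix u
      have "(\<lambda>j. I (j + N) u / ?d (j + N)) \<longlonglongrightarrow> 0" using LIMSEQ_ignore_initial_segment[OF I0[of u]] .
      then show "(\<lambda>j. ennreal (\<kappa> u) * (I (j + N) u / ?d (j + N))) \<longlonglongrightarrow> ennreal (\<kappa> u) * 0"
        by (intro ennreal_tendsto_cmult) auto
    qed
    show "(\<lambda>u. ennreal (\<kappa> u) * (I (j + N) u / ?d (j + N))) \<in> borel_measurable lborel" for j by measurable
    show "(\<lambda>u. ennreal (\<kappa> u) * 0) \<in> borel_measurable lborel" by measurable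
    show "(\<lambda>u. ennreal (\<kappa> u) * (ennreal ((2 * B) powr p) * ennreal c)) \<in> borel_measurable lborel" by measurable
  qed
  then have "(\<lambda>j. \<integral>\<^sup>+u. ennreal (\<kappa> u) * (I (j + N) u / ?d (j + N)) \<partial>lborel) \<longlonglongrightarrow> 0" by simp
  then have L: "(\<lambda>j. \<integral>\<^sup>+u. ennreal (\<kappa> u) * (I j u / ?d j) \<partial>lborel) \<longlonglongrightarrow> 0"
    by (rule LIMSEQ_offset)
  show ?thesis
  proof (rule tendsto_sandwich[OF _ _ tendsto_const L])
    show "eventually (\<lambda>j. pint lborel p (\<lambda>x. Qop \<kappa> (a j) g x - of_real (tot \<kappa> (a j *\<^sub>R x)) * g x)
        \<le> (\<integral>\<^sup>+u. ennreal (\<kappa> u) * (I j u / ?d j) \<partial>lborel)) sequentially"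
    proof (intro always_eventually allI)
      fix j
      let ?P = "pint lborel p (\<lambda>x. Qop \<kappa> (a j) g x - of_real (tot \<kappa> (a j *\<^sub>R x)) * g x)"
      have "?d j * ?P \<le> (\<integral>\<^sup>+u. ennreal (\<kappa> u) * I j u \<partial>lborel)"
        unfolding I_def by (rule pint_Qop_diff[OF \<kappa> p a(1) g])
      then have "?d j * ?P / ?d j \<le> (\<integral>\<^sup>+u. ennreal (\<kappa> u) * I j u \<partial>lborel) / ?d j" by (rule divide_right_mono_ennreal)
      moreover have "?d j * ?P / ?d j = ?P"
        using ennreal_mult_divide_eq[OF dnz, of ?P j] by (simp only: mult.commute)
      moreover have "(\<integral>\<^sup>+u. ennreal (\<kappa> u) * I j u \<partial>lborel) / ?d j = (\<integral>\<^sup>+u. ennreal (\<kappa> u) * (I j u / ?d j) \<partial>lborel)"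
        unfolding ennreal_times_divide by (rule nn_integral_divide[symmetric]) measurable
      ultimately show "?P \<le> (\<integral>\<^sup>+u. ennreal (\<kappa> u) * (I j u / ?d j) \<partial>lborel)" by simp
    qed
  qed simp
qed

lemma Qop_approx:
  fixes g :: "real^'n::finite \<Rightarrow> complex"
  assumes \<kappa>: "kernel p \<kappa>" and p: "1 \<le> p" and g: "g \<in> Cc"
    and a: "\<And>j. a j \<noteq> 0" "filterlim (\<lambda>j. \<bar>a j\<bar>) at_top sequentially" and e: "0 < e"
  shows "eventually (\<lambda>j::nat. (\<lambda>x. Qop \<kappa> (a j) g x - of_real (tot \<kappa> (a j *\<^sub>R x)) * g x) \<in> bLp p \<and>
    Lp_norm p (\<lambda>x. Qop \<kappa> (a j) g x - of_real (tot \<kappa> (a j *\<^sub>R x)) * g x) < e) sequentially"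
proof -
  have [measurable]: "g \<in> borel_measurable borel" using Cc_bLp[OF g, of 1] by (simp add: bLp_def)
  have [measurable]: "tot \<kappa> \<in> borel_measurable borel" by (rule tot_measurable[OF kernelD(1)[OF \<kappa>]])
  have m: "(\<lambda>x. Qop \<kappa> (a j) g x - of_real (tot \<kappa> (a j *\<^sub>R x)) * g x) \<in> borel_measurable borel" for j
  proof -
    have [measurable]: "Qop \<kappa> (a j) g \<in> borel_measurable borel" by (rule Qop_measurable[OF \<kappa>])
    show ?thesis by measurable
  qed
  have "0 < ennreal ((e / 2) powr p)" using e by simp
  from order_tendstoD(2)[OF Qop_Cc_tendsto[OF \<kappa> p g a] this] show ?thesis
  proof eventually_elim
    fix j
    let ?F = "\<lambda>x. Qop \<kappa> (a j) g x - of_real (tot \<kappa> (a j *\<^sub>R x)) * g x"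
    assume lt: "pint lborel p ?F < ennreal ((e / 2) powr p)"
    have b: "?F \<in> bLp p" using lt m[of j] by (auto simp: bLp_def elim: order.strict_trans)
    have "Lp_norm p ?F \<le> e / 2"
      by (rule Lp_norm_leI(2)[OF Lp_measurable[OF bLp_Lp[OF b]]]) (use p e lt in \<open>auto simp: pint_lebesgue\<close>)
    then show "?F \<in> bLp p \<and> Lp_norm p ?F < e" using b e by simp
  qed
qed

section \<open>A Riemann-Lebesgue lemma for periodic factors\<close>

lemma tot_unit_cell: "tot (indicator unit_cell) x = 1"
proof -
  have "(\<integral>\<^sup>+k. ennreal (indicator unit_cell (x - int_vec k)) \<partial>count_space UNIV) = 1"
    by (simp only: ennreal_indicator tile_indicator)
  then show ?thesis unfolding tot_def by (subst integral_eq_nn_integral) auto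
qed

text \<open>Here the lattice sum is 1 everywhere, so the operators converge to the identity on
  \<open>Cc\<close>, and, being contractions, on L^p.\<close>

lemma Qop_unit_cell_tendsto:
  fixes u :: "real^'n::finite \<Rightarrow> complex"
  assumes p: "1 \<le> p" and u: "u \<in> bLp p"
    and a: "\<And>j. a j \<noteq> 0" "filterlim (\<lambda>j. \<bar>a j\<bar>) at_top sequentially" and e: "0 < e"
  shows "eventually (\<lambda>j::nat. Lp_norm p (\<lambda>x. u x - Qop (indicator unit_cell) (a j) u x) < e) sequentially"
proof -
  let ?Q = "Qop (indicator unit_cell :: real^'n \<Rightarrow> real)"
  have \<kappa>: "kernel p (indicator unit_cell :: real^'n \<Rightarrow> real)" by (rule kernel_unit_cell)
  obtain g where g: "g \<in> Cc" "Lp_norm p (\<lambda>x. u x - g x) < e / 3"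
    using Cc_dense[OF p bLp_Lp[OF u], of "e / 3"] e by auto
  have gb: "g \<in> bLp p" using g p by (intro Cc_bLp) auto
  have "0 < e / 3" using e by simp
  from Qop_approx[OF \<kappa> p g(1) a this] show ?thesis unfolding tot_unit_cell
  proof eventually_elim
    fix j
    assume "(\<lambda>x. ?Q (a j) g x - of_real 1 * g x) \<in> bLp p \<and> Lp_norm p (\<lambda>x. ?Q (a j) g x - of_real 1 * g x) < e / 3"
    then have 1: "Lp_norm p (\<lambda>x. g x - ?Q (a j) g x) < e / 3" using Lp_norm_minus_commute[of p g] by simp
    have Q: "?Q (a j) u \<in> bLp p" "?Q (a j) g \<in> bLp p" using u gb by (auto intro!: bLp_Qop \<kappa> a p)
    have d: "(\<lambda>x. g x - u x) \<in> bLp p" by (rule bLp_diff[OF p gb u])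
    have "AE x in lebesgue. ?Q (a j) g x - ?Q (a j) u x = ?Q (a j) (\<lambda>x. g x - u x) x"
      using Qop_diff_AE[OF \<kappa> a(1)[of j] p gb u] by (intro AE_completion) (auto elim: eventually_mono)
    then have "Lp_norm p (\<lambda>x. ?Q (a j) g x - ?Q (a j) u x) = Lp_norm p (?Q (a j) (\<lambda>x. g x - u x))"
      using p by (intro Lp_norm_cong_AE bLp_Lp bLp_Qop \<kappa> a d) auto
    also have "... \<le> Lp_norm p (\<lambda>x. g x - u x)" by (rule Lp_norm_Qop[OF \<kappa> a(1) p d])
    also have "... < e / 3" using g(2) Lp_norm_minus_commute[of p g u] by simp
    finally have 2: "Lp_norm p (\<lambda>x. ?Q (a j) g x - ?Q (a j) u x) < e / 3" .
    have "Lp_norm p (\<lambda>x. u x - ?Q (a j) u x) \<le> Lp_norm p (\<lambda>x. u x - g x) + Lp_norm p (\<lambda>x. g x - ?Q (a j) u x)"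
      by (intro Lp_norm_three p bLp_Lp u gb Q)
    also have "Lp_norm p (\<lambda>x. g x - ?Q (a j) u x) \<le> Lp_norm p (\<lambda>x. g x - ?Q (a j) g x) + Lp_norm p (\<lambda>x. ?Q (a j) g x - ?Q (a j) u x)"
      by (intro Lp_norm_three p bLp_Lp u gb Q)
    finally show "Lp_norm p (\<lambda>x. u x - ?Q (a j) u x) < e" using 1 2 g(2) by simp
  qed
qed

lemma integral_dilate:
  fixes F :: "real^'n::finite \<Rightarrow> 'b::{banach, second_countable_topology}"
  assumes [measurable]: "F \<in> borel_measurable borel" and "\<alpha> \<noteq> 0"
  shows "(\<integral>x. F x \<partial>lborel) = (\<bar>\<alpha>\<bar> ^ CARD('n)) *\<^sub>R (\<integral>x. F (\<alpha> *\<^sub>R x) \<partial>lborel)"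
proof -
  have "(\<integral>x. F x \<partial>lborel) = (\<integral>x. F x \<partial>density (distr lborel borel (\<lambda>x :: real^'n. 0 + \<alpha> *\<^sub>R x)) (\<lambda>_. ennreal (\<bar>\<alpha>\<bar> ^ DIM(real^'n))))"
    using lborel_affine[OF assms(2), of "0 :: real^'n"] by simp
  also have "... = (\<bar>\<alpha>\<bar> ^ CARD('n)) *\<^sub>R (\<integral>x. F (\<alpha> *\<^sub>R x) \<partial>lborel)"
    by (subst integral_density) (auto simp: integral_distr)
  finally show ?thesis .
qed

definition mean_zero :: "(real^'n::finite \<Rightarrow> real) \<Rightarrow> bool" where
  "mean_zero h \<longleftrightarrow> h \<in> borel_measurable borel \<and> (\<forall>x k. h (x - int_vec k) = h x) \<and> integrable cell h \<and> (\<integral>x. h x \<partial>cell) = 0"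

lemma mean_zeroD:
  assumes "mean_zero h"
  shows "h \<in> borel_measurable borel" "h (x - int_vec k) = h x" "h (int_vec k + x) = h x" "integrable cell h" "(\<integral>x. h x \<partial>cell) = 0"
proof -
  show *: "h (x - int_vec k) = h x" for x k using assms by (simp add: mean_zero_def)
  show "h (int_vec k + x) = h x" using *[of "int_vec k + x" k] by simp
qed (use assms in \<open>simp_all add: mean_zero_def\<close>)

text \<open>The operator produces a step function on the grid of mesh
  \<open>inverse \<alpha>\<close>, and \<open>h (\<alpha> x)\<close> has integral 0 over each cell
  of this grid.\<close>

lemma integral_mean_zero_Qop:
  fixes h :: "real^'n::finite \<Rightarrow> real"
  assumes h: "mean_zero h" and B: "\<And>x. \<bar>h x\<bar> \<le> B" and \<alpha>: "\<alpha> \<noteq> 0" and u: "u \<in> bLp 1"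
  shows "(\<integral>x. h (\<alpha> *\<^sub>R x) *\<^sub>R Qop (indicator unit_cell) \<alpha> u x \<partial>lborel) = 0"
proof -
  interpret pair_sigma_finite "lborel :: (real^'n) measure" "count_space (UNIV :: (int^'n) set)" by (rule pair_sigma_finite_lborel_count)
  let ?s = "smp \<alpha> u" and ?i = "\<lambda>z k. indicator unit_cell (z - int_vec k) :: real"
  have [measurable]: "h \<in> borel_measurable borel" by (rule mean_zeroD(1)[OF h])
  have \<kappa>: "kernel 1 (indicator unit_cell :: real^'n \<Rightarrow> real)" by (rule kernel_unit_cell)
  have B0: "0 \<le> B" using B[of 0] by linarith
  have [measurable]: "?s \<in> borel_measurable (count_space UNIV)" by simp
  have s: "lp 1 ?s" by (rule lp_smp[OF \<alpha> _ u]) simp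
  have Fm: "(\<lambda>(z, k). (h z * ?i z k) *\<^sub>R ?s k) \<in> borel_measurable (lborel \<Otimes>\<^sub>M count_space UNIV)" by measurable
  have F: "integrable (lborel \<Otimes>\<^sub>M count_space UNIV) (\<lambda>(z, k). (h z * ?i z k) *\<^sub>R ?s k)"
  proof (rule integrableI_bounded[OF Fm])
    have "(\<integral>\<^sup>+q. ennreal (norm (case q of (z, k) \<Rightarrow> (h z * ?i z k) *\<^sub>R ?s k)) \<partial>(lborel \<Otimes>\<^sub>M count_space UNIV))
        = (\<integral>\<^sup>+z. (\<integral>\<^sup>+k. ennreal (norm ((h z * ?i z k) *\<^sub>R ?s k)) \<partial>count_space UNIV) \<partial>lborel)"
      using M2.nn_integral_fst[of "\<lambda>q. ennreal (norm (case q of (z, k) \<Rightarrow> (h z * ?i z k) *\<^sub>R ?s k))" lborel] Fm by simp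
    also have "... \<le> (\<integral>\<^sup>+z. (\<integral>\<^sup>+k. ennreal (?i z k) * (ennreal B * ennreal (norm (?s k))) \<partial>count_space UNIV) \<partial>lborel)"
    proof (intro nn_integral_mono)
      fix z k
      have "norm ((h z * ?i z k) *\<^sub>R ?s k) \<le> ?i z k * (B * norm (?s k))"
        using mult_right_mono[OF B[of z] norm_ge_zero[of "?s k"]] by (auto simp: abs_mult split: split_indicator)
      then have "ennreal (norm ((h z * ?i z k) *\<^sub>R ?s k)) \<le> ennreal (?i z k * (B * norm (?s k)))" by (rule ennreal_leI)
      also have "... = ennreal (?i z k) * (ennreal B * ennreal (norm (?s k)))"
        using B0 by (simp only: ennreal_mult' ennreal_mult indicator_pos_le)
      finally show "ennreal (norm ((h z * ?i z k) *\<^sub>R ?s k)) \<le> ennreal (?i z k) * (ennreal B * ennreal (norm (?s k)))" .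
    qed
    also have "... = (\<integral>\<^sup>+k. ennreal B * ennreal (norm (?s k)) \<partial>count_space UNIV)"
      by (rule nn_integral_kernel_translates[OF \<kappa>])
    also have "... = ennreal B * pint (count_space UNIV) 1 ?s"
      by (simp add: pint_def nn_integral_cmult)
    also have "... < \<infinity>" using s by (simp add: lp_def ennreal_mult_less_top)
    finally show "(\<integral>\<^sup>+q. ennreal (norm (case q of (z, k) \<Rightarrow> (h z * ?i z k) *\<^sub>R ?s k)) \<partial>(lborel \<Otimes>\<^sub>M count_space UNIV)) < \<infinity>" .
  qed
  have zero: "(\<integral>z. h z * ?i z k \<partial>lborel) = 0" for k
  proof -
    have m: "(\<lambda>z. h z * ?i z k) \<in> borel_measurable borel" by measurable
    have "(\<integral>z. h z * ?i z k \<partial>lborel) = (\<integral>z. h (z + int_vec k) * ?i (z + int_vec k) k \<partial>lborel)"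
      by (rule integral_lborel_translate[OF m, symmetric])
    also have "... = (\<integral>z. indicator unit_cell z *\<^sub>R h z \<partial>lborel)"
      using mean_zeroD(3)[OF h] by (simp add: add.commute mult.commute)
    also have "... = 0" using integral_cell[of h] mean_zeroD(5)[OF h] by simp
    finally show ?thesis .
  qed
  have "(\<integral>z. h z *\<^sub>R syn (indicator unit_cell) ?s z \<partial>lborel) = (\<integral>z. (\<integral>k. (h z * ?i z k) *\<^sub>R ?s k \<partial>count_space UNIV) \<partial>lborel)"
    unfolding syn_def by (simp flip: scaleR_scaleR)
  also have "... = (\<integral>k. (\<integral>z. (h z * ?i z k) *\<^sub>R ?s k \<partial>lborel) \<partial>count_space UNIV)"
    by (rule Fubini_integral[OF F, symmetric])
  also have "... = (\<integral>k. 0 \<partial>count_space (UNIV :: (int^'n) set))"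
  proof (rule Bochner_Integration.integral_cong[OF refl])
    fix k
    have i: "integrable lborel (\<lambda>z. h z * ?i z k)"
    proof (rule Bochner_Integration.integrable_bound)
      show "integrable lborel (\<lambda>z. B * ?i z k)"
      proof -
        have "integrable lborel (indicator unit_cell :: real^'n \<Rightarrow> real)"
          by (intro integrable_real_indicator) (auto simp: emeasure_unit_cell)
        then have "integrable (distr lborel borel ((+) (- int_vec k))) (indicator unit_cell :: real^'n \<Rightarrow> real)"
          by (simp add: lborel_distr_plus)
        then have "integrable lborel (\<lambda>z. indicator unit_cell (- int_vec k + z) :: real)"
          by (subst (asm) integrable_distr_eq) auto
        then show ?thesis by simp
      qed
      show "AE z in lborel. norm (h z * ?i z k) \<le> norm (B * ?i z k)"
      proof (rule AE_I2)
        fix z show "norm (h z * ?i z k) \<le> norm (B * ?i z k)"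
          using B[of z] B0 by (cases "z - int_vec k \<in> unit_cell") auto
      qed
    qed measurable
    have "(\<integral>z. (h z * ?i z k) *\<^sub>R ?s k \<partial>lborel) = (\<integral>z. h z * ?i z k \<partial>lborel) *\<^sub>R ?s k"
      by (rule integral_scaleR_left) (rule i)
    then show "(\<integral>z. (h z * ?i z k) *\<^sub>R ?s k \<partial>lborel) = 0" by (simp only: zero scaleR_zero_left)
  qed
  finally have "(\<integral>z. h z *\<^sub>R syn (indicator unit_cell) ?s z \<partial>lborel) = 0" by simp
  moreover have [measurable]: "syn (indicator unit_cell) ?s \<in> borel_measurable borel" by (rule syn_measurable[OF kernelD(1)[OF \<kappa>]])
  ultimately show ?thesis
    using integral_dilate[of "\<lambda>z. h z *\<^sub>R syn (indicator unit_cell) ?s z" \<alpha>] \<alpha> by (simp add: Qop_def)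
qed

text \<open>\<open>u\<close> is close in L^1 to a step function on the very grid on which the
  oscillating factor has mean 0 in each cell; only the difference, times the bound \<open>B\<close>,
  remains.\<close>

lemma riemann_lebesgue:
  fixes h :: "real^'n::finite \<Rightarrow> real"
  assumes h: "mean_zero h" and B: "\<And>x. \<bar>h x\<bar> \<le> B" and u: "u \<in> bLp 1"
    and a: "\<And>j. a j \<noteq> 0" "filterlim (\<lambda>j. \<bar>a j\<bar>) at_top sequentially" and e: "0 < e"
  shows "eventually (\<lambda>j::nat. norm (\<integral>x. h (a j *\<^sub>R x) *\<^sub>R u x \<partial>lborel) < e) sequentially"
proof -
  let ?Q = "\<lambda>j. Qop (indicator unit_cell :: real^'n \<Rightarrow> real) (a j) u"
  have B0: "0 \<le> B" using B[of 0] by linarith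
  have hm [measurable]: "h \<in> borel_measurable borel" by (rule mean_zeroD(1)[OF h])
  have "0 < e / (B + 1)" using e B0 by simp
  from Qop_unit_cell_tendsto[OF order_refl u a this] show ?thesis
  proof eventually_elim
    fix j assume "Lp_norm 1 (\<lambda>x. u x - ?Q j x) < e / (B + 1)"
    have Qb: "?Q j \<in> bLp 1" by (intro bLp_Qop kernel_unit_cell a u) simp
    have int: "integrable lborel U" if "U \<in> bLp 1" for U :: "real^'n \<Rightarrow> complex"
      using that by (intro integrableI_bounded) (auto simp: bLp_def pint_def)
    have inth: "integrable lborel (\<lambda>x. h (a j *\<^sub>R x) *\<^sub>R U x)" if U: "U \<in> bLp 1" for U
    proof (rule Bochner_Integration.integrable_bound[OF integrable_scaleR_right[OF int[OF U], of B]])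
      have [measurable]: "U \<in> borel_measurable borel" using U by (simp add: bLp_def)
      show "(\<lambda>x. h (a j *\<^sub>R x) *\<^sub>R U x) \<in> borel_measurable lborel" by measurable
      show "AE x in lborel. norm (h (a j *\<^sub>R x) *\<^sub>R U x) \<le> norm (B *\<^sub>R U x)"
        using B B0 by (intro AE_I2) (auto intro: mult_right_mono)
    qed
    let ?d = "\<lambda>x. u x - ?Q j x"
    have d: "?d \<in> bLp 1" by (rule bLp_diff[OF _ u Qb]) simp
    have "(\<integral>x. h (a j *\<^sub>R x) *\<^sub>R u x \<partial>lborel)
        = (\<integral>x. h (a j *\<^sub>R x) *\<^sub>R u x \<partial>lborel) - (\<integral>x. h (a j *\<^sub>R x) *\<^sub>R ?Q j x \<partial>lborel)"
      by (simp add: integral_mean_zero_Qop[OF h B a(1) u])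
    also have "... = (\<integral>x. h (a j *\<^sub>R x) *\<^sub>R ?d x \<partial>lborel)"
      by (simp add: scaleR_diff_right Bochner_Integration.integral_diff[OF inth[OF u] inth[OF Qb]])
    finally have "norm (\<integral>x. h (a j *\<^sub>R x) *\<^sub>R u x \<partial>lborel) = norm (\<integral>x. h (a j *\<^sub>R x) *\<^sub>R ?d x \<partial>lborel)" by simp
    also have "... \<le> (\<integral>x. norm (h (a j *\<^sub>R x) *\<^sub>R ?d x) \<partial>lborel)" by (rule integral_norm_bound)
    also have "... \<le> (\<integral>x. B * norm (?d x) \<partial>lborel)"
    proof (rule integral_mono[OF integrable_norm[OF inth[OF d]]])
      show "integrable lborel (\<lambda>x. B * norm (?d x))" by (intro integrable_mult_right integrable_norm int d)
      show "norm (h (a j *\<^sub>R x) *\<^sub>R ?d x) \<le> B * norm (?d x)" for x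
        unfolding norm_scaleR by (rule mult_right_mono) (use B in auto)
    qed
    also have "... = B * (\<integral>x. norm (?d x) \<partial>lborel)" by simp
    also have "(\<integral>x. norm (?d x) \<partial>lborel) = Lp_norm 1 ?d"
    proof -
      have "(\<lambda>x. norm (?d x)) \<in> borel_measurable lborel" using int[OF d] by measurable
      from integral_completion[OF this] show ?thesis unfolding Lp_norm_def by simp
    qed
    also have "B * Lp_norm 1 ?d \<le> B * (e / (B + 1))"
      using \<open>Lp_norm 1 ?d < e / (B + 1)\<close> B0 by (intro mult_left_mono) auto
    also have "... < e" using e B0 by (simp add: field_simps)
    finally show "norm (\<integral>x. h (a j *\<^sub>R x) *\<^sub>R u x \<partial>lborel) < e" .
  qed
qed

section \<open>A weak law for periodic functions at different scales\<close>

lemma integrable_bounded_cball: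
  fixes w :: "real^'n::finite \<Rightarrow> real"
  assumes w: "w \<in> borel_measurable borel" and B: "\<And>x. \<bar>w x\<bar> \<le> B" and R: "\<And>x. R < norm x ==> w x = 0"
  shows "integrable lborel w"
proof -
  have "integrable lebesgue w"
    by (rule bounded_support_integrable[OF borel_imp_lebesgue_measurable[OF w] B R])
  then show ?thesis using integrable_completion[of w lborel] w by simp
qed

lemma bLp_of_real:
  assumes "w \<in> borel_measurable borel" "integrable lborel w"
  shows "(\<lambda>x. complex_of_real (w x)) \<in> bLp 1"
proof -
  note [measurable] = assms(1)
  show ?thesis using assms by (simp add: bLp_def pint_def integrable_iff_bounded)
qed

text \<open>The cross terms of the squared sum are made small one at a time by \<open>riemann_lebesgue\<close>;
  this replaces the independence in the usual proof of the weak law of large numbers.\<close>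

lemma weak_law_bounded:
  fixes H :: "(real^'n::finite \<Rightarrow> real) set"
  assumes fin: "finite H" and mz: "\<And>h. h \<in> H ==> mean_zero h" and B: "\<And>h x. h \<in> H ==> \<bar>h x\<bar> \<le> B"
    and a: "\<And>j. a j \<noteq> 0" "filterlim (\<lambda>j. \<bar>a j\<bar>) at_top sequentially"
  shows "\<exists>J::nat set. finite J \<and> J \<subseteq> {N..} \<and> card J = n \<and> (\<forall>h\<in>H.
    (\<integral>x. indicator (cball 0 R) x * (\<Sum>j\<in>J. h (a j *\<^sub>R x))\<^sup>2 \<partial>lborel) \<le> n * (measure lborel (cball 0 R :: (real^'n) set) * B\<^sup>2 + 1))"
proof (induction n)
  case 0
  show ?case by (intro exI[of _ "{}"]) simp
next
  case (Suc n)
  let ?K = "indicator (cball 0 R) :: real^'n \<Rightarrow> real" and ?V = "measure lborel (cball 0 R :: (real^'n) set)"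
  obtain J where J: "finite J" "J \<subseteq> {N..}" "card J = n"
    and le: "\<And>h. h \<in> H ==> (\<integral>x. ?K x * (\<Sum>j\<in>J. h (a j *\<^sub>R x))\<^sup>2 \<partial>lborel) \<le> n * (?V * B\<^sup>2 + 1)"
    using Suc by blast
  let ?S = "\<lambda>h x. \<Sum>j\<in>J. h (a j *\<^sub>R x)"
  have Km [measurable]: "?K \<in> borel_measurable borel" by (intro borel_measurable_indicator) simp
  have hm: "h \<in> borel_measurable borel" if "h \<in> H" for h using mean_zeroD(1)[OF mz[OF that]] .
  have Sm: "?S h \<in> borel_measurable borel" if "h \<in> H" for h
  proof -
    have [measurable]: "h \<in> borel_measurable borel" using hm[OF that] .
    show ?thesis by measurable
  qed
  have SB: "\<bar>?S h x\<bar> \<le> n * B" if "h \<in> H" for h x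
    using order_trans[OF sum_abs sum_bounded_above[of J "\<lambda>j. \<bar>h (a j *\<^sub>R x)\<bar>" B, OF B[OF that]]] J(3) by simp
  have K01: "0 \<le> ?K x" "?K x \<le> 1" for x by auto
  \<comment> \<open>The new index is chosen after \<open>J\<close>, when \<open>?S h\<close> is a
    fixed bounded function on the ball. A cross term below 1/2, counted twice in the square, costs
    at most 1: this is the summand 1 in the bound.\<close>
  have ev: "eventually (\<lambda>j. norm (\<integral>x. h (a j *\<^sub>R x) *\<^sub>R complex_of_real (?K x * ?S h x) \<partial>lborel) < 1 / 2) sequentially"
    if h: "h \<in> H" for h
  proof (rule riemann_lebesgue[OF mz[OF h] B[OF h] _ a])
    have m: "(\<lambda>x. ?K x * ?S h x) \<in> borel_measurable borel" using Sm[OF h] by simp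
    have "integrable lborel (\<lambda>x. ?K x * ?S h x)"
    proof (rule integrable_bounded_cball[OF m])
      show "\<bar>?K x * ?S h x\<bar> \<le> n * B" for x
        using SB[OF h, of x] by (auto split: split_indicator)
      show "?K x * ?S h x = 0" if "R < norm x" for x using that by simp
    qed
    from bLp_of_real[OF m this] show "(\<lambda>x. complex_of_real (?K x * ?S h x)) \<in> bLp 1" .
  qed simp
  have "eventually (\<lambda>j. \<forall>h\<in>H. norm (\<integral>x. h (a j *\<^sub>R x) *\<^sub>R complex_of_real (?K x * ?S h x) \<partial>lborel) < 1 / 2) sequentially"
    using fin ev by (simp add: eventually_ball_finite)
  \<comment> \<open>An index beyond \<open>N\<close> and all of \<open>J\<close> is admissible and
    new.\<close>
  moreover have "eventually (\<lambda>j. Max (insert N J) < j) sequentially" by (rule eventually_gt_at_top)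
  ultimately have "eventually (\<lambda>j. (\<forall>h\<in>H. norm (\<integral>x. h (a j *\<^sub>R x) *\<^sub>R complex_of_real (?K x * ?S h x) \<partial>lborel) < 1 / 2) \<and> Max (insert N J) < j) sequentially"
    by (rule eventually_conj)
  then obtain j where j: "\<And>h. h \<in> H ==> norm (\<integral>x. h (a j *\<^sub>R x) *\<^sub>R complex_of_real (?K x * ?S h x) \<partial>lborel) < 1 / 2"
    and jM: "Max (insert N J) < j"
    unfolding eventually_sequentially by blast
  have jN: "N < j" and jJ: "j \<notin> J" using jM J(1) by auto
  show ?case
  proof (intro exI[of _ "insert j J"] conjI ballI)
    show "finite (insert j J)" "insert j J \<subseteq> {N..}" "card (insert j J) = Suc n" using J jN jJ by auto
    fix h assume h: "h \<in> H"
    have [measurable]: "h \<in> borel_measurable borel" by (rule hm[OF h])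
    note [measurable] = Sm[OF h]
    let ?h = "\<lambda>x. h (a j *\<^sub>R x)"
    have B0: "0 \<le> B" using B[OF h, of 0] by linarith
    have i1: "integrable lborel (\<lambda>x. ?K x * (?S h x)\<^sup>2)"
    proof (rule integrable_bounded_cball)
      show "\<bar>?K x * (?S h x)\<^sup>2\<bar> \<le> (n * B)\<^sup>2" for x
        using power_mono[OF SB[OF h, of x], of 2] by (auto split: split_indicator)
      show "?K x * (?S h x)\<^sup>2 = 0" if "R < norm x" for x using that by simp
    qed measurable
    have i2: "integrable lborel (\<lambda>x. ?h x * (?K x * ?S h x))"
    proof (rule integrable_bounded_cball)
      show "\<bar>?h x * (?K x * ?S h x)\<bar> \<le> B * (n * B)" for x
        using mult_mono[OF B[OF h, of "a j *\<^sub>R x"] SB[OF h, of x] B0] B0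
        by (auto simp: abs_mult split: split_indicator)
      show "?h x * (?K x * ?S h x) = 0" if "R < norm x" for x using that by simp
    qed measurable
    have hB: "(?h x)\<^sup>2 \<le> B\<^sup>2" for x
      using power_mono[OF B[OF h, of "a j *\<^sub>R x"], of 2] by simp
    have i3: "integrable lborel (\<lambda>x. ?K x * (?h x)\<^sup>2)"
    proof (rule integrable_bounded_cball)
      show "\<bar>?K x * (?h x)\<^sup>2\<bar> \<le> B\<^sup>2" for x using hB[of x] by (auto split: split_indicator)
      show "?K x * (?h x)\<^sup>2 = 0" if "R < norm x" for x using that by simp
    qed measurable
    have iK: "integrable lborel (\<lambda>x. ?K x * B\<^sup>2)"
      using emeasure_cball_eq[of R, where 'a = "real^'n"] by (intro integrable_mult_left integrable_real_indicator) auto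
    have c3: "(\<integral>x. ?K x * (?h x)\<^sup>2 \<partial>lborel) \<le> ?V * B\<^sup>2"
    proof -
      have "(\<integral>x. ?K x * (?h x)\<^sup>2 \<partial>lborel) \<le> (\<integral>x. ?K x * B\<^sup>2 \<partial>lborel)"
        by (rule integral_mono[OF i3 iK]) (rule mult_left_mono[OF hB K01(1)])
      then show ?thesis by simp
    qed
    have c2: "(\<integral>x. ?h x * (?K x * ?S h x) \<partial>lborel) < 1 / 2"
    proof -
      have "(\<integral>x. ?h x *\<^sub>R complex_of_real (?K x * ?S h x) \<partial>lborel) = complex_of_real (\<integral>x. ?h x * (?K x * ?S h x) \<partial>lborel)"
        unfolding integral_complex_of_real[symmetric] by (simp add: scaleR_conv_of_real)
      then have "norm (complex_of_real (\<integral>x. ?h x * (?K x * ?S h x) \<partial>lborel)) < 1 / 2" using j[OF h] by (simp only:)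
      then show ?thesis unfolding norm_of_real by linarith
    qed
    have "(\<integral>x. ?K x * (\<Sum>j\<in>insert j J. h (a j *\<^sub>R x))\<^sup>2 \<partial>lborel)
        = (\<integral>x. ?K x * (?S h x)\<^sup>2 + (2 * (?h x * (?K x * ?S h x)) + ?K x * (?h x)\<^sup>2) \<partial>lborel)"
      using J(1) jJ by (intro Bochner_Integration.integral_cong refl) (simp add: power2_eq_square algebra_simps)
    also have "... = (\<integral>x. ?K x * (?S h x)\<^sup>2 \<partial>lborel) + (2 * (\<integral>x. ?h x * (?K x * ?S h x) \<partial>lborel) + (\<integral>x. ?K x * (?h x)\<^sup>2 \<partial>lborel))"
      by (subst Bochner_Integration.integral_add[OF i1 Bochner_Integration.integrable_add[OF integrable_mult_right[OF i2] i3]],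
          subst Bochner_Integration.integral_add[OF integrable_mult_right[OF i2] i3], simp)
    also have "... \<le> n * (?V * B\<^sup>2 + 1) + (1 + ?V * B\<^sup>2)" using le[OF h] c2 c3 by linarith
    also have "... = Suc n * (?V * B\<^sup>2 + 1)" by (simp add: algebra_simps)
    finally show "(\<integral>x. ?K x * (\<Sum>j\<in>insert j J. h (a j *\<^sub>R x))\<^sup>2 \<partial>lborel) \<le> Suc n * (?V * B\<^sup>2 + 1)" .
  qed
qed

text \<open>Truncation at height \<open>M\<close> spoils the mean; subtracting the new mean
  \<open>c\<close> restores it. As \<open>|c|\<close> is at most the truncation error, each of the
  two costs \<open>e / 2\<close>.\<close>

lemma mean_zero_truncate:
  fixes h :: "real^'n::finite \<Rightarrow> real"
  assumes h: "mean_zero h" and e: "0 < e"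
  shows "\<exists>h' B. mean_zero h' \<and> (\<forall>x. \<bar>h' x\<bar> \<le> B) \<and> (\<integral>\<^sup>+x. ennreal \<bar>h x - h' x\<bar> \<partial>cell) \<le> ennreal e"
proof -
  interpret c: finite_measure "cell :: (real^'n) measure" by (rule bprob_finite[OF bprob_cell])
  have m1: "measure (cell :: (real^'n) measure) UNIV = 1" by (simp add: measure_def)
  have [measurable]: "h \<in> borel_measurable borel" and hi: "integrable cell h" by (rule mean_zeroD[OF h])+
  define T where "T M x = max (- real M) (min (real M) (h x))" for M :: nat and x
  have Tm [measurable]: "T M \<in> borel_measurable borel" for M unfolding T_def by measurable
  have TB: "\<bar>T M x\<bar> \<le> M" for M x by (auto simp: T_def)
  have Ti: "integrable cell (T M)" for M by (rule c.integrable_const_bound[where B = "real M"]) (auto simp: TB)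
  have "(\<lambda>M. \<integral>x. \<bar>h x - T M x\<bar> \<partial>cell) \<longlonglongrightarrow> (\<integral>x. 0 \<partial>(cell :: (real^'n) measure))"
  proof (rule integral_dominated_convergence)
    show "integrable cell (\<lambda>x. \<bar>h x\<bar>)" using hi by (rule integrable_abs)
    show "AE x in cell. (\<lambda>M. \<bar>h x - T M x\<bar>) \<longlonglongrightarrow> 0"
    proof (rule AE_I2)
      fix x
      obtain k where k: "\<bar>h x\<bar> \<le> real k" using real_arch_simple by blast
      have "eventually (\<lambda>M. 0 = \<bar>h x - T M x\<bar>) sequentially"
        using eventually_ge_at_top[of k] by (rule eventually_mono) (use k in \<open>auto simp: T_def\<close>)
      then show "(\<lambda>M. \<bar>h x - T M x\<bar>) \<longlonglongrightarrow> 0" by (rule Lim_transform_eventually[OF tendsto_const])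
    qed
    show "AE x in cell. norm \<bar>h x - T M x\<bar> \<le> \<bar>h x\<bar>" for M by (rule AE_I2) (auto simp: T_def)
    show "(\<lambda>x. \<bar>h x - T M x\<bar>) \<in> borel_measurable cell" for M by measurable
    show "(\<lambda>x. 0) \<in> borel_measurable (cell :: (real^'n) measure)" by measurable
  qed
  then have "(\<lambda>M. \<integral>x. \<bar>h x - T M x\<bar> \<partial>cell) \<longlonglongrightarrow> 0" by simp
  from order_tendstoD(2)[OF this, of "e / 2"] e obtain M where M: "(\<integral>x. \<bar>h x - T M x\<bar> \<partial>cell) < e / 2"
    by (auto simp: eventually_sequentially)
  define c where "c = (\<integral>x. T M x \<partial>cell)"
  have "\<bar>c\<bar> = \<bar>\<integral>x. h x - T M x \<partial>cell\<bar>"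
    using mean_zeroD(5)[OF h] by (simp add: c_def Bochner_Integration.integral_diff[OF hi Ti])
  also have "... \<le> (\<integral>x. \<bar>h x - T M x\<bar> \<partial>cell)" by (rule integral_abs_bound)
  finally have c: "\<bar>c\<bar> < e / 2" using M by simp
  let ?h = "\<lambda>x. T M x - c"
  have hi': "integrable cell ?h" using Ti by simp
  have "mean_zero ?h"
    unfolding mean_zero_def
  proof (intro conjI allI)
    show "(\<integral>x. ?h x \<partial>cell) = 0" using Ti by (simp add: c_def[symmetric] m1)
    show "T M (x - int_vec k) - c = T M x - c" for x k by (simp add: T_def mean_zeroD(2)[OF h])
  qed (use hi' in simp_all)
  moreover have "\<bar>?h x\<bar> \<le> M + \<bar>c\<bar>" for x using TB[of M x] by linarith
  moreover have "(\<integral>\<^sup>+x. ennreal \<bar>h x - ?h x\<bar> \<partial>cell) \<le> ennreal e"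
  proof -
    have i: "integrable cell (\<lambda>x. \<bar>h x - ?h x\<bar>)" by (rule integrable_abs[OF Bochner_Integration.integrable_diff[OF hi hi']])
    have i0: "integrable cell (\<lambda>x. \<bar>h x - T M x\<bar> + \<bar>c\<bar>)"
      by (rule Bochner_Integration.integrable_add[OF integrable_abs[OF Bochner_Integration.integrable_diff[OF hi Ti]] c.integrable_const])
    have "(\<integral>x. \<bar>h x - ?h x\<bar> \<partial>cell) \<le> (\<integral>x. \<bar>h x - T M x\<bar> + \<bar>c\<bar> \<partial>cell)"
      by (rule integral_mono[OF i i0]) linarith
    also have "... = (\<integral>x. \<bar>h x - T M x\<bar> \<partial>cell) + \<bar>c\<bar>"
      using hi Ti by (simp add: m1)
    finally have "(\<integral>x. \<bar>h x - ?h x\<bar> \<partial>cell) \<le> e" using M c by linarith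
    then show ?thesis using nn_integral_eq_integral[OF i] by (simp add: ennreal_leI)
  qed
  ultimately show ?thesis by blast
qed

text \<open>Integrals of \<open>r (\<alpha> x)\<close> over a fixed ball are controlled by the cell
  mean of \<open>r\<close> uniformly in \<open>\<alpha>\<close>. The truncation error is small in
  this mean only and has to be handled at every selected scale.\<close>

lemma nn_integral_periodic_ball:
  fixes r :: "real^'n::finite \<Rightarrow> ennreal"
  assumes [measurable]: "r \<in> borel_measurable borel" and per: "\<And>x k. r (int_vec k + x) = r x" and \<alpha>: "1 \<le> \<bar>\<alpha>\<bar>"
  shows "(\<integral>\<^sup>+x. indicator (cball 0 R) x * r (\<alpha> *\<^sub>R x) \<partial>lborel)
    \<le> emeasure lborel (cball 0 (R + CARD('n)) :: (real^'n) set) * (\<integral>\<^sup>+x. r x \<partial>cell)"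
proof -
  interpret pair_sigma_finite "cell :: (real^'n) measure" "count_space (UNIV :: (int^'n) set)" by (rule pair_sigma_finite_count[OF bprob_cell])
  have \<alpha>0: "\<alpha> \<noteq> 0" using \<alpha> by auto
  let ?d = "ennreal (\<bar>\<alpha>\<bar> ^ CARD('n))" and ?E = "emeasure lborel (cball 0 (R + CARD('n)) :: (real^'n) set)"
  let ?K = "indicator (cball 0 R) :: real^'n \<Rightarrow> ennreal"
  let ?F = "\<lambda>z. ?K (inverse \<alpha> *\<^sub>R z) * r z"
  have Fm: "?F \<in> borel_measurable borel" by measurable
  have "?d * (\<integral>\<^sup>+x. ?K x * r (\<alpha> *\<^sub>R x) \<partial>lborel) = (\<integral>\<^sup>+z. ?F z \<partial>lborel)"
    using nn_integral_dilate[OF Fm \<alpha>0] \<alpha>0 by simp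
  also have "... = (\<integral>\<^sup>+k. (\<integral>\<^sup>+y. ?F (int_vec k + y) \<partial>cell) \<partial>count_space UNIV)"
    by (rule nn_integral_tile[OF Fm, symmetric])
  also have "... = (\<integral>\<^sup>+k. (\<integral>\<^sup>+y. ?K (inverse \<alpha> *\<^sub>R (int_vec k + y)) * r y \<partial>cell) \<partial>count_space UNIV)"
    by (simp only: per)
  also have "... = (\<integral>\<^sup>+y. (\<integral>\<^sup>+k. ?K (inverse \<alpha> *\<^sub>R (int_vec k + y)) * r y \<partial>count_space UNIV) \<partial>cell)"
    by (rule Fubini') measurable
  also have "... = (\<integral>\<^sup>+y. (\<integral>\<^sup>+k. ?K (inverse \<alpha> *\<^sub>R (int_vec k + y)) \<partial>count_space UNIV) * r y \<partial>cell)"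
    by (simp add: nn_integral_multc)
  also have "... \<le> (\<integral>\<^sup>+y. (?d * ?E) * r y \<partial>cell)"
    by (intro nn_integral_mono mult_right_mono lattice_count_bound[OF \<alpha>]) auto
  also have "... = ?d * (?E * (\<integral>\<^sup>+x. r x \<partial>cell))"
    by (simp add: nn_integral_cmult mult.assoc)
  finally show ?thesis using \<alpha>0 by (simp add: ennreal_mult_le_mult_iff)
qed

lemma small_fraction:
  fixes E e k :: real
  assumes "0 \<le> E" "0 < e" "0 < k"
  shows "0 < e / (k * (E + 1))" "E * (e / (k * (E + 1))) \<le> e / k"
proof -
  show "0 < e / (k * (E + 1))" using assms by (intro divide_pos_pos mult_pos_pos) auto
  have "E * e / (E + 1) \<le> e" using assms by (simp add: pos_divide_le_eq algebra_simps)
  then have "E * e / (E + 1) / k \<le> e / k" using assms by (intro divide_right_mono) auto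
  then show "E * (e / (k * (E + 1))) \<le> e / k" by (simp add: mult.commute)
qed

text \<open>The lattice sum of a kernel may be unbounded when \<open>p = 1\<close>, so the second
  moment method is applied to truncations, and the rest is estimated in L^1.\<close>

lemma weak_law:
  fixes H :: "(real^'n::finite \<Rightarrow> real) set"
  assumes fin: "finite H" and mz: "\<And>h. h \<in> H ==> mean_zero h"
    and a: "\<And>j. a j \<noteq> 0" "filterlim (\<lambda>j. \<bar>a j\<bar>) at_top sequentially" and e: "0 < e"
  shows "\<exists>J::nat set. finite J \<and> J \<noteq> {} \<and> J \<subseteq> {N..} \<and> (\<forall>h\<in>H.
    (\<integral>\<^sup>+x. indicator (cball 0 R) x * ennreal \<bar>(\<Sum>j\<in>J. h (a j *\<^sub>R x)) / card J\<bar> \<partial>lborel) \<le> ennreal e)"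
proof -
  let ?K = "indicator (cball 0 R) :: real^'n \<Rightarrow> real" and ?V = "measure lborel (cball 0 R :: (real^'n) set)"
  let ?Ke = "indicator (cball 0 R) :: real^'n \<Rightarrow> ennreal"
  let ?E = "measure lborel (cball 0 (R + CARD('n)) :: (real^'n) set)"
  \<comment> \<open>\<open>?E\<close> is the uniform constant for integrals of periodic functions
    over the ball; the truncation errors then cost at most \<open>e / 2\<close>.\<close>
  define \<delta> where "\<delta> = e / (2 * (?E + 1))"
  have E0: "0 \<le> ?E" "0 \<le> ?V" by auto
  have \<delta>: "0 < \<delta>" and \<delta>E: "?E * \<delta> \<le> e / 2"
    using small_fraction[OF E0(1) e, of 2] by (simp_all add: \<delta>_def)
  have "\<forall>h\<in>H. \<exists>h' B. mean_zero h' \<and> (\<forall>x. \<bar>h' x\<bar> \<le> B) \<and> (\<integral>\<^sup>+x. ennreal \<bar>h x - h' x\<bar> \<partial>cell) \<le> ennreal \<delta>"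
    using mean_zero_truncate[OF mz \<delta>] by blast
  then obtain T b where T: "\<And>h. h \<in> H ==> mean_zero (T h)" "\<And>h x. h \<in> H ==> \<bar>T h x\<bar> \<le> b h"
      "\<And>h. h \<in> H ==> (\<integral>\<^sup>+x. ennreal \<bar>h x - T h x\<bar> \<partial>cell) \<le> ennreal \<delta>"
    by metis
  define B where "B = (\<Sum>h\<in>H. \<bar>b h\<bar>)"
  have TB: "\<bar>T h x\<bar> \<le> B" if "h \<in> H" for h x
    using T(2)[OF that, of x] member_le_sum[OF that, of "\<lambda>h. \<bar>b h\<bar>"] fin by (simp add: B_def)
  \<comment> \<open>\<open>\<theta>\<close> enters through
    \<open>|s| \<le> \<theta> + s^2 / \<theta>\<close>, which passes from the second moment to the
    first; integrated over the ball, its constant term costs \<open>e / 4\<close>.\<close>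
  define \<theta> where "\<theta> = e / (4 * (?V + 1))"
  have \<theta>: "0 < \<theta>" and \<theta>V: "\<theta> * ?V \<le> e / 4"
    using small_fraction[OF E0(2) e, of 4] by (simp_all add: \<theta>_def mult.commute)
  define C where "C = ?V * B\<^sup>2 + 1"
  have C: "0 < C" by (simp add: C_def add_nonneg_pos)
  \<comment> \<open>The mean of \<open>n\<close> terms has second moment at most
    \<open>n * C / n^2\<close>, which contributes \<open>C / (n * \<theta>)\<close>; it is to be at
    most \<open>e / 4\<close>.\<close>
  obtain n :: nat where n: "4 * C / (\<theta> * e) < n" using reals_Archimedean2 by blast
  have n0: "0 < real n" using n C \<theta> e by (smt (verit) divide_nonneg_pos mult_pos_pos)
  have nC: "C / (n * \<theta>) \<le> e / 4"
  proof -
    have "4 * C < n * (\<theta> * e)" using n \<theta> e by (simp add: pos_divide_less_eq)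
    then show ?thesis using n0 \<theta> by (simp add: field_simps)
  qed
  have "eventually (\<lambda>j. 1 \<le> \<bar>a j\<bar>) sequentially" using a(2)[unfolded filterlim_at_top] by (rule spec)
  then obtain N1 where N1: "\<And>j. N1 \<le> j ==> 1 \<le> \<bar>a j\<bar>" unfolding eventually_sequentially by auto
  \<comment> \<open>One set of scales serves all truncated functions. It starts beyond
    \<open>N1\<close>, so that \<open>|a j| \<ge> 1\<close> on it.\<close>
  have "\<exists>J::nat set. finite J \<and> J \<subseteq> {max N N1..} \<and> card J = n \<and> (\<forall>h\<in>T ` H.
    (\<integral>x. ?K x * (\<Sum>j\<in>J. h (a j *\<^sub>R x))\<^sup>2 \<partial>lborel) \<le> n * (?V * B\<^sup>2 + 1))"
    by (rule weak_law_bounded[OF _ _ _ a]) (use fin T(1) TB in auto)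
  then obtain J where J: "finite J" "J \<subseteq> {max N N1..}" "card J = n"
    and sq: "\<And>h. h \<in> H ==> (\<integral>x. ?K x * (\<Sum>j\<in>J. T h (a j *\<^sub>R x))\<^sup>2 \<partial>lborel) \<le> n * C"
    unfolding C_def by auto
  have Jn: "J \<noteq> {}" using J(3) n0 by auto
  have Km [measurable]: "?K \<in> borel_measurable borel" by (intro borel_measurable_indicator) simp
  have bound: "(\<integral>\<^sup>+x. ?Ke x * ennreal \<bar>(\<Sum>j\<in>J. h (a j *\<^sub>R x)) / card J\<bar> \<partial>lborel) \<le> ennreal e" if h: "h \<in> H" for h
  proof -
    have [measurable]: "h \<in> borel_measurable borel" "T h \<in> borel_measurable borel"
      by (rule mean_zeroD(1)[OF mz[OF h]], rule mean_zeroD(1)[OF T(1)[OF h]])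
    let ?S = "\<lambda>x. \<Sum>j\<in>J. T h (a j *\<^sub>R x)" and ?r = "\<lambda>x. \<bar>h x - T h x\<bar>"
    have p1: "(\<integral>\<^sup>+x. ?Ke x * ennreal \<bar>?S x / n\<bar> \<partial>lborel) \<le> ennreal (e / 2)"
    proof -
      have i: "integrable lborel (\<lambda>x. ?K x * (?S x)\<^sup>2)"
      proof (rule integrable_bounded_cball)
        fix x
        have "\<bar>?S x\<bar> \<le> n * B"
          using order_trans[OF sum_abs sum_bounded_above[of J "\<lambda>j. \<bar>T h (a j *\<^sub>R x)\<bar>" B, OF TB[OF h]]] J(3) by simp
        from power_mono[OF this, of 2] show "\<bar>?K x * (?S x)\<^sup>2\<bar> \<le> (n * B)\<^sup>2" by (auto split: split_indicator)
        show "?K x * (?S x)\<^sup>2 = 0" if "R < norm x" using that by simp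
      qed measurable
      have iK: "integrable lborel ?K" using emeasure_cball_eq[of R, where 'a = "real^'n"] by (intro integrable_real_indicator) auto
      have ib: "integrable lborel (\<lambda>x. \<theta> * ?K x + (1 / (n\<^sup>2 * \<theta>)) * (?K x * (?S x)\<^sup>2))"
        by (rule Bochner_Integration.integrable_add[OF integrable_mult_right[OF iK] integrable_mult_right[OF i]])
      have pt: "?Ke x * ennreal \<bar>?S x / n\<bar> \<le> ennreal (\<theta> * ?K x + (1 / (n\<^sup>2 * \<theta>)) * (?K x * (?S x)\<^sup>2))" for x
      proof (cases "x \<in> cball 0 R")
        case True
        have "\<bar>s\<bar> \<le> \<theta> + (1 / \<theta>) * s\<^sup>2" for s :: real
        proof (cases "\<bar>s\<bar> \<le> \<theta>")
          case True
          then show ?thesis using \<theta> by (simp add: add_increasing2)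
        next
          case False
          then have "\<theta> * \<bar>s\<bar> \<le> \<bar>s\<bar> * \<bar>s\<bar>" by (intro mult_right_mono) auto
          then have "\<bar>s\<bar> \<le> s\<^sup>2 / \<theta>" using \<theta> by (simp add: field_simps power2_eq_square)
          then show ?thesis using \<theta> by simp
        qed
        from this[of "?S x / n"] have "\<bar>?S x / n\<bar> \<le> \<theta> * 1 + (1 / (n\<^sup>2 * \<theta>)) * (1 * (?S x)\<^sup>2)"
          by (simp add: power_divide mult.commute)
        then show ?thesis using True by (auto intro: ennreal_leI)
      qed simp
      have "(\<integral>\<^sup>+x. ?Ke x * ennreal \<bar>?S x / n\<bar> \<partial>lborel) \<le> (\<integral>\<^sup>+x. ennreal (\<theta> * ?K x + (1 / (n\<^sup>2 * \<theta>)) * (?K x * (?S x)\<^sup>2)) \<partial>lborel)"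
        by (rule nn_integral_mono[OF pt])
      also have "... = ennreal (\<integral>x. \<theta> * ?K x + (1 / (n\<^sup>2 * \<theta>)) * (?K x * (?S x)\<^sup>2) \<partial>lborel)"
        by (rule nn_integral_eq_integral[OF ib]) (use \<theta> in auto)
      also have "(\<integral>x. \<theta> * ?K x + (1 / (n\<^sup>2 * \<theta>)) * (?K x * (?S x)\<^sup>2) \<partial>lborel) = \<theta> * ?V + (1 / (n\<^sup>2 * \<theta>)) * (\<integral>x. ?K x * (?S x)\<^sup>2 \<partial>lborel)"
        by (subst Bochner_Integration.integral_add[OF integrable_mult_right[OF iK] integrable_mult_right[OF i]]) simp
      also have "... \<le> \<theta> * ?V + (1 / (n\<^sup>2 * \<theta>)) * (n * C)"
        by (intro add_left_mono mult_left_mono sq h) (use \<theta> in auto)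
      also have "(1 / (n\<^sup>2 * \<theta>)) * (n * C) = C / (n * \<theta>)" using n0 by (simp add: power2_eq_square)
      also have "\<theta> * ?V + C / (n * \<theta>) \<le> e / 2" using \<theta>V nC by linarith
      finally show ?thesis by (simp add: ennreal_leI)
    qed
    have p2: "(\<integral>\<^sup>+x. ?Ke x * ennreal (?r (a j *\<^sub>R x)) \<partial>lborel) \<le> ennreal (e / 2)" if j: "j \<in> J" for j
    proof -
      have "(\<integral>\<^sup>+x. ?Ke x * ennreal (?r (a j *\<^sub>R x)) \<partial>lborel) \<le> ennreal ?E * (\<integral>\<^sup>+x. ennreal (?r x) \<partial>cell)"
        unfolding emeasure_cball_eq[symmetric]
      proof (rule nn_integral_periodic_ball[of "\<lambda>x. ennreal (?r x)"])
        show "1 \<le> \<bar>a j\<bar>" using J(2) j by (intro N1) auto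
      qed (use mean_zeroD(3)[OF mz[OF h]] mean_zeroD(3)[OF T(1)[OF h]] in auto)
      also have "... \<le> ennreal ?E * ennreal \<delta>" by (intro mult_left_mono T(3)[OF h]) auto
      also have "... = ennreal (?E * \<delta>)" using \<delta> by (simp add: ennreal_mult)
      also have "... \<le> ennreal (e / 2)" by (rule ennreal_leI[OF \<delta>E])
      finally show ?thesis .
    qed
    \<comment> \<open>The truncation error is split off scale by scale, each time with weight
      \<open>1 / n\<close>.\<close>
    have pt: "?Ke x * ennreal \<bar>(\<Sum>j\<in>J. h (a j *\<^sub>R x)) / n\<bar>
        \<le> ?Ke x * ennreal \<bar>?S x / n\<bar> + (\<Sum>j\<in>J. ennreal (1 / n) * (?Ke x * ennreal (?r (a j *\<^sub>R x))))" for x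
    proof -
      have "\<bar>(\<Sum>j\<in>J. h (a j *\<^sub>R x)) / n\<bar> = \<bar>?S x / n + (\<Sum>j\<in>J. (1 / n) * (h (a j *\<^sub>R x) - T h (a j *\<^sub>R x)))\<bar>"
        by (simp add: sum_subtractf sum_divide_distrib[symmetric] diff_divide_distrib)
      also have "... \<le> \<bar>?S x / n\<bar> + (\<Sum>j\<in>J. \<bar>(1 / n) * (h (a j *\<^sub>R x) - T h (a j *\<^sub>R x))\<bar>)"
        by (rule order_trans[OF abs_triangle_ineq add_left_mono[OF sum_abs]])
      also have "(\<Sum>j\<in>J. \<bar>(1 / n) * (h (a j *\<^sub>R x) - T h (a j *\<^sub>R x))\<bar>) = (\<Sum>j\<in>J. (1 / n) * ?r (a j *\<^sub>R x))"
        by (simp add: abs_mult)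
      finally have "ennreal \<bar>(\<Sum>j\<in>J. h (a j *\<^sub>R x)) / n\<bar> \<le> ennreal (\<bar>?S x / n\<bar> + (\<Sum>j\<in>J. (1 / n) * ?r (a j *\<^sub>R x)))" by (rule ennreal_leI)
      also have "... = ennreal \<bar>?S x / n\<bar> + ennreal (\<Sum>j\<in>J. (1 / n) * ?r (a j *\<^sub>R x))"
        by (intro ennreal_plus abs_ge_zero sum_nonneg) simp
      also have "ennreal (\<Sum>j\<in>J. (1 / n) * ?r (a j *\<^sub>R x)) = (\<Sum>j\<in>J. ennreal (1 / n) * ennreal (?r (a j *\<^sub>R x)))"
        by (subst sum_ennreal[symmetric]) (simp_all add: ennreal_mult'[symmetric])
      finally show ?thesis by (auto split: split_indicator)
    qed
    have "(\<integral>\<^sup>+x. ?Ke x * ennreal \<bar>(\<Sum>j\<in>J. h (a j *\<^sub>R x)) / n\<bar> \<partial>lborel)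
        \<le> (\<integral>\<^sup>+x. ?Ke x * ennreal \<bar>?S x / n\<bar> + (\<Sum>j\<in>J. ennreal (1 / n) * (?Ke x * ennreal (?r (a j *\<^sub>R x)))) \<partial>lborel)"
      by (rule nn_integral_mono[OF pt])
    also have "... = (\<integral>\<^sup>+x. ?Ke x * ennreal \<bar>?S x / n\<bar> \<partial>lborel) + (\<Sum>j\<in>J. ennreal (1 / n) * (\<integral>\<^sup>+x. ?Ke x * ennreal (?r (a j *\<^sub>R x)) \<partial>lborel))"
      by (simp add: nn_integral_add nn_integral_sum nn_integral_cmult)
    also have "... \<le> ennreal (e / 2) + (\<Sum>j\<in>J. ennreal (1 / n) * ennreal (e / 2))"
      by (intro add_mono p1 sum_mono mult_left_mono p2) auto
    also have "(\<Sum>j\<in>J. ennreal (1 / n) * ennreal (e / 2)) = ennreal (\<Sum>j\<in>J. (1 / n) * (e / 2))"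
      using e by (subst sum_ennreal[symmetric]) (simp_all add: ennreal_mult'[symmetric])
    also have "(\<Sum>j\<in>J. (1 / n) * (e / 2)) = e / 2" using J(3) n0 by simp
    also have "ennreal (e / 2) + ennreal (e / 2) = ennreal e" using e by (simp flip: ennreal_plus)
    finally show ?thesis by (simp only: J(3))
  qed
  moreover have "J \<subseteq> {N..}" using J(2) by auto
  ultimately show ?thesis using J(1) Jn by blast
qed

section \<open>Removal of the oscillating factor by averaging over scales\<close>

lemma mean_zero_tot:
  assumes "kernel p \<kappa>" shows "mean_zero (\<lambda>x. tot \<kappa> x - 1)"
  unfolding mean_zero_def
proof (intro conjI allI)
  interpret c: finite_measure "cell :: (real^'a) measure" by (rule bprob_finite[OF bprob_cell])
  have [measurable]: "tot \<kappa> \<in> borel_measurable borel" by (rule tot_measurable[OF kernelD(1)[OF assms]])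
  show "(\<lambda>x. tot \<kappa> x - 1) \<in> borel_measurable borel" by measurable
  show "tot \<kappa> (x - int_vec k) - 1 = tot \<kappa> x - 1" for x k by (simp add: tot_periodic)
  show "integrable cell (\<lambda>x. tot \<kappa> x - 1)" using tot_cell(1)[OF assms] by simp
  show "(\<integral>x. tot \<kappa> x - 1 \<partial>cell) = 0" using tot_cell[OF assms] by (simp add: measure_def)
qed

text \<open>A factor of bounded support localizes the weak law to a ball. One set \<open>J\<close>
  must serve the whole finite family, because all derivatives of a function are approximated with
  the same coefficients.\<close>

lemma averaged_periodic_small:
  fixes \<kappa> :: "'i \<Rightarrow> real^'n::finite \<Rightarrow> real"
  assumes I: "finite I" and \<kappa>: "\<And>i. i \<in> I ==> kernel p (\<kappa> i)" and p: "1 \<le> p" and g: "\<And>i. i \<in> I ==> g i \<in> Cc"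
    and a: "\<And>j. a j \<noteq> 0" "filterlim (\<lambda>j. \<bar>a j\<bar>) at_top sequentially" and e: "0 < e"
  shows "\<exists>J::nat set. finite J \<and> J \<noteq> {} \<and> J \<subseteq> {N..} \<and> (\<forall>i\<in>I.
     (\<lambda>x. of_real ((\<Sum>j\<in>J. tot (\<kappa> i) (a j *\<^sub>R x) - 1) / card J) * g i x) \<in> bLp p \<and>
     Lp_norm p (\<lambda>x. of_real ((\<Sum>j\<in>J. tot (\<kappa> i) (a j *\<^sub>R x) - 1) / card J) * g i x) \<le> e)"
proof -
  have m: "(\<lambda>x. of_real ((\<Sum>j\<in>J. tot (\<kappa> i) (a j *\<^sub>R x) - 1) / card J) * g i x) \<in> borel_measurable borel" if "i \<in> I" for i J
  proof -
    have [measurable]: "tot (\<kappa> i) \<in> borel_measurable borel" by (rule tot_measurable[OF kernelD(1)[OF \<kappa>[OF that]]])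
    have [measurable]: "g i \<in> borel_measurable borel" using Cc_bLp[OF g[OF that], of 1] by (simp add: bLp_def)
    show ?thesis by measurable
  qed
  have fin: "(\<lambda>x. of_real ((\<Sum>j\<in>J. tot (\<kappa> i) (a j *\<^sub>R x) - 1) / card J) * g i x) \<in> bLp p \<and>
     Lp_norm p (\<lambda>x. of_real ((\<Sum>j\<in>J. tot (\<kappa> i) (a j *\<^sub>R x) - 1) / card J) * g i x) \<le> e"
    if i: "i \<in> I" and le: "pint lborel p (\<lambda>x. of_real ((\<Sum>j\<in>J. tot (\<kappa> i) (a j *\<^sub>R x) - 1) / card J) * g i x) \<le> ennreal (e powr p)" for i J
  proof
    show b: "(\<lambda>x. of_real ((\<Sum>j\<in>J. tot (\<kappa> i) (a j *\<^sub>R x) - 1) / card J) * g i x) \<in> bLp p"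
      unfolding bLp_def using m[OF i] le_less_trans[OF le] by simp
    show "Lp_norm p (\<lambda>x. of_real ((\<Sum>j\<in>J. tot (\<kappa> i) (a j *\<^sub>R x) - 1) / card J) * g i x) \<le> e"
      by (rule Lp_norm_leI(2)[OF Lp_measurable[OF bLp_Lp[OF b]]]) (use p e le in \<open>auto simp: pint_lebesgue\<close>)
  qed
  show ?thesis
  proof (cases "p = 1")
    \<comment> \<open>For \<open>p > 1\<close> the lattice sums are 1 almost everywhere, so a single
      scale will do.\<close>
    case False
    then have p1: "1 < p" using p by simp
    have "pint lborel p (\<lambda>x. of_real ((\<Sum>j\<in>{N}. tot (\<kappa> i) (a j *\<^sub>R x) - 1) / card {N}) * g i x) \<le> ennreal (e powr p)" if i: "i \<in> I" for i
    proof -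
      have "AE x in lborel. tot (\<kappa> i) (a N *\<^sub>R x) = 1" by (rule AE_dilate[OF tot_eq_1[OF \<kappa>[OF i] p1] a(1)])
      then have "AE x in lborel. of_real ((\<Sum>j\<in>{N}. tot (\<kappa> i) (a j *\<^sub>R x) - 1) / card {N}) * g i x = 0" by eventually_elim simp
      then have "pint lborel p (\<lambda>x. of_real ((\<Sum>j\<in>{N}. tot (\<kappa> i) (a j *\<^sub>R x) - 1) / card {N}) * g i x) = pint lborel p (\<lambda>x :: real^'n. 0)"
        by (rule pint_cong_AE)
      also have "... = 0" by (simp add: pint_def)
      finally show ?thesis by simp
    qed
    note P = this
    show ?thesis
    proof (rule exI[of _ "{N}"], intro conjI ballI)
      fix i assume i: "i \<in> I"
      note F = fin[OF i P[OF i]]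
      show "(\<lambda>x. of_real ((\<Sum>j\<in>{N}. tot (\<kappa> i) (a j *\<^sub>R x) - 1) / card {N}) * g i x) \<in> bLp p" by (rule conjunct1[OF F])
      show "Lp_norm p (\<lambda>x. of_real ((\<Sum>j\<in>{N}. tot (\<kappa> i) (a j *\<^sub>R x) - 1) / card {N}) * g i x) \<le> e" by (rule conjunct2[OF F])
    qed simp_all
  next
    case True
    have "\<forall>i\<in>I. \<exists>B R. 0 < B \<and> 0 < R \<and> (\<forall>x. norm (g i x) \<le> B) \<and> (\<forall>x. R < norm x \<longrightarrow> g i x = 0)"
      using Cc_bounds[OF g] by metis
    then obtain B0 R0 where BR: "\<And>i. i \<in> I ==> 0 < B0 i \<and> 0 < R0 i \<and> (\<forall>x. norm (g i x) \<le> B0 i) \<and> (\<forall>x. R0 i < norm x \<longrightarrow> g i x = 0)"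
      by metis
    define B where "B = (\<Sum>i\<in>I. B0 i) + 1"
    define R where "R = (\<Sum>i\<in>I. R0 i)"
    have s: "B0 i \<le> B" "R0 i \<le> R" if "i \<in> I" for i
      using member_le_sum[OF that, of B0] member_le_sum[OF that, of R0] I BR by (auto simp: B_def R_def less_imp_le)
    have B: "0 < B" unfolding B_def using BR by (intro add_nonneg_pos sum_nonneg) (auto intro: less_imp_le)
    have gB: "norm (g i x) \<le> B * indicator (cball 0 R) x" if "i \<in> I" for i x
    proof (cases "norm x \<le> R")
      case True
      then show ?thesis using BR[OF that] s(1)[OF that] by (auto intro: order_trans)
    next
      case False
      then have "R0 i < norm x" using s(2)[OF that] by simp
      then show ?thesis using BR[OF that] B by simp
    qed
    have eB: "0 < e / B" using e B by simp
    have mz: "mean_zero h" if "h \<in> (\<lambda>i x. tot (\<kappa> i) x - 1) ` I" for h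
      using that mean_zero_tot[OF \<kappa>] by auto
    from weak_law[OF finite_imageI[OF I] mz a eB, of "\<lambda>i x. tot (\<kappa> i) x - 1" N R] obtain J
      where J: "finite J" "J \<noteq> {}" "J \<subseteq> {N..}"
        and W: "\<And>i. i \<in> I ==> (\<integral>\<^sup>+x. indicator (cball 0 R) x * ennreal \<bar>(\<Sum>j\<in>J. tot (\<kappa> i) (a j *\<^sub>R x) - 1) / card J\<bar> \<partial>lborel) \<le> ennreal (e / B)"
      by (auto simp del: abs_divide)
    have "pint lborel p (\<lambda>x. of_real ((\<Sum>j\<in>J. tot (\<kappa> i) (a j *\<^sub>R x) - 1) / card J) * g i x) \<le> ennreal (e powr p)" if i: "i \<in> I" for i
    proof -
      let ?s = "\<lambda>x. (\<Sum>j\<in>J. tot (\<kappa> i) (a j *\<^sub>R x) - 1) / card J"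
      have [measurable]: "tot (\<kappa> i) \<in> borel_measurable borel" by (rule tot_measurable[OF kernelD(1)[OF \<kappa>[OF i]]])
      have "pint lborel p (\<lambda>x. of_real (?s x) * g i x) \<le> (\<integral>\<^sup>+x. ennreal B * (indicator (cball 0 R) x * ennreal \<bar>?s x\<bar>) \<partial>lborel)"
        unfolding pint_def True
      proof (rule nn_integral_mono)
        fix x
        have "norm (of_real (?s x) * g i x) \<le> \<bar>?s x\<bar> * (B * indicator (cball 0 R) x)"
          unfolding norm_mult norm_of_real by (rule mult_left_mono[OF gB[OF i]]) simp
        then have "ennreal (norm (of_real (?s x) * g i x) powr 1) \<le> ennreal (\<bar>?s x\<bar> * (B * indicator (cball 0 R) x))" by (simp add: ennreal_leI)
        also have "... = ennreal B * (indicator (cball 0 R) x * ennreal \<bar>?s x\<bar>)"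
        proof -
          have "ennreal (s * (B * indicator (cball 0 R) x)) = ennreal B * (indicator (cball 0 R) x * ennreal s)" if "0 \<le> s" for s
            using B that by (cases "x \<in> cball 0 R") (simp_all add: ennreal_mult[symmetric] mult.commute)
          from this[of "\<bar>?s x\<bar>"] show ?thesis by simp
        qed
        finally show "ennreal (norm (of_real (?s x) * g i x) powr 1) \<le> ennreal B * (indicator (cball 0 R) x * ennreal \<bar>?s x\<bar>)" .
      qed
      also have "... = ennreal B * (\<integral>\<^sup>+x. indicator (cball 0 R) x * ennreal \<bar>?s x\<bar> \<partial>lborel)"
        by (rule nn_integral_cmult) measurable
      also have "... \<le> ennreal B * ennreal (e / B)" by (intro mult_left_mono W i) auto
      also have "... = ennreal (e powr p)" using B e True by (simp add: ennreal_mult'[symmetric])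
      finally show ?thesis .
    qed
    then show ?thesis using J fin by blast
  qed
qed

text \<open>In the application \<open>W i j\<close> is the scaled difference of order
  \<open>i\<close> at scale \<open>a j\<close>, and \<open>D i\<close> the derivative to which it
  tends. The error splits into replacing \<open>W\<close> by a continuous function
  (\<open>?Z\<close>), its quasi-interpolation (\<open>?X\<close>), the averaged oscillation
  (\<open>?Y\<close>) and the return to \<open>D\<close> (\<open>?G\<close>).\<close>

lemma mean_approx:
  fixes \<kappa> :: "'i \<Rightarrow> real^'n::finite \<Rightarrow> real"
  assumes I: "finite I" and \<kappa>: "\<And>i. i \<in> I ==> kernel p (\<kappa> i)" and p: "1 \<le> p"
    and D: "\<And>i. i \<in> I ==> D i \<in> bLp p" and W: "\<And>i j. i \<in> I ==> W i j \<in> bLp p"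
    and lim: "\<And>i. i \<in> I ==> (\<lambda>j. Lp_norm p (\<lambda>x. W i j x - D i x)) \<longlonglongrightarrow> 0"
    and a: "\<And>j. a j \<noteq> 0" "filterlim (\<lambda>j. \<bar>a j\<bar>) at_top sequentially" and e: "0 < e"
  shows "\<exists>J::nat set. finite J \<and> J \<noteq> {} \<and> J \<subseteq> {N..} \<and> (\<forall>i\<in>I.
    Lp_norm p (\<lambda>x. (\<Sum>j\<in>J. Qop (\<kappa> i) (a j) (W i j) x) / card J - D i x) < e)"
proof -
  \<comment> \<open>At each scale \<open>?Z\<close> costs \<open>e / 3\<close> and \<open>?X\<close>
    costs \<open>e / 6\<close>, hence \<open>e / 2\<close> in the mean; \<open>?Y\<close> and
    \<open>?G\<close> cost \<open>e / 6\<close> each.\<close>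
  have e6: "0 < e / 6" using e by simp
  have "\<forall>i\<in>I. \<exists>g. g \<in> Cc \<and> Lp_norm p (\<lambda>x. D i x - g x) < e / 6"
    using Cc_dense[OF p bLp_Lp[OF D] e6] by blast
  then obtain g where g: "\<And>i. i \<in> I ==> g i \<in> Cc" and gD: "\<And>i. i \<in> I ==> Lp_norm p (\<lambda>x. D i x - g i x) < e / 6" by metis
  have gb: "g i \<in> bLp p" if "i \<in> I" for i using g[OF that] p by (intro Cc_bLp) auto
  let ?X = "\<lambda>i j x. Qop (\<kappa> i) (a j) (g i) x - of_real (tot (\<kappa> i) (a j *\<^sub>R x)) * g i x"
  have "eventually (\<lambda>j. \<forall>i\<in>I. (?X i j \<in> bLp p \<and> Lp_norm p (?X i j) < e / 6) \<and> Lp_norm p (\<lambda>x. W i j x - D i x) < e / 6) sequentially"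
  proof (rule eventually_ball_finite[OF I], intro ballI, rule eventually_conj)
    fix i assume i: "i \<in> I"
    show "eventually (\<lambda>j. ?X i j \<in> bLp p \<and> Lp_norm p (?X i j) < e / 6) sequentially"
      by (rule Qop_approx[OF \<kappa>[OF i] p g[OF i] a e6])
    show "eventually (\<lambda>j. Lp_norm p (\<lambda>x. W i j x - D i x) < e / 6) sequentially"
      using order_tendstoD(2)[OF lim[OF i] e6] .
  qed
  then obtain N1 where N1: "\<And>i j. i \<in> I ==> N1 \<le> j ==> ?X i j \<in> bLp p"
      "\<And>i j. i \<in> I ==> N1 \<le> j ==> Lp_norm p (?X i j) < e / 6"
      "\<And>i j. i \<in> I ==> N1 \<le> j ==> Lp_norm p (\<lambda>x. W i j x - D i x) < e / 6"
    unfolding eventually_sequentially by blast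
  from averaged_periodic_small[OF I \<kappa> p g a e6, where N = "max N N1"]
  obtain J where JJ: "finite J \<and> J \<noteq> {} \<and> J \<subseteq> {max N N1..} \<and> (\<forall>i\<in>I. (\<lambda>x. of_real ((\<Sum>j\<in>J. tot (\<kappa> i) (a j *\<^sub>R x) - 1) / card J) * g i x) \<in> bLp p \<and>
     Lp_norm p (\<lambda>x. of_real ((\<Sum>j\<in>J. tot (\<kappa> i) (a j *\<^sub>R x) - 1) / card J) * g i x) \<le> e / 6)"
    by (rule exE)
  note J = JJ[THEN conjunct1] JJ[THEN conjunct2, THEN conjunct1] JJ[THEN conjunct2, THEN conjunct2, THEN conjunct1]
  note Y = bspec[OF JJ[THEN conjunct2, THEN conjunct2, THEN conjunct2]]
  define n where "n = real (card J)"
  have n: "0 < n" using J by (simp add: n_def card_gt_0_iff)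
  have "Lp_norm p (\<lambda>x. (\<Sum>j\<in>J. Qop (\<kappa> i) (a j) (W i j) x) / card J - D i x) < e" if i: "i \<in> I" for i
  proof -
    let ?Y = "\<lambda>x. of_real ((\<Sum>j\<in>J. tot (\<kappa> i) (a j *\<^sub>R x) - 1) / n) * g i x"
    let ?Z = "\<lambda>j x. Qop (\<kappa> i) (a j) (W i j) x - Qop (\<kappa> i) (a j) (g i) x"
    let ?G = "\<lambda>x. g i x - D i x"
    have jN: "N1 \<le> j" if "j \<in> J" for j using J(3) that by auto
    have Q: "Qop (\<kappa> i) (a j) U \<in> bLp p" if "U \<in> bLp p" for U j by (rule bLp_Qop[OF \<kappa>[OF i] a(1) p that])
    have Zb: "?Z j \<in> bLp p" for j by (intro bLp_diff p Q W gb i)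
    have Z: "Lp_norm p (?Z j) < e / 3" if j: "j \<in> J" for j
    proof -
      have d: "(\<lambda>x. W i j x - g i x) \<in> bLp p" by (intro bLp_diff p W gb i)
      have "AE x in lebesgue. ?Z j x = Qop (\<kappa> i) (a j) (\<lambda>x. W i j x - g i x) x"
        using Qop_diff_AE[OF \<kappa>[OF i] a(1)[of j] p W[OF i, of j] gb[OF i]] by (intro AE_completion) (auto elim: eventually_mono)
      then have "Lp_norm p (?Z j) = Lp_norm p (Qop (\<kappa> i) (a j) (\<lambda>x. W i j x - g i x))"
        using p by (intro Lp_norm_cong_AE bLp_Lp Q d) auto
      also have "... \<le> Lp_norm p (\<lambda>x. W i j x - g i x)" by (rule Lp_norm_Qop[OF \<kappa>[OF i] a(1) p d])
      also have "... \<le> Lp_norm p (\<lambda>x. W i j x - D i x) + Lp_norm p (\<lambda>x. D i x - g i x)"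
        by (intro Lp_norm_three p bLp_Lp W D gb i)
      finally show ?thesis using N1(3)[OF i jN[OF j]] gD[OF i] by simp
    qed
    let ?A = "\<lambda>x. \<Sum>j\<in>J. of_real (1 / n) * (?Z j x + ?X i j x)"
    have ZX: "(\<lambda>x. ?Z j x + ?X i j x) \<in> bLp p" if "j \<in> J" for j by (intro bLp_add p Zb N1(1)[OF i jN[OF that]])
    have Ab: "?A \<in> Lp p" by (intro Lp_sum p Lp_cmult bLp_Lp ZX)
    have A: "Lp_norm p ?A \<le> e / 2"
    proof -
      have "Lp_norm p ?A \<le> (\<Sum>j\<in>J. Lp_norm p (\<lambda>x. of_real (1 / n) * (?Z j x + ?X i j x)))"
        by (rule Lp_norm_sum_le[OF p]) (intro Lp_cmult bLp_Lp ZX)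
      also have "... \<le> (\<Sum>j\<in>J. (1 / n) * (e / 2))"
      proof (rule sum_mono)
        fix j assume j: "j \<in> J"
        have "Lp_norm p (\<lambda>x. of_real (1 / n) * (?Z j x + ?X i j x)) = (1 / n) * Lp_norm p (\<lambda>x. ?Z j x + ?X i j x)"
          using Lp_norm_cmult[of p "of_real (1 / n)" "\<lambda>x. ?Z j x + ?X i j x"] p n by (simp only: norm_of_real) simp
        also have "Lp_norm p (\<lambda>x. ?Z j x + ?X i j x) \<le> Lp_norm p (?Z j) + Lp_norm p (?X i j)"
          by (intro Lp_norm_triangle p bLp_Lp Zb N1(1)[OF i jN[OF j]])
        then have "(1 / n) * Lp_norm p (\<lambda>x. ?Z j x + ?X i j x) \<le> (1 / n) * (e / 2)"
          using Z[OF j] N1(2)[OF i jN[OF j]] n by (intro mult_left_mono) auto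
        finally show "Lp_norm p (\<lambda>x. of_real (1 / n) * (?Z j x + ?X i j x)) \<le> (1 / n) * (e / 2)" .
      qed
      also have "... = e / 2" using n by (simp add: n_def)
      finally show ?thesis .
    qed
    have Yb: "?Y \<in> bLp p" and Yn: "Lp_norm p ?Y \<le> e / 6" using Y[OF i] by (simp_all only: n_def)
    have Gb: "?G \<in> bLp p" by (intro bLp_diff p gb D i)
    \<comment> \<open>\<open>?A\<close> contains the mean of \<open>tot * g\<close> with a minus
      sign and \<open>?Y\<close> with a plus sign, so the lattice sums cancel; the \<open>g\<close>
      left over cancels against \<open>?G\<close>.\<close>
    have eq: "(\<Sum>j\<in>J. Qop (\<kappa> i) (a j) (W i j) x) / card J - D i x = ?A x + (?Y x + ?G x)" for x
    proof -
      let ?c = "complex_of_real (1 / n)" and ?T = "\<Sum>j\<in>J. complex_of_real (tot (\<kappa> i) (a j *\<^sub>R x))"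
        and ?q = "\<Sum>j\<in>J. Qop (\<kappa> i) (a j) (W i j) x"
      have "?A x = (\<Sum>j\<in>J. ?c * (Qop (\<kappa> i) (a j) (W i j) x - of_real (tot (\<kappa> i) (a j *\<^sub>R x)) * g i x))"
        by (intro sum.cong refl) simp
      also have "... = ?c * (?q - ?T * g i x)"
        by (simp only: sum_distrib_left[symmetric] sum_subtractf sum_distrib_right[symmetric])
      finally have A1: "?A x = ?c * (?q - ?T * g i x)" .
      have Y1: "?Y x = ?c * (?T - of_nat (card J)) * g i x" by (simp add: sum_subtractf)
      have cn: "?c * of_nat (card J) = 1" using n by (simp add: n_def)
      have "u * (q - T * y) + (u * (T - k) * y + (y - d)) = u * q + (1 - u * k) * y - d" for u q T y k d :: complex
        by (simp add: algebra_simps)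
      from this[of ?c ?q ?T "g i x" "of_nat (card J)" "D i x"]
      have "?A x + (?Y x + ?G x) = ?c * ?q - D i x" unfolding A1 Y1 cn by simp
      moreover have "?c * ?q = ?q / card J" by (simp add: n_def)
      ultimately show ?thesis by (simp only:)
    qed
    have "Lp_norm p (\<lambda>x. ?A x + (?Y x + ?G x)) \<le> Lp_norm p ?A + Lp_norm p (\<lambda>x. ?Y x + ?G x)"
      by (intro Lp_norm_triangle p Ab bLp_Lp bLp_add Yb Gb)
    also have "Lp_norm p (\<lambda>x. ?Y x + ?G x) \<le> Lp_norm p ?Y + Lp_norm p ?G"
      by (intro Lp_norm_triangle p bLp_Lp Yb Gb)
    also have "Lp_norm p ?G < e / 6" using gD[OF i] Lp_norm_minus_commute[of p "g i" "D i"] by simp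
    finally have "Lp_norm p (\<lambda>x. ?A x + (?Y x + ?G x)) < e" using A Yn e by simp
    then show ?thesis by (simp only: eq)
  qed
  moreover have "J \<subseteq> {N..}" using J(3) by auto
  ultimately show ?thesis using J(1,2) by blast
qed

section \<open>Weak derivatives under dilation\<close>

lemma mat_mult_scaleR: "(mat c :: real^'n::finite^'n) *v x = c *\<^sub>R x"
proof -
  have "(\<Sum>j\<in>UNIV. (mat c :: real^'n^'n) $ i $ j * x $ j) = c * x $ i" for i
  proof -
    have "(\<Sum>j\<in>UNIV. (mat c :: real^'n^'n) $ i $ j * x $ j) = (\<Sum>j\<in>UNIV. if j = i then c * x $ j else 0)"
      by (rule sum.cong) (auto simp: mat_def)
    then show ?thesis by (simp only: sum.delta finite UNIV_I if_True)
  qed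
  then show ?thesis by (simp only: vec_eq_iff matrix_vector_mult_def vec_lambda_beta vector_scaleR_component) simp
qed

lemma det_mat: "det (mat c :: real^'n::finite^'n) = c ^ CARD('n)"
proof -
  have "det (mat c :: real^'n^'n) = (\<Prod>i\<in>UNIV. (mat c :: real^'n^'n) $ i $ i)"
    by (rule det_diagonal) (simp add: mat_def)
  then show ?thesis by (simp add: mat_def)
qed

lemma invertible_mat: "c \<noteq> 0 ==> invertible (mat c :: real^'n::finite^'n)"
  by (simp add: invertible_det_nz det_mat)

lemma multi_op_partial_scale:
  fixes \<phi> :: "real^'n::finite \<Rightarrow> real"
  assumes t: "test_function \<phi>" and c: "c \<noteq> 0"
  shows "test_function (\<lambda>z. \<phi> (c *\<^sub>R z))"
    "multi_op partial \<rho> (\<lambda>z. \<phi> (c *\<^sub>R z)) = (\<lambda>z. c ^ mdeg \<rho> * multi_op partial \<rho> \<phi> (c *\<^sub>R z))"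
proof -
  have tt: "test_function (\<lambda>z. \<theta> (c *\<^sub>R z))" if "test_function \<theta>" for \<theta> :: "real^'n \<Rightarrow> real"
    using test_function_affine[OF that invertible_mat[OF c], of 0] by (simp only: mat_mult_scaleR add_0_right)
  then show t': "test_function (\<lambda>z. \<phi> (c *\<^sub>R z))" using t .
  have p: "partial i (\<lambda>z. \<theta> (c *\<^sub>R z)) = (\<lambda>z. c * partial i \<theta> (c *\<^sub>R z))" if "test_function \<theta>" for i and \<theta> :: "real^'n \<Rightarrow> real"
  proof -
    have "(\<Sum>s\<in>UNIV. (mat c :: real^'n^'n) $ s $ i * d s) = c * d i" for d :: "'n \<Rightarrow> real"
    proof -
      have "(\<Sum>s\<in>UNIV. (mat c :: real^'n^'n) $ s $ i * d s) = (\<Sum>s\<in>UNIV. if s = i then c * d s else 0)"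
        by (rule sum.cong) (auto simp: mat_def)
      then show ?thesis by (simp only: sum.delta finite UNIV_I if_True)
    qed
    with partial_affine[OF test_function_C_k[OF that, of "Suc 0"], of i "mat c" 0]
    show ?thesis by (simp only: mat_mult_scaleR add_0_right)
  qed
  show "multi_op partial \<rho> (\<lambda>z. \<phi> (c *\<^sub>R z)) = (\<lambda>z. c ^ mdeg \<rho> * multi_op partial \<rho> \<phi> (c *\<^sub>R z))"
  proof (induction \<rho> rule: multiindex_induct)
    case (inc \<rho> i)
    have "multi_op partial (inc i \<rho>) (\<lambda>z. \<phi> (c *\<^sub>R z)) = partial i (\<lambda>z. c ^ mdeg \<rho> * multi_op partial \<rho> \<phi> (c *\<^sub>R z))"
      unfolding multi_op_partial_inc(2)[OF t'] inc.IH ..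
    also have "... = (\<lambda>z. c ^ mdeg \<rho> * partial i (\<lambda>z. multi_op partial \<rho> \<phi> (c *\<^sub>R z)) z)"
      by (rule partial_cmult[OF test_function_C_k[OF tt[OF test_function_multi_op[OF t]], of "Suc 0"]])
    also have "... = (\<lambda>z. c ^ mdeg (inc i \<rho>) * multi_op partial (inc i \<rho>) \<phi> (c *\<^sub>R z))"
      unfolding p[OF test_function_multi_op[OF t]] multi_op_partial_inc(2)[OF t] mdeg_inc by (simp add: fun_eq_iff)
    finally show ?case .
  qed simp
qed

lemma bLp_dilate:
  fixes U :: "real^'n::finite \<Rightarrow> complex"
  assumes U: "U \<in> bLp p" and \<alpha>: "\<alpha> \<noteq> 0" shows "(\<lambda>x. U (\<alpha> *\<^sub>R x)) \<in> bLp p"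
proof -
  have m [measurable]: "U \<in> borel_measurable borel" using U by (simp add: bLp_def)
  have "ennreal (\<bar>\<alpha>\<bar> ^ CARD('n)) * pint lborel p (\<lambda>x. U (\<alpha> *\<^sub>R x)) < \<infinity>"
    using pint_dilate[OF m \<alpha>] U by (simp add: bLp_def)
  then show ?thesis using \<alpha> by (auto simp: bLp_def ennreal_mult_less_top)
qed

text \<open>The chain rule, by testing with \<open>\<phi> (inverse \<alpha> z)\<close>; the Jacobian
  occurs on both sides and cancels.\<close>

lemma has_weak_deriv_dilate:
  fixes U G :: "real^'n::finite \<Rightarrow> complex"
  assumes p: "1 \<le> p" and U: "U \<in> bLp p" and G: "G \<in> bLp p" and wd: "has_weak_deriv \<rho> U G" and \<alpha>: "\<alpha> \<noteq> 0"
  shows "has_weak_deriv \<rho> (\<lambda>x. U (\<alpha> *\<^sub>R x)) (\<lambda>x. of_real \<alpha> ^ mdeg \<rho> * G (\<alpha> *\<^sub>R x))"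
  unfolding has_weak_deriv_def
proof (intro conjI allI impI)
  show "locally_integrable (\<lambda>x. U (\<alpha> *\<^sub>R x))" "locally_integrable (\<lambda>x. of_real \<alpha> ^ mdeg \<rho> * G (\<alpha> *\<^sub>R x))"
    by (intro Lp_locally_integrable[OF p] bLp_Lp bLp_cmult bLp_dilate U G \<alpha>)+
  fix \<phi> :: "real^'n \<Rightarrow> real" assume t: "test_function \<phi>"
  let ?c = "inverse \<alpha>"
  have c: "?c \<noteq> 0" using \<alpha> by simp
  let ?\<psi> = "\<lambda>z. \<phi> (?c *\<^sub>R z)"
  note t' = multi_op_partial_scale[OF t c]
  have Um [measurable]: "U \<in> borel_measurable borel" "G \<in> borel_measurable borel" using U G by (auto simp: bLp_def)
  have d: "(\<bar>\<alpha>\<bar> ^ CARD('n)) *\<^sub>R (\<integral>x. \<theta> x *\<^sub>R W (\<alpha> *\<^sub>R x) \<partial>lebesgue) = (\<integral>z. \<theta> (?c *\<^sub>R z) *\<^sub>R W z \<partial>lebesgue)"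
    if \<theta>: "test_function \<theta>" and W [measurable]: "W \<in> borel_measurable borel" for \<theta> and W :: "real^'n \<Rightarrow> complex"
  proof -
    have [measurable]: "\<theta> \<in> borel_measurable borel" by (rule test_function_measurable[OF \<theta>])
    have "(\<integral>z. \<theta> (?c *\<^sub>R z) *\<^sub>R W z \<partial>lborel) = (\<bar>\<alpha>\<bar> ^ CARD('n)) *\<^sub>R (\<integral>x. \<theta> (?c *\<^sub>R \<alpha> *\<^sub>R x) *\<^sub>R W (\<alpha> *\<^sub>R x) \<partial>lborel)"
      by (rule integral_dilate[OF _ \<alpha>]) measurable
    then have "(\<integral>z. \<theta> (?c *\<^sub>R z) *\<^sub>R W z \<partial>lborel) = (\<bar>\<alpha>\<bar> ^ CARD('n)) *\<^sub>R (\<integral>x. \<theta> x *\<^sub>R W (\<alpha> *\<^sub>R x) \<partial>lborel)"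
      using \<alpha> by simp
    then show ?thesis by (subst (1 2) integral_lebesgue_lborel) auto
  qed
  let ?r = "mdeg \<rho>"
  have "(\<bar>\<alpha>\<bar> ^ CARD('n)) *\<^sub>R (\<integral>x. multi_op partial \<rho> \<phi> x *\<^sub>R U (\<alpha> *\<^sub>R x) \<partial>lebesgue)
      = (\<integral>z. multi_op partial \<rho> \<phi> (?c *\<^sub>R z) *\<^sub>R U z \<partial>lebesgue)"
    by (rule d[OF test_function_multi_op[OF t] Um(1)])
  also have "... = (\<integral>z. \<alpha> ^ ?r *\<^sub>R (multi_op partial \<rho> ?\<psi> z *\<^sub>R U z) \<partial>lebesgue)"
  proof -
    have "\<alpha> ^ ?r * (?c ^ ?r * y) = y" for y using \<alpha> by (simp add: power_inverse mult.assoc[symmetric])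
    then show ?thesis unfolding t'(2) by (simp only: scaleR_scaleR)
  qed
  also have "... = \<alpha> ^ ?r *\<^sub>R ((- 1) ^ ?r * (\<integral>z. ?\<psi> z *\<^sub>R G z \<partial>lebesgue))"
    unfolding has_weak_derivD[OF wd t'(1), symmetric] by (rule integral_scaleR_right)
  also have "(\<integral>z. ?\<psi> z *\<^sub>R G z \<partial>lebesgue) = (\<bar>\<alpha>\<bar> ^ CARD('n)) *\<^sub>R (\<integral>x. \<phi> x *\<^sub>R G (\<alpha> *\<^sub>R x) \<partial>lebesgue)"
    by (rule d[OF t Um(2), symmetric])
  also have "\<alpha> ^ ?r *\<^sub>R ((- 1) ^ ?r * ((\<bar>\<alpha>\<bar> ^ CARD('n)) *\<^sub>R (\<integral>x. \<phi> x *\<^sub>R G (\<alpha> *\<^sub>R x) \<partial>lebesgue)))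
      = (\<bar>\<alpha>\<bar> ^ CARD('n)) *\<^sub>R ((- 1) ^ ?r * (of_real \<alpha> ^ ?r * (\<integral>x. \<phi> x *\<^sub>R G (\<alpha> *\<^sub>R x) \<partial>lebesgue)))"
    by (simp add: scaleR_conv_of_real)
  also have "of_real \<alpha> ^ ?r * (\<integral>x. \<phi> x *\<^sub>R G (\<alpha> *\<^sub>R x) \<partial>lebesgue) = (\<integral>x. \<phi> x *\<^sub>R (of_real \<alpha> ^ ?r * G (\<alpha> *\<^sub>R x)) \<partial>lebesgue)"
    by (simp add: mult_scaleR_right[symmetric] del: mult_scaleR_right)
  finally show "(\<integral>x. multi_op partial \<rho> \<phi> x *\<^sub>R U (\<alpha> *\<^sub>R x) \<partial>lebesgue)
      = (- 1) ^ ?r * (\<integral>x. \<phi> x *\<^sub>R (of_real \<alpha> ^ ?r * G (\<alpha> *\<^sub>R x)) \<partial>lebesgue)"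
    using \<alpha> by simp
qed

subsection \<open>Sobolev norms\<close>

text \<open>By uniqueness almost everywhere any family of weak derivatives computes the norm, so the
  arbitrary choice in \<open>weak_deriv\<close> need not be looked at again.\<close>

lemma sobolevI:
  fixes f :: "real^'n::finite \<Rightarrow> complex"
  assumes p: "1 \<le> p" and G: "\<And>\<rho>. mdeg \<rho> \<le> m ==> has_weak_deriv \<rho> f (G \<rho>)" "\<And>\<rho>. mdeg \<rho> \<le> m ==> G \<rho> \<in> Lp p"
  shows "f \<in> sobolev m p" "sobolev_norm m p f = (\<Sum>\<rho> | mdeg \<rho> \<le> m. Lp_norm p (G \<rho>))"
proof -
  have z: "mdeg (\<lambda>_ :: 'n. 0) \<le> m" by simp
  have "has_weak_deriv (\<lambda>_. 0) f f" by (rule has_weak_deriv_zero[OF has_weak_deriv_locally(1)[OF G(1)[OF z]]])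
  then have "AE x in lebesgue. f x = G (\<lambda>_. 0) x" by (rule has_weak_deriv_unique[OF _ G(1)[OF z]])
  then have "f \<in> Lp p" by (rule Lp_cong_AE[OF _ G(2)[OF z]])
  then show "f \<in> sobolev m p" unfolding sobolev_def using G by blast
  have "Lp_norm p (weak_deriv \<rho> f) = Lp_norm p (G \<rho>)" if "mdeg \<rho> \<le> m" for \<rho>
  proof (rule Lp_norm_cong_AE[OF _ G(2)[OF that]])
    have "has_weak_deriv \<rho> f (weak_deriv \<rho> f)" unfolding weak_deriv_def by (rule someI[of "\<lambda>g. has_weak_deriv \<rho> f g", OF G(1)[OF that]])
    then show "AE x in lebesgue. weak_deriv \<rho> f x = G \<rho> x" by (rule has_weak_deriv_unique[OF _ G(1)[OF that]])
  qed (use p in simp)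
  then show "sobolev_norm m p f = (\<Sum>\<rho> | mdeg \<rho> \<le> m. Lp_norm p (G \<rho>))"
    unfolding sobolev_norm_def by (intro sum.cong) auto
qed

lemma sobolev_weak_deriv:
  assumes "f \<in> sobolev m p" "mdeg \<rho> \<le> m"
  obtains g where "g \<in> Lp p" "has_weak_deriv \<rho> f g"
  using assms unfolding sobolev_def by blast

lemma sobolev_borel_derivs:
  fixes f :: "real^'n::finite \<Rightarrow> complex"
  assumes p: "1 \<le> p" and f: "f \<in> sobolev m p"
  obtains G where "\<And>\<rho>. mdeg \<rho> \<le> m ==> has_weak_deriv \<rho> f (G \<rho>)" "\<And>\<rho>. mdeg \<rho> \<le> m ==> G \<rho> \<in> bLp p"
proof -
  have "\<exists>g. mdeg \<rho> \<le> m \<longrightarrow> has_weak_deriv \<rho> f g \<and> g \<in> bLp p" for \<rho>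
  proof (cases "mdeg \<rho> \<le> m")
    case True
    obtain g where g: "g \<in> Lp p" "has_weak_deriv \<rho> f g" using sobolev_weak_deriv[OF f True] by blast
    obtain g' where g': "g' \<in> borel_measurable borel" "AE x in lebesgue. g x = g' x"
      using Lp_borel_representative[OF Lp_measurable[OF g(1)]] by blast
    have e: "AE x in lebesgue. g' x = g x" using g'(2) by eventually_elim simp
    have z: "AE x in lebesgue. f x = f x" by simp
    have "has_weak_deriv \<rho> f g'" by (rule has_weak_deriv_cong_AE[OF g(2) z e])
    moreover have "g' \<in> bLp p" using Lp_cong_AE[OF e g(1)] g'(1) by (simp add: bLp_iff)
    ultimately show ?thesis by blast
  qed simp
  then obtain G where "\<And>\<rho>. mdeg \<rho> \<le> m \<longrightarrow> has_weak_deriv \<rho> f (G \<rho>) \<and> G \<rho> \<in> bLp p" by metis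
  then show ?thesis using that by blast
qed

lemma sobolev_linear:
  fixes f g :: "real^'n::finite \<Rightarrow> complex"
  assumes p: "1 \<le> p" and f: "f \<in> sobolev m p" and g: "g \<in> sobolev m p"
  shows "(\<lambda>x. f x + c * g x) \<in> sobolev m p"
    "sobolev_norm m p (\<lambda>x. f x + c * g x) \<le> sobolev_norm m p f + norm c * sobolev_norm m p g"
proof -
  obtain F where F: "\<And>\<rho>. mdeg \<rho> \<le> m ==> has_weak_deriv \<rho> f (F \<rho>)" "\<And>\<rho>. mdeg \<rho> \<le> m ==> F \<rho> \<in> bLp p"
    using sobolev_borel_derivs[OF p f] by metis
  obtain G where G: "\<And>\<rho>. mdeg \<rho> \<le> m ==> has_weak_deriv \<rho> g (G \<rho>)" "\<And>\<rho>. mdeg \<rho> \<le> m ==> G \<rho> \<in> bLp p"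
    using sobolev_borel_derivs[OF p g] by metis
  have wd: "has_weak_deriv \<rho> (\<lambda>x. f x + c * g x) (\<lambda>x. F \<rho> x + c * G \<rho> x)" if "mdeg \<rho> \<le> m" for \<rho>
    by (intro has_weak_deriv_add has_weak_deriv_cmult F G that)
  have L: "(\<lambda>x. F \<rho> x + c * G \<rho> x) \<in> Lp p" if "mdeg \<rho> \<le> m" for \<rho>
    by (intro Lp_add p Lp_cmult bLp_Lp F G that)
  show "(\<lambda>x. f x + c * g x) \<in> sobolev m p" by (rule sobolevI(1)[OF p wd L])
  have "sobolev_norm m p (\<lambda>x. f x + c * g x) = (\<Sum>\<rho> | mdeg \<rho> \<le> m. Lp_norm p (\<lambda>x. F \<rho> x + c * G \<rho> x))"
    by (rule sobolevI(2)[OF p wd L])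
  also have "... \<le> (\<Sum>\<rho> | mdeg \<rho> \<le> m. Lp_norm p (F \<rho>) + norm c * Lp_norm p (G \<rho>))"
  proof (rule sum_mono)
    fix \<rho> :: "'n \<Rightarrow> nat" assume "\<rho> \<in> {\<rho>. mdeg \<rho> \<le> m}"
    then have r: "mdeg \<rho> \<le> m" by simp
    have "Lp_norm p (\<lambda>x. F \<rho> x + c * G \<rho> x) \<le> Lp_norm p (F \<rho>) + Lp_norm p (\<lambda>x. c * G \<rho> x)"
      by (intro Lp_norm_triangle p Lp_cmult bLp_Lp F G r)
    then show "Lp_norm p (\<lambda>x. F \<rho> x + c * G \<rho> x) \<le> Lp_norm p (F \<rho>) + norm c * Lp_norm p (G \<rho>)"
      using Lp_norm_cmult[of p c "G \<rho>"] p by simp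
  qed
  also have "... = sobolev_norm m p f + norm c * sobolev_norm m p g"
    by (simp add: sobolevI(2)[OF p F(1) bLp_Lp[OF F(2)]] sobolevI(2)[OF p G(1) bLp_Lp[OF G(2)]] sum.distrib sum_distrib_left)
  finally show "sobolev_norm m p (\<lambda>x. f x + c * g x) \<le> sobolev_norm m p f + norm c * sobolev_norm m p g" .
qed

lemma sobolev_norm_nonneg: "0 \<le> sobolev_norm m p f"
  unfolding sobolev_norm_def by (intro sum_nonneg Lp_norm_nonneg)

lemma sobolev_zero:
  assumes p: "1 \<le> p" shows "(\<lambda>x :: real^'n::finite. 0) \<in> sobolev m p" "sobolev_norm m p (\<lambda>x :: real^'n. 0) = 0"
  using sobolevI[OF p, of m "\<lambda>x :: real^'n. 0" "\<lambda>_ x. 0"] by (simp_all add: has_weak_deriv_const_zero Lp_zero)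

lemma sobolev_diff:
  assumes p: "1 \<le> p" and f: "f \<in> sobolev m p" and g: "g \<in> sobolev m p"
  shows "(\<lambda>x. f x - g x) \<in> sobolev m p" "sobolev_norm m p (\<lambda>x. f x - g x) \<le> sobolev_norm m p f + sobolev_norm m p g"
  using sobolev_linear[OF assms, of "-1"] by simp_all

lemma sobolev_sum:
  assumes p: "1 \<le> p" and f: "\<And>i. i \<in> I ==> f i \<in> sobolev m p"
  shows "(\<lambda>x. \<Sum>i\<in>I. f i x) \<in> sobolev m p \<and> sobolev_norm m p (\<lambda>x. \<Sum>i\<in>I. f i x) \<le> (\<Sum>i\<in>I. sobolev_norm m p (f i))"
  using f
proof (induction I rule: infinite_finite_induct)
  case (insert i I)
  then show ?case using sobolev_linear[OF p, of "f i" m "\<lambda>x. \<Sum>i\<in>I. f i x" 1] by (simp add: add_left_mono order_trans)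
qed (simp_all add: sobolev_zero[OF p])

subsection \<open>Level functions\<close>

definition seqn :: "real \<Rightarrow> (int^'n::finite \<Rightarrow> complex) \<Rightarrow> real" where
  "seqn p s = (\<Sum>\<^sub>\<infinity>k. norm (s k) powr p) powr (1 / p)"

text \<open>The contribution of one level to \<open>l1w_norm\<close>.\<close>

definition weight :: "nat \<Rightarrow> real \<Rightarrow> real \<Rightarrow> (int^'n::finite \<Rightarrow> complex) \<Rightarrow> real" where
  "weight m p \<alpha> s = (\<Sum>\<rho> | mdeg \<rho> \<le> m. \<bar>\<alpha>\<bar> ^ mdeg \<rho> * seqn p (multi_op diff_op \<rho> s))"

text \<open>The level function in coordinates where the translations are by integer points;
  \<open>|\<alpha>| ^ CARD('n)\<close> is the modulus of the determinant of the dilation.\<close>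

definition lev :: "real \<Rightarrow> (real^'n::finite \<Rightarrow> real) \<Rightarrow> real \<Rightarrow> (int^'n \<Rightarrow> complex) \<Rightarrow> real^'n \<Rightarrow> complex" where
  "lev p \<kappa> \<alpha> s x = of_real ((\<bar>\<alpha>\<bar> ^ CARD('n)) powr (1 / p)) * syn \<kappa> s (\<alpha> *\<^sub>R x)"

text \<open>The link between the sums in the sequence norm and integrals over counting
  measure.\<close>

lemma lp_summable:
  "lp p s \<longleftrightarrow> (\<lambda>k. norm (s k) powr p) summable_on UNIV"
  "lp p s ==> pint (count_space UNIV) p s = ennreal (\<Sum>\<^sub>\<infinity>k. norm (s k) powr p)"
proof -
  have i: "integrable (count_space UNIV) (\<lambda>k. norm (s k) powr p) \<longleftrightarrow> (\<lambda>k. norm (s k) powr p) summable_on UNIV"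
    using abs_summable_equivalent[of "\<lambda>k. norm (s k) powr p" UNIV]
    by (simp add: Infinite_Set_Sum.abs_summable_on_def)
  show l: "lp p s \<longleftrightarrow> (\<lambda>k. norm (s k) powr p) summable_on UNIV"
    unfolding lp_def pint_def i[symmetric] by (simp add: integrable_iff_bounded)
  assume s: "lp p s"
  have "(\<Sum>\<^sub>\<infinity>k. norm (s k) powr p) = (\<integral>k. norm (s k) powr p \<partial>count_space UNIV)"
    using s[unfolded l] infsetsum_infsum[of "\<lambda>k. norm (s k) powr p" UNIV] 
      abs_summable_equivalent[of "\<lambda>k. norm (s k) powr p" UNIV]
    by (simp add: infsetsum_def)
  moreover have "pint (count_space UNIV) p s = ennreal (\<integral>k. norm (s k) powr p \<partial>count_space UNIV)"
    unfolding pint_def by (rule nn_integral_eq_integral) (use s[unfolded l] i in auto)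
  ultimately show "pint (count_space UNIV) p s = ennreal (\<Sum>\<^sub>\<infinity>k. norm (s k) powr p)" by simp
qed

lemma seqn_nonneg: "0 \<le> seqn p s" by (simp add: seqn_def)

lemma seqn_powr: "0 < p ==> lp p s ==> pint (count_space UNIV) p s = ennreal (seqn p s powr p)"
  by (simp add: lp_summable(2) seqn_def powr_powr infsum_nonneg)

lemma seqn_cmult: "0 < p ==> seqn p (\<lambda>k. c * s k) = norm c * seqn p s"
  by (simp add: seqn_def norm_mult powr_mult infsum_cmult_right' powr_powr infsum_nonneg)

lemma diff_op_cmult: "diff_op t (\<lambda>k. c * s k) = (\<lambda>k. c * diff_op t s k)"
  by (simp add: diff_op_def fun_eq_iff right_diff_distrib)

lemma multi_op_diff_op_cmult: "multi_op diff_op \<rho> (\<lambda>k. c * s k) = (\<lambda>k. c * multi_op diff_op \<rho> s k)"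
  by (induction \<rho> rule: multiindex_induct)
    (simp_all add: multi_op_diff_op_inc diff_op_cmult del: fun_upd_apply)

lemma weight_cmult: "0 < p ==> weight m p \<alpha> (\<lambda>k. c * s k) = norm c * weight m p \<alpha> s"
  by (simp add: weight_def multi_op_diff_op_cmult seqn_cmult sum_distrib_left mult_ac)

lemma weight_nonneg: "0 \<le> weight m p \<alpha> s"
  unfolding weight_def by (intro sum_nonneg mult_nonneg_nonneg seqn_nonneg) auto

lemma syn_cmult: "syn \<kappa> (\<lambda>k. c * s k) x = c * syn \<kappa> s x"
  unfolding syn_def by (simp add: mult_scaleR_right[symmetric] del: mult_scaleR_right)

lemma lev_cmult: "lev p \<kappa> \<alpha> (\<lambda>k. c * s k) x = c * lev p \<kappa> \<alpha> s x"
  by (simp add: lev_def syn_cmult)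

text \<open>The scalar factor is the L^p normalization of the dilation, so the contraction property
  of synthesis survives at every scale.\<close>

lemma lev_bounds:
  fixes \<kappa> :: "real^'n::finite \<Rightarrow> real"
  assumes p: "1 \<le> p" and \<kappa>: "kernel p \<kappa>" and s: "lp p s" and \<alpha>: "\<alpha> \<noteq> 0"
  shows "lev p \<kappa> \<alpha> s \<in> bLp p" "Lp_norm p (lev p \<kappa> \<alpha> s) \<le> seqn p s"
proof -
  let ?d = "\<bar>\<alpha>\<bar> ^ CARD('n)"
  have b: "syn \<kappa> s \<in> bLp p" by (rule bLp_syn[OF \<kappa> p s])
  show l: "lev p \<kappa> \<alpha> s \<in> bLp p" unfolding lev_def by (intro bLp_cmult bLp_dilate b \<alpha>)
  have m: "(\<lambda>x. syn \<kappa> s (\<alpha> *\<^sub>R x)) \<in> borel_measurable lborel" using bLp_dilate[OF b \<alpha>] by (simp add: bLp_def)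
  have "pint lborel p (lev p \<kappa> \<alpha> s) = ennreal (norm (complex_of_real (?d powr (1 / p))) powr p) * pint lborel p (\<lambda>x. syn \<kappa> s (\<alpha> *\<^sub>R x))"
    unfolding lev_def by (rule pint_cmult[OF m])
  also have "norm (complex_of_real (?d powr (1 / p))) powr p = ?d" using p \<alpha> by (simp add: powr_powr)
  also have "ennreal ?d * pint lborel p (\<lambda>x. syn \<kappa> s (\<alpha> *\<^sub>R x)) = pint lborel p (syn \<kappa> s)"
    by (rule pint_dilate[OF bLp_measurable[OF b] \<alpha>, symmetric])
  also have "... \<le> ennreal (seqn p s powr p)" using pint_syn[OF \<kappa> p, of s] seqn_powr[of p s] p s by simp
  finally show "Lp_norm p (lev p \<kappa> \<alpha> s) \<le> seqn p s"
    using p by (intro Lp_norm_leI(2)[OF Lp_measurable[OF bLp_Lp[OF l]]]) (auto simp: pint_lebesgue seqn_nonneg)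
qed

text \<open>Each derivative brings a factor \<open>\<alpha>\<close> by the chain rule and one
  difference by regularity of the kernel. This reproduces the sequence norm term by term, with
  constant 1.\<close>

lemma lev_sobolev:
  fixes \<kappa> :: "real^'n::finite \<Rightarrow> real"
  assumes p: "1 \<le> p" and r: "reg p m \<kappa>" and s: "lp p s" and \<alpha>: "\<alpha> \<noteq> 0"
  shows "lev p \<kappa> \<alpha> s \<in> sobolev m p" "sobolev_norm m p (lev p \<kappa> \<alpha> s) \<le> weight m p \<alpha> s"
proof -
  have \<kappa>: "kernel p \<kappa>" by (rule reg_kernel[OF r])
  have "\<exists>\<kappa>'. mdeg \<rho> \<le> m \<longrightarrow> kernel p \<kappa>' \<and> (\<forall>s. lp p s \<longrightarrow> has_weak_deriv \<rho> (syn \<kappa> s) (syn \<kappa>' (multi_op diff_op \<rho> s)))" for \<rho>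
    using reg_has_weak_deriv[OF p r, of \<rho>] reg_kernel by blast
  then obtain k where k: "\<And>\<rho>. mdeg \<rho> \<le> m ==> kernel p (k \<rho>)"
      "\<And>\<rho> s. mdeg \<rho> \<le> m ==> lp p s ==> has_weak_deriv \<rho> (syn \<kappa> s) (syn (k \<rho>) (multi_op diff_op \<rho> s))" by metis
  let ?G = "\<lambda>\<rho> x. of_real \<alpha> ^ mdeg \<rho> * lev p (k \<rho>) \<alpha> (multi_op diff_op \<rho> s) x"
  have wd: "has_weak_deriv \<rho> (lev p \<kappa> \<alpha> s) (?G \<rho>)" if m: "mdeg \<rho> \<le> m" for \<rho>
    using has_weak_deriv_cmult[OF has_weak_deriv_dilate[OF p bLp_syn[OF \<kappa> p s] bLp_syn[OF k(1)[OF m] p lp_multi_op[OF p s]] k(2)[OF m s] \<alpha>],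
        of "of_real ((\<bar>\<alpha>\<bar> ^ CARD('n)) powr (1 / p))"]
    by (simp add: lev_def[abs_def] mult.left_commute)
  have L: "?G \<rho> \<in> Lp p" if m: "mdeg \<rho> \<le> m" for \<rho>
    by (intro Lp_cmult bLp_Lp lev_bounds(1)[OF p k(1)[OF m] lp_multi_op[OF p s] \<alpha>])
  show "lev p \<kappa> \<alpha> s \<in> sobolev m p" by (rule sobolevI(1)[OF p wd L])
  have "sobolev_norm m p (lev p \<kappa> \<alpha> s) = (\<Sum>\<rho> | mdeg \<rho> \<le> m. Lp_norm p (?G \<rho>))" by (rule sobolevI(2)[OF p wd L])
  also have "... \<le> weight m p \<alpha> s"
    unfolding weight_def
  proof (rule sum_mono)
    fix \<rho> :: "'n \<Rightarrow> nat" assume "\<rho> \<in> {\<rho>. mdeg \<rho> \<le> m}"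
    then have m: "mdeg \<rho> \<le> m" by simp
    have "Lp_norm p (?G \<rho>) = \<bar>\<alpha>\<bar> ^ mdeg \<rho> * Lp_norm p (lev p (k \<rho>) \<alpha> (multi_op diff_op \<rho> s))"
      using p by (subst Lp_norm_cmult) (auto simp: norm_power)
    also have "... \<le> \<bar>\<alpha>\<bar> ^ mdeg \<rho> * seqn p (multi_op diff_op \<rho> s)"
      by (intro mult_left_mono lev_bounds(2)[OF p k(1)[OF m] lp_multi_op[OF p s] \<alpha>]) auto
    finally show "Lp_norm p (?G \<rho>) \<le> \<bar>\<alpha>\<bar> ^ mdeg \<rho> * seqn p (multi_op diff_op \<rho> s)" .
  qed
  finally show "sobolev_norm m p (lev p \<kappa> \<alpha> s) \<le> weight m p \<alpha> s" .
qed

section \<open>Approximation by finitely many levels\<close>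

text \<open>The factor inverts the normalization in \<open>lev\<close> and cancels the number of
  cells per unit volume.\<close>

lemma seqn_smp_le:
  fixes g :: "real^'n::finite \<Rightarrow> complex"
  assumes p: "1 \<le> p" and \<alpha>: "\<alpha> \<noteq> 0" and g: "g \<in> bLp p"
  shows "seqn p (\<lambda>k. of_real ((\<bar>\<alpha>\<bar> ^ CARD('n)) powr (- (1 / p))) * smp \<alpha> g k) \<le> Lp_norm p g"
proof -
  let ?d = "\<bar>\<alpha>\<bar> ^ CARD('n)"
  have d: "0 < ?d" using \<alpha> by simp
  have p0: "0 < p" using p by simp
  have "ennreal (seqn p (smp \<alpha> g) powr p) = pint (count_space UNIV) p (smp \<alpha> g)"
    by (rule seqn_powr[OF p0 lp_smp[OF \<alpha> p g], symmetric])
  also have "... \<le> ennreal ?d * pint lborel p g" by (rule pint_smp[OF \<alpha> p bLp_measurable[OF g]])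
  also have "... = ennreal (?d * Lp_norm p g powr p)"
    using Lp_norm_pint[OF bLp_Lp[OF g] p0] d by (simp add: pint_lebesgue ennreal_mult)
  finally have "seqn p (smp \<alpha> g) powr p \<le> ?d * Lp_norm p g powr p" using d by (simp add: ennreal_le_iff)
  then have "(seqn p (smp \<alpha> g) powr p) powr (1 / p) \<le> (?d * Lp_norm p g powr p) powr (1 / p)"
    using p0 by (intro powr_mono2) auto
  also have "(?d * Lp_norm p g powr p) powr (1 / p) = ?d powr (1 / p) * Lp_norm p g"
    using p0 d by (simp add: powr_mult powr_powr)
  finally have le: "seqn p (smp \<alpha> g) \<le> ?d powr (1 / p) * Lp_norm p g"
    using p0 by (simp add: powr_powr seqn_nonneg)
  have "seqn p (\<lambda>k. of_real (?d powr (- (1 / p))) * smp \<alpha> g k) = ?d powr (- (1 / p)) * seqn p (smp \<alpha> g)"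
    by (subst seqn_cmult[OF p0]) simp
  also have "... \<le> ?d powr (- (1 / p)) * (?d powr (1 / p) * Lp_norm p g)" by (rule mult_left_mono[OF le]) simp
  also have "... = Lp_norm p g" using d by (simp add: mult.assoc[symmetric] powr_add[symmetric])
  finally show ?thesis .
qed

lemma syn_smp_cmult: "syn \<kappa> (smp \<alpha> (\<lambda>x. c * g x)) z = c * syn \<kappa> (smp \<alpha> g) z"
  using syn_cmult[of \<kappa> c "smp \<alpha> g" z] by (simp add: smp_cmult[abs_def])

lemma approx_step:
  fixes f :: "real^'n::finite \<Rightarrow> complex"
  assumes p: "1 \<le> p" and r: "reg p m \<kappa>" and f: "f \<in> sobolev m p"
    and a: "\<And>j. a j \<noteq> 0" "filterlim (\<lambda>j. \<bar>a j\<bar>) at_top sequentially" and e: "0 < e"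
  shows "\<exists>J c. finite J \<and> J \<noteq> {} \<and> J \<subseteq> {N::nat..} \<and> (\<forall>j. lp p (c j)) \<and>
    (\<Sum>j\<in>J. weight m p (a j) (c j)) \<le> sobolev_norm m p f \<and>
    sobolev_norm m p (\<lambda>x. f x - (\<Sum>j\<in>J. lev p \<kappa> (a j) (c j) x)) < e"
proof -
  have p0: "0 < p" using p by simp
  have \<kappa>: "kernel p \<kappa>" by (rule reg_kernel[OF r])
  obtain G where G: "\<And>\<rho>. mdeg \<rho> \<le> m ==> has_weak_deriv \<rho> f (G \<rho>)" "\<And>\<rho>. mdeg \<rho> \<le> m ==> G \<rho> \<in> bLp p"
    using sobolev_borel_derivs[OF p f] by metis
  have nf: "sobolev_norm m p f = (\<Sum>\<rho> | mdeg \<rho> \<le> m. Lp_norm p (G \<rho>))"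
    by (rule sobolevI(2)[OF p G(1) bLp_Lp[OF G(2)]])
  \<comment> \<open>A Borel representative of \<open>f\<close>, on which sampling and differencing
    act.\<close>
  define f0 where "f0 = G (\<lambda>_. 0)"
  have z: "mdeg (\<lambda>_ :: 'n. 0) \<le> m" by simp
  have f0: "f0 \<in> bLp p" unfolding f0_def by (rule G(2)[OF z])
  have "has_weak_deriv (\<lambda>_. 0) f f" by (rule has_weak_deriv_zero[OF has_weak_deriv_locally(1)[OF G(1)[OF z]]])
  then have ae: "AE x in lebesgue. f0 x = f x" unfolding f0_def by (rule has_weak_deriv_unique[OF G(1)[OF z]])
  have wd0: "has_weak_deriv \<rho> f0 (G \<rho>)" if "mdeg \<rho> \<le> m" for \<rho>
    by (rule has_weak_deriv_cong_AE[OF G(1)[OF that] ae]) simp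
  have bs: "bsob (mdeg \<rho>) p f0" if "mdeg \<rho> \<le> m" for \<rho> :: "'n \<Rightarrow> nat"
    unfolding bsob_def using f0 wd0 G(2) that by (meson order_trans)
  have DQ: "(\<forall>\<alpha>. \<alpha> \<noteq> 0 \<longrightarrow> Lp_norm p (\<lambda>x. of_real \<alpha> ^ mdeg \<rho> * multi_op (dlt \<alpha>) \<rho> f0 x) \<le> Lp_norm p (G \<rho>)) \<and>
    (\<forall>a. (\<forall>j. a j \<noteq> 0) \<longrightarrow> filterlim (\<lambda>j. \<bar>a j\<bar>) at_top sequentially \<longrightarrow>
      (\<lambda>j::nat. Lp_norm p (\<lambda>x. of_real (a j) ^ mdeg \<rho> * multi_op (dlt (a j)) \<rho> f0 x - G \<rho> x)) \<longlonglongrightarrow> 0)" if "mdeg \<rho> \<le> m" for \<rho>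
    by (rule difference_quotients[OF p bs[OF that] G(2)[OF that] wd0[OF that]])
  have "\<exists>\<kappa>'. mdeg \<rho> \<le> m \<longrightarrow> kernel p \<kappa>' \<and> (\<forall>s. lp p s \<longrightarrow> has_weak_deriv \<rho> (syn \<kappa> s) (syn \<kappa>' (multi_op diff_op \<rho> s)))" for \<rho>
    using reg_has_weak_deriv[OF p r, of \<rho>] reg_kernel by blast
  then obtain k where k: "\<And>\<rho>. mdeg \<rho> \<le> m ==> kernel p (k \<rho>)"
      "\<And>\<rho> s. mdeg \<rho> \<le> m ==> lp p s ==> has_weak_deriv \<rho> (syn \<kappa> s) (syn (k \<rho>) (multi_op diff_op \<rho> s))" by metis
  let ?W = "\<lambda>\<rho> j x. of_real (a j) ^ mdeg \<rho> * multi_op (dlt (a j)) \<rho> f0 x"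
  let ?I = "{\<rho> :: 'n \<Rightarrow> nat. mdeg \<rho> \<le> m}"
  \<comment> \<open>The error is shared among the multiindices; the summand 1 makes the final
    inequality strict.\<close>
  define e' where "e' = e / (card ?I + 1)"
  have e': "0 < e'" using e by (simp add: e'_def)
  have WB: "?W \<rho> j \<in> bLp p" for \<rho> j by (intro bLp_cmult bLp_multi_dlt p f0)
  have lim: "(\<lambda>j. Lp_norm p (\<lambda>x. ?W \<rho> j x - G \<rho> x)) \<longlonglongrightarrow> 0" if "\<rho> \<in> ?I" for \<rho>
    using conjunct2[OF DQ[of \<rho>]] that a by simp
  have "\<exists>J::nat set. finite J \<and> J \<noteq> {} \<and> J \<subseteq> {N..} \<and> (\<forall>\<rho>\<in>?I.
      Lp_norm p (\<lambda>x. (\<Sum>j\<in>J. Qop (k \<rho>) (a j) (?W \<rho> j) x) / card J - G \<rho> x) < e')"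
  proof (rule mean_approx[OF finite_mdeg_le _ p _ WB lim a e'])
    show "kernel p (k \<rho>)" if "\<rho> \<in> ?I" for \<rho> using k(1) that by simp
    show "G \<rho> \<in> bLp p" if "\<rho> \<in> ?I" for \<rho> using G(2) that by simp
  qed
  then obtain J :: "nat set" where JJ: "finite J \<and> J \<noteq> {} \<and> J \<subseteq> {N..} \<and> (\<forall>\<rho>\<in>?I.
      Lp_norm p (\<lambda>x. (\<Sum>j\<in>J. Qop (k \<rho>) (a j) (?W \<rho> j) x) / card J - G \<rho> x) < e')" by (rule exE)
  note J = JJ[THEN conjunct1] JJ[THEN conjunct2, THEN conjunct1] JJ[THEN conjunct2, THEN conjunct2, THEN conjunct1]
  note small = bspec[OF JJ[THEN conjunct2, THEN conjunct2, THEN conjunct2]]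
  define n where "n = real (card J)"
  have n: "0 < n" using J by (simp add: n_def card_gt_0_iff)
  \<comment> \<open>Compensates the normalizing factor of the generators in
    \<open>lev\<close>.\<close>
  define q where "q \<alpha> = (\<bar>\<alpha>\<bar> ^ CARD('n)) powr (- (1 / p))" for \<alpha> :: real
  define s where "s \<alpha> = (\<lambda>k. of_real (q \<alpha>) * smp \<alpha> f0 k)" for \<alpha>
  define c where "c j = (\<lambda>k. of_real (1 / n) * s (a j) k)" for j
  have ls: "lp p (\<lambda>k. c * w k)" if "lp p w" for c and w :: "int^'n \<Rightarrow> complex"
    using pint_cmult[of w "count_space UNIV" p c] that by (simp add: lp_def ennreal_mult_less_top)
  have lps: "lp p (s \<alpha>)" if "\<alpha> \<noteq> 0" for \<alpha> unfolding s_def by (intro ls lp_smp that p f0)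
  have lpc: "lp p (c j)" for j unfolding c_def by (intro ls lps a)
  have levs: "lev p \<kappa> (a j) (c j) x = of_real (1 / n) * Qop \<kappa> (a j) f0 x" for j x
  proof -
    have "of_real ((\<bar>a j\<bar> ^ CARD('n)) powr (1 / p)) * of_real (q (a j)) = (1 :: complex)"
      using a(1)[of j] unfolding q_def of_real_mult[symmetric] by (simp add: powr_add[symmetric])
    then have "lev p \<kappa> (a j) (s (a j)) x = Qop \<kappa> (a j) f0 x"
      by (simp add: s_def lev_def syn_cmult Qop_def mult.assoc[symmetric])
    then show ?thesis unfolding c_def lev_cmult by simp
  qed
  \<comment> \<open>A derivative of the quasi-interpolant is the quasi-interpolant, for another
    kernel, of a scaled difference of \<open>f0\<close>. Thus one application of the mean
    approximation treats all derivatives at once.\<close>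
  have wdQ: "has_weak_deriv \<rho> (Qop \<kappa> (a j) f0) (Qop (k \<rho>) (a j) (?W \<rho> j))" if m: "mdeg \<rho> \<le> m" for \<rho> j
  proof -
    have "has_weak_deriv \<rho> (\<lambda>x. syn \<kappa> (smp (a j) f0) (a j *\<^sub>R x))
        (\<lambda>x. of_real (a j) ^ mdeg \<rho> * syn (k \<rho>) (multi_op diff_op \<rho> (smp (a j) f0)) (a j *\<^sub>R x))"
      by (rule has_weak_deriv_dilate[OF p bLp_syn[OF \<kappa> p lp_smp[OF a(1) p f0]]
            bLp_syn[OF k(1)[OF m] p lp_multi_op[OF p lp_smp[OF a(1) p f0]]] k(2)[OF m lp_smp[OF a(1) p f0]] a(1)])
    then show ?thesis
      unfolding multi_diff_op_smp[OF a(1) p f0] Qop_def[abs_def] syn_smp_cmult .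
  qed
  let ?F = "\<lambda>x. f x - (\<Sum>j\<in>J. lev p \<kappa> (a j) (c j) x)"
  let ?D = "\<lambda>\<rho> x. G \<rho> x - (\<Sum>j\<in>J. Qop (k \<rho>) (a j) (?W \<rho> j) x) / card J"
  have wdF: "has_weak_deriv \<rho> ?F (?D \<rho>)" if m: "mdeg \<rho> \<le> m" for \<rho>
  proof -
    have "has_weak_deriv \<rho> (\<lambda>x. f x + (-1) * (of_real (1 / n) * (\<Sum>j\<in>J. Qop \<kappa> (a j) f0 x)))
        (\<lambda>x. G \<rho> x + (-1) * (of_real (1 / n) * (\<Sum>j\<in>J. Qop (k \<rho>) (a j) (?W \<rho> j) x)))"
      by (intro has_weak_deriv_add has_weak_deriv_cmult has_weak_deriv_sum G(1) wdQ m)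
    moreover have "(\<lambda>x. f x + (-1) * (of_real (1 / n) * (\<Sum>j\<in>J. Qop \<kappa> (a j) f0 x))) = ?F"
      unfolding levs by (simp add: sum_distrib_left[symmetric] sum_divide_distrib[symmetric])
    moreover have "(\<lambda>x. G \<rho> x + (-1) * (of_real (1 / n) * (\<Sum>j\<in>J. Qop (k \<rho>) (a j) (?W \<rho> j) x))) = ?D \<rho>"
      by (simp add: n_def)
    ultimately show ?thesis by (simp only:)
  qed
  have QB: "Qop (k \<rho>) (a j) (?W \<rho> j) \<in> bLp p" if m: "mdeg \<rho> \<le> m" for \<rho> j
    by (rule bLp_Qop[OF k(1)[OF m] a(1) p WB])
  have DL: "?D \<rho> \<in> Lp p" if m: "mdeg \<rho> \<le> m" for \<rho>
  proof -
    have "(\<lambda>x. of_real (1 / n) * (\<Sum>j\<in>J. Qop (k \<rho>) (a j) (?W \<rho> j) x)) \<in> Lp p"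
      by (intro Lp_cmult Lp_sum p bLp_Lp QB m)
    then have "(\<lambda>x. G \<rho> x - of_real (1 / n) * (\<Sum>j\<in>J. Qop (k \<rho>) (a j) (?W \<rho> j) x)) \<in> Lp p"
      by (rule Lp_diff[OF p bLp_Lp[OF G(2)[OF m]]])
    then show ?thesis by (simp add: n_def)
  qed
  have "sobolev_norm m p ?F = (\<Sum>\<rho>\<in>?I. Lp_norm p (?D \<rho>))" by (rule sobolevI(2)[OF p wdF DL])
  also have "... \<le> (\<Sum>\<rho>\<in>?I. e')"
    using small by (intro sum_mono) (subst Lp_norm_minus_commute, simp add: less_imp_le)
  also have "... = card ?I * e'" by simp
  also have "... < e" using e by (simp add: e'_def field_simps)
  finally have F: "sobolev_norm m p ?F < e" .
  \<comment> \<open>Differences of samples are samples of differences, and the scaled differences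
    are bounded in norm by the derivatives.\<close>
  have ws: "weight m p (a j) (s (a j)) \<le> sobolev_norm m p f" for j
    unfolding weight_def nf
  proof (rule sum_mono)
    fix \<rho> assume "\<rho> \<in> ?I"
    then have m: "mdeg \<rho> \<le> m" by simp
    have "multi_op diff_op \<rho> (s (a j)) = (\<lambda>k. of_real (q (a j)) * smp (a j) (multi_op (dlt (a j)) \<rho> f0) k)"
      unfolding s_def multi_op_diff_op_cmult multi_diff_op_smp[OF a(1) p f0] ..
    then have "seqn p (multi_op diff_op \<rho> (s (a j))) \<le> Lp_norm p (multi_op (dlt (a j)) \<rho> f0)"
      using seqn_smp_le[OF p a(1) bLp_multi_dlt[OF p f0], of j "a j" \<rho>] by (simp only: q_def)
    then have "\<bar>a j\<bar> ^ mdeg \<rho> * seqn p (multi_op diff_op \<rho> (s (a j))) \<le> \<bar>a j\<bar> ^ mdeg \<rho> * Lp_norm p (multi_op (dlt (a j)) \<rho> f0)"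
      by (intro mult_left_mono) auto
    also have "... = Lp_norm p (?W \<rho> j)" by (subst Lp_norm_cmult[OF p0]) (simp add: norm_power)
    also have "... \<le> Lp_norm p (G \<rho>)" using conjunct1[OF DQ[OF m]] a(1) by blast
    finally show "\<bar>a j\<bar> ^ mdeg \<rho> * seqn p (multi_op diff_op \<rho> (s (a j))) \<le> Lp_norm p (G \<rho>)" .
  qed
  have "(\<Sum>j\<in>J. weight m p (a j) (c j)) = (\<Sum>j\<in>J. (1 / n) * weight m p (a j) (s (a j)))"
    unfolding c_def weight_cmult[OF p0] using n by (simp add: norm_divide)
  also have "... \<le> (\<Sum>j\<in>J. (1 / n) * sobolev_norm m p f)" using n by (intro sum_mono mult_left_mono ws) auto
  also have "... = sobolev_norm m p f" using n by (simp add: n_def)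
  finally have "(\<Sum>j\<in>J. weight m p (a j) (c j)) \<le> sobolev_norm m p f" .
  then show ?thesis using J F lpc by blast
qed

section \<open>Exact representation by iteration on the remainder\<close>

text \<open>Splices a new block \<open>d\<close>, placed on \<open>J\<close> beyond
  \<open>N\<close>, onto the coefficients up to \<open>N\<close>. The abstract \<open>\<phi>\<close>
  covers function values and weights, and the cut \<open>n\<close> may fall inside the
  block.\<close>

lemma glue_sum:
  fixes \<phi> :: "nat \<Rightarrow> 's \<Rightarrow> 'b::comm_monoid_add"
  assumes J: "finite J" "J \<subseteq> {Suc N..}" and n: "N \<le> n" and zero: "\<And>j. \<phi> j z = 0"
  shows "(\<Sum>j=1..n. \<phi> j (if j \<in> J then d j else if j \<le> N then c j else z))
    = (\<Sum>j=1..N. \<phi> j (c j)) + (\<Sum>j\<in>J \<inter> {..n}. \<phi> j (d j))"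
proof -
  let ?g = "\<lambda>j. \<phi> j (if j \<in> J then d j else if j \<le> N then c j else z)"
  have "{1..n} = {1..N} \<union> {Suc N..n}" using n by auto
  then have "(\<Sum>j=1..n. ?g j) = (\<Sum>j=1..N. ?g j) + (\<Sum>j\<in>{Suc N..n}. ?g j)"
    by (simp only:) (rule sum.union_disjoint, auto)
  also have "(\<Sum>j=1..N. ?g j) = (\<Sum>j=1..N. \<phi> j (c j))" using J(2) by (intro sum.cong) auto
  also have "(\<Sum>j\<in>{Suc N..n}. ?g j) = (\<Sum>j\<in>J \<inter> {..n}. ?g j)"
    using J(2) zero by (intro sum.mono_neutral_right) auto
  also have "... = (\<Sum>j\<in>J \<inter> {..n}. \<phi> j (d j))" by (intro sum.cong) auto
  finally show ?thesis .
qed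

lemma interleave_index:
  fixes N :: "nat \<Rightarrow> nat"
  assumes N: "strict_mono N" and i: "N i \<le> n"
  shows "\<exists>k\<ge>i. N k \<le> n \<and> n < N (Suc k)"
proof -
  have ex: "\<exists>k. n < N k" using strict_mono_imp_increasing[OF N, of "Suc n"] by (intro exI[of _ "Suc n"]) simp
  define k where "k = (LEAST k. n < N k)"
  have k: "n < N k" unfolding k_def by (rule LeastI_ex[OF ex])
  have ik: "i < k" using k i strict_mono_less[OF N, of i k] by linarith
  then obtain l where l: "k = Suc l" by (cases k) auto
  have "\<not> n < N l" using not_less_Least[of l "\<lambda>k. n < N k"] l unfolding k_def by simp
  then show ?thesis using k ik l by (intro exI[of _ l]) auto
qed

text \<open>Blocks occupy successive disjoint ranges of levels, and each costs at most the norm of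
  the remainder before it. All partial sums must converge, also those that end inside a block; a
  part of a block has norm at most the weight of the block.\<close>

lemma exact_representation:
  fixes f :: "real^'n::finite \<Rightarrow> complex"
  assumes p: "1 \<le> p" and r: "reg p m \<kappa>" and f: "f \<in> sobolev m p"
    and a: "\<And>j. a j \<noteq> 0" "filterlim (\<lambda>j. \<bar>a j\<bar>) at_top sequentially" and e: "0 < e"
  shows "\<exists>c. (\<forall>j. lp p (c j)) \<and> (\<forall>n. (\<Sum>j=1..n. weight m p (a j) (c j)) \<le> sobolev_norm m p f + e) \<and>
    (\<lambda>n. sobolev_norm m p (\<lambda>x. f x - (\<Sum>j=1..n. lev p \<kappa> (a j) (c j) x))) \<longlonglongrightarrow> 0"
proof -
  have p0: "0 < p" using p by simp
  \<comment> \<open>A bound for the remainder before block \<open>i\<close>, hence for the weight of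
    that block: the first block costs at most the norm of \<open>f\<close>, all later ones together
    at most \<open>e\<close>.\<close>
  define E where "E i = (if i = 0 then sobolev_norm m p f else e / 2 ^ i)" for i :: nat
  define R where "R n c = (\<lambda>x. f x - (\<Sum>j=1..n. lev p \<kappa> (a j) (c j) x))" for n and c :: "nat \<Rightarrow> int^'n \<Rightarrow> complex"
  define W where "W n c = (\<Sum>j=1..n. weight m p (a j) (c j))" for n and c :: "nat \<Rightarrow> int^'n \<Rightarrow> complex"
  \<comment> \<open>A state \<open>F\<close> is a cut together with coefficients. \<open>P\<close>
    is the invariant after \<open>i\<close> blocks; \<open>Q\<close> says that the next state
    freezes the coefficients up to the cut and that the remainders on the way stay
    controlled.\<close>
  define P where "P i F \<longleftrightarrow> (\<forall>j. lp p (snd F j)) \<and> sobolev_norm m p (R (fst F) (snd F)) \<le> E i \<and> W (fst F) (snd F) \<le> (\<Sum>l<i. E l)"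
    for i and F :: "nat \<times> (nat \<Rightarrow> int^'n \<Rightarrow> complex)"
  define Q where "Q i F F' \<longleftrightarrow> fst F < fst F' \<and> (\<forall>j\<le>fst F. snd F' j = snd F j) \<and>
      (\<forall>n. fst F \<le> n \<longrightarrow> n \<le> fst F' \<longrightarrow> sobolev_norm m p (R n (snd F')) \<le> 2 * E i)"
    for i :: nat and F F' :: "nat \<times> (nat \<Rightarrow> int^'n \<Rightarrow> complex)"
  have lp0: "lp p (\<lambda>_ :: int^'n. 0)" using p0 by (simp add: lp_def pint_def)
  have lev0: "lev p \<kappa> \<beta> (\<lambda>_. 0) x = 0" for \<beta> and x :: "real^'n" using lev_cmult[of p \<kappa> \<beta> 0 "\<lambda>_. 0" x] by simp
  have w0: "weight m p \<beta> (\<lambda>_ :: int^'n. 0) = 0" for \<beta> using weight_cmult[OF p0, of m \<beta> 0 "\<lambda>_ :: int^'n. 0"] by simp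
  have base: "\<exists>F. P 0 F"
    by (rule exI[of _ "(0, \<lambda>_ _. 0)"]) (simp add: P_def lp0 R_def W_def E_def)
  have step: "\<exists>F'. P (Suc i) F' \<and> Q i F F'" if PF: "P i F" for i F
  proof -
    define N where "N = fst F"
    define c where "c = snd F"
    define g where "g = R N c"
    have lpc: "lp p (c j)" for j using PF by (simp add: P_def c_def)
    have gE: "sobolev_norm m p g \<le> E i" using PF by (simp add: P_def g_def N_def c_def)
    have WE: "W N c \<le> (\<Sum>l<i. E l)" using PF by (simp add: P_def N_def c_def)
    have g: "g \<in> sobolev m p" unfolding g_def R_def
      by (rule sobolev_diff(1)[OF p f conjunct1[OF sobolev_sum[OF p lev_sobolev(1)[OF p r lpc a(1)]]]])
    have ES: "0 < E (Suc i)" using e by (simp add: E_def)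
    define A where "A J d \<longleftrightarrow> finite J \<and> J \<noteq> {} \<and> J \<subseteq> {Suc N..} \<and> (\<forall>j. lp p (d j)) \<and>
        (\<Sum>j\<in>J. weight m p (a j) (d j)) \<le> sobolev_norm m p g \<and>
        sobolev_norm m p (\<lambda>x. g x - (\<Sum>j\<in>J. lev p \<kappa> (a j) (d j) x)) < E (Suc i)" for J d
    have "\<exists>J d. A J d" unfolding A_def by (rule approx_step[OF p r g a ES])
    then obtain J d where "A J d" by blast
    note Jd = this[unfolded A_def]
    note J = conjunct1[OF Jd] conjunct1[OF conjunct2[OF Jd]] conjunct1[OF conjunct2[OF conjunct2[OF Jd]]]
    note Jd' = conjunct2[OF conjunct2[OF conjunct2[OF Jd]]]
    have d: "lp p (d j)" for j by (rule spec[OF conjunct1[OF Jd']])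
    note wd = conjunct1[OF conjunct2[OF Jd']]
    note nd = conjunct2[OF conjunct2[OF Jd']]
    define c' where "c' j = (if j \<in> J then d j else if j \<le> N then c j else (\<lambda>_. 0))" for j
    define N' where "N' = Max J"
    have "N' \<in> J" unfolding N'_def by (rule Max_in[OF J(1,2)])
    then have "N' \<in> {Suc N..}" using J(3) by blast
    then have NJ: "N < N'" by simp
    have "j \<le> N'" if "j \<in> J" for j unfolding N'_def by (rule Max_ge[OF J(1) that])
    then have JN: "J \<inter> {..N'} = J" by blast
    have Rn: "R n c' = (\<lambda>x. g x - (\<Sum>j\<in>J \<inter> {..n}. lev p \<kappa> (a j) (d j) x))" if "N \<le> n" for n
    proof
      fix x
      have "(\<Sum>j=1..n. lev p \<kappa> (a j) (c' j) x) = (\<Sum>j=1..N. lev p \<kappa> (a j) (c j) x) + (\<Sum>j\<in>J \<inter> {..n}. lev p \<kappa> (a j) (d j) x)"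
        unfolding c'_def
        by (rule glue_sum[where \<phi> = "\<lambda>j s. lev p \<kappa> (a j) s x" and z = "\<lambda>_. 0" and c = c and d = d, OF J(1,3) that]) (rule lev0)
      then show "R n c' x = g x - (\<Sum>j\<in>J \<inter> {..n}. lev p \<kappa> (a j) (d j) x)" by (simp add: R_def g_def)
    qed
    have Wn: "W N' c' = W N c + (\<Sum>j\<in>J \<inter> {..N'}. weight m p (a j) (d j))"
      unfolding W_def c'_def
      by (rule glue_sum[where \<phi> = "\<lambda>j. weight m p (a j)" and z = "\<lambda>_. 0" and c = c and d = d, OF J(1,3) less_imp_le[OF NJ]]) (rule w0)
    have "P (Suc i) (N', c')"
      unfolding P_def fst_conv snd_conv
    proof (intro conjI allI)
      show "lp p (c' j)" for j by (simp add: c'_def d lpc lp0)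
      show "sobolev_norm m p (R N' c') \<le> E (Suc i)" using nd by (simp add: Rn[OF less_imp_le[OF NJ]] JN)
      show "W N' c' \<le> (\<Sum>l<Suc i. E l)" using Wn WE wd gE by (simp add: JN)
    qed
    \<comment> \<open>The remainder before the block and the part of the block used so far are each
      at most \<open>E i\<close>.\<close>
    moreover have "sobolev_norm m p (R n c') \<le> 2 * E i" if n: "N \<le> n" for n
    proof -
      let ?s = "\<lambda>x. \<Sum>j\<in>J \<inter> {..n}. lev p \<kappa> (a j) (d j) x"
      have s: "?s \<in> sobolev m p \<and> sobolev_norm m p ?s \<le> (\<Sum>j\<in>J \<inter> {..n}. sobolev_norm m p (lev p \<kappa> (a j) (d j)))"
        by (rule sobolev_sum[OF p lev_sobolev(1)[OF p r d a(1)]])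
      have "(\<Sum>j\<in>J \<inter> {..n}. sobolev_norm m p (lev p \<kappa> (a j) (d j))) \<le> (\<Sum>j\<in>J \<inter> {..n}. weight m p (a j) (d j))"
        by (rule sum_mono) (rule lev_sobolev(2)[OF p r d a(1)])
      also have "... \<le> (\<Sum>j\<in>J. weight m p (a j) (d j))" by (rule sum_mono2) (auto simp: J weight_nonneg)
      finally have "sobolev_norm m p ?s \<le> sobolev_norm m p g" using s wd by linarith
      then show ?thesis using sobolev_diff(2)[OF p g conjunct1[OF s]] gE by (simp add: Rn[OF n])
    qed
    moreover have "c' j = c j" if "j \<le> N" for j using that J(3) by (auto simp: c'_def)
    ultimately have "P (Suc i) (N', c') \<and> Q i F (N', c')"
      unfolding Q_def fst_conv snd_conv N_def[symmetric] c_def[symmetric] using NJ by blast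
    then show ?thesis by (rule exI)
  qed
  from dependent_nat_choice[of P Q, OF base step] obtain F where F: "\<forall>n. P n (F n) \<and> Q n (F n) (F (Suc n))"
    by (rule exE)
  have PF: "P i (F i)" for i by (rule conjunct1[OF spec[OF F]])
  have QF: "Q i (F i) (F (Suc i))" for i by (rule conjunct2[OF spec[OF F]])
  define N where "N i = fst (F i)" for i
  define C where "C i = snd (F i)" for i
  \<comment> \<open>The diagonal is the limit of the states: coefficients up to \<open>N i\<close>
    never change after stage \<open>i\<close>, and \<open>j \<le> N j\<close>.\<close>
  define c where "c j = C j j" for j
  have N: "strict_mono N" using QF by (simp add: strict_mono_Suc_iff Q_def N_def)
  have lpC: "lp p (C i j)" for i j using PF by (simp add: P_def C_def)
  have CS: "C (Suc i) j = C i j" if "j \<le> N i" for i j using QF[of i] that by (simp add: Q_def C_def N_def)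
  have agree: "C k j = C i j" if "i \<le> k" "j \<le> N i" for i j k
    using that(1)
  proof (induction k rule: dec_induct)
    case (step k)
    have "N i \<le> N k" using step strict_mono_less_eq[OF N] by simp
    then show ?case using step CS[of j k] that(2) by simp
  qed simp
  have cC: "c j = C i j" if "j \<le> N i" for i j
    using agree[OF _ that, of "max i j"] agree[OF _ strict_mono_imp_increasing[OF N], of j "max i j"] by (simp add: c_def)
  have Rc: "R n c = R n (C i)" if "n \<le> N i" for n i
  proof -
    have "(\<Sum>j=1..n. lev p \<kappa> (a j) (c j) x) = (\<Sum>j=1..n. lev p \<kappa> (a j) (C i j) x)" for x
      by (rule sum.cong[OF refl]) (simp add: cC[of _ i] that order_trans[OF _ that])
    then show ?thesis by (simp add: R_def)
  qed
  have Wc: "W n c = W n (C i)" if "n \<le> N i" for n i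
    unfolding W_def by (rule sum.cong[OF refl]) (simp add: cC[of _ i] that order_trans[OF _ that])
  have Esum: "(\<Sum>l<Suc i. E l) \<le> sobolev_norm m p f + e * (1 - 1 / 2 ^ i)" for i
  proof (induction i)
    case (Suc i)
    have "(\<Sum>l<Suc (Suc i). E l) = (\<Sum>l<Suc i. E l) + e / 2 ^ Suc i"
      unfolding sum.lessThan_Suc[of _ "Suc i"] by (simp add: E_def)
    moreover have "e * (1 - 1 / 2 ^ i) + e / 2 ^ Suc i = e * (1 - 1 / 2 ^ Suc i)" by (simp add: field_simps)
    ultimately show ?case using Suc by linarith
  qed (simp add: E_def)
  have Wb: "W n c \<le> sobolev_norm m p f + e" for n
  proof -
    have n: "n \<le> N n" by (rule strict_mono_imp_increasing[OF N])
    have "W n c \<le> W (N n) c" unfolding W_def using n by (intro sum_mono2) (auto simp: weight_nonneg)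
    also have "... = W (N n) (C n)" by (rule Wc) simp
    also have "... \<le> (\<Sum>l<n. E l)" using PF[of n] by (simp add: P_def N_def C_def)
    also have "... \<le> (\<Sum>l<Suc n. E l)" using e sobolev_norm_nonneg[of m p f] by (simp add: E_def)
    also have "... \<le> sobolev_norm m p f + e * (1 - 1 / 2 ^ n)" by (rule Esum)
    also have "... \<le> sobolev_norm m p f + e * 1" using e by (intro add_left_mono mult_left_mono) auto
    finally show ?thesis by simp
  qed
  have lim: "(\<lambda>n. sobolev_norm m p (R n c)) \<longlonglongrightarrow> 0"
  proof (rule LIMSEQ_I)
    fix s :: real assume s: "0 < s"
    have "(\<lambda>i. (2 * e) / 2 ^ i) \<longlonglongrightarrow> 0" by (rule LIMSEQ_divide_realpow_zero) simp
    then obtain i0 where i0: "\<And>i. i0 \<le> i ==> (2 * e) / 2 ^ i < s"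
      using LIMSEQ_D[OF _ s, of _ 0] e by fastforce
    show "\<exists>no. \<forall>n\<ge>no. norm (sobolev_norm m p (R n c) - 0) < s"
    proof (intro exI allI impI)
      \<comment> \<open>From stage \<open>Suc i0\<close> on, so that \<open>E k\<close> is a
        geometric term and not the exceptional \<open>E 0\<close>.\<close>
      fix n assume "N (Suc i0) \<le> n"
      then obtain k where k: "Suc i0 \<le> k" "N k \<le> n" "n < N (Suc k)" using interleave_index[OF N] by blast
      have "sobolev_norm m p (R n c) \<le> 2 * E k"
        using QF[of k] k Rc[of n "Suc k"] by (simp add: Q_def N_def C_def)
      also have "... < s" using i0[of k] k(1) by (simp add: E_def)
      finally show "norm (sobolev_norm m p (R n c) - 0) < s" using sobolev_norm_nonneg[of m p "R n c"] by simp
    qed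
  qed
  show ?thesis
    by (intro exI[of _ c] conjI allI) (use lpC Wb lim in \<open>simp_all add: c_def W_def R_def\<close>)
qed

subsection \<open>Linear changes of variables\<close>

lemma nn_integral_coords:
  fixes F :: "'a::euclidean_space \<Rightarrow> ennreal"
  assumes [measurable]: "F \<in> borel_measurable borel"
  shows "(\<integral>\<^sup>+x. F x \<partial>lborel) = (\<integral>\<^sup>+f. F (\<Sum>b\<in>Basis. f b *\<^sub>R b) \<partial>(\<Pi>\<^sub>M b\<in>Basis. lborel))"
proof -
  have "(\<integral>\<^sup>+x. F x \<partial>(lborel :: 'a measure)) = (\<integral>\<^sup>+x. F x \<partial>distr (\<Pi>\<^sub>M b\<in>Basis. lborel) borel (\<lambda>f. \<Sum>b\<in>Basis. f b *\<^sub>R b))"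
    by (subst lborel_eq) (rule refl)
  also have "... = (\<integral>\<^sup>+f. F (\<Sum>b\<in>Basis. f b *\<^sub>R b) \<partial>(\<Pi>\<^sub>M b\<in>Basis. lborel))"
    by (rule nn_integral_distr) measurable
  finally show ?thesis .
qed

text \<open>Tonelli with the coordinate along \<open>e\<close> innermost: there the shear is a
  translation by a constant.\<close>

lemma nn_integral_shear:
  fixes F :: "'a::euclidean_space \<Rightarrow> ennreal"
  assumes [measurable]: "F \<in> borel_measurable borel" and e: "e \<in> Basis" "e' \<in> Basis" "e \<noteq> e'"
  shows "(\<integral>\<^sup>+x. F (x + (c * (x \<bullet> e')) *\<^sub>R e) \<partial>lborel) = (\<integral>\<^sup>+x. F x \<partial>lborel)"
proof -
  interpret product_sigma_finite "\<lambda>_ :: 'a. lborel :: real measure"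
    by (simp add: product_sigma_finite_def sigma_finite_lborel)
  let ?I = "Basis - {e}"
  let ?M = "\<Pi>\<^sub>M b\<in>?I. (lborel :: real measure)"
  have B: "insert e ?I = (Basis :: 'a set)" using e by auto
  have ins: "(\<integral>\<^sup>+x. G x \<partial>lborel) = (\<integral>\<^sup>+f. \<integral>\<^sup>+y. G (y *\<^sub>R e + (\<Sum>b\<in>?I. f b *\<^sub>R b)) \<partial>lborel \<partial>?M)"
    if [measurable]: "G \<in> borel_measurable borel" for G :: "'a \<Rightarrow> ennreal"
  proof -
    have m: "(\<lambda>f. G (\<Sum>b\<in>insert e ?I. f b *\<^sub>R b)) \<in> borel_measurable (\<Pi>\<^sub>M b\<in>insert e ?I. (lborel :: real measure))"
      by measurable
    have "(\<integral>\<^sup>+x. G x \<partial>lborel) = (\<integral>\<^sup>+f. G (\<Sum>b\<in>insert e ?I. f b *\<^sub>R b) \<partial>(\<Pi>\<^sub>M b\<in>insert e ?I. (lborel :: real measure)))"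
      unfolding B by (rule nn_integral_coords) measurable
    also have "... = (\<integral>\<^sup>+f. \<integral>\<^sup>+y. G (\<Sum>b\<in>insert e ?I. (f(e := y)) b *\<^sub>R b) \<partial>lborel \<partial>?M)"
      by (rule product_nn_integral_insert[OF _ _ m]) auto
    finally have 1: "(\<integral>\<^sup>+x. G x \<partial>lborel) = (\<integral>\<^sup>+f. \<integral>\<^sup>+y. G (\<Sum>b\<in>insert e ?I. (f(e := y)) b *\<^sub>R b) \<partial>lborel \<partial>?M)" .
    have 2: "(\<Sum>b\<in>insert e ?I. (f(e := y)) b *\<^sub>R b) = y *\<^sub>R e + (\<Sum>b\<in>?I. f b *\<^sub>R b)" for f and y :: real
      by (subst sum.insert) (auto intro!: sum.cong)
    show ?thesis using 1 unfolding 2 .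
  qed
  have inner: "(y *\<^sub>R e + (\<Sum>b\<in>?I. f b *\<^sub>R b)) \<bullet> e' = f e'" for f y
  proof -
    have "y *\<^sub>R e + (\<Sum>b\<in>?I. f b *\<^sub>R b) = (\<Sum>b\<in>Basis. (f(e := y)) b *\<^sub>R b)"
      using e by (subst sum.remove[of _ e]) (auto intro!: sum.cong)
    then show ?thesis using e by (simp only: inner_sum_left_Basis) simp
  qed
  have "(\<integral>\<^sup>+x. F (x + (c * (x \<bullet> e')) *\<^sub>R e) \<partial>lborel)
      = (\<integral>\<^sup>+f. \<integral>\<^sup>+y. F (y *\<^sub>R e + (\<Sum>b\<in>?I. f b *\<^sub>R b) + (c * f e') *\<^sub>R e) \<partial>lborel \<partial>?M)"
    by (subst ins) (simp_all add: inner)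
  also have "... = (\<integral>\<^sup>+f. \<integral>\<^sup>+y. F ((y + c * f e') *\<^sub>R e + (\<Sum>b\<in>?I. f b *\<^sub>R b)) \<partial>lborel \<partial>?M)"
    by (simp add: scaleR_add_left add_ac)
  also have "... = (\<integral>\<^sup>+f. \<integral>\<^sup>+y. F (y *\<^sub>R e + (\<Sum>b\<in>?I. f b *\<^sub>R b)) \<partial>lborel \<partial>?M)"
    by (intro nn_integral_cong nn_integral_lborel_translate[of "\<lambda>y :: real. F (y *\<^sub>R e + _)"]) measurable
  also have "... = (\<integral>\<^sup>+x. F x \<partial>lborel)" by (rule ins[symmetric]) measurable
  finally show ?thesis .
qed

lemma nn_integral_diagonal:
  fixes F :: "real^'n::finite \<Rightarrow> ennreal"
  assumes [measurable]: "F \<in> borel_measurable borel" and c: "\<And>i. c i \<noteq> 0"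
  shows "(\<integral>\<^sup>+x. F x \<partial>lborel) = ennreal \<bar>\<Prod>i\<in>UNIV. c i\<bar> * (\<integral>\<^sup>+x. F (\<chi> i. c i * x $ i) \<partial>lborel)"
proof -
  define g where "g b = (\<Sum>i\<in>UNIV. c i * b $ i)" for b :: "real^'n"
  have ga: "g (axis i 1) = c i" for i by (simp add: g_def axis_def if_distrib cong: if_cong)
  have B: "(Basis :: (real^'n) set) = (\<lambda>i. axis i 1) ` UNIV" by (auto simp: Basis_vec_def)
  have inj: "inj (\<lambda>i :: 'n. axis i (1 :: real))" by (auto simp: inj_on_def axis_eq_axis)
  have T: "0 + (\<Sum>j\<in>Basis. (g j * (x \<bullet> j)) *\<^sub>R j) = (\<chi> i. c i * x $ i)" for x :: "real^'n"
  proof -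
    have "(\<Sum>j\<in>Basis. (g j * (x \<bullet> j)) *\<^sub>R j) = (\<Sum>i\<in>UNIV. (c i * x $ i) *\<^sub>R axis i 1)"
      unfolding B sum.reindex[OF inj] o_def by (simp add: ga inner_axis)
    then show ?thesis by (simp add: vec_eq_iff axis_def if_distrib cong: if_cong)
  qed
  have P: "(\<Prod>j\<in>Basis. \<bar>g j\<bar>) = \<bar>\<Prod>i\<in>UNIV. c i\<bar>"
    unfolding B prod.reindex[OF inj] o_def by (simp add: ga abs_prod)
  have "lborel = density (distr lborel borel (\<lambda>x :: real^'n. 0 + (\<Sum>j\<in>Basis. (g j * (x \<bullet> j)) *\<^sub>R j))) (\<lambda>_. \<Prod>j\<in>Basis. \<bar>g j\<bar>)"
    by (rule lborel_affine_euclidean) (auto simp: B ga c)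
  then have l: "lborel = density (distr lborel borel (\<lambda>x :: real^'n. \<chi> i. c i * x $ i)) (\<lambda>_. ennreal \<bar>\<Prod>i\<in>UNIV. c i\<bar>)"
    unfolding T P by simp
  have m [measurable]: "(\<lambda>x :: real^'n. \<chi> i. c i * x $ i) \<in> borel_measurable borel"
    by (intro borel_measurable_continuous_onI continuous_on_vec_lambda continuous_intros)
  have "(\<integral>\<^sup>+x. F x \<partial>lborel) = (\<integral>\<^sup>+x. F x \<partial>density (distr lborel borel (\<lambda>x :: real^'n. \<chi> i. c i * x $ i)) (\<lambda>_. ennreal \<bar>\<Prod>i\<in>UNIV. c i\<bar>))"
    by (rule arg_cong[of lborel _ "\<lambda>M. integral\<^sup>N M F", OF l])
  also have "... = ennreal \<bar>\<Prod>i\<in>UNIV. c i\<bar> * (\<integral>\<^sup>+x. F (\<chi> i. c i * x $ i) \<partial>lborel)"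
    by (subst nn_integral_density) (auto simp: nn_integral_distr nn_integral_cmult)
  finally show ?thesis .
qed

lemma matrix_vector_measurable [measurable]: "(*v) (A :: real^'n::finite^'n) \<in> borel_measurable borel"
  by (intro borel_measurable_continuous_onI linear_continuous_on matrix_vector_mul_bounded_linear)

text \<open>A transposition of coordinates is a product of three shears and one change of
  sign.\<close>

lemma nn_integral_transposition:
  fixes F :: "real^'n::finite \<Rightarrow> ennreal"
  assumes [measurable]: "F \<in> borel_measurable borel" and mn: "m \<noteq> n"
  shows "(\<integral>\<^sup>+x. F (\<chi> i. x $ Transposition.transpose m n i) \<partial>lborel) = (\<integral>\<^sup>+x. F x \<partial>lborel)"
proof -
  let ?S = "\<lambda>i j c x. x + (c * (x \<bullet> axis j 1)) *\<^sub>R axis i (1 :: real) :: real^'n"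
  let ?D = "\<lambda>x. (\<chi> i. (if i = n then -1 else 1) * x $ i) :: real^'n"
  have sm: "?S i j c \<in> borel_measurable borel" for i j c by measurable
  have dm: "?D \<in> borel_measurable borel"
    by (intro borel_measurable_continuous_onI continuous_on_vec_lambda continuous_intros)
  have S: "(\<integral>\<^sup>+x. G (?S i j c x) \<partial>lborel) = (\<integral>\<^sup>+x. G x \<partial>lborel)"
    if "G \<in> borel_measurable borel" "i \<noteq> j" for G :: "real^'n \<Rightarrow> ennreal" and i j c
    using that by (intro nn_integral_shear) (auto simp: axis_eq_axis)
  have eq: "(\<chi> i. x $ Transposition.transpose m n i) = ?D (?S m n 1 (?S n m (-1) (?S m n 1 x)))" for x :: "real^'n"
    using mn by (simp add: vec_eq_iff inner_axis) (auto simp: axis_def Transposition.transpose_def)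
  have "(\<integral>\<^sup>+x. F (\<chi> i. x $ Transposition.transpose m n i) \<partial>lborel) = (\<integral>\<^sup>+x. F (?D (?S m n 1 (?S n m (-1) (?S m n 1 x)))) \<partial>lborel)"
    by (simp only: eq)
  also have "... = (\<integral>\<^sup>+x. F (?D (?S m n 1 (?S n m (-1) x))) \<partial>lborel)"
    by (rule S[of "\<lambda>x. F (?D (?S m n 1 (?S n m (-1) x)))"])
      (intro measurable_compose[OF _ assms(1)] measurable_compose[OF _ dm] measurable_compose[OF _ sm] sm, rule mn)
  also have "... = (\<integral>\<^sup>+x. F (?D (?S m n 1 x)) \<partial>lborel)"
    by (rule S[of "\<lambda>x. F (?D (?S m n 1 x))"])
      (intro measurable_compose[OF _ assms(1)] measurable_compose[OF _ dm] sm, rule mn[symmetric])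
  also have "... = (\<integral>\<^sup>+x. F (?D x) \<partial>lborel)"
    by (rule S[of "\<lambda>x. F (?D x)"]) (intro measurable_compose[OF _ assms(1)] dm, rule mn)
  also have "... = (\<integral>\<^sup>+x. F x \<partial>lborel)"
    using nn_integral_diagonal[OF assms(1), of "\<lambda>i. if i = n then -1 else 1"] by (simp add: abs_prod if_distrib cong: if_cong)
  finally show ?thesis .
qed

text \<open>The change of variables formula holds for elementary matrices and passes to products.
  The condition on the determinant inside \<open>?P\<close> makes the case of a zero row
  vacuous.\<close>

lemma nn_integral_linear:
  fixes F :: "real^'n::finite \<Rightarrow> ennreal" and A :: "real^'n^'n"
  assumes A: "invertible A" and F: "F \<in> borel_measurable borel"
  shows "(\<integral>\<^sup>+x. F x \<partial>lborel) = ennreal \<bar>det A\<bar> * (\<integral>\<^sup>+x. F (A *v x) \<partial>lborel)"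
proof -
  let ?P = "\<lambda>A :: real^'n^'n. det A \<noteq> 0 \<longrightarrow> (\<forall>F \<in> borel_measurable borel.
      (\<integral>\<^sup>+x. F x \<partial>lborel) = ennreal \<bar>det A\<bar> * (\<integral>\<^sup>+x. F (A *v x) \<partial>lborel))"
  have dA: "det A \<noteq> 0" using A by (simp add: invertible_det_nz)
  have PA: "?P A"
  proof (rule induct_matrix_elementary_alt)
    fix A B :: "real^'n^'n" assume A: "?P A" and B: "?P B"
    show "?P (A ** B)"
    proof (intro impI ballI)
      fix F :: "real^'n \<Rightarrow> ennreal" assume d: "det (A ** B) \<noteq> 0" and F [measurable]: "F \<in> borel_measurable borel"
      have dA: "det A \<noteq> 0" and dB: "det B \<noteq> 0" using d by (simp_all add: det_mul)
      have FA: "(\<lambda>x. F (A *v x)) \<in> borel_measurable borel" by measurable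
      have e1: "(\<integral>\<^sup>+x. F x \<partial>lborel) = ennreal \<bar>det A\<bar> * (\<integral>\<^sup>+x. F (A *v x) \<partial>lborel)"
        by (rule bspec[OF mp[OF A dA] F])
      have e2: "(\<integral>\<^sup>+x. F (A *v x) \<partial>lborel) = ennreal \<bar>det B\<bar> * (\<integral>\<^sup>+x. F (A *v (B *v x)) \<partial>lborel)"
        by (rule bspec[OF mp[OF B dB] FA])
      have "(\<integral>\<^sup>+x. F x \<partial>lborel) = ennreal \<bar>det A\<bar> * (ennreal \<bar>det B\<bar> * (\<integral>\<^sup>+x. F (A *v (B *v x)) \<partial>lborel))"
        using e1 unfolding e2 .
      also have "... = ennreal \<bar>det (A ** B)\<bar> * (\<integral>\<^sup>+x. F ((A ** B) *v x) \<partial>lborel)"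
        by (simp add: det_mul abs_mult ennreal_mult mult.assoc matrix_vector_mul_assoc)
      finally show "(\<integral>\<^sup>+x. F x \<partial>lborel) = ennreal \<bar>det (A ** B)\<bar> * (\<integral>\<^sup>+x. F ((A ** B) *v x) \<partial>lborel)" .
    qed
  next
    fix A :: "real^'n^'n" and i assume "row i A = 0"
    then have "det A = 0" by (simp add: det_zero_row)
    then show "?P A" by simp
  next
    fix A :: "real^'n^'n" assume d: "\<And>i j. i \<noteq> j ==> A $ i $ j = 0"
    have det: "det A = (\<Prod>i\<in>UNIV. A $ i $ i)" by (rule det_diagonal[OF d])
    have v: "A *v x = (\<chi> i. A $ i $ i * x $ i)" for x
    proof -
      have "(\<Sum>j\<in>UNIV. A $ i $ j * x $ j) = (\<Sum>j\<in>{i}. A $ i $ j * x $ j)" for i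
        by (rule sum.mono_neutral_right) (auto simp: d)
      then show ?thesis by (simp add: matrix_vector_mult_def)
    qed
    show "?P A"
    proof (intro impI ballI)
      fix F :: "real^'n \<Rightarrow> ennreal" assume d: "det A \<noteq> 0" and F: "F \<in> borel_measurable borel"
      show "(\<integral>\<^sup>+x. F x \<partial>lborel) = ennreal \<bar>det A\<bar> * (\<integral>\<^sup>+x. F (A *v x) \<partial>lborel)"
        unfolding det v by (rule nn_integral_diagonal[OF F]) (use d det in auto)
    qed
  next
    fix m n :: 'n assume mn: "m \<noteq> n"
    let ?A = "(\<chi> i j. mat 1 $ i $ Transposition.transpose m n j) :: real^'n^'n"
    have v: "?A *v x = (\<chi> i. x $ Transposition.transpose m n i)" for x
    proof -
      have "(\<Sum>j\<in>UNIV. mat 1 $ i $ Transposition.transpose m n j * x $ j) = (\<Sum>j\<in>UNIV. if j = Transposition.transpose m n i then x $ j else 0)" for i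
        by (rule sum.cong) (auto simp: mat_def)
      then show ?thesis by (simp add: matrix_vector_mult_def)
    qed
    \<comment> \<open>The matrix is an involution, so its determinant has modulus 1.\<close>
    have "?A ** ?A = mat 1" by (simp add: matrix_eq flip: matrix_vector_mul_assoc) (simp add: v vec_eq_iff)
    then have "det ?A * det ?A = 1" by (metis det_mul det_I)
    then have "\<bar>det ?A\<bar> = 1" using abs_square_eq_1[of "det ?A"] by (simp add: power2_eq_square)
    note det = this
    show "?P ?A"
    proof (intro impI ballI)
      fix F :: "real^'n \<Rightarrow> ennreal" assume F: "F \<in> borel_measurable borel"
      show "(\<integral>\<^sup>+x. F x \<partial>lborel) = ennreal \<bar>det ?A\<bar> * (\<integral>\<^sup>+x. F (?A *v x) \<partial>lborel)"
        by (simp only: v det nn_integral_transposition[OF F mn] ennreal_1 mult_1_left)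
    qed
  next
    fix m n :: 'n assume mn: "m \<noteq> n"
    let ?A = "(\<chi> i j. of_bool (i = m \<and> j = n \<or> i = j)) :: real^'n^'n"
    have A: "?A = (\<chi> k. if k = m then row m (mat 1) + 1 *s row n (mat 1) else row k (mat 1))"
      using mn by (auto simp: vec_eq_iff row_def mat_def)
    have det: "det ?A = 1" unfolding A det_row_operation[OF mn] by simp
    have v: "?A *v x = x + (1 * (x \<bullet> axis n 1)) *\<^sub>R axis m 1" for x
    proof -
      have "(\<Sum>j\<in>UNIV. of_bool (i = m \<and> j = n \<or> i = j) * x $ j)
          = (\<Sum>j\<in>UNIV. (if j = i then x $ j else 0) + (if j = n then (if i = m then x $ n else 0) else 0))" for i
        using mn by (intro sum.cong) auto
      moreover have ix: "x \<bullet> axis n 1 = x $ n" by (simp add: inner_axis)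
      ultimately show ?thesis unfolding ix by (simp add: matrix_vector_mult_def vec_eq_iff sum.distrib axis_def)
    qed
    show "?P ?A"
    proof (intro impI ballI)
      fix F :: "real^'n \<Rightarrow> ennreal" assume F: "F \<in> borel_measurable borel"
      show "(\<integral>\<^sup>+x. F x \<partial>lborel) = ennreal \<bar>det ?A\<bar> * (\<integral>\<^sup>+x. F (?A *v x) \<partial>lborel)"
      proof -
        have "(\<integral>\<^sup>+x. F (x + (1 * (x \<bullet> axis n 1)) *\<^sub>R axis m 1) \<partial>lborel) = (\<integral>\<^sup>+x. F x \<partial>lborel)"
          by (rule nn_integral_shear[OF F]) (use mn in \<open>simp_all add: axis_eq_axis\<close>)
        then show ?thesis by (simp only: v det abs_one ennreal_1 mult_1_left)
      qed
    qed
  qed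
  show ?thesis by (rule bspec[OF mp[OF PA dA] F])
qed

lemma AE_linear:
  fixes P :: "real^'n::finite \<Rightarrow> bool" and A :: "real^'n^'n"
  assumes P: "AE x in lborel. P x" and A: "invertible A"
  shows "AE x in lborel. P (A *v x)"
proof -
  from P obtain N where N: "N \<in> null_sets lborel" "{x \<in> space lborel. \<not> P x} \<subseteq> N"
    unfolding eventually_ae_filter by blast
  have [measurable]: "N \<in> sets borel" using N(1) by auto
  have d: "det A \<noteq> 0" using A by (simp add: invertible_det_nz)
  have "ennreal \<bar>det A\<bar> * (\<integral>\<^sup>+x. indicator N (A *v x) \<partial>lborel) = (\<integral>\<^sup>+x. indicator N x \<partial>lborel)"
    by (rule nn_integral_linear[OF A, of "indicator N", symmetric]) measurable
  also have "... = 0" using N(1) by (simp add: null_setsD1)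
  finally have "(\<integral>\<^sup>+x. indicator N (A *v x) \<partial>(lborel :: (real^'n) measure)) = 0" using d by simp
  moreover have m: "(\<lambda>x. indicator N (A *v x) :: ennreal) \<in> borel_measurable lborel" by measurable
  ultimately have "AE x in lborel. (indicator N (A *v x) :: ennreal) = 0"
    using nn_integral_0_iff_AE[OF m] by blast
  then show ?thesis
    by eventually_elim (use N(2) in \<open>auto split: split_indicator_asm\<close>)
qed

lemma lborel_linear:
  fixes A :: "real^'n::finite^'n"
  assumes A: "invertible A"
  shows "lborel = density (distr lborel borel ((*v) A)) (\<lambda>_. ennreal \<bar>det A\<bar>)"
proof (rule measure_eqI)
  fix X :: "(real^'n) set" assume "X \<in> sets lborel"
  then have [measurable]: "X \<in> sets borel" by simp
  have "emeasure lborel X = (\<integral>\<^sup>+x. indicator X x \<partial>lborel)" by simp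
  also have "... = ennreal \<bar>det A\<bar> * (\<integral>\<^sup>+x. indicator X (A *v x) \<partial>lborel)"
    by (rule nn_integral_linear[OF A, of "indicator X"]) measurable
  also have "... = ennreal \<bar>det A\<bar> * (\<integral>\<^sup>+x. indicator X x \<partial>distr lborel borel ((*v) A))"
    by (subst nn_integral_distr) auto
  also have "... = emeasure (density (distr lborel borel ((*v) A)) (\<lambda>_. ennreal \<bar>det A\<bar>)) X"
    by (subst emeasure_density) (auto simp: nn_integral_cmult)
  finally show "emeasure lborel X = emeasure (density (distr lborel borel ((*v) A)) (\<lambda>_. ennreal \<bar>det A\<bar>)) X" .
qed simp

lemma integral_linear:
  fixes F :: "real^'n::finite \<Rightarrow> 'b::{banach, second_countable_topology}" and A :: "real^'n^'n"
  assumes A: "invertible A" and [measurable]: "F \<in> borel_measurable borel"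
  shows "(\<integral>x. F x \<partial>lborel) = \<bar>det A\<bar> *\<^sub>R (\<integral>x. F (A *v x) \<partial>lborel)"
proof -
  have "(\<integral>x. F x \<partial>lborel) = (\<integral>x. F x \<partial>density (distr lborel borel ((*v) A)) (\<lambda>_. ennreal \<bar>det A\<bar>))"
    by (rule arg_cong[of lborel _ "\<lambda>M. integral\<^sup>L M F", OF lborel_linear[OF A]])
  also have "... = \<bar>det A\<bar> *\<^sub>R (\<integral>x. F (A *v x) \<partial>lborel)"
    by (subst integral_density) (auto simp: integral_distr)
  finally show ?thesis .
qed

lemma bLp_linear:
  fixes U :: "real^'n::finite \<Rightarrow> complex" and B :: "real^'n^'n"
  assumes U: "U \<in> bLp p" and B: "invertible B" shows "(\<lambda>x. U (B *v x)) \<in> bLp p"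
proof -
  have m [measurable]: "U \<in> borel_measurable borel" using U by (simp add: bLp_def)
  have m': "(\<lambda>x. ennreal (norm (U x) powr p)) \<in> borel_measurable borel" by measurable
  have "ennreal \<bar>det B\<bar> * pint lborel p (\<lambda>x. U (B *v x)) < \<infinity>"
    using nn_integral_linear[OF B m'] U by (simp add: bLp_def pint_def)
  moreover have "(\<lambda>x. U (B *v x)) \<in> borel_measurable borel" by measurable
  ultimately show ?thesis using B by (auto simp: bLp_def ennreal_mult_less_top invertible_det_nz)
qed

lemma Lp_norm_linear:
  fixes U :: "real^'n::finite \<Rightarrow> complex" and B :: "real^'n^'n"
  assumes U: "U \<in> bLp p" and B: "invertible B"
  shows "Lp_norm p (\<lambda>x. U (B *v x)) = \<bar>det B\<bar> powr (- (1 / p)) * Lp_norm p U"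
proof -
  have m [measurable]: "U \<in> borel_measurable borel" using U by (simp add: bLp_def)
  have n: "Lp_norm p V = (\<integral>x. norm (V x) powr p \<partial>lborel) powr (1 / p)" if "V \<in> borel_measurable borel"
    for V :: "real^'n \<Rightarrow> complex"
  proof -
    note that [measurable]
    have "(\<lambda>x. norm (V x) powr p) \<in> borel_measurable borel" by measurable
    then show ?thesis unfolding Lp_norm_def by (simp only: integral_lebesgue_lborel)
  qed
  have m1: "(\<lambda>x. norm (U x) powr p) \<in> borel_measurable borel" by measurable
  have m2: "(\<lambda>x. U (B *v x)) \<in> borel_measurable borel" by measurable
  have d: "\<bar>det B\<bar> \<noteq> 0" using B by (simp add: invertible_det_nz)
  have "(\<integral>x. norm (U x) powr p \<partial>lborel) = \<bar>det B\<bar> * (\<integral>x. norm (U (B *v x)) powr p \<partial>lborel)"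
    using integral_linear[OF B m1] by simp
  then have "Lp_norm p U = \<bar>det B\<bar> powr (1 / p) * Lp_norm p (\<lambda>x. U (B *v x))"
    unfolding n[OF m] n[OF m2] by (simp add: powr_mult)
  then show ?thesis using d by (simp add: powr_minus)
qed

lemma invertible_matrix_inv': "invertible B ==> invertible (matrix_inv (B :: real^'n::finite^'n))"
  using matrix_inv_inverse[of B] unfolding invertible_def[of "matrix_inv B"] by blast

lemma matrix_inv_cancel:
  fixes B :: "real^'n::finite^'n"
  assumes "invertible B" shows "matrix_inv B *v (B *v x) = x" "B *v (matrix_inv B *v x) = x"
  using matrix_inv_inverse[OF assms] by (simp_all add: matrix_vector_mul_assoc)

lemma integrable_test_lborel:
  fixes f :: "real^'n::finite \<Rightarrow> complex"
  assumes p: "1 \<le> p" and \<phi>: "test_function \<phi>" and f: "f \<in> bLp p"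
  shows "integrable lborel (\<lambda>x. \<phi> x *\<^sub>R f x)"
proof -
  have m: "(\<lambda>x. \<phi> x *\<^sub>R f x) \<in> borel_measurable lborel"
    using borel_measurable_scaleR[OF test_function_measurable[OF \<phi>] bLp_measurable[OF f]] by simp
  have "integrable lebesgue (\<lambda>x. \<phi> x *\<^sub>R f x)"
    by (rule integrable_test_function[OF \<phi> Lp_locally_integrable[OF p bLp_Lp[OF f]]])
  then show ?thesis using integrable_completion[OF m] by blast
qed

text \<open>The chain rule on the dual side: the test function is transported by the inverse matrix,
  and its partial derivatives mix with the entries of column \<open>t\<close> of
  \<open>B\<close>.\<close>

lemma has_weak_deriv_unit_linear:
  fixes U :: "real^'n::finite \<Rightarrow> complex" and B :: "real^'n^'n"
  assumes p: "1 \<le> p" and B: "invertible B" and U: "U \<in> bLp p" and V: "\<And>s. V s \<in> bLp p"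
    and wd: "\<And>s. has_weak_deriv (unit_mi s) U (V s)"
  shows "has_weak_deriv (unit_mi t) (\<lambda>x. U (B *v x)) (\<lambda>x. \<Sum>s\<in>UNIV. of_real (B $ s $ t) * V s (B *v x))"
proof -
  have [measurable]: "U \<in> borel_measurable borel" "\<And>s. V s \<in> borel_measurable borel"
    using U V by (simp_all add: bLp_def)
  have W: "(\<lambda>x. \<Sum>s\<in>UNIV. of_real (B $ s $ t) * V s (B *v x)) \<in> bLp p"
    unfolding bLp_iff
  proof
    show "(\<lambda>x. \<Sum>s\<in>UNIV. of_real (B $ s $ t) * V s (B *v x)) \<in> Lp p"
      by (intro Lp_sum[OF p] Lp_cmult bLp_Lp bLp_linear[OF V B])
  qed measurable
  have d: "\<bar>det B\<bar> \<noteq> 0" using B by (simp add: invertible_det_nz)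
  show ?thesis
    unfolding has_weak_deriv_unit_lborel[OF p bLp_linear[OF U B] W]
  proof (intro allI impI)
    fix \<phi> :: "real^'n \<Rightarrow> real" assume \<phi>: "test_function \<phi>"
    define \<theta> where "\<theta> = (\<lambda>y. \<phi> (matrix_inv B *v y + 0))"
    have \<theta>: "test_function \<theta>" unfolding \<theta>_def by (rule test_function_affine[OF \<phi> invertible_matrix_inv'[OF B]])
    have \<phi>\<theta>: "\<phi> = (\<lambda>x. \<theta> (B *v x + 0))" by (simp add: \<theta>_def matrix_inv_cancel[OF B])
    have \<theta>': "\<phi> x = \<theta> (B *v x)" for x using fun_cong[OF \<phi>\<theta>, of x] by simp
    have pt: "partial t \<phi> = (\<lambda>x. \<Sum>s\<in>UNIV. B $ s $ t * partial s \<theta> (B *v x + 0))"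
      by (subst \<phi>\<theta>) (rule partial_affine[OF test_function_C_k[OF \<theta>]])
    have mp [measurable]: "partial s \<theta> \<in> borel_measurable borel" for s by (rule test_function_measurable[OF test_function_partial[OF \<theta>]])
    have m\<theta> [measurable]: "\<theta> \<in> borel_measurable borel" by (rule test_function_measurable[OF \<theta>])
    define X where "X s = (\<integral>y. \<theta> y *\<^sub>R V s y \<partial>lborel)" for s
    have wX: "(\<integral>y. partial s \<theta> y *\<^sub>R U y \<partial>lborel) = - X s" for s
      using wd[of s] \<theta> unfolding has_weak_deriv_unit_lborel[OF p U V] X_def by blast
    have iU: "integrable lborel (\<lambda>y. partial s \<theta> y *\<^sub>R U y)" for s
      by (rule integrable_test_lborel[OF p test_function_partial[OF \<theta>] U])
    have iV: "integrable lborel (\<lambda>y. \<theta> y *\<^sub>R V s y)" for s by (rule integrable_test_lborel[OF p \<theta> V])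
    let ?\<Phi> = "\<lambda>y. \<Sum>s\<in>UNIV. B $ s $ t *\<^sub>R (partial s \<theta> y *\<^sub>R U y)"
    let ?\<Psi> = "\<lambda>y. \<Sum>s\<in>UNIV. B $ s $ t *\<^sub>R (\<theta> y *\<^sub>R V s y)"
    have m\<Phi>: "?\<Phi> \<in> borel_measurable borel" and m\<Psi>: "?\<Psi> \<in> borel_measurable borel" by measurable
    have e1: "partial t \<phi> x *\<^sub>R U (B *v x) = ?\<Phi> (B *v x)" for x
      by (simp add: pt scaleR_sum_left)
    have e2: "\<phi> x *\<^sub>R (\<Sum>s\<in>UNIV. of_real (B $ s $ t) * V s (B *v x)) = ?\<Psi> (B *v x)" for x
      by (simp add: \<theta>' sum_distrib_left scaleR_sum_right scaleR_conv_of_real mult_ac)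
    have "\<bar>det B\<bar> *\<^sub>R (\<integral>x. ?\<Phi> (B *v x) \<partial>lborel) = (\<integral>y. ?\<Phi> y \<partial>lborel)"
      by (rule integral_linear[OF B m\<Phi>, symmetric])
    also have "... = (\<Sum>s\<in>UNIV. B $ s $ t *\<^sub>R - X s)"
    proof -
      have "(\<integral>y. ?\<Phi> y \<partial>lborel) = (\<Sum>s\<in>UNIV. \<integral>y. B $ s $ t *\<^sub>R (partial s \<theta> y *\<^sub>R U y) \<partial>lborel)"
        by (rule Bochner_Integration.integral_sum) (intro integrable_scaleR_right iU)
      then show ?thesis by (simp only: integral_scaleR_right wX)
    qed
    also have "... = - (\<Sum>s\<in>UNIV. B $ s $ t *\<^sub>R X s)" by (simp add: sum_negf)
    also have "(\<Sum>s\<in>UNIV. B $ s $ t *\<^sub>R X s) = (\<integral>y. ?\<Psi> y \<partial>lborel)"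
    proof -
      have "(\<integral>y. ?\<Psi> y \<partial>lborel) = (\<Sum>s\<in>UNIV. \<integral>y. B $ s $ t *\<^sub>R (\<theta> y *\<^sub>R V s y) \<partial>lborel)"
        by (rule Bochner_Integration.integral_sum) (intro integrable_scaleR_right iV)
      then show ?thesis by (simp only: integral_scaleR_right X_def)
    qed
    also have "... = \<bar>det B\<bar> *\<^sub>R (\<integral>x. ?\<Psi> (B *v x) \<partial>lborel)" by (rule integral_linear[OF B m\<Psi>])
    finally have "\<bar>det B\<bar> *\<^sub>R (\<integral>x. ?\<Phi> (B *v x) \<partial>lborel) = \<bar>det B\<bar> *\<^sub>R - (\<integral>x. ?\<Psi> (B *v x) \<partial>lborel)" by simp
    then have "(\<integral>x. ?\<Phi> (B *v x) \<partial>lborel) = - (\<integral>x. ?\<Psi> (B *v x) \<partial>lborel)"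
      using d by (simp only: scaleR_cancel_left) simp
    then show "(\<integral>x. partial t \<phi> x *\<^sub>R U (B *v x) \<partial>lborel)
        = - (\<integral>x. \<phi> x *\<^sub>R (\<Sum>s\<in>UNIV. of_real (B $ s $ t) * V s (B *v x)) \<partial>lborel)"
      unfolding e1 e2 .
  qed
qed

text \<open>Here the derivative in direction \<open>t\<close> comes first and \<open>\<rho>\<close>
  afterwards, in contrast to \<open>has_weak_deriv_inc\<close>; the derivatives of order
  \<open>\<rho>\<close> are those of \<open>g\<close>.\<close>

lemma has_weak_deriv_inc_compose:
  assumes fg: "has_weak_deriv (unit_mi t) f g" and gh: "has_weak_deriv \<rho> g h"
  shows "has_weak_deriv (inc t \<rho>) f h"
  unfolding has_weak_deriv_def
proof (intro conjI allI impI)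
  fix \<phi> :: "real^'a \<Rightarrow> real" assume t: "test_function \<phi>"
  have "(\<integral>x. partial t (multi_op partial \<rho> \<phi>) x *\<^sub>R f x \<partial>lebesgue) = - (\<integral>x. multi_op partial \<rho> \<phi> x *\<^sub>R g x \<partial>lebesgue)"
    using fg test_function_multi_op[OF t] by (simp only: has_weak_deriv_unit_iff)
  then show "(\<integral>x. multi_op partial (inc t \<rho>) \<phi> x *\<^sub>R f x \<partial>lebesgue) = (- 1) ^ mdeg (inc t \<rho>) * (\<integral>x. \<phi> x *\<^sub>R h x \<partial>lebesgue)"
    using has_weak_derivD[OF gh t] by (simp add: multi_op_partial_inc(2)[OF t] del: fun_upd_apply)
qed (use fg gh in \<open>auto dest: has_weak_deriv_locally\<close>)

lemma Lp_norm_le_sobolev_norm: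
  fixes f :: "real^'n::finite \<Rightarrow> complex"
  assumes "1 \<le> p" "\<And>\<rho>. mdeg \<rho> \<le> m ==> has_weak_deriv \<rho> f (G \<rho>)" "\<And>\<rho>. mdeg \<rho> \<le> m ==> G \<rho> \<in> Lp p" and \<rho>: "mdeg \<rho> \<le> m"
  shows "Lp_norm p (G \<rho>) \<le> sobolev_norm m p f"
proof -
  have "sobolev_norm m p f = (\<Sum>\<rho> | mdeg \<rho> \<le> m. Lp_norm p (G \<rho>))" by (rule sobolevI(2)[OF assms(1-3)])
  then show ?thesis using member_le_sum[of \<rho> "{\<rho>. mdeg \<rho> \<le> m}" "\<lambda>\<rho>. Lp_norm p (G \<rho>)"] \<rho>
    by (simp add: finite_mdeg_le Lp_norm_nonneg)
qed

lemma AE_lebesgue_linear: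
  fixes P :: "real^'n::finite \<Rightarrow> bool" and A :: "real^'n^'n"
  assumes "AE x in lebesgue. P x" "invertible A" shows "AE x in lebesgue. P (A *v x)"
  using AE_linear[of P A] assms by (simp add: AE_completion_iff)

text \<open>What matters is a constant independent of \<open>f\<close>. The induction takes one
  derivative first and applies the hypothesis to the first derivatives \<open>V s\<close>, which lie
  in the space of one order less.\<close>

lemma weak_deriv_linear_bound:
  fixes B :: "real^'n::finite^'n" and \<rho> :: "'n \<Rightarrow> nat"
  assumes p: "1 \<le> p" and B: "invertible B"
  shows "\<exists>K\<ge>0. \<forall>f\<in>sobolev (mdeg \<rho>) p. \<exists>h\<in>Lp p. has_weak_deriv \<rho> (\<lambda>x. f (B *v x)) h \<and> Lp_norm p h \<le> K * sobolev_norm (mdeg \<rho>) p f"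
proof (induction \<rho> rule: multiindex_induct)
  case zero
  show ?case
  proof (intro exI[of _ "\<bar>det B\<bar> powr (- (1 / p))"] conjI ballI)
    fix f :: "real^'n \<Rightarrow> complex" assume f: "f \<in> sobolev (mdeg (\<lambda>_ :: 'n. 0)) p"
    obtain G where G: "\<And>\<rho>. mdeg \<rho> \<le> mdeg (\<lambda>_ :: 'n. 0) ==> has_weak_deriv \<rho> f (G \<rho>)" "\<And>\<rho>. mdeg \<rho> \<le> mdeg (\<lambda>_ :: 'n. 0) ==> G \<rho> \<in> bLp p"
      using sobolev_borel_derivs[OF p f] by metis
    let ?g = "G (\<lambda>_. 0)"
    have g: "?g \<in> bLp p" "has_weak_deriv (\<lambda>_. 0) f ?g" by (rule G(2)[OF order_refl], rule G(1)[OF order_refl])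
    have "has_weak_deriv (\<lambda>_. 0) f f" by (rule has_weak_deriv_zero[OF has_weak_deriv_locally(1)[OF g(2)]])
    then have "AE x in lebesgue. f x = ?g x" by (rule has_weak_deriv_unique[OF _ g(2)])
    then have ae: "AE x in lebesgue. f (B *v x) = ?g (B *v x)" by (rule AE_lebesgue_linear[OF _ B])
    have gB: "(\<lambda>x. ?g (B *v x)) \<in> Lp p" by (rule bLp_Lp[OF bLp_linear[OF g(1) B]])
    have "has_weak_deriv (\<lambda>_. 0) (\<lambda>x. ?g (B *v x)) (\<lambda>x. ?g (B *v x))"
      by (rule has_weak_deriv_zero[OF Lp_locally_integrable[OF p gB]])
    then have w: "has_weak_deriv (\<lambda>_. 0) (\<lambda>x. f (B *v x)) (\<lambda>x. ?g (B *v x))"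
      by (rule has_weak_deriv_cong_AE[OF _ ae]) simp
    have n: "Lp_norm p ?g \<le> sobolev_norm (mdeg (\<lambda>_ :: 'n. 0)) p f"
      by (rule Lp_norm_le_sobolev_norm[OF p G(1) bLp_Lp[OF G(2)] order_refl])
    have "Lp_norm p (\<lambda>x. ?g (B *v x)) \<le> \<bar>det B\<bar> powr (- (1 / p)) * sobolev_norm (mdeg (\<lambda>_ :: 'n. 0)) p f"
      unfolding Lp_norm_linear[OF g(1) B] by (rule mult_left_mono[OF n]) simp
    then show "\<exists>h\<in>Lp p. has_weak_deriv (\<lambda>_. 0) (\<lambda>x. f (B *v x)) h \<and> Lp_norm p h \<le> \<bar>det B\<bar> powr (- (1 / p)) * sobolev_norm (mdeg (\<lambda>_ :: 'n. 0)) p f"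
      using w gB by blast
  qed simp
next
  case (inc \<rho> t)
  then obtain K where K: "0 \<le> K" and IH: "\<And>f. f \<in> sobolev (mdeg \<rho>) p ==>
      \<exists>h\<in>Lp p. has_weak_deriv \<rho> (\<lambda>x. f (B *v x)) h \<and> Lp_norm p h \<le> K * sobolev_norm (mdeg \<rho>) p f"
    by metis
  let ?d = "mdeg \<rho>"
  have star: "\<exists>h\<in>Lp p. has_weak_deriv (inc t \<rho>) (\<lambda>x. f (B *v x)) h \<and> Lp_norm p h \<le> (\<Sum>s\<in>UNIV. \<bar>B $ s $ t\<bar> * K) * sobolev_norm (Suc ?d) p f"
    if f: "f \<in> sobolev (Suc ?d) p" for f :: "real^'n \<Rightarrow> complex"
  proof -
    obtain G where G: "\<And>\<rho>'. mdeg \<rho>' \<le> Suc ?d ==> has_weak_deriv \<rho>' f (G \<rho>')" "\<And>\<rho>'. mdeg \<rho>' \<le> Suc ?d ==> G \<rho>' \<in> bLp p"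
      using sobolev_borel_derivs[OF p f] by metis
    have u: "mdeg (unit_mi s) \<le> Suc ?d" for s :: 'n by (simp del: fun_upd_apply)
    have z: "mdeg (\<lambda>_ :: 'n. 0) \<le> Suc ?d" by simp
    define V where "V s = G (unit_mi s)" for s
    let ?g = "G (\<lambda>_. 0)"
    have V: "V s \<in> bLp p" "has_weak_deriv (unit_mi s) f (V s)" for s
      unfolding V_def by (rule G(2)[OF u], rule G(1)[OF u])
    have g: "?g \<in> bLp p" "has_weak_deriv (\<lambda>_. 0) f ?g" by (rule G(2)[OF z], rule G(1)[OF z])
    have "has_weak_deriv (\<lambda>_. 0) f f" by (rule has_weak_deriv_zero[OF has_weak_deriv_locally(1)[OF g(2)]])
    then have ae: "AE x in lebesgue. f x = ?g x" by (rule has_weak_deriv_unique[OF _ g(2)])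
    then have ae': "AE x in lebesgue. ?g x = f x" by eventually_elim simp
    have gV: "has_weak_deriv (unit_mi s) ?g (V s)" for s
      by (rule has_weak_deriv_cong_AE[OF V(2) ae']) simp
    have i: "mdeg (inc s \<sigma>) \<le> Suc ?d" if "mdeg \<sigma> \<le> ?d" for s and \<sigma> :: "'n \<Rightarrow> nat" using that by (simp del: fun_upd_apply)
    have VG: "has_weak_deriv \<sigma> (V s) (G (inc s \<sigma>))" if "mdeg \<sigma> \<le> ?d" for s \<sigma>
      by (rule has_weak_deriv_inc_left[OF V(2) G(1)[OF i[OF that]]])
    have Vs1: "V s \<in> sobolev ?d p" for s
      by (rule sobolevI(1)[where G = "\<lambda>\<sigma>. G (inc s \<sigma>)", OF p VG bLp_Lp[OF G(2)[OF i]]])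
    have Vs2: "sobolev_norm ?d p (V s) = (\<Sum>\<sigma> | mdeg \<sigma> \<le> ?d. Lp_norm p (G (inc s \<sigma>)))" for s
      by (rule sobolevI(2)[where G = "\<lambda>\<sigma>. G (inc s \<sigma>)", OF p VG bLp_Lp[OF G(2)[OF i]]])
    have Vn: "sobolev_norm ?d p (V s) \<le> sobolev_norm (Suc ?d) p f" for s
    proof -
      have inj: "inj_on (inc s) {\<sigma> :: 'n \<Rightarrow> nat. mdeg \<sigma> \<le> ?d}"
      proof (rule inj_onI)
        fix \<sigma> \<tau> :: "'n \<Rightarrow> nat" assume "inc s \<sigma> = inc s \<tau>"
        then have "inc s \<sigma> i = inc s \<tau> i" for i by (rule fun_cong)
        then show "\<sigma> = \<tau>" by (auto simp: fun_eq_iff split: if_splits) (metis nat.inject)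
      qed
      have "sobolev_norm ?d p (V s) = (\<Sum>\<sigma> | mdeg \<sigma> \<le> ?d. Lp_norm p (G (inc s \<sigma>)))" by (rule Vs2)
      also have "... = (\<Sum>\<tau>\<in>inc s ` {\<sigma>. mdeg \<sigma> \<le> ?d}. Lp_norm p (G \<tau>))"
        by (subst sum.reindex[OF inj]) (simp add: o_def)
      also have "... \<le> (\<Sum>\<tau> | mdeg \<tau> \<le> Suc ?d. Lp_norm p (G \<tau>))"
        by (rule sum_mono2[OF finite_mdeg_le]) (use i in \<open>auto simp: Lp_norm_nonneg simp del: fun_upd_apply\<close>)
      also have "... = sobolev_norm (Suc ?d) p f" by (rule sobolevI(2)[OF p G(1) bLp_Lp[OF G(2)], symmetric])
      finally show ?thesis .
    qed
    have "\<exists>h. h \<in> Lp p \<and> has_weak_deriv \<rho> (\<lambda>x. V s (B *v x)) h \<and> Lp_norm p h \<le> K * sobolev_norm ?d p (V s)" for s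
      using IH[OF Vs1[of s]] by blast
    then obtain h where h: "\<And>s. h s \<in> Lp p" "\<And>s. has_weak_deriv \<rho> (\<lambda>x. V s (B *v x)) (h s)"
      "\<And>s. Lp_norm p (h s) \<le> K * sobolev_norm ?d p (V s)" by metis
    let ?h = "\<lambda>x. \<Sum>s\<in>UNIV. of_real (B $ s $ t) * h s x"
    have hL: "(\<lambda>x. of_real (B $ s $ t) * h s x) \<in> Lp p" for s by (rule Lp_cmult[OF h(1)])
    have w1: "has_weak_deriv \<rho> (\<lambda>x. \<Sum>s\<in>UNIV. of_real (B $ s $ t) * V s (B *v x)) ?h"
      by (rule has_weak_deriv_sum) (rule has_weak_deriv_cmult[OF h(2)])
    have w2: "has_weak_deriv (inc t \<rho>) (\<lambda>x. ?g (B *v x)) ?h"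
      by (rule has_weak_deriv_inc_compose[OF has_weak_deriv_unit_linear[OF p B g(1) V(1) gV] w1])
    have w: "has_weak_deriv (inc t \<rho>) (\<lambda>x. f (B *v x)) ?h"
      by (rule has_weak_deriv_cong_AE[OF w2 AE_lebesgue_linear[OF ae B]]) simp
    have "Lp_norm p ?h \<le> (\<Sum>s\<in>UNIV. Lp_norm p (\<lambda>x. of_real (B $ s $ t) * h s x))"
      by (rule Lp_norm_sum_le[OF p hL])
    also have "... = (\<Sum>s\<in>UNIV. \<bar>B $ s $ t\<bar> * Lp_norm p (h s))" using p by (subst Lp_norm_cmult) auto
    also have "... \<le> (\<Sum>s\<in>UNIV. \<bar>B $ s $ t\<bar> * (K * sobolev_norm (Suc ?d) p f))"
    proof (intro sum_mono mult_left_mono)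
      show "Lp_norm p (h s) \<le> K * sobolev_norm (Suc ?d) p f" for s
        by (rule order_trans[OF h(3) mult_left_mono[OF Vn K]])
    qed simp
    finally have nb: "Lp_norm p ?h \<le> (\<Sum>s\<in>UNIV. \<bar>B $ s $ t\<bar> * K) * sobolev_norm (Suc ?d) p f"
      by (simp add: sum_distrib_right mult.assoc)
    have hs: "?h \<in> Lp p" by (rule Lp_sum[OF p hL])
    show ?thesis by (intro bexI[of _ ?h] conjI w nb hs)
  qed
  show ?case
    unfolding mdeg_inc
  proof (intro exI conjI ballI)
    show "0 \<le> (\<Sum>s\<in>UNIV. \<bar>B $ s $ t\<bar> * K)" using K by (intro sum_nonneg mult_nonneg_nonneg) auto
    fix f :: "real^'n \<Rightarrow> complex" assume f: "f \<in> sobolev (Suc ?d) p"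
    show "\<exists>h\<in>Lp p. has_weak_deriv (inc t \<rho>) (\<lambda>x. f (B *v x)) h \<and> Lp_norm p h \<le> (\<Sum>s\<in>UNIV. \<bar>B $ s $ t\<bar> * K) * sobolev_norm (Suc ?d) p f"
      by (rule star[OF f])
  qed
qed

lemma sobolev_norm_mono:
  assumes "k \<le> m" shows "sobolev m p \<subseteq> sobolev k p" "sobolev_norm k p f \<le> sobolev_norm m p f"
  using assms unfolding sobolev_def sobolev_norm_def
  by (auto intro!: sum_mono2 finite_mdeg_le Lp_norm_nonneg)

text \<open>The rescaling by \<open>b\<close> and its inverse are bounded on the Sobolev space
  without being isometries; this is enough to transport membership and convergence.\<close>

lemma sobolev_linear_change:
  fixes B :: "real^'n::finite^'n" and \<gamma> :: complex
  assumes p: "1 \<le> p" and B: "invertible B"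
  shows "\<exists>K\<ge>0. \<forall>g h. g \<in> sobolev m p \<longrightarrow> (AE x in lebesgue. h x = \<gamma> * g (B *v x)) \<longrightarrow>
    h \<in> sobolev m p \<and> sobolev_norm m p h \<le> K * sobolev_norm m p g"
proof -
  have "\<forall>\<rho> :: 'n \<Rightarrow> nat. \<exists>K. 0 \<le> K \<and> (\<forall>f\<in>sobolev (mdeg \<rho>) p. \<exists>h\<in>Lp p. has_weak_deriv \<rho> (\<lambda>x. f (B *v x)) h \<and>
      Lp_norm p h \<le> K * sobolev_norm (mdeg \<rho>) p f)"
    using weak_deriv_linear_bound[OF p B] by blast
  then obtain k where k: "\<forall>\<rho> :: 'n \<Rightarrow> nat. 0 \<le> k \<rho> \<and> (\<forall>f\<in>sobolev (mdeg \<rho>) p. \<exists>h\<in>Lp p. has_weak_deriv \<rho> (\<lambda>x. f (B *v x)) h \<and>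
      Lp_norm p h \<le> k \<rho> * sobolev_norm (mdeg \<rho>) p f)"
    unfolding choice_iff by (rule exE)
  define K where "K = (\<Sum>\<rho> :: 'n \<Rightarrow> nat | mdeg \<rho> \<le> m. norm \<gamma> * k \<rho>)"
  have "h \<in> sobolev m p \<and> sobolev_norm m p h \<le> K * sobolev_norm m p g"
    if g: "g \<in> sobolev m p" and ae: "AE x in lebesgue. h x = \<gamma> * g (B *v x)" for g h
  proof -
    have "\<exists>H. mdeg \<rho> \<le> m \<longrightarrow> H \<in> Lp p \<and> has_weak_deriv \<rho> (\<lambda>x. g (B *v x)) H \<and> Lp_norm p H \<le> k \<rho> * sobolev_norm m p g" for \<rho>
    proof (cases "mdeg \<rho> \<le> m")
      case True
      have "g \<in> sobolev (mdeg \<rho>) p" using sobolev_norm_mono(1)[OF True] g by blast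
      then obtain H where H: "H \<in> Lp p" "has_weak_deriv \<rho> (\<lambda>x. g (B *v x)) H" "Lp_norm p H \<le> k \<rho> * sobolev_norm (mdeg \<rho>) p g"
        using conjunct2[OF spec[OF k]] by (meson bexE)
      have "k \<rho> * sobolev_norm (mdeg \<rho>) p g \<le> k \<rho> * sobolev_norm m p g"
        by (rule mult_left_mono[OF sobolev_norm_mono(2)[OF True]]) (use k in blast)
      then show ?thesis using H by (intro exI[of _ H]) simp
    qed simp
    then obtain H where H: "\<And>\<rho>. mdeg \<rho> \<le> m ==> H \<rho> \<in> Lp p" "\<And>\<rho>. mdeg \<rho> \<le> m ==> has_weak_deriv \<rho> (\<lambda>x. g (B *v x)) (H \<rho>)"
      "\<And>\<rho>. mdeg \<rho> \<le> m ==> Lp_norm p (H \<rho>) \<le> k \<rho> * sobolev_norm m p g" by metis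
    have w: "has_weak_deriv \<rho> h (\<lambda>x. \<gamma> * H \<rho> x)" if "mdeg \<rho> \<le> m" for \<rho>
      by (rule has_weak_deriv_cong_AE[OF has_weak_deriv_cmult[OF H(2)[OF that]] ae]) simp
    note s = sobolevI[OF p w Lp_cmult[OF H(1)]]
    have "sobolev_norm m p h = (\<Sum>\<rho> | mdeg \<rho> \<le> m. norm \<gamma> * Lp_norm p (H \<rho>))"
      using s(2) p by (simp add: Lp_norm_cmult)
    also have "... \<le> (\<Sum>\<rho> | mdeg \<rho> \<le> m. norm \<gamma> * (k \<rho> * sobolev_norm m p g))"
      by (intro sum_mono mult_left_mono) (simp_all add: H(3))
    also have "... = K * sobolev_norm m p g" by (simp add: K_def sum_distrib_right mult.assoc)
    finally show ?thesis using s(1) by blast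
  qed
  moreover have "0 \<le> K" unfolding K_def using k by (intro sum_nonneg mult_nonneg_nonneg) auto
  ultimately show ?thesis by blast
qed

subsection \<open>The kernel of the affine system\<close>

lemma nn_integral_count_space_infsum:
  fixes g :: "int^'n::finite \<Rightarrow> real"
  assumes g: "\<And>k. 0 \<le> g k" "g summable_on UNIV"
  shows "(\<integral>\<^sup>+k. ennreal (g k) \<partial>count_space UNIV) = ennreal (\<Sum>\<^sub>\<infinity>k. g k)"
proof -
  have e: "norm (complex_of_real (g k)) powr 1 = g k" for k using g(1)[of k] by simp
  have "lp 1 (\<lambda>k. complex_of_real (g k))" unfolding lp_summable(1) e by (rule g(2))
  from lp_summable(2)[OF this] show ?thesis unfolding pint_def e .
qed

text \<open>Integrating the lattice sum over one cell unfolds to the integral over the whole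
  space.\<close>

lemma nn_integral_eq_one_of_periodization:
  fixes \<kappa> :: "real^'n::finite \<Rightarrow> real"
  assumes [measurable]: "\<kappa> \<in> borel_measurable borel"
    and one: "AE x in lborel. (\<integral>\<^sup>+k. ennreal (\<kappa> (x - int_vec k)) \<partial>count_space UNIV) = 1"
  shows "(\<integral>\<^sup>+x. ennreal (\<kappa> x) \<partial>lborel) = 1"
proof -
  interpret c: sigma_finite_measure "cell :: (real^'n) measure" by (rule bprob_sigma_finite[OF bprob_cell])
  interpret pair_sigma_finite "cell :: (real^'n) measure" "count_space (UNIV :: (int^'n) set)"
    by (simp add: pair_sigma_finite_def sigma_finite_count c.sigma_finite_measure_axioms)
  have neg: "int_vec (- k) = - int_vec k" for k :: "int^'n" by (simp add: int_vec_def vec_eq_iff)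
  have m: "(\<lambda>x. ennreal (\<kappa> x)) \<in> borel_measurable borel" by measurable
  have b: "bij_betw uminus (UNIV :: (int^'n) set) UNIV" by (rule bij_betwI[where g = uminus]) auto
  have "(\<integral>\<^sup>+x. ennreal (\<kappa> x) \<partial>lborel) = (\<integral>\<^sup>+k. (\<integral>\<^sup>+y. ennreal (\<kappa> (int_vec k + y)) \<partial>cell) \<partial>count_space UNIV)"
    by (rule nn_integral_tile[OF m, symmetric])
  also have "... = (\<integral>\<^sup>+k. (\<integral>\<^sup>+y. ennreal (\<kappa> (int_vec (- k) + y)) \<partial>cell) \<partial>count_space UNIV)"
    by (rule nn_integral_bij_count_space[OF b, of "\<lambda>k. \<integral>\<^sup>+y. ennreal (\<kappa> (int_vec k + y)) \<partial>cell", symmetric])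
  also have "... = (\<integral>\<^sup>+k. (\<integral>\<^sup>+y. ennreal (\<kappa> (y - int_vec k)) \<partial>cell) \<partial>count_space UNIV)"
    by (simp add: neg)
  also have "... = (\<integral>\<^sup>+y. (\<integral>\<^sup>+k. ennreal (\<kappa> (y - int_vec k)) \<partial>count_space UNIV) \<partial>cell)"
    by (rule Fubini'[of "\<lambda>y k. ennreal (\<kappa> (y - int_vec k))"]) measurable
  also have "... = (\<integral>\<^sup>+y. 1 \<partial>(cell :: (real^'n) measure))"
  proof (rule nn_integral_cong_AE)
    show "AE y in cell. (\<integral>\<^sup>+k. ennreal (\<kappa> (y - int_vec k)) \<partial>count_space UNIV) = 1"
      unfolding cell_def using one by (subst AE_density) (auto elim!: eventually_mono)
  qed
  also have "... = 1" by simp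
  finally show ?thesis .
qed

lemma AE_lattice_translates:
  fixes P :: "real^'n::finite \<Rightarrow> bool"
  assumes "AE x in lborel. P x" shows "AE x in lborel. \<forall>k. P (x - b *v int_vec k)"
proof -
  have "AE x in lborel. P (x - b *v int_vec k)" for k
    using AE_translate[OF assms, of "- (b *v int_vec k)"] by simp
  then show ?thesis by (subst AE_all_countable) blast
qed

text \<open>\<open>\<kappa>\<close> is \<open>|det b| * \<eta> (b x)\<close>, changed on a null set
  to be Borel and nonnegative everywhere; hence the modulus of a real part. For \<open>p > 1\<close>
  the unit integral is deduced from the periodization.\<close>

lemma kernel_of_generator:
  fixes \<eta> :: "real^'n::finite \<Rightarrow> complex" and b :: "real^'n^'n"
  assumes b: "invertible b" and p: "1 \<le> p" and \<eta>: "\<eta> \<in> Lp p" and nn: "AE x in lebesgue. \<eta> x \<in> \<real>\<^sub>\<ge>\<^sub>0"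
    and one: "p = 1 ==> (\<integral>x. \<eta> x \<partial>lebesgue) = 1"
    and per: "1 < p ==> AE x in lebesgue. periodization b \<eta> x = 1"
  obtains \<kappa> where "kernel p \<kappa>" "AE x in lborel. of_real \<bar>det b\<bar> * \<eta> (b *v x) = of_real (\<kappa> x)"
proof -
  define D where "D = \<bar>det b\<bar>"
  have D: "0 < D" using b by (simp add: D_def invertible_det_nz)
  obtain g where g [measurable]: "g \<in> borel_measurable borel" and \<eta>g: "AE x in lebesgue. \<eta> x = g x"
    using Lp_borel_representative[OF Lp_measurable[OF \<eta>]] by blast
  define \<kappa>0 where "\<kappa>0 x = \<bar>Re (g x)\<bar>" for x
  define \<kappa> where "\<kappa> x = D * \<kappa>0 (b *v x)" for x
  have m0 [measurable]: "\<kappa>0 \<in> borel_measurable borel" unfolding \<kappa>0_def by measurable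
  have m [measurable]: "\<kappa> \<in> borel_measurable borel" unfolding \<kappa>_def by measurable
  have pos: "0 \<le> \<kappa>0 x" "0 \<le> \<kappa> x" for x using D by (simp_all add: \<kappa>0_def \<kappa>_def)
  have aeL: "AE x in lebesgue. \<eta> x = of_real (\<kappa>0 x)"
    using nn \<eta>g by eventually_elim (auto simp: \<kappa>0_def complex_nonneg_Reals_iff complex_eq_iff)
  then have ae: "AE x in lborel. \<eta> x = of_real (\<kappa>0 x)" by (simp add: AE_completion_iff)
  have rel: "AE x in lborel. of_real \<bar>det b\<bar> * \<eta> (b *v x) = of_real (\<kappa> x)"
    using AE_linear[OF ae b] by eventually_elim (simp add: \<kappa>_def D_def)
  have per\<kappa>: "AE x in lborel. (\<integral>\<^sup>+k. ennreal (\<kappa> (x - int_vec k)) \<partial>count_space UNIV) = 1" if p1: "1 < p"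
  proof -
    have "AE x in lborel. periodization b \<eta> x = 1" using per[OF p1] by (simp add: AE_completion_iff)
    then have "AE x in lborel. periodization b \<eta> x = 1 \<and> (\<forall>k. \<eta> (x - b *v int_vec k) = of_real (\<kappa>0 (x - b *v int_vec k)))"
      using AE_lattice_translates[OF ae, of b] by eventually_elim simp
    from AE_linear[OF this b] show ?thesis
    proof eventually_elim
      case (elim x)
      let ?g = "\<lambda>k. \<kappa>0 (b *v x - b *v int_vec k)"
      have \<kappa>g: "\<kappa> (x - int_vec k) = D * ?g k" for k by (simp add: \<kappa>_def matrix_vector_mult_diff_distrib)
      have \<eta>g: "\<eta> (b *v x - b *v int_vec k) = complex_of_real (?g k)" for k using elim by blast
      have "of_real \<bar>det b\<bar> * (\<Sum>\<^sub>\<infinity>k. \<eta> (b *v x - b *v int_vec k)) = 1"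
        using conjunct1[OF elim] by (simp only: periodization_def)
      then have e: "of_real D * (\<Sum>\<^sub>\<infinity>k. complex_of_real (?g k)) = 1" unfolding \<eta>g D_def .
      \<comment> \<open>A divergent sum would have the value 0 and could not produce 1.\<close>
      then have "(\<lambda>k. complex_of_real (?g k)) summable_on UNIV" using infsum_not_exists by force
      then have "(\<lambda>k. norm (complex_of_real (?g k))) summable_on UNIV"
        by (simp only: summable_on_iff_abs_summable_on_complex)
      then have s: "?g summable_on UNIV" using pos(1) by simp
      have "(\<Sum>\<^sub>\<infinity>k. complex_of_real (?g k)) = of_real (\<Sum>\<^sub>\<infinity>k. ?g k)"
        by (rule infsumI) (rule has_sum_of_real[OF has_sum_infsum[OF s]])
      with e have "complex_of_real (D * (\<Sum>\<^sub>\<infinity>k. ?g k)) = of_real 1" by simp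
      then have e': "D * (\<Sum>\<^sub>\<infinity>k. ?g k) = 1" by (simp only: of_real_eq_iff)
      have "(\<lambda>k. D * ?g k) summable_on UNIV" by (rule summable_on_cmult_right[OF s])
      then have "(\<integral>\<^sup>+k. ennreal (D * ?g k) \<partial>count_space UNIV) = ennreal (\<Sum>\<^sub>\<infinity>k. D * ?g k)"
        by (rule nn_integral_count_space_infsum[rotated]) (use pos(1) D in simp)
      also have "(\<Sum>\<^sub>\<infinity>k. D * ?g k) = 1" using e' by (subst infsum_cmult_right') simp
      finally show ?case by (simp add: \<kappa>g)
    qed
  qed
  have int\<kappa>: "(\<integral>\<^sup>+x. ennreal (\<kappa> x) \<partial>lborel) = 1"
  proof (cases "1 < p")
    case True
    then show ?thesis by (rule nn_integral_eq_one_of_periodization[OF m per\<kappa>])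
  next
    case False
    then have p1: "p = 1" using p by simp
    have "(\<lambda>x. complex_of_real (\<kappa>0 x)) \<in> Lp 1"
      by (rule Lp_cong_AE[OF _ \<eta>[unfolded p1]]) (use aeL in eventually_elim, simp)
    then have "integrable lebesgue (\<lambda>x. norm (complex_of_real (\<kappa>0 x)) powr 1)" by (simp add: Lp_def)
    then have "integrable lebesgue \<kappa>0" using pos(1) by simp
    then have i: "integrable lborel \<kappa>0" by (subst (asm) integrable_completion) simp_all
    have "(\<integral>x. \<eta> x \<partial>lebesgue) = (\<integral>x. complex_of_real (\<kappa>0 x) \<partial>lebesgue)"
      by (rule integral_cong_AE[OF Lp_measurable[OF \<eta>] _ aeL]) (intro borel_imp_lebesgue_measurable, measurable)
    also have "... = (\<integral>x. complex_of_real (\<kappa>0 x) \<partial>lborel)" by (rule integral_lebesgue_lborel) measurable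
    also have "... = of_real (\<integral>x. \<kappa>0 x \<partial>lborel)" by simp
    finally have "complex_of_real (\<integral>x. \<kappa>0 x \<partial>lborel) = of_real 1" using one[OF p1] by simp
    then have "(\<integral>x. \<kappa>0 x \<partial>lborel) = 1" by (simp only: of_real_eq_iff)
    then have k0: "(\<integral>\<^sup>+x. ennreal (\<kappa>0 x) \<partial>lborel) = 1" using i pos(1) by (subst nn_integral_eq_integral) auto
    have mm: "(\<lambda>x. ennreal (\<kappa>0 x)) \<in> borel_measurable borel" by measurable
    have mm': "(\<lambda>x. ennreal (\<kappa>0 (b *v x))) \<in> borel_measurable lborel" by measurable
    have "(\<integral>\<^sup>+x. ennreal (\<kappa> x) \<partial>lborel) = (\<integral>\<^sup>+x. ennreal D * ennreal (\<kappa>0 (b *v x)) \<partial>lborel)"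
      using D pos(1) by (simp add: \<kappa>_def ennreal_mult)
    also have "... = ennreal D * (\<integral>\<^sup>+x. ennreal (\<kappa>0 (b *v x)) \<partial>lborel)" by (rule nn_integral_cmult[OF mm'])
    also have "... = 1" using nn_integral_linear[OF b mm] k0 by (simp add: D_def)
    finally show ?thesis .
  qed
  show ?thesis by (rule that[OF _ rel]) (simp add: kernel_def m pos int\<kappa> per\<kappa>)
qed

lemma image_unit_cell:
  fixes b :: "real^'n::finite^'n"
  assumes b: "invertible b"
  shows "(*v) b ` unit_cell = {x. matrix_inv b *v x \<in> unit_cell}"
    "measure lebesgue ((*v) b ` unit_cell) = \<bar>det b\<bar>"
proof -
  show s: "(*v) b ` unit_cell = {x. matrix_inv b *v x \<in> unit_cell}"
    using matrix_inv_cancel[OF b] by (auto simp: image_iff) metis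
  have [measurable]: "{x. matrix_inv b *v x \<in> unit_cell} \<in> sets borel"
    using measurable_sets[OF matrix_vector_measurable[of "matrix_inv b"] unit_cell_borel] by (simp add: vimage_def)
  let ?S = "{x. matrix_inv b *v x \<in> unit_cell}"
  have "emeasure lborel ?S = (\<integral>\<^sup>+x. indicator ?S x \<partial>lborel)" by simp
  also have "... = ennreal \<bar>det b\<bar> * (\<integral>\<^sup>+x. indicator ?S (b *v x) \<partial>lborel)"
    by (rule nn_integral_linear[OF b, of "indicator ?S"]) measurable
  also have "(\<lambda>x. indicator ?S (b *v x) :: ennreal) = indicator unit_cell"
    by (auto simp: indicator_def matrix_inv_cancel[OF b] fun_eq_iff)
  also have "(\<integral>\<^sup>+x. indicator (unit_cell :: (real^'n) set) x \<partial>lborel) = 1" by (simp add: emeasure_unit_cell)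
  finally have "emeasure lborel ?S = ennreal \<bar>det b\<bar>" by simp
  then show "measure lebesgue ((*v) b ` unit_cell) = \<bar>det b\<bar>" unfolding s by (simp add: measure_def)
qed

lemma integral_lborel_reflect:
  fixes F :: "real^'n::finite \<Rightarrow> 'b::{banach, second_countable_topology}"
  assumes [measurable]: "F \<in> borel_measurable borel"
  shows "(\<integral>u. F (y - u) \<partial>lborel) = (\<integral>u. F u \<partial>lborel)"
proof -
  have m: "(\<lambda>u. F (y + u)) \<in> borel_measurable borel" by measurable
  have "(\<integral>u. F (y + u) \<partial>lborel) = (\<integral>u. F (y - u) \<partial>lborel)" using integral_dilate[OF m, of "-1"] by simp
  moreover have "(\<integral>u. F (y + u) \<partial>lborel) = (\<integral>u. F u \<partial>lborel)" using integral_lborel_translate[OF assms, of y] by (simp add: add.commute)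
  ultimately show ?thesis by simp
qed

text \<open>Transported by \<open>b\<close>, convolution with the normalized indicator is the
  average over the unit cell. The identity holds at every \<open>y\<close>, although
  \<open>g\<close> and \<open>\<kappa>\<close> are related almost everywhere only, since a
  convolution does not see null sets.\<close>

lemma convolution_cell_average:
  fixes b :: "real^'n::finite^'n"
  assumes b: "invertible b" and [measurable]: "\<kappa> \<in> borel_measurable borel"
    and rel: "AE x in lborel. of_real \<bar>det b\<bar> * g (b *v x) = complex_of_real (\<kappa> x)"
  shows "of_real \<bar>det b\<bar> * convolution (cell_average b) g (b *v y) = of_real (avgR cell \<kappa> y)"
proof -
  define D where "D = \<bar>det b\<bar>"
  have D: "0 < D" using b by (simp add: D_def invertible_det_nz)
  define g' where "g' z = complex_of_real (\<kappa> (matrix_inv b *v z) / D)" for z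
  have [measurable]: "g' \<in> borel_measurable borel" unfolding g'_def by measurable
  have S [measurable]: "(*v) b ` unit_cell \<in> sets borel"
    unfolding image_unit_cell(1)[OF b] using measurable_sets[OF matrix_vector_measurable[of "matrix_inv b"] unit_cell_borel]
    by (simp add: vimage_def)
  have ca: "cell_average b x = of_real (indicator ((*v) b ` unit_cell) x / D)" for x
    unfolding cell_average_def image_unit_cell(2)[OF b] D_def by simp
  have [measurable]: "cell_average b \<in> borel_measurable borel" unfolding ca by measurable
  have cab: "cell_average b (b *v x) = of_real (indicator unit_cell x / D)" for x
    unfolding ca image_unit_cell(1)[OF b] by (simp add: indicator_def matrix_inv_cancel[OF b])
  have "AE z in lborel. of_real D * g (b *v (matrix_inv b *v z)) = complex_of_real (\<kappa> (matrix_inv b *v z))"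
    using AE_linear[OF rel invertible_matrix_inv'[OF b]] by (simp add: D_def)
  then have "AE z in lborel. g z = g' z"
    by eventually_elim (use D in \<open>simp add: matrix_inv_cancel[OF b] g'_def field_simps\<close>)
  then have ae: "AE z in lebesgue. g z = g' z" by (simp add: AE_completion_iff)
  let ?h = "\<lambda>z. cell_average b (b *v y - z) * g' z"
  have mh: "?h \<in> borel_measurable borel" by measurable
  have aeh: "AE z in lebesgue. cell_average b (b *v y - z) * g z = ?h z" using ae by eventually_elim simp
  have mh': "?h \<in> borel_measurable lebesgue" by (rule borel_imp_lebesgue_measurable) (use mh in simp)
  have mg: "(\<lambda>z. cell_average b (b *v y - z) * g z) \<in> borel_measurable lebesgue"
    using borel_measurable_lebesgue_AE[OF aeh] mh' by blast
  have "convolution (cell_average b) g (b *v y) = (\<integral>z. ?h z \<partial>lebesgue)"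
    unfolding convolution_def by (rule integral_cong_AE[OF mg mh' aeh])
  also have "... = (\<integral>z. ?h z \<partial>lborel)" by (rule integral_lebesgue_lborel[OF mh])
  \<comment> \<open>The Jacobian \<open>D\<close> and the outer \<open>D\<close> of the claim
    balance the two factors \<open>1 / D\<close> from \<open>cell_average\<close> and from
    \<open>g'\<close>.\<close>
  also have "... = D *\<^sub>R (\<integral>u. ?h (b *v u) \<partial>lborel)" unfolding D_def by (rule integral_linear[OF b mh])
  also have "(\<lambda>u. ?h (b *v u)) = (\<lambda>u. complex_of_real (indicator unit_cell (y - u) * \<kappa> u / (D * D)))"
    by (simp add: cab g'_def matrix_inv_cancel[OF b] flip: matrix_vector_mult_diff_distrib)
  also have "(\<integral>u. complex_of_real (indicator unit_cell (y - u) * \<kappa> u / (D * D)) \<partial>lborel)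
      = of_real ((\<integral>u. indicator unit_cell (y - u) * \<kappa> u \<partial>lborel) / (D * D))"
    by (simp only: integral_complex_of_real integral_divide_zero)
  also have "(\<integral>u. indicator unit_cell (y - u) * \<kappa> u \<partial>lborel) = (\<integral>u. indicator unit_cell u * \<kappa> (y - u) \<partial>lborel)"
    using integral_lborel_reflect[of "\<lambda>u. indicator unit_cell u * \<kappa> (y - u)" y] by simp
  also have "... = avgR cell \<kappa> y"
    unfolding avgR_def by (subst integral_cell) simp_all
  finally have "convolution (cell_average b) g (b *v y) = D *\<^sub>R of_real (avgR cell \<kappa> y / (D * D))" .
  then show ?thesis unfolding D_def[symmetric] using D by (simp add: scaleR_conv_of_real)
qed

lemma reg_iterate:
  assumes p: "1 \<le> p" and \<kappa>: "kernel p \<kappa>"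
  shows "reg p m ((avgR cell ^^ m) \<kappa>)"
  by (induction m) (auto intro: reg_cell[OF p] simp: \<kappa> simp del: reg.simps(2))

lemma convolution_iterate:
  fixes b :: "real^'n::finite^'n"
  assumes b: "invertible b" and p: "1 \<le> p" and \<kappa>: "kernel p \<kappa>"
    and rel: "AE x in lborel. of_real \<bar>det b\<bar> * \<eta> (b *v x) = complex_of_real (\<kappa> x)"
  shows "AE x in lborel. of_real \<bar>det b\<bar> * (convolution (cell_average b) ^^ m) \<eta> (b *v x) = complex_of_real ((avgR cell ^^ m) \<kappa> x)"
proof (induction m)
  case (Suc m)
  have "(avgR cell ^^ m) \<kappa> \<in> borel_measurable borel" by (rule kernelD(1)[OF reg_kernel[OF reg_iterate[OF p \<kappa>]]])
  from convolution_cell_average[OF b this Suc] show ?case by simp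
qed (simp add: rel)

text \<open>Isotropy of the dilations enters here: a scalar commutes with \<open>b\<close>, so one
  substitution turns the translations into integer ones at all levels.\<close>

lemma synthesis_level_lev:
  fixes b :: "real^'n::finite^'n" and c :: "nat \<Rightarrow> int^'n \<Rightarrow> complex"
  assumes b: "invertible b" and p: "1 \<le> p" and \<kappa>: "kernel p \<kappa>" and \<alpha>: "\<alpha> j \<noteq> 0" and c: "lp p (c j)"
    and rel: "AE x in lborel. of_real \<bar>det b\<bar> * \<psi> (b *v x) = complex_of_real (\<kappa> x)"
  shows "AE x in lborel. (\<lambda>k. norm (c j k * affine_elem p (dilation \<alpha>) b \<psi> j k (b *v x))) summable_on UNIV \<and>
    of_real \<bar>det b\<bar> * synthesis_level p (dilation \<alpha>) b \<psi> c j (b *v x) = lev p \<kappa> (\<alpha> j) (c j) x"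
proof -
  define D where "D = \<bar>det b\<bar>"
  have D: "0 < D" using b by (simp add: D_def invertible_det_nz)
  have one: "mat 1 *v v = v" for v :: "real^'n" by simp
  have "AE x in lborel. \<forall>k. of_real \<bar>det b\<bar> * \<psi> (b *v (x - int_vec k)) = complex_of_real (\<kappa> (x - int_vec k))"
    using AE_lattice_translates[OF rel, of "mat 1"] by (simp only: one)
  then have "AE x in lborel. (\<forall>k. of_real \<bar>det b\<bar> * \<psi> (b *v (x - int_vec k)) = complex_of_real (\<kappa> (x - int_vec k))) \<and>
      integrable (count_space UNIV) (\<lambda>k. \<kappa> (x - int_vec k) *\<^sub>R c j k)"
    using AE_syn_integrable[OF \<kappa> p c] by eventually_elim blast
  from AE_dilate[OF this \<alpha>] show ?thesis
  proof eventually_elim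
    case (elim x)
    let ?A = "\<bar>\<alpha> j\<bar> ^ CARD('n)"
    let ?t = "\<lambda>k. \<kappa> (\<alpha> j *\<^sub>R x - int_vec k) *\<^sub>R c j k"
    let ?C = "complex_of_real (?A powr (1 / p) / D)"
    have \<psi>: "\<psi> (b *v (\<alpha> j *\<^sub>R x - int_vec k)) = of_real (\<kappa> (\<alpha> j *\<^sub>R x - int_vec k) / D)" for k
      using elim D by (simp add: D_def field_simps)
    have arg: "mat (\<alpha> j) *v (b *v x) - b *v int_vec k = b *v (\<alpha> j *\<^sub>R x - int_vec k)" for k
      by (simp add: mat_mult_scaleR matrix_vector_mult_diff_distrib matrix_vector_mult_scaleR)
    have t: "c j k * affine_elem p (dilation \<alpha>) b \<psi> j k (b *v x) = ?C * ?t k" for k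
      unfolding affine_elem_def dilation_def arg \<psi> by (simp add: det_mat power_abs scaleR_conv_of_real)
    have ab: "(\<lambda>k. norm (?t k)) summable_on UNIV"
      using elim abs_summable_equivalent[of ?t UNIV] by (simp add: Infinite_Set_Sum.abs_summable_on_def)
    have "(\<lambda>k. norm ?C * norm (?t k)) summable_on UNIV" by (rule summable_on_cmult_right[OF ab])
    then have s: "(\<lambda>k. norm (c j k * affine_elem p (dilation \<alpha>) b \<psi> j k (b *v x))) summable_on UNIV"
      unfolding t by (simp only: norm_mult)
    have i: "infsum ?t UNIV = syn \<kappa> (c j) (\<alpha> j *\<^sub>R x)"
      using infsetsum_infsum[of ?t UNIV] elim by (simp add: syn_def infsetsum_def Infinite_Set_Sum.abs_summable_on_def)
    have "synthesis_level p (dilation \<alpha>) b \<psi> c j (b *v x) = ?C * infsum ?t UNIV"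
      unfolding synthesis_level_def t by (rule infsum_cmult_right')
    then show ?case using s D by (simp add: i lev_def flip: D_def)
  qed
qed

section \<open>Coefficient norms level by level, and the equality of norms\<close>

lemma l1w_lp:
  assumes c: "c \<in> l1w m p \<alpha>" and j: "1 \<le> j" shows "lp p (c j)"
proof -
  have "(\<lambda>k. norm (multi_op diff_op (\<lambda>_. 0) (c j) k) powr p) summable_on UNIV"
    using c j unfolding l1w_def by (auto dest!: spec[of _ "\<lambda>_. 0"])
  then show ?thesis by (simp add: lp_summable(1))
qed

lemma l1w_weight:
  "l1w_norm m p \<alpha> c = (\<Sum>\<^sub>\<infinity>j\<in>{1..}. weight m p (\<alpha> j) (c j))"
  "c \<in> l1w m p \<alpha> ==> (\<lambda>j. weight m p (\<alpha> j) (c j)) summable_on {1..}"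
  by (simp_all add: l1w_norm_def l1w_def weight_def seqn_def)

lemma l1wI:
  assumes p: "1 \<le> p" and lp: "\<And>j. lp p (c j)" and s: "(\<lambda>j. weight m p (\<alpha> j) (c j)) summable_on {1..}"
  shows "c \<in> l1w m p \<alpha>"
proof -
  have "(\<lambda>k. norm (multi_op diff_op \<rho> (c j) k) powr p) summable_on UNIV" for \<rho> j
    using lp_multi_op[OF p lp[of j], of \<rho>] by (simp only: lp_summable(1))
  then show ?thesis using s unfolding l1w_def weight_def seqn_def by simp
qed

lemma summable_on_nat_bounded:
  fixes w :: "nat \<Rightarrow> real"
  assumes nn: "\<And>j. 0 \<le> w j" and B: "\<And>n. (\<Sum>j=1..n. w j) \<le> B"
  shows "w summable_on {1..}" "(\<Sum>\<^sub>\<infinity>j\<in>{1..}. w j) \<le> B"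
proof -
  have b: "sum w F \<le> B" if F: "finite F" "F \<subseteq> {1..}" for F
  proof -
    have "F \<subseteq> {1..Max (insert 0 F)}" using F by (auto intro: Max_ge)
    then have "sum w F \<le> (\<Sum>j=1..Max (insert 0 F). w j)" by (intro sum_mono2) (auto simp: nn)
    then show ?thesis using B order_trans by blast
  qed
  show s: "w summable_on {1..}"
    by (rule nonneg_bdd_above_summable_on) (use nn b in \<open>auto intro!: bdd_aboveI2[of _ _ B]\<close>)
  show "(\<Sum>\<^sub>\<infinity>j\<in>{1..}. w j) \<le> B" by (rule infsum_le_finite_sums[OF s b])
qed

theorem corollary14:
  fixes \<alpha> :: "nat \<Rightarrow> real" and b :: "real^'n::finite^'n" and p :: real and m :: nat
    and \<eta> \<psi> f :: "real^'n \<Rightarrow> complex"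
  assumes "\<And>j. j \<ge> 1 \<Longrightarrow> \<alpha> j \<noteq> 0"
    and "filterlim (\<lambda>j. \<bar>\<alpha> j\<bar>) at_top sequentially"
    and "invertible b"
    and "1 \<le> p"
    and "\<eta> \<in> Lp p"
    and "AE x in lebesgue. \<eta> x \<in> \<real>\<^sub>\<ge>\<^sub>0"
    and "p = 1 \<Longrightarrow> (\<integral>x. \<eta> x \<partial>lebesgue) = 1"
    and "1 < p \<Longrightarrow> AE x in lebesgue. periodization b \<eta> x = 1"
    and "m \<ge> 1"
    and "\<psi> = (convolution (cell_average b) ^^ m) \<eta>"
    and "f \<in> sobolev m p"
  shows "ereal (sobolev_norm m p f) =
    (INF c \<in> {c \<in> l1w m p \<alpha>. synthesizes m p (dilation \<alpha>) b \<psi> c (rescale_inv b f)}.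
       ereal (l1w_norm m p \<alpha> c))"
proof -
  note \<alpha> = assms(1) and b = assms(3) and p = assms(4) and f = assms(11)
  define D where "D = \<bar>det b\<bar>"
  have D: "0 < D" using b by (simp add: D_def invertible_det_nz)
  note bi = invertible_matrix_inv'[OF b]
  obtain \<kappa>0 where \<kappa>0: "kernel p \<kappa>0" and rel0: "AE x in lborel. of_real \<bar>det b\<bar> * \<eta> (b *v x) = of_real (\<kappa>0 x)"
    by (rule kernel_of_generator[OF b p assms(5-8)])
  define \<kappa> where "\<kappa> = (avgR cell ^^ m) \<kappa>0"
  have r: "reg p m \<kappa>" unfolding \<kappa>_def by (rule reg_iterate[OF p \<kappa>0])
  note \<kappa> = reg_kernel[OF r]
  have rel: "AE x in lborel. of_real \<bar>det b\<bar> * \<psi> (b *v x) = complex_of_real (\<kappa> x)"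
    unfolding \<kappa>_def assms(10) by (rule convolution_iterate[OF b p \<kappa>0 rel0])
  define SL where "SL c j = synthesis_level p (dilation \<alpha>) b \<psi> c j" for c j
  define F where "F = rescale_inv b f"
  \<comment> \<open>\<open>E\<close> and \<open>e\<close> are the remainders of the same series, in
    normalized and in original coordinates.\<close>
  define E where "E c J x = f x - (\<Sum>j=1..J. lev p \<kappa> (\<alpha> j) (c j) x)" for c J x
  define e where "e c J x = F x - (\<Sum>j=1..J. SL c j x)" for c J x
  have Fb: "f x = of_real D * F (b *v x)" for x
    using D by (simp add: F_def rescale_inv_def matrix_inv_cancel[OF b] D_def)
  have pullback: "AE z in lebesgue. h z = of_real (1 / D) * g (matrix_inv b *v z)"
    if "AE x in lborel. of_real D * h (b *v x) = g x" for h g :: "real^'n \<Rightarrow> complex"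
  proof -
    have "AE z in lborel. h z = of_real (1 / D) * g (matrix_inv b *v z)"
      using AE_linear[OF that bi] by eventually_elim (use D in \<open>simp add: matrix_inv_cancel[OF b] field_simps\<close>)
    then show ?thesis by (rule AE_completion)
  qed
  \<comment> \<open>\<open>K1\<close> and \<open>K2\<close> multiply only remainders that tend to 0
    and level norms whose summability is at stake, so they do not show in the final
    inequalities.\<close>
  obtain K1 where K1: "0 \<le> K1" "\<And>g h. g \<in> sobolev m p ==> (AE x in lebesgue. h x = of_real (1 / D) * g (matrix_inv b *v x)) ==>
      h \<in> sobolev m p \<and> sobolev_norm m p h \<le> K1 * sobolev_norm m p g"
    using sobolev_linear_change[OF p bi, of m "of_real (1 / D)"] by metis
  obtain K2 where K2: "0 \<le> K2" "\<And>g h. g \<in> sobolev m p ==> (AE x in lebesgue. h x = of_real D * g (b *v x)) ==>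
      h \<in> sobolev m p \<and> sobolev_norm m p h \<le> K2 * sobolev_norm m p g"
    using sobolev_linear_change[OF p b, of m "of_real D"] by metis
  have SLlev: "AE x in lborel. (\<lambda>k. norm (c j k * affine_elem p (dilation \<alpha>) b \<psi> j k (b *v x))) summable_on UNIV"
      "AE x in lborel. of_real D * SL c j (b *v x) = lev p \<kappa> (\<alpha> j) (c j) x"
    if "1 \<le> j" "lp p (c j)" for c j
  proof -
    note s = synthesis_level_lev[where c = c and j = j and \<alpha> = \<alpha>, OF b p \<kappa> \<alpha>[OF that(1)] that(2) rel]
    show "AE x in lborel. (\<lambda>k. norm (c j k * affine_elem p (dilation \<alpha>) b \<psi> j k (b *v x))) summable_on UNIV"
      using s by eventually_elim blast
    show "AE x in lborel. of_real D * SL c j (b *v x) = lev p \<kappa> (\<alpha> j) (c j) x"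
      unfolding SL_def D_def using s by eventually_elim blast
  qed
  have eE: "AE x in lborel. of_real D * e c J (b *v x) = E c J x" if lp: "\<And>j. 1 \<le> j ==> lp p (c j)" for c J
  proof -
    have "AE x in lborel. \<forall>j\<in>{1..J}. of_real D * SL c j (b *v x) = lev p \<kappa> (\<alpha> j) (c j) x"
    proof (rule AE_finite_allI[OF finite_atLeastAtMost])
      fix j assume "j \<in> {1..J}"
      then have j: "1 \<le> j" by simp
      show "AE x in lborel. of_real D * SL c j (b *v x) = lev p \<kappa> (\<alpha> j) (c j) x"
        by (rule SLlev(2)[where c = c and j = j, OF j lp[OF j]])
    qed
    then show ?thesis
    proof eventually_elim
      case (elim x)
      have "of_real D * (\<Sum>j=1..J. SL c j (b *v x)) = (\<Sum>j=1..J. lev p \<kappa> (\<alpha> j) (c j) x)"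
        unfolding sum_distrib_left using elim by (intro sum.cong) auto
      then show ?case by (simp add: e_def E_def Fb right_diff_distrib)
    qed
  qed
  have Fs: "F \<in> sobolev m p"
    using K1(2)[OF f, of F] by (simp add: F_def rescale_inv_def D_def inverse_eq_divide)
  have levS: "lev p \<kappa> (\<alpha> j) (c j) \<in> sobolev m p" "sobolev_norm m p (lev p \<kappa> (\<alpha> j) (c j)) \<le> weight m p (\<alpha> j) (c j)"
    if "1 \<le> j" "lp p (c j)" for c j
    by (rule lev_sobolev(1)[OF p r that(2) \<alpha>[OF that(1)]], rule lev_sobolev(2)[OF p r that(2) \<alpha>[OF that(1)]])
  \<comment> \<open>The sharp bound is applied to partial sums of \<open>lev\<close>, in normalized
    coordinates; the remainder is estimated crudely with \<open>K2\<close> and vanishes in the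
    limit.\<close>
  have lower: "sobolev_norm m p f \<le> l1w_norm m p \<alpha> c"
    if c: "c \<in> l1w m p \<alpha>" and S: "synthesizes m p (dilation \<alpha>) b \<psi> c F" for c
  proof -
    have lp: "lp p (c j)" if "1 \<le> j" for j by (rule l1w_lp[OF c that])
    have eEc: "AE x in lborel. of_real D * e c J (b *v x) = E c J x" for J by (rule eE[where c = c]) (rule lp)
    have SLs: "SL c j \<in> sobolev m p" if "1 \<le> j" for j using S that by (simp add: synthesizes_def SL_def)
    have lim: "(\<lambda>J. sobolev_norm m p (e c J)) \<longlonglongrightarrow> 0"
      using S by (simp add: synthesizes_def e_def[abs_def] SL_def)
    have bound: "sobolev_norm m p f \<le> K2 * sobolev_norm m p (e c J) + l1w_norm m p \<alpha> c" for J
    proof -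
      let ?s = "\<lambda>x. \<Sum>j=1..J. SL c j x"
      have ss: "?s \<in> sobolev m p \<and> sobolev_norm m p ?s \<le> (\<Sum>j=1..J. sobolev_norm m p (SL c j))"
        by (rule sobolev_sum[OF p]) (simp add: SLs)
      have es: "e c J \<in> sobolev m p"
        unfolding e_def[abs_def] by (rule sobolev_diff(1)[OF p Fs conjunct1[OF ss]])
      have "AE x in lborel. E c J x = of_real D * e c J (b *v x)" using eEc[of J] by eventually_elim simp
      then have "AE x in lebesgue. E c J x = of_real D * e c J (b *v x)" by (rule AE_completion)
      note Es = K2(2)[OF es this]
      let ?l = "\<lambda>x. \<Sum>j=1..J. lev p \<kappa> (\<alpha> j) (c j) x"
      have ls: "?l \<in> sobolev m p \<and> sobolev_norm m p ?l \<le> (\<Sum>j=1..J. sobolev_norm m p (lev p \<kappa> (\<alpha> j) (c j)))"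
        by (rule sobolev_sum[OF p]) (simp add: levS lp)
      have "(\<Sum>j=1..J. sobolev_norm m p (lev p \<kappa> (\<alpha> j) (c j))) \<le> (\<Sum>j=1..J. weight m p (\<alpha> j) (c j))"
        by (rule sum_mono) (simp add: levS lp)
      also have "... \<le> l1w_norm m p \<alpha> c"
        unfolding l1w_weight(1) by (rule finite_sum_le_infsum[OF l1w_weight(2)[OF c]]) (auto simp: weight_nonneg)
      finally have ln: "sobolev_norm m p ?l \<le> l1w_norm m p \<alpha> c" using ls by linarith
      have "(\<lambda>x. E c J x + 1 * ?l x) = f" by (simp add: E_def)
      then have "sobolev_norm m p f \<le> sobolev_norm m p (E c J) + norm (1 :: complex) * sobolev_norm m p ?l"
        using sobolev_linear(2)[OF p conjunct1[OF Es] conjunct1[OF ls], of 1] by simp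
      then show ?thesis using Es ln by simp
    qed
    have "(\<lambda>J. K2 * sobolev_norm m p (e c J) + l1w_norm m p \<alpha> c) \<longlonglongrightarrow> K2 * 0 + l1w_norm m p \<alpha> c"
      by (intro tendsto_intros lim)
    then have "sobolev_norm m p f \<le> K2 * 0 + l1w_norm m p \<alpha> c"
      by (rule LIMSEQ_le_const) (use bound in blast)
    then show ?thesis by simp
  qed
  have upper: "\<exists>c. c \<in> l1w m p \<alpha> \<and> synthesizes m p (dilation \<alpha>) b \<psi> c F \<and> l1w_norm m p \<alpha> c \<le> sobolev_norm m p f + \<epsilon>"
    if \<epsilon>: "0 < \<epsilon>" for \<epsilon>
  proof -
    \<comment> \<open>The value of \<open>\<alpha>\<close> at index 0 is arbitrary and may be 0.
      Replacing it gives a sequence without zeros, and no sum over levels starts below 1.\<close>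
    define a where "a j = (if j = 0 then 1 else \<alpha> j)" for j
    have a0: "a j \<noteq> 0" for j using \<alpha>[of j] by (simp add: a_def)
    have ev: "\<forall>\<^sub>F j in sequentially. \<bar>\<alpha> j\<bar> = \<bar>a j\<bar>"
      using eventually_ge_at_top[of 1] by eventually_elim (simp add: a_def)
    have al: "filterlim (\<lambda>j. \<bar>a j\<bar>) at_top sequentially"
      by (rule iffD1[OF filterlim_cong[OF refl refl ev] assms(2)])
    have aj: "a j = \<alpha> j" if "1 \<le> j" for j using that by (simp add: a_def)
    define A where "A c \<longleftrightarrow> (\<forall>j. lp p (c j)) \<and> (\<forall>n. (\<Sum>j=1..n. weight m p (a j) (c j)) \<le> sobolev_norm m p f + \<epsilon>) \<and>
      (\<lambda>n. sobolev_norm m p (\<lambda>x. f x - (\<Sum>j=1..n. lev p \<kappa> (a j) (c j) x))) \<longlonglongrightarrow> 0" for c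
    have "\<exists>c. A c" unfolding A_def by (rule exact_representation[OF p r f a0 al \<epsilon>])
    then obtain c where "A c" by blast
    note Ac = this[unfolded A_def]
    have lp: "lp p (c j)" for j by (rule spec[OF conjunct1[OF Ac]])
    have wa: "(\<Sum>j=1..n. weight m p (a j) (c j)) = (\<Sum>j=1..n. weight m p (\<alpha> j) (c j))" for n
      by (rule sum.cong) (simp_all add: aj)
    have la: "(\<Sum>j=1..n. lev p \<kappa> (a j) (c j) x) = (\<Sum>j=1..n. lev p \<kappa> (\<alpha> j) (c j) x)" for n x
      by (rule sum.cong) (simp_all add: aj)
    have wb: "(\<Sum>j=1..n. weight m p (\<alpha> j) (c j)) \<le> sobolev_norm m p f + \<epsilon>" for n
      using spec[OF conjunct1[OF conjunct2[OF Ac]], of n] unfolding wa .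
    note ws = summable_on_nat_bounded[where w = "\<lambda>j. weight m p (\<alpha> j) (c j)", OF weight_nonneg wb]
    have cl: "c \<in> l1w m p \<alpha>" by (rule l1wI[where c = c and \<alpha> = \<alpha>, OF p lp ws(1)])
    have lim: "(\<lambda>J. sobolev_norm m p (E c J)) \<longlonglongrightarrow> 0"
      using conjunct2[OF conjunct2[OF Ac]] unfolding la E_def[abs_def] .
    have SLs: "SL c j \<in> sobolev m p \<and> sobolev_norm m p (SL c j) \<le> K1 * sobolev_norm m p (lev p \<kappa> (\<alpha> j) (c j))" if "1 \<le> j" for j
      by (rule K1(2)[OF levS(1)[where c = c and j = j, OF that lp] pullback[where h = "SL c j" and g = "lev p \<kappa> (\<alpha> j) (c j)", OF SLlev(2)[where c = c and j = j, OF that lp]]])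
    have SLw: "sobolev_norm m p (SL c j) \<le> K1 * weight m p (\<alpha> j) (c j)" if "1 \<le> j" for j
      using conjunct2[OF SLs[OF that]] mult_left_mono[OF levS(2)[where c = c and j = j, OF that lp] K1(1)] by linarith
    have "synthesizes m p (dilation \<alpha>) b \<psi> c F"
      unfolding synthesizes_def SL_def[symmetric]
    proof (intro conjI allI impI)
      fix j :: nat assume j: "1 \<le> j"
      have "AE z in lborel. (\<lambda>k. norm (c j k * affine_elem p (dilation \<alpha>) b \<psi> j k (b *v (matrix_inv b *v z)))) summable_on UNIV"
        by (rule AE_linear[OF SLlev(1)[where c = c and j = j, OF j lp] bi])
      then show "AE x in lebesgue. (\<lambda>k. norm (c j k * affine_elem p (dilation \<alpha>) b \<psi> j k x)) summable_on UNIV"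
        unfolding matrix_inv_cancel[OF b] by (rule AE_completion)
      show "SL c j \<in> sobolev m p" using SLs[OF j] by blast
    next
      show "(\<lambda>j. sobolev_norm m p (SL c j)) summable_on {1..}"
      proof (rule summable_on_comparison_test)
        show "(\<lambda>j. K1 * weight m p (\<alpha> j) (c j)) summable_on {1..}" by (rule summable_on_cmult_right[OF ws(1)])
      qed (auto simp: SLw sobolev_norm_nonneg)
    next
      show "F \<in> sobolev m p" by (rule Fs)
    next
      have eb: "sobolev_norm m p (e c J) \<le> K1 * sobolev_norm m p (E c J)" for J
      proof -
        let ?l = "\<lambda>x. \<Sum>j=1..J. lev p \<kappa> (\<alpha> j) (c j) x"
        have ls: "?l \<in> sobolev m p \<and> sobolev_norm m p ?l \<le> (\<Sum>j=1..J. sobolev_norm m p (lev p \<kappa> (\<alpha> j) (c j)))"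
          by (rule sobolev_sum[OF p]) (simp add: levS lp)
        have ES: "E c J \<in> sobolev m p" unfolding E_def[abs_def] by (rule sobolev_diff(1)[OF p f conjunct1[OF ls]])
        have "AE x in lborel. of_real D * e c J (b *v x) = E c J x" by (rule eE[where c = c]) (rule lp)
        then show ?thesis by (rule conjunct2[OF K1(2)[OF ES pullback[where h = "e c J" and g = "E c J"]]])
      qed
      have "(\<lambda>J. sobolev_norm m p (e c J)) \<longlonglongrightarrow> 0"
      proof (rule tendsto_sandwich[OF _ _ tendsto_const])
        show "(\<lambda>J. K1 * sobolev_norm m p (E c J)) \<longlonglongrightarrow> 0" using tendsto_mult_left[OF lim, of K1] by simp
      qed (simp_all add: sobolev_norm_nonneg eb)
      then show "(\<lambda>J. sobolev_norm m p (\<lambda>x. F x - (\<Sum>j=1..J. SL c j x))) \<longlonglongrightarrow> 0" by (simp add: e_def[abs_def])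
    qed
    then show ?thesis using cl ws(2) unfolding l1w_weight(1) by blast
  qed
  show ?thesis
    unfolding F_def[symmetric]
  proof (rule antisym)
    show "ereal (sobolev_norm m p f) \<le> (INF c \<in> {c \<in> l1w m p \<alpha>. synthesizes m p (dilation \<alpha>) b \<psi> c F}. ereal (l1w_norm m p \<alpha> c))"
      by (rule INF_greatest) (auto simp: lower)
    have step: "(INF c \<in> {c \<in> l1w m p \<alpha>. synthesizes m p (dilation \<alpha>) b \<psi> c F}. ereal (l1w_norm m p \<alpha> c)) \<le> ereal (sobolev_norm m p f) + ereal \<epsilon>"
      if \<epsilon>: "0 < \<epsilon>" for \<epsilon>
    proof -
      obtain c where c: "c \<in> {c \<in> l1w m p \<alpha>. synthesizes m p (dilation \<alpha>) b \<psi> c F}"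
        and n: "l1w_norm m p \<alpha> c \<le> sobolev_norm m p f + \<epsilon>" using upper[OF \<epsilon>] by blast
      show ?thesis by (rule INF_lower2[OF c]) (use n in simp)
    qed
    show "(INF c \<in> {c \<in> l1w m p \<alpha>. synthesizes m p (dilation \<alpha>) b \<psi> c F}. ereal (l1w_norm m p \<alpha> c)) \<le> ereal (sobolev_norm m p f)"
      by (rule ereal_le_epsilon2) (rule step)
  qed
qed

end
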